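(* Let $R$ be a regular local ring of dimension two with maximal ideal $\mathfrak m_R$, residue field $\mathfrak k=R/\mathfrak m_R$ and coefficient set $CS$, dominated by a valuation $\nu$ of its quotient field. Let $x,y$ be regular parameters in $R$. Let $P_0=x$, $P_1=y$, $P_2,\ldots$, together with $\Omega$, $n_i$, $\alpha_i$, be a sequence constructed from $\nu,x,y$ by the algorithm described in the context, and suppose that $\Omega\ge2$. Let $R\to T_1\to T_2\to\cdots$ be the sequence of quadratic transforms along $\nu$. Then there exists some smallest value $i$ such that the divisor of $xy$ in $\mathrm{Spec}(T_i)$ has only one component. Let $R_1=T_i$. Then $R_1/\mathfrak m_{R_1}\cong\mathfrak k(\alpha_1)$, and there exist $x_1\in R_1$ and $w\in\mathbb Z_{>0}$ such that $x_1=0$ is a local equation of the exceptional divisor of $\mathrm{Spec}(R_1)\to\mathrm{Spec}(R)$, and $Q_0=x_1$, $Q_1=\frac{P_2}{x_1^{wn_1}}$ are regular parameters in $R_1$. Moreover, the elements $Q_0$ and $$Q_i=\frac{P_{i+1}}{Q_0^{wn_1n_2\cdots n_i}}\qquad\text{for } 1\le i<\min\{\Omega,\infty\}$$ form a key sequence (in the sense of the context) for the ring $R_1$, the valuation $\nu$ and the regular parameters $Q_0,Q_1$, of length $\Omega-1$ (interpreted as $\infty$ if $\Omega=\infty$).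
   Context: $\mathbb N=\{0,1,2,\ldots\}$. $V_\nu$ is the valuation ring of $\nu$, with maximal ideal $\mathfrak m_\nu$; $\nu$ dominates $R$ if $R\subset V_\nu$ and $\mathfrak m_\nu\cap R=\mathfrak m_R$. $[f]$ denotes the class of $f\in V_\nu$ in $V_\nu/\mathfrak m_\nu$. $G(z_1,\ldots,z_n)$ is the subgroup generated by $z_1,\ldots,z_n$. A coefficient set of $R$ is a subset $CS\subset R$ with $0,1\in CS$ mapping bijectively to $\mathfrak k$. Quadratic transforms. If $R$ is a two dimensional regular local ring dominated by $\nu$ and $u,v$ are regular parameters of $R$ with $\nu(u)\le\nu(v)$, the quadratic transform of $R$ along $\nu$ is $R[\frac vu]_{R[\frac vu]\cap\mathfrak m_\nu}$. Iterating gives the sequence $R\to T_1\to T_2\to\cdots$ of quadratic transforms along $\nu$ (iteration stops if a one dimensional ring is reached). The divisor of $xy$ in $\mathrm{Spec}(T_i)$ has only one component if $xy$ is a unit times a power of a single prime element of $T_i$. The algorithm. Set $P_0=x$, $P_1=y$. Given $P_0,\ldots,P_i$ ($i\ge1$), let $\overline n_i=[G(\nu(P_0),\ldots,\nu(P_i)):G(\nu(P_0),\ldots,\nu(P_{i-1}))]$. If $\overline n_i=\infty$, stop: $\Omega=i$. If $\overline n_i<\infty$, choose a monomial $U_i=P_0^{w_0(i)}\cdots P_{i-1}^{w_{i-1}(i)}$ with $w_j(i)\in\mathbb N$, $w_j(i)<n_j$ for $1\le j\le i-1$, and $\nu(U_i)=\overline n_i\nu(P_i)$; let $\alpha_i=[P_i^{\overline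 n_i}/U_i]$ and $d_i=[\mathfrak k(\alpha_1,\ldots,\alpha_i):\mathfrak k(\alpha_1,\ldots,\alpha_{i-1})]$. If $d_i=\infty$, stop: $\Omega=i$. Otherwise let $n_i=\overline n_id_i$, let $f_i(u)=u^{d_i}+b_{i,d_i-1}u^{d_i-1}+\cdots+b_{i,0}$ be the minimal polynomial of $\alpha_i$ over $\mathfrak k(\alpha_1,\ldots,\alpha_{i-1})$, and choose finitely many $a_{s,t}\in CS$ and exponents $j_k(s,t)\in\mathbb N$ ($0\le t<d_i$, $1\le s\le\lambda_t$, $0\le k\le i-1$) with $j_k(s,t)<n_k$ for $k\ge1$, $\nu(P_0^{j_0(s,t)}\cdots P_{i-1}^{j_{i-1}(s,t)}P_i^{t\overline n_i})=n_i\nu(P_i)$ for all $s,t$, and $b_{i,t}=\left[\sum_{s}a_{s,t}P_0^{j_0(s,t)}\cdots P_{i-1}^{j_{i-1}(s,t)}/U_i^{d_i-t}\right]$ for $0\le t\le d_i-1$; then set $$P_{i+1}=P_i^{n_i}+\sum_{t=0}^{d_i-1}\Big(\sum_{s=1}^{\lambda_t}a_{s,t}P_0^{j_0(s,t)}\cdots P_{i-1}^{j_{i-1}(s,t)}\Big)P_i^{t\overline n_i}.$$ Such choices are always possible. If the procedure never stops, $\Omega=\infty$. The sequence is $(P_i)_{0\le i\le\Omega}$ if $\Omega<\infty$ and $(P_i)_{i\ge0}$ if $\Omega=\infty$. Key sequences. Let $T$ be a two dimensional regular local ring with residue field $\kappa$, dominated by $\nu$, and let $Q_0,Q_1$ be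 regular parameters of $T$. A key sequence of length $M\in\mathbb Z_{>0}\cup\{\infty\}$ for $T,\nu,Q_0,Q_1$ is a sequence $Q_i\in\mathfrak m_T$, $0\le i<\min\{M+1,\infty\}$, such that for $1\le i<M$ there is an expression $Q_{i+1}=Q_i^{m_i}+\sum_{k=1}^{\mu_i}c_{i,k}Q_0^{\tau_{i,0}(k)}\cdots Q_i^{\tau_{i,i}(k)}$ with $m_i\ge1$, $\mu_i\ge1$, $c_{i,k}$ units of $T$, $\tau_{i,s}(k)\in\mathbb N$, $\tau_{i,s}(k)<m_s$ for $s\ge1$, and $m_i\nu(Q_i)=\nu(Q_0^{\tau_{i,0}(k)}\cdots Q_i^{\tau_{i,i}(k)})$ for all $k$, and such that for $1\le i<M$: (1) $\nu(Q_{i+1})>m_i\nu(Q_i)$. (2) For $r<M$, whenever finitely many monomials $Q_0^{j_0(l)}\cdots Q_r^{j_r(l)}$ ($1\le l\le m$) with distinct exponent vectors in $\mathbb N^{r+1}$ satisfying $j_k(l)<m_k$ for $1\le k\le r$ all have the same value, the classes in $V_\nu/\mathfrak m_\nu$ of their quotients by the first of them ($l=1,\ldots,m$) are linearly independent over $\kappa$. (3) With $\overline m_i=[G(\nu(Q_0),\ldots,\nu(Q_i)):G(\nu(Q_0),\ldots,\nu(Q_{i-1}))]$, $\overline m_i$ divides $\tau_{i,i}(k)$ for all $k$; in particular $m_i=\overline m_ie_i$ with $e_i\in\mathbb Z_{>0}$. (4) There is a monomial $V_i=Q_0^{v_0(i)}\cdots Q_{i-1}^{v_{i-1}(i)}$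 with exponents in $\mathbb N$, $v_j(i)<m_j$ for $1\le j\le i-1$, and $\nu(Q_i^{\overline m_i})=\nu(V_i)$, such that, with $\hat\alpha_i=[Q_i^{\overline m_i}/V_i]$, the elements $\hat b_{i,t}=\left[\sum_{k:\tau_{i,i}(k)=t\overline m_i}c_{i,k}Q_0^{\tau_{i,0}(k)}\cdots Q_{i-1}^{\tau_{i,i-1}(k)}/V_i^{e_i-t}\right]$, $0\le t\le e_i-1$, lie in $\kappa(\hat\alpha_1,\ldots,\hat\alpha_{i-1})$ and $u^{e_i}+\hat b_{i,e_i-1}u^{e_i-1}+\cdots+\hat b_{i,0}$ is the minimal polynomial of $\hat\alpha_i$ over $\kappa(\hat\alpha_1,\ldots,\hat\alpha_{i-1})$. Moreover, if $M<\infty$, then either $\overline m_M=\infty$, or $\overline m_M<\infty$ and (with $V_M$, $\hat\alpha_M$ defined as in (4)) $[\kappa(\hat\alpha_1,\ldots,\hat\alpha_M):\kappa(\hat\alpha_1,\ldots,\hat\alpha_{M-1})]=\infty$. *)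

theory Defs
  imports
    "HOL-Algebra.Finite_Extensions"
    "HOL-Algebra.Generated_Fields"
    "HOL-Library.Extended_Nat"
    "HOL-Computational_Algebra.Group_Closure"
begin

text \<open>
  All local rings under consideration lie in one fixed field \<open>K\<close>, the quotient field of the ring
  \<open>R\<close> we start from. They are given by their carriers, and \<open>A\<close> is turned into a ring as
  \<open>K\<lparr>carrier := A\<rparr>\<close>.
\<close>

section \<open>Regular local rings of dimension two\<close>

definition local_ring :: "('a, 'b) ring_scheme \<Rightarrow> bool" where
  "local_ring A \<longleftrightarrow> cring A \<and> (\<exists>!m. maximalideal m A)"

definition max_ideal :: "('a, 'b) ring_scheme \<Rightarrow> 'a set" where
  "max_ideal A = (THE m. maximalideal m A)"

definition krull_dim :: "('a, 'b) ring_scheme \<Rightarrow> enat" where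
  "krull_dim A =
     (SUP n \<in> {n. \<exists>p :: nat \<Rightarrow> 'a set.
        (\<forall>i\<le>n. primeideal (p i) A) \<and> (\<forall>i<n. p i \<subset> p (Suc i))}. enat n)"

definition regular_local_ring :: "('a, 'b) ring_scheme \<Rightarrow> bool" where
  "regular_local_ring A \<longleftrightarrow>
     noetherian_ring A \<and> local_ring A \<and>
     (\<exists>S \<subseteq> carrier A. finite S \<and> enat (card S) = krull_dim A \<and> max_ideal A = Idl\<^bsub>A\<^esub> S)"

definition regular_parameters :: "('a, 'b) ring_scheme \<Rightarrow> 'a \<Rightarrow> 'a \<Rightarrow> bool" where
  "regular_parameters A u v \<longleftrightarrow>
     regular_local_ring A \<and> krull_dim A = 2 \<and>
     u \<in> carrier A \<and> v \<in> carrier A \<and> max_ideal A = Idl\<^bsub>A\<^esub> {u, v}"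

definition is_quotient_field :: "('a, 'b) ring_scheme \<Rightarrow> 'a set \<Rightarrow> bool" where
  "is_quotient_field K R \<longleftrightarrow>
     field K \<and> subring R K \<and>
     (\<forall>z \<in> carrier K. \<exists>a \<in> R. \<exists>b \<in> R - {\<zero>\<^bsub>K\<^esub>}. z = a \<otimes>\<^bsub>K\<^esub> inv\<^bsub>K\<^esub> b)"

definition coefficient_set :: "('a, 'b) ring_scheme \<Rightarrow> 'a set \<Rightarrow> bool" where
  "coefficient_set A CS \<longleftrightarrow>
     CS \<subseteq> carrier A \<and> \<zero>\<^bsub>A\<^esub> \<in> CS \<and> \<one>\<^bsub>A\<^esub> \<in> CS \<and>
     bij_betw (\<lambda>a. max_ideal A +>\<^bsub>A\<^esub> a) CS (carrier (A Quot max_ideal A))"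


section \<open>Valuations\<close>

text \<open>
  A valuation takes values in an arbitrary ordered abelian group. Only its values on nonzero
  elements are meaningful; \<open>\<nu> \<zero>\<close>, which is \<open>\<infinity>\<close> in the usual convention, is left unspecified.
\<close>

definition valuation ::
    "('a, 'b) ring_scheme \<Rightarrow> ('a \<Rightarrow> 'g :: linordered_ab_group_add) \<Rightarrow> bool" where
  "valuation K \<nu> \<longleftrightarrow>
     (\<forall>f \<in> carrier K - {\<zero>\<^bsub>K\<^esub>}. \<forall>g \<in> carrier K - {\<zero>\<^bsub>K\<^esub>}.
        \<nu> (f \<otimes>\<^bsub>K\<^esub> g) = \<nu> f + \<nu> g \<and>
        (f \<oplus>\<^bsub>K\<^esub> g \<noteq> \<zero>\<^bsub>K\<^esub> \<longrightarrow> min (\<nu> f) (\<nu> g) \<le> \<nu> (f \<oplus>\<^bsub>K\<^esub> g)))"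

definition val_ring ::
    "('a, 'b) ring_scheme \<Rightarrow> ('a \<Rightarrow> 'g :: linordered_ab_group_add) \<Rightarrow> 'a set" where
  "val_ring K \<nu> = {f \<in> carrier K. f = \<zero>\<^bsub>K\<^esub> \<or> 0 \<le> \<nu> f}"

definition val_ideal ::
    "('a, 'b) ring_scheme \<Rightarrow> ('a \<Rightarrow> 'g :: linordered_ab_group_add) \<Rightarrow> 'a set" where
  "val_ideal K \<nu> = {f \<in> carrier K. f = \<zero>\<^bsub>K\<^esub> \<or> 0 < \<nu> f}"

definition val_residue_field ::
    "('a, 'b) ring_scheme \<Rightarrow> ('a \<Rightarrow> 'g :: linordered_ab_group_add) \<Rightarrow> 'a set ring" where
  "val_residue_field K \<nu> = K\<lparr>carrier := val_ring K \<nu>\<rparr> Quot val_ideal K \<nu>"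

definition residue_class ::
    "('a, 'b) ring_scheme \<Rightarrow> ('a \<Rightarrow> 'g :: linordered_ab_group_add) \<Rightarrow> 'a \<Rightarrow> 'a set" where
  "residue_class K \<nu> f = val_ideal K \<nu> +>\<^bsub>K\<lparr>carrier := val_ring K \<nu>\<rparr>\<^esub> f"

definition dominates ::
    "('a, 'b) ring_scheme \<Rightarrow> ('a \<Rightarrow> 'g :: linordered_ab_group_add) \<Rightarrow> 'a set \<Rightarrow> bool" where
  "dominates K \<nu> T \<longleftrightarrow>
     T \<subseteq> val_ring K \<nu> \<and> val_ideal K \<nu> \<inter> T = max_ideal (K\<lparr>carrier := T\<rparr>)"

text \<open>
  If \<open>\<nu>\<close> dominates \<open>T\<close>, the residue field of \<open>T\<close> embeds into the residue field of \<open>\<nu>\<close>, and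
  \<open>residue_subfield K \<nu> T\<close> is its image.
\<close>

definition residue_subfield ::
    "('a, 'b) ring_scheme \<Rightarrow> ('a \<Rightarrow> 'g :: linordered_ab_group_add) \<Rightarrow> 'a set \<Rightarrow> 'a set set" where
  "residue_subfield K \<nu> T = residue_class K \<nu> ` T"

text \<open>\<open>adjoin K \<nu> T \<alpha> i\<close> is the field \<open>\<kappa>(\<alpha>\<^sub>1, \<dots>, \<alpha>\<^sub>i)\<close>, where \<open>\<kappa>\<close> is the residue field of \<open>T\<close>.\<close>

definition adjoin ::
    "('a, 'b) ring_scheme \<Rightarrow> ('a \<Rightarrow> 'g :: linordered_ab_group_add) \<Rightarrow> 'a set \<Rightarrow>
      (nat \<Rightarrow> 'a set) \<Rightarrow> nat \<Rightarrow> 'a set set" where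
  "adjoin K \<nu> T \<alpha> i =
     generate_field (val_residue_field K \<nu>) (residue_subfield K \<nu> T \<union> \<alpha> ` {1..i})"

definition extension_degree :: "('a, 'b) ring_scheme \<Rightarrow> 'a set \<Rightarrow> 'a set \<Rightarrow> enat" where
  "extension_degree L F E =
     (if ring.finite_dimension L F E then enat (ring.dim L F E) else \<infinity>)"

definition group_index :: "'g :: ab_group_add set \<Rightarrow> 'g set \<Rightarrow> enat" where
  "group_index G H =
     (let cosets = (\<lambda>g. (+) g ` H) ` G in if finite cosets then enat (card cosets) else \<infinity>)"


section \<open>Quadratic transforms\<close>

definition local_subring :: "('a, 'b) ring_scheme \<Rightarrow> 'a set \<Rightarrow> 'a set \<Rightarrow> 'a set" where
  "local_subring K A p = {a \<otimes>\<^bsub>K\<^esub> inv\<^bsub>K\<^esub> b | a b. a \<in> A \<and> b \<in> A - p}"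

definition quadratic_transform ::
    "('a, 'b) ring_scheme \<Rightarrow> ('a \<Rightarrow> 'g :: linordered_ab_group_add) \<Rightarrow> 'a set \<Rightarrow> 'a set \<Rightarrow> bool"
  where
  "quadratic_transform K \<nu> S S' \<longleftrightarrow>
     (\<exists>u v. regular_parameters (K\<lparr>carrier := S\<rparr>) u v \<and> \<nu> u \<le> \<nu> v \<and>
        (let A = generate_ring K (S \<union> {v \<otimes>\<^bsub>K\<^esub> inv\<^bsub>K\<^esub> u})
         in S' = local_subring K A (A \<inter> val_ideal K \<nu>)))"

text \<open>
  \<open>T 0 = R, T 1, T 2, \<dots>\<close> is the sequence of quadratic transforms of \<open>R\<close> along \<open>\<nu>\<close>, and \<open>N\<close> is
  the number of transforms: it is finite precisely if a one dimensional ring \<open>T N\<close> is reached.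
  Values \<open>T j\<close> with \<open>j > N\<close> have no meaning.
\<close>

definition quadratic_sequence ::
    "('a, 'b) ring_scheme \<Rightarrow> ('a \<Rightarrow> 'g :: linordered_ab_group_add) \<Rightarrow> 'a set \<Rightarrow>
      enat \<Rightarrow> (nat \<Rightarrow> 'a set) \<Rightarrow> bool" where
  "quadratic_sequence K \<nu> R N T \<longleftrightarrow>
     T 0 = R \<and>
     (\<forall>j. enat j < N \<longrightarrow> quadratic_transform K \<nu> (T j) (T (Suc j))) \<and>
     (\<forall>j. N = enat j \<longrightarrow> krull_dim (K\<lparr>carrier := T j\<rparr>) = 1)"

definition one_component :: "('a, 'b) ring_scheme \<Rightarrow> 'a \<Rightarrow> bool" where
  "one_component A f \<longleftrightarrow>
     (\<exists>p \<in> carrier A. \<exists>u \<in> Units A. \<exists>n > (0 :: nat).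
        ring_prime\<^bsub>A\<^esub> p \<and> f = u \<otimes>\<^bsub>A\<^esub> (p [^]\<^bsub>A\<^esub> n))"

text \<open>
  The ideal of the exceptional divisor of \<open>Spec T \<rightarrow> Spec R\<close>, that is, of the preimage of the closed
  point of \<open>Spec R\<close> with its reduced structure: the intersection of the primes of \<open>T\<close> lying over
  the maximal ideal of \<open>R\<close>.
\<close>

definition exceptional_ideal :: "('a, 'b) ring_scheme \<Rightarrow> 'a set \<Rightarrow> 'a set \<Rightarrow> 'a set" where
  "exceptional_ideal K R T =
     \<Inter> {p. primeideal p (K\<lparr>carrier := T\<rparr>) \<and> p \<inter> R = max_ideal (K\<lparr>carrier := R\<rparr>)}"


section \<open>Quantities attached to a sequence of elements\<close>

text \<open>
  The following are used both for the sequences \<open>P\<close> produced by the algorithm and for key sequences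
  \<open>Q\<close>. The \<open>i\<close>-th comparison monomial (\<open>U\<^sub>i\<close> or \<open>V\<^sub>i\<close>) is encoded by its exponent vector \<open>w i\<close>.
\<close>

definition power_product ::
    "('a, 'b) ring_scheme \<Rightarrow> (nat \<Rightarrow> 'a) \<Rightarrow> nat \<Rightarrow> (nat \<Rightarrow> nat) \<Rightarrow> 'a" where
  "power_product K Q r e = (\<Otimes>\<^bsub>K\<^esub>k\<in>{..<r}. Q k [^]\<^bsub>K\<^esub> e k)"

text \<open>\<open>value_index\<close> is the index \<open>[G(\<nu> Q\<^sub>0, \<dots>, \<nu> Q\<^sub>i) : G(\<nu> Q\<^sub>0, \<dots>, \<nu> Q\<^sub>i\<^sub>-\<^sub>1)]\<close>.\<close>

definition value_index ::
    "('a \<Rightarrow> 'g :: linordered_ab_group_add) \<Rightarrow> (nat \<Rightarrow> 'a) \<Rightarrow> nat \<Rightarrow> enat" where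
  "value_index \<nu> Q i =
     group_index (group_closure ((\<lambda>k. \<nu> (Q k)) ` {..i})) (group_closure ((\<lambda>k. \<nu> (Q k)) ` {..<i}))"

text \<open>\<open>alpha\<close> is the class \<open>[P\<^sub>i ^ n / U\<^sub>i]\<close>, where \<open>n\<close> is the \<open>i\<close>-th value index.\<close>

definition alpha ::
    "('a, 'b) ring_scheme \<Rightarrow> ('a \<Rightarrow> 'g :: linordered_ab_group_add) \<Rightarrow> (nat \<Rightarrow> 'a) \<Rightarrow>
      (nat \<Rightarrow> nat \<Rightarrow> nat) \<Rightarrow> nat \<Rightarrow> 'a set" where
  "alpha K \<nu> Q w i =
     residue_class K \<nu>
       ((Q i [^]\<^bsub>K\<^esub> the_enat (value_index \<nu> Q i)) \<otimes>\<^bsub>K\<^esub> inv\<^bsub>K\<^esub> (power_product K Q i (w i)))"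

definition alpha_degree ::
    "('a, 'b) ring_scheme \<Rightarrow> ('a \<Rightarrow> 'g :: linordered_ab_group_add) \<Rightarrow> 'a set \<Rightarrow>
      (nat \<Rightarrow> 'a) \<Rightarrow> (nat \<Rightarrow> nat \<Rightarrow> nat) \<Rightarrow> nat \<Rightarrow> enat" where
  "alpha_degree K \<nu> T Q w i =
     extension_degree (val_residue_field K \<nu>)
       (adjoin K \<nu> T (alpha K \<nu> Q w) (i - 1)) (adjoin K \<nu> T (alpha K \<nu> Q w) i)"

text \<open>The number \<open>n\<^sub>i\<close> of the algorithm; it is only used if both factors are finite.\<close>

definition step_degree ::
    "('a, 'b) ring_scheme \<Rightarrow> ('a \<Rightarrow> 'g :: linordered_ab_group_add) \<Rightarrow> 'a set \<Rightarrow>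
      (nat \<Rightarrow> 'a) \<Rightarrow> (nat \<Rightarrow> nat \<Rightarrow> nat) \<Rightarrow> nat \<Rightarrow> nat" where
  "step_degree K \<nu> T Q w i =
     the_enat (value_index \<nu> Q i) * the_enat (alpha_degree K \<nu> T Q w i)"

definition balancing_exponents ::
    "('a, 'b) ring_scheme \<Rightarrow> ('a \<Rightarrow> 'g :: linordered_ab_group_add) \<Rightarrow> (nat \<Rightarrow> 'a) \<Rightarrow>
      (nat \<Rightarrow> nat) \<Rightarrow> nat \<Rightarrow> (nat \<Rightarrow> nat) \<Rightarrow> bool" where
  "balancing_exponents K \<nu> Q n i e \<longleftrightarrow>
     (\<forall>j\<in>{1..<i}. e j < n j) \<and>
     \<nu> (power_product K Q i e) = \<nu> (Q i [^]\<^bsub>K\<^esub> the_enat (value_index \<nu> Q i))"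

text \<open>
  Polynomials are coefficient lists with the leading coefficient first, so this says that
  \<open>u\<^sup>d + b (d - 1) u\<^sup>d\<^sup>-\<^sup>1 + \<dots> + b 0\<close> is the minimal polynomial of \<open>x\<close> over \<open>F\<close>.
\<close>

definition has_minimal_polynomial ::
    "('a, 'b) ring_scheme \<Rightarrow> 'a set \<Rightarrow> 'a \<Rightarrow> nat \<Rightarrow> (nat \<Rightarrow> 'a) \<Rightarrow> bool" where
  "has_minimal_polynomial L F x d b \<longleftrightarrow>
     \<not> ring.transcendental L F x \<and> ring.Irr L F x = \<one>\<^bsub>L\<^esub> # map b (rev [0..<d])"


section \<open>The algorithm\<close>

text \<open>The equation defining \<open>P\<^sub>i\<^sub>+\<^sub>1\<close> from \<open>P\<^sub>0, \<dots>, P\<^sub>i\<close>, with some admissible choice of the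
  coefficients \<open>a s t\<close> and of the exponent vectors \<open>j s t\<close>.\<close>

definition algorithm_step ::
    "('a, 'b) ring_scheme \<Rightarrow> ('a \<Rightarrow> 'g :: linordered_ab_group_add) \<Rightarrow> 'a set \<Rightarrow> 'a set \<Rightarrow>
      (nat \<Rightarrow> 'a) \<Rightarrow> (nat \<Rightarrow> nat \<Rightarrow> nat) \<Rightarrow> nat \<Rightarrow> bool" where
  "algorithm_step K \<nu> R CS P w i \<longleftrightarrow>
     (let nbar = the_enat (value_index \<nu> P i);
          d = the_enat (alpha_degree K \<nu> R P w i);
          n = step_degree K \<nu> R P w;
          U = power_product K P i (w i)
      in \<exists>(lam :: nat \<Rightarrow> nat) (a :: nat \<Rightarrow> nat \<Rightarrow> 'a) (j :: nat \<Rightarrow> nat \<Rightarrow> nat \<Rightarrow> nat).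
        (\<forall>t<d. \<forall>s\<in>{1..lam t}.
           a s t \<in> CS \<and> (\<forall>k\<in>{1..<i}. j s t k < n k) \<and>
           \<nu> (power_product K P i (j s t) \<otimes>\<^bsub>K\<^esub> (P i [^]\<^bsub>K\<^esub> (t * nbar))) = \<nu> (P i [^]\<^bsub>K\<^esub> n i)) \<and>
        has_minimal_polynomial (val_residue_field K \<nu>)
          (adjoin K \<nu> R (alpha K \<nu> P w) (i - 1)) (alpha K \<nu> P w i) d
          (\<lambda>t. residue_class K \<nu>
             ((\<Oplus>\<^bsub>K\<^esub>s\<in>{1..lam t}. a s t \<otimes>\<^bsub>K\<^esub> power_product K P i (j s t))
                \<otimes>\<^bsub>K\<^esub> inv\<^bsub>K\<^esub> (U [^]\<^bsub>K\<^esub> (d - t)))) \<and>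
        P (Suc i) =
          (P i [^]\<^bsub>K\<^esub> n i) \<oplus>\<^bsub>K\<^esub>
          (\<Oplus>\<^bsub>K\<^esub>t\<in>{..<d}.
             (\<Oplus>\<^bsub>K\<^esub>s\<in>{1..lam t}. a s t \<otimes>\<^bsub>K\<^esub> power_product K P i (j s t))
               \<otimes>\<^bsub>K\<^esub> (P i [^]\<^bsub>K\<^esub> (t * nbar))))"

text \<open>
  \<open>P i\<close> for \<open>i \<le> \<Omega>\<close> is the sequence produced by a run of the algorithm, and \<open>w\<close> records the
  choice of the monomials \<open>U\<^sub>i\<close>. Values \<open>P i\<close> with \<open>i > \<Omega>\<close> have no meaning.
\<close>

definition algorithm_sequence ::
    "('a, 'b) ring_scheme \<Rightarrow> ('a \<Rightarrow> 'g :: linordered_ab_group_add) \<Rightarrow> 'a set \<Rightarrow> 'a set \<Rightarrow>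
      'a \<Rightarrow> 'a \<Rightarrow> enat \<Rightarrow> (nat \<Rightarrow> 'a) \<Rightarrow> (nat \<Rightarrow> nat \<Rightarrow> nat) \<Rightarrow> bool" where
  "algorithm_sequence K \<nu> R CS x y \<Omega> P w \<longleftrightarrow>
     P 0 = x \<and> P 1 = y \<and> 1 \<le> \<Omega> \<and>
     (\<forall>i\<ge>1. enat i \<le> \<Omega> \<longrightarrow>
        (if value_index \<nu> P i = \<infinity> then \<Omega> = enat i
         else balancing_exponents K \<nu> P (step_degree K \<nu> R P w) i (w i) \<and>
              (if alpha_degree K \<nu> R P w i = \<infinity> then \<Omega> = enat i
               else enat i < \<Omega> \<and> algorithm_step K \<nu> R CS P w i)))"


section \<open>Key sequences\<close>

definition key_sequence ::
    "('a, 'b) ring_scheme \<Rightarrow> ('a \<Rightarrow> 'g :: linordered_ab_group_add) \<Rightarrow> 'a set \<Rightarrow>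
      'a \<Rightarrow> 'a \<Rightarrow> enat \<Rightarrow> (nat \<Rightarrow> 'a) \<Rightarrow> bool" where
  "key_sequence K \<nu> T q0 q1 M Q \<longleftrightarrow>
     regular_parameters (K\<lparr>carrier := T\<rparr>) q0 q1 \<and> dominates K \<nu> T \<and>
     1 \<le> M \<and> Q 0 = q0 \<and> Q 1 = q1 \<and>
     \<comment> \<open>nonvanishing is implicit in the use of the values \<open>\<nu> (Q i)\<close> as group elements\<close>
     (\<forall>i. enat i \<le> M \<longrightarrow> Q i \<in> max_ideal (K\<lparr>carrier := T\<rparr>) \<and> Q i \<noteq> \<zero>\<^bsub>K\<^esub>) \<and>
     (\<exists>(m :: nat \<Rightarrow> nat) (mu :: nat \<Rightarrow> nat) (c :: nat \<Rightarrow> nat \<Rightarrow> 'a)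
        (tau :: nat \<Rightarrow> nat \<Rightarrow> nat \<Rightarrow> nat) (v :: nat \<Rightarrow> nat \<Rightarrow> nat).
        \<comment> \<open>the expression for \<open>Q\<^sub>i\<^sub>+\<^sub>1\<close>; \<open>tau i k\<close> is the exponent vector of the \<open>k\<close>-th monomial\<close>
        (\<forall>i\<ge>1. enat i < M \<longrightarrow>
           1 \<le> m i \<and> 1 \<le> mu i \<and>
           (\<forall>k\<in>{1..mu i}.
              c i k \<in> Units (K\<lparr>carrier := T\<rparr>) \<and> (\<forall>s\<in>{1..i}. tau i k s < m s) \<and>
              \<nu> (Q i [^]\<^bsub>K\<^esub> m i) = \<nu> (power_product K Q (Suc i) (tau i k))) \<and>
           Q (Suc i) =
             (Q i [^]\<^bsub>K\<^esub> m i) \<oplus>\<^bsub>K\<^esub>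
             (\<Oplus>\<^bsub>K\<^esub>k\<in>{1..mu i}. c i k \<otimes>\<^bsub>K\<^esub> power_product K Q (Suc i) (tau i k))) \<and>
        (\<forall>i\<ge>1. enat i < M \<longrightarrow> \<nu> (Q (Suc i)) > \<nu> (Q i [^]\<^bsub>K\<^esub> m i)) \<and>
        (\<forall>r. enat r < M \<longrightarrow>
           (\<forall>(N :: nat) (e :: nat \<Rightarrow> nat \<Rightarrow> nat).
              (\<forall>l<N. \<forall>k\<in>{1..r}. e l k < m k) \<and>
              (\<forall>l<N. \<forall>l'<N. l \<noteq> l' \<longrightarrow> (\<exists>k\<le>r. e l k \<noteq> e l' k)) \<and>
              (\<forall>l<N. \<nu> (power_product K Q (Suc r) (e l)) = \<nu> (power_product K Q (Suc r) (e 0))) \<longrightarrow>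
              ring.independent (val_residue_field K \<nu>) (residue_subfield K \<nu> T)
                (map (\<lambda>l. residue_class K \<nu>
                        (power_product K Q (Suc r) (e l)
                           \<otimes>\<^bsub>K\<^esub> inv\<^bsub>K\<^esub> (power_product K Q (Suc r) (e 0)))) [0..<N]))) \<and>
        (\<forall>i\<ge>1. enat i < M \<longrightarrow>
           value_index \<nu> Q i \<noteq> \<infinity> \<and>
           (let mbar = the_enat (value_index \<nu> Q i);
                V = power_product K Q i (v i);
                F = adjoin K \<nu> T (alpha K \<nu> Q v) (i - 1)
            in (\<forall>k\<in>{1..mu i}. mbar dvd tau i k i) \<and>
               balancing_exponents K \<nu> Q m i (v i) \<and>
               (\<exists>e b. 0 < e \<and> m i = mbar * e \<and>
                  (\<forall>t<e. b t = residue_class K \<nu>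
                     ((\<Oplus>\<^bsub>K\<^esub>k\<in>{k \<in> {1..mu i}. tau i k i = t * mbar}.
                         c i k \<otimes>\<^bsub>K\<^esub> power_product K Q i (tau i k))
                        \<otimes>\<^bsub>K\<^esub> inv\<^bsub>K\<^esub> (V [^]\<^bsub>K\<^esub> (e - t))) \<and> b t \<in> F) \<and>
                  has_minimal_polynomial (val_residue_field K \<nu>) F (alpha K \<nu> Q v i) e b))) \<and>
        (\<forall>i. M = enat i \<longrightarrow>
           value_index \<nu> Q i = \<infinity> \<or>
           (value_index \<nu> Q i \<noteq> \<infinity> \<and> balancing_exponents K \<nu> Q m i (v i) \<and>
            alpha_degree K \<nu> T Q v i = \<infinity>)))"

end

theory Submission
  imports Defs
begin

text \<open>
  As long as the values of the two parameters differ, a quadratic transform along \<open>\<nu>\<close> replaces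
  \<open>(s, t)\<close> by \<open>(s, t/s)\<close>, and \<open>x\<close>, \<open>y\<close> remain monomials in the parameters with exponent matrix of
  determinant 1. Since \<open>\<nu> x\<close> and \<open>\<nu> y\<close> are commensurable, this Euclidean algorithm ends with \<open>\<nu> s = \<nu> t\<close>.
  One more transform makes \<open>z = t/s\<close> a unit: \<open>x = s\<^sup>a z\<^sup>b\<close> and \<open>y = s\<^sup>\<omega> z\<^sup>c\<close> with \<open>a\<close> the first value index,
  \<open>y\<^sup>a/x\<^sup>\<omega> = z\<close>, and \<open>P\<^sub>2\<close> is a unit times a power of \<open>s\<close> times a lift of the minimal polynomial of
  \<open>[z] = \<alpha>\<^sub>1\<close>, evaluated at \<open>z\<close>; this lift is the second regular parameter.

  Afterwards every monomial in the \<open>P\<^sub>k\<close> is a power of \<open>z\<close> times a monomial in \<open>s\<close> and the \<open>Q\<^sub>k\<close>. The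
  estimate \<open>n\<^sub>k \<nu> Q\<^sub>k < \<nu> Q\<^sub>k\<^sub>+\<^sub>1\<close> shows that the exponent of \<open>s\<close> stays nonnegative, so the equations of
  the algorithm become those of a key sequence, with \<open>\<alpha>\<^sub>i\<close> changed by a power of \<open>\<alpha>\<^sub>1\<close>.
  The linear independence of monomials follows by induction on the last index: equal values force
  congruent last exponents modulo the value index, so the quotients are powers of \<open>\<alpha>\<^sub>i\<close> below its degree
  with coefficients in the preceding field.

  Regularity is handled without dimension theory: a noetherian local domain with maximal ideal
  generated by \<open>u, v\<close> is two-dimensional if and only if \<open>u \<noteq> 0\<close>
  and no power of \<open>v\<close> is a multiple of \<open>u\<close>.
\<close>

section \<open>Valued fields\<close>

text \<open>The values lie in an arbitrary ordered group, so no comparison with real numbers is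
  available: the descent is measured by \<open>p + q\<close> for a relation
  \<open>nsm p (\<nu> t) = nsm q (\<nu> s)\<close>, and all estimates compare natural multiples. The
  determinant condition \<open>A * D = B * C + 1\<close> is the pivot. It makes \<open>A + B\<close>
  and \<open>C + D\<close> coprime, which pins down the first value index and the monomial
  \<open>U 1\<close>. It puts \<open>\<nu> s\<close> into the group generated by
  \<open>\<nu> x\<close> and \<open>\<nu> y\<close>, so that the value groups of \<open>P\<close>
  and of the new sequence agree up to a shift by one. The obstacle in the last transform is that a
  ring given only as a localisation of \<open>S[z]\<close>, with \<open>s z = t\<close>, must be
  shown to be regular. What decides is that \<open>S[z]\<close> modulo \<open>s\<close> is a
  polynomial ring over the residue field of \<open>S\<close>: a linear relation between powers of
  \<open>z\<close> has all its coefficients in the maximal ideal. The unit \<open>z\<close> causes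
  no harm afterwards because its residue \<alpha>_1 belongs to the new residue field. Factors that
  are powers of \<open>z\<close> therefore disappear into unit coefficients, or rescale minimal
  polynomials over a field that contains the scaling factor.\<close>

primrec nsm :: "nat \<Rightarrow> 'g :: ab_group_add \<Rightarrow> 'g" where
  "nsm 0 g = 0"
| "nsm (Suc n) g = g + nsm n g"

lemma nsm_add: "nsm (m + n) g = nsm m g + nsm n g"
  by (induction m) (simp_all add: add.assoc)

lemma nsm_mult: "nsm (m * n) g = nsm m (nsm n g)"
  by (induction m) (simp_all add: nsm_add)

lemma nsm_add_right: "nsm n (g + h) = nsm n g + nsm n h"
  by (induction n) (simp_all add: algebra_simps)

lemma nsm_zero [simp]: "nsm n 0 = 0"
  by (induction n) simp_all

lemma nsm_uminus: "nsm n (- g) = - nsm n g"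
  by (induction n) simp_all

lemma nsm_diff_right: "nsm n (g - h) = nsm n g - nsm n h"
  using nsm_add_right[of n g "- h"] by (simp add: nsm_uminus)

lemma nsm_diff: "n \<le> m \<Longrightarrow> nsm (m - n) g = nsm m g - nsm n g"
  using nsm_add[of "m - n" n g] by simp

lemma nsm_nonneg: "0 \<le> (g :: 'g :: linordered_ab_group_add) \<Longrightarrow> 0 \<le> nsm n g"
  by (induction n) simp_all

lemma nsm_mono: "(g :: 'g :: linordered_ab_group_add) \<le> h \<Longrightarrow> nsm n g \<le> nsm n h"
  by (induction n) (simp_all add: add_mono)

lemma nsm_strict_mono: "(g :: 'g :: linordered_ab_group_add) < h \<Longrightarrow> 0 < n \<Longrightarrow> nsm n g < nsm n h"
  using nsm_mono[of g h] by (cases n) (simp_all add: add_less_le_mono less_imp_le)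

lemma nsm_pos: "0 < (g :: 'g :: linordered_ab_group_add) \<Longrightarrow> 0 < n \<Longrightarrow> 0 < nsm n g"
  using nsm_strict_mono[of 0 g n] by simp

text \<open>The order makes the group torsion free: multiplication by a positive \<open>n\<close>
  preserves strict inequalities.\<close>

lemma nsm_cancel:
  fixes g h :: "'g :: linordered_ab_group_add"
  assumes "0 < n" "nsm n g = nsm n h" shows "g = h"
  using nsm_strict_mono[of g h n] nsm_strict_mono[of h g n] assms by (metis less_irrefl neqE)

lemma nsm_le_mono:
  assumes "0 \<le> (g :: 'g :: linordered_ab_group_add)" "m \<le> n" shows "nsm m g \<le> nsm n g"
proof -
  have "nsm n g = nsm m g + nsm (n - m) g"
    using nsm_add[of m "n - m" g] assms(2) by simp
  with nsm_nonneg[OF assms(1), of "n - m"] show ?thesis by simp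
qed

lemma nsm_less_mono:
  assumes "0 < (g :: 'g :: linordered_ab_group_add)" "m < n" shows "nsm m g < nsm n g"
proof -
  have "nsm n g = nsm m g + nsm (n - m) g"
    using nsm_add[of m "n - m" g] assms(2) by simp
  with nsm_pos[OF assms(1), of "n - m"] assms(2) show ?thesis by simp
qed

lemma nsm_inj: "0 < (g :: 'g :: linordered_ab_group_add) \<Longrightarrow> nsm m g = nsm n g \<longleftrightarrow> m = n"
  using nsm_less_mono[of g m n] nsm_less_mono[of g n m] by (metis less_irrefl linorder_neqE_nat)

section \<open>Arithmetic of fractions in a field\<close>

context field
begin

lemma inv_in [simp, intro]: "a \<in> carrier R \<Longrightarrow> a \<noteq> \<zero> \<Longrightarrow> inv a \<in> carrier R"
  by (simp add: field_Units)

lemma mult_inv [simp]: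
  assumes "a \<in> carrier R" "a \<noteq> \<zero>" shows "a \<otimes> inv a = \<one>" "inv a \<otimes> a = \<one>"
  using assms by (simp_all add: field_Units)

lemma inv_nonzero [simp]: "a \<in> carrier R \<Longrightarrow> a \<noteq> \<zero> \<Longrightarrow> inv a \<noteq> \<zero>"
  by (metis mult_inv(1) r_null zero_not_one)

lemma mult_nonzero [simp]:
  "a \<in> carrier R \<Longrightarrow> b \<in> carrier R \<Longrightarrow> a \<noteq> \<zero> \<Longrightarrow> b \<noteq> \<zero> \<Longrightarrow> a \<otimes> b \<noteq> \<zero>"
  using integral by blast

lemma pow_nonzero [simp]: "a \<in> carrier R \<Longrightarrow> a \<noteq> \<zero> \<Longrightarrow> a [^] (n :: nat) \<noteq> \<zero>"
  by (induction n) auto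

lemma eq_divide_iff:
  assumes "a \<in> carrier R" "b \<in> carrier R" "c \<in> carrier R" "b \<noteq> \<zero>"
  shows "c = a \<otimes> inv b \<longleftrightarrow> c \<otimes> b = a"
proof
  assume "c = a \<otimes> inv b"
  then show "c \<otimes> b = a" using assms by (simp add: m_assoc)
next
  assume "c \<otimes> b = a"
  then show "c = a \<otimes> inv b" using assms by (auto simp: m_assoc)
qed

lemma divide_mult_cancel [simp]:
  assumes "a \<in> carrier R" "b \<in> carrier R" "b \<noteq> \<zero>"
  shows "a \<otimes> inv b \<otimes> b = a" "b \<otimes> (a \<otimes> inv b) = a"
    "a \<otimes> b \<otimes> inv b = a" "b \<otimes> (inv b \<otimes> a) = a" "inv b \<otimes> (b \<otimes> a) = a"
proof -
  show "a \<otimes> inv b \<otimes> b = a" "a \<otimes> b \<otimes> inv b = a" using assms by (simp_all add: m_assoc)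
  show "b \<otimes> (inv b \<otimes> a) = a" "inv b \<otimes> (b \<otimes> a) = a"
    using m_assoc[of b "inv b" a, symmetric] m_assoc[of "inv b" b a, symmetric] assms by simp_all
  then show "b \<otimes> (a \<otimes> inv b) = a" using assms by (simp add: m_comm)
qed

lemma inv_mult_distrib:
  assumes "a \<in> carrier R" "b \<in> carrier R" "a \<noteq> \<zero>" "b \<noteq> \<zero>"
  shows "inv (a \<otimes> b) = inv a \<otimes> inv b"
proof -
  have "(a \<otimes> b) \<otimes> (inv a \<otimes> inv b) = a \<otimes> ((b \<otimes> inv b) \<otimes> inv a)"
    using assms by (simp add: m_ac del: mult_inv divide_mult_cancel)
  then have "(a \<otimes> b) \<otimes> (inv a \<otimes> inv b) = \<one>"
    using assms by simp
  then show ?thesis using assms by (intro comm_inv_char) auto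
qed

lemma inv_pow:
  assumes "a \<in> carrier R" "a \<noteq> \<zero>" shows "inv (a [^] (n :: nat)) = inv a [^] n"
  using assms by (induction n) (simp_all add: inv_mult_distrib)

lemma inv_inv_eq [simp]: "a \<in> carrier R \<Longrightarrow> a \<noteq> \<zero> \<Longrightarrow> inv (inv a) = a"
  by (simp add: field_Units)

lemma inv_divide:
  assumes "a \<in> carrier R" "b \<in> carrier R" "a \<noteq> \<zero>" "b \<noteq> \<zero>"
  shows "inv (a \<otimes> inv b) = b \<otimes> inv a"
  using assms by (simp add: inv_mult_distrib m_comm)

lemma divide_eq_divide_iff:
  assumes "a \<in> carrier R" "b \<in> carrier R" "c \<in> carrier R" "d \<in> carrier R" "b \<noteq> \<zero>" "d \<noteq> \<zero>"
  shows "a \<otimes> inv b = c \<otimes> inv d \<longleftrightarrow> a \<otimes> d = c \<otimes> b"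
proof -
  have "a \<otimes> inv b = c \<otimes> inv d \<longleftrightarrow> a \<otimes> inv b \<otimes> d = c"
    using assms by (simp add: eq_divide_iff)
  also have "a \<otimes> inv b \<otimes> d = (a \<otimes> d) \<otimes> inv b" using assms by (simp add: m_ac)
  also have "(a \<otimes> d) \<otimes> inv b = c \<longleftrightarrow> c \<otimes> b = a \<otimes> d"
    using assms eq_divide_iff[of "a \<otimes> d" b c] by auto
  finally show ?thesis by auto
qed

lemma mult_divide_mult:
  assumes "a \<in> carrier R" "b \<in> carrier R" "c \<in> carrier R" "d \<in> carrier R" "b \<noteq> \<zero>" "d \<noteq> \<zero>"
  shows "(a \<otimes> inv b) \<otimes> (c \<otimes> inv d) = (a \<otimes> c) \<otimes> inv (b \<otimes> d)"
  using assms by (simp add: inv_mult_distrib m_ac)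

lemma add_divide:
  assumes "a \<in> carrier R" "b \<in> carrier R" "c \<in> carrier R" "d \<in> carrier R" "b \<noteq> \<zero>" "d \<noteq> \<zero>"
  shows "(a \<otimes> inv b) \<oplus> (c \<otimes> inv d) = (a \<otimes> d \<oplus> c \<otimes> b) \<otimes> inv (b \<otimes> d)"
proof -
  have "(a \<otimes> inv b \<oplus> c \<otimes> inv d) \<otimes> (b \<otimes> d) = (a \<otimes> inv b \<otimes> b) \<otimes> d \<oplus> (c \<otimes> inv d \<otimes> d) \<otimes> b"
    using assms by (simp add: l_distr r_distr m_ac del: divide_mult_cancel mult_inv)
  also have "\<dots> = a \<otimes> d \<oplus> c \<otimes> b" using assms by simp
  finally show ?thesis using assms by (subst eq_divide_iff) auto
qed

lemma divide_pow:
  assumes "a \<in> carrier R" "b \<in> carrier R" "b \<noteq> \<zero>"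
  shows "(a \<otimes> inv b) [^] (n :: nat) = a [^] n \<otimes> inv (b [^] n)"
  using assms by (simp add: inv_pow nat_pow_distrib)

end

section \<open>The valuation ring, its maximal ideal and its residue field\<close>

locale valued_field = field K for K (structure) +
  fixes \<nu> :: "'a \<Rightarrow> 'g :: linordered_ab_group_add"
  assumes valuation: "valuation K \<nu>"
begin

abbreviation V where "V \<equiv> val_ring K \<nu>"
abbreviation M where "M \<equiv> val_ideal K \<nu>"
abbreviation L where "L \<equiv> val_residue_field K \<nu>"
abbreviation res where "res \<equiv> residue_class K \<nu>"

lemma val_mult [simp]:
  "a \<in> carrier K \<Longrightarrow> b \<in> carrier K \<Longrightarrow> a \<noteq> \<zero> \<Longrightarrow> b \<noteq> \<zero> \<Longrightarrow> \<nu> (a \<otimes> b) = \<nu> a + \<nu> b"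
  using valuation by (auto simp: valuation_def)

lemma val_add:
  "a \<in> carrier K \<Longrightarrow> b \<in> carrier K \<Longrightarrow> a \<noteq> \<zero> \<Longrightarrow> b \<noteq> \<zero> \<Longrightarrow> a \<oplus> b \<noteq> \<zero>
    \<Longrightarrow> min (\<nu> a) (\<nu> b) \<le> \<nu> (a \<oplus> b)"
  using valuation by (auto simp: valuation_def)

lemma val_one [simp]: "\<nu> \<one> = 0"
  using val_mult[of \<one> \<one>] by simp

lemma val_pow [simp]:
  "a \<in> carrier K \<Longrightarrow> a \<noteq> \<zero> \<Longrightarrow> \<nu> (a [^] (n :: nat)) = nsm n (\<nu> a)"
  by (induction n) (simp_all add: add.commute)

lemma val_inv [simp]: "a \<in> carrier K \<Longrightarrow> a \<noteq> \<zero> \<Longrightarrow> \<nu> (inv a) = - \<nu> a"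
  using val_mult[of a "inv a"] by (simp add: eq_neg_iff_add_eq_0 add.commute)

text \<open>The square of \<open>\<ominus> \<one>\<close> is \<open>\<one>\<close>, so twice the
  value is zero, and an ordered group has no torsion.\<close>

lemma val_uminus_one: "\<nu> (\<ominus> \<one>) = 0"
proof -
  have *: "\<ominus> \<one> \<noteq> \<zero>" using one_not_zero by (metis minus_minus minus_zero one_closed)
  have "\<nu> ((\<ominus> \<one>) \<otimes> (\<ominus> \<one>)) = nsm 2 (\<nu> (\<ominus> \<one>))" using * by (simp add: numeral_2_eq_2)
  moreover have "(\<ominus> \<one>) \<otimes> (\<ominus> \<one>) = \<one>" by (simp add: l_minus)
  ultimately show ?thesis using nsm_cancel[of 2 "\<nu> (\<ominus> \<one>)" 0] by simp
qed

lemma val_uminus [simp]: "a \<in> carrier K \<Longrightarrow> \<nu> (\<ominus> a) = \<nu> a"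
proof (cases "a = \<zero>")
  case False
  assume a: "a \<in> carrier K"
  have "\<ominus> \<one> \<noteq> \<zero>" using one_not_zero by (metis minus_minus minus_zero one_closed)
  then have "\<nu> ((\<ominus> \<one>) \<otimes> a) = \<nu> a" using False a by (simp add: val_uminus_one)
  then show ?thesis using a by (simp add: l_minus)
qed simp

lemma V_carrier: "a \<in> V \<Longrightarrow> a \<in> carrier K" by (simp add: val_ring_def)
lemma M_V: "a \<in> M \<Longrightarrow> a \<in> V" by (auto simp: val_ring_def val_ideal_def)
lemma M_carrier: "a \<in> M \<Longrightarrow> a \<in> carrier K" by (auto simp: val_ideal_def)
lemma V_iff: "a \<noteq> \<zero> \<Longrightarrow> a \<in> V \<longleftrightarrow> a \<in> carrier K \<and> 0 \<le> \<nu> a" by (simp add: val_ring_def)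
lemma M_iff: "a \<noteq> \<zero> \<Longrightarrow> a \<in> M \<longleftrightarrow> a \<in> carrier K \<and> 0 < \<nu> a" by (simp add: val_ideal_def)
lemma zero_in_M [simp]: "\<zero> \<in> M" by (simp add: val_ideal_def)
lemma one_notin_M [simp]: "\<one> \<notin> M" by (simp add: val_ideal_def)
lemma not_M: "a \<in> V \<Longrightarrow> a \<notin> M \<longleftrightarrow> a \<noteq> \<zero> \<and> \<nu> a = 0"
  by (auto simp: val_ring_def val_ideal_def)

lemma V_mult [simp]: "a \<in> V \<Longrightarrow> b \<in> V \<Longrightarrow> a \<otimes> b \<in> V"
  by (cases "a = \<zero>"; cases "b = \<zero>") (auto simp: val_ring_def)

lemma V_add [simp]: "a \<in> V \<Longrightarrow> b \<in> V \<Longrightarrow> a \<oplus> b \<in> V"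
  using val_add[of a b]
  by (cases "a = \<zero>"; cases "b = \<zero>"; cases "a \<oplus> b = \<zero>")
    (auto simp: val_ring_def min_le_iff_disj)

lemma V_uminus [simp]: "a \<in> V \<Longrightarrow> \<ominus> a \<in> V"
  by (auto simp: val_ring_def)

lemma V_one [simp]: "\<one> \<in> V" and V_zero [simp]: "\<zero> \<in> V" by (auto simp: val_ring_def)

lemma M_mult [simp]: "a \<in> M \<Longrightarrow> b \<in> V \<Longrightarrow> a \<otimes> b \<in> M" "b \<in> V \<Longrightarrow> a \<in> M \<Longrightarrow> b \<otimes> a \<in> M"
  by (cases "a = \<zero>"; cases "b = \<zero>"; auto simp: val_ring_def val_ideal_def add_pos_nonneg add_nonneg_pos)+

lemma M_add [simp]: "a \<in> M \<Longrightarrow> b \<in> M \<Longrightarrow> a \<oplus> b \<in> M"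
  using val_add[of a b]
  by (cases "a = \<zero>"; cases "b = \<zero>"; cases "a \<oplus> b = \<zero>")
    (auto simp: val_ideal_def min_le_iff_disj)

lemma M_uminus [simp]: "a \<in> M \<Longrightarrow> \<ominus> a \<in> M"
  by (auto simp: val_ideal_def)

lemma V_divide: "a \<in> carrier K \<Longrightarrow> b \<in> carrier K \<Longrightarrow> b \<noteq> \<zero> \<Longrightarrow> a = \<zero> \<or> \<nu> b \<le> \<nu> a \<Longrightarrow> a \<otimes> inv b \<in> V"
  by (cases "a = \<zero>") (auto simp: val_ring_def)

lemma V_inv: "a \<in> V \<Longrightarrow> a \<notin> M \<Longrightarrow> inv a \<in> V"
  by (auto simp: not_M val_ring_def)

declare V_carrier [simp]

lemma V_subring: "subring V K"
  by (rule subringI) auto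

lemma V_pow [simp]: "a \<in> V \<Longrightarrow> a [^] (n :: nat) \<in> V"
  by (induction n) auto

lemma inv_notin_M: "a \<in> V \<Longrightarrow> a \<notin> M \<Longrightarrow> inv a \<notin> M"
  using not_M[of a] M_iff[of "inv a"] by auto

lemma M_prime: "a \<in> V \<Longrightarrow> b \<in> V \<Longrightarrow> a \<otimes> b \<in> M \<longleftrightarrow> a \<in> M \<or> b \<in> M"
  using not_M[of "a \<otimes> b"] not_M[of a] not_M[of b] by auto

lemma V_ring: "cring (K\<lparr>carrier := V\<rparr>)"
  using subcring_iff[OF subringE(1)[OF V_subring]] subcringI'[OF V_subring] by simp

lemma M_ideal: "ideal M (K\<lparr>carrier := V\<rparr>)"
proof (rule idealI)
  show "ring (K\<lparr>carrier := V\<rparr>)" by (rule cring.axioms(1)[OF V_ring])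
  interpret V: cring "K\<lparr>carrier := V\<rparr>" by (rule V_ring)
  show "subgroup M (add_monoid (K\<lparr>carrier := V\<rparr>))"
  proof (rule V.add.subgroupI)
    fix a assume a: "a \<in> M"
    have "\<ominus>\<^bsub>K\<lparr>carrier := V\<rparr>\<^esub> a = \<ominus> a"
      by (rule V.minus_equality) (use a M_V in \<open>auto simp: l_neg\<close>)
    then show "\<ominus>\<^bsub>K\<lparr>carrier := V\<rparr>\<^esub> a \<in> M" using a by simp
    next
    show "M \<noteq> {}" using zero_in_M by blast
  qed (use M_V in auto)
qed auto

text \<open>An element of \<open>V\<close> outside \<open>M\<close> has value 0, so its inverse lies
  in \<open>V\<close> as well and any ideal containing it is everything.\<close>

lemma M_maximal: "maximalideal M (K\<lparr>carrier := V\<rparr>)"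
proof (rule maximalidealI[OF M_ideal])
  show "carrier (K\<lparr>carrier := V\<rparr>) \<noteq> M" using one_notin_M V_one by (metis partial_object.select_convs(1) partial_object.surjective partial_object.update_convs(1))
next
  fix J assume J: "ideal J (K\<lparr>carrier := V\<rparr>)" "M \<subseteq> J" "J \<subseteq> carrier (K\<lparr>carrier := V\<rparr>)"
  show "J = M \<or> J = carrier (K\<lparr>carrier := V\<rparr>)"
  proof (cases "J \<subseteq> M")
    case False
    then obtain a where a: "a \<in> J" "a \<notin> M" by auto
    then have aV: "a \<in> V" using J(3) by auto
    have "inv a \<otimes> a \<in> J" using ideal.I_l_closed[OF J(1) a(1), of "inv a"] V_inv[OF aV a(2)] by simp
    then have one: "\<one> \<in> J" using a aV not_M by auto
    have "V \<subseteq> J"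
    proof
      fix x assume "x \<in> V" then show "x \<in> J" using ideal.I_l_closed[OF J(1) one, of x] by simp
    qed
    then show ?thesis using J(3) by auto
  qed (use J(2) in auto)
qed

lemma L_field: "field L"
  unfolding val_residue_field_def by (rule maximalideal.quotient_is_field[OF M_maximal V_ring])

sublocale L: field L by (rule L_field)

lemma res_hom: "res \<in> ring_hom (K\<lparr>carrier := V\<rparr>) L"
  unfolding val_residue_field_def residue_class_def[abs_def] by (rule ideal.rcos_ring_hom[OF M_ideal])

lemma res_closed [simp]: "a \<in> V \<Longrightarrow> res a \<in> carrier L"
  using ring_hom_closed[OF res_hom] by simp
lemma res_mult [simp]: "a \<in> V \<Longrightarrow> b \<in> V \<Longrightarrow> res (a \<otimes> b) = res a \<otimes>\<^bsub>L\<^esub> res b"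
  using ring_hom_mult[OF res_hom] by simp
lemma res_add [simp]: "a \<in> V \<Longrightarrow> b \<in> V \<Longrightarrow> res (a \<oplus> b) = res a \<oplus>\<^bsub>L\<^esub> res b"
  using ring_hom_add[OF res_hom] by simp
lemma res_one [simp]: "res \<one> = \<one>\<^bsub>L\<^esub>"
  using ring_hom_one[OF res_hom] by simp
lemma res_zero [simp]: "res \<zero> = \<zero>\<^bsub>L\<^esub>"
  using res_add[of \<zero> \<zero>] L.add.l_cancel[of "res \<zero>" "res \<zero>" "\<zero>\<^bsub>L\<^esub>"] by simp
lemma res_uminus [simp]: "a \<in> V \<Longrightarrow> res (\<ominus> a) = \<ominus>\<^bsub>L\<^esub> res a"
  using res_add[of "\<ominus> a" a] by (simp add: l_neg L.minus_equality)
lemma res_pow [simp]: "a \<in> V \<Longrightarrow> res (a [^] (n :: nat)) = res a [^]\<^bsub>L\<^esub> n"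
  by (induction n) auto

lemma res_zero_iff: "a \<in> V \<Longrightarrow> res a = \<zero>\<^bsub>L\<^esub> \<longleftrightarrow> a \<in> M"
proof -
  assume a: "a \<in> V"
  interpret V: cring "K\<lparr>carrier := V\<rparr>" by (rule V_ring)
  have z: "\<zero>\<^bsub>L\<^esub> = M" by (simp add: val_residue_field_def FactRing_def)
  show ?thesis unfolding z residue_class_def
    using V.a_rcos_zero[OF M_ideal, of a] abelian_subgroup.a_rcos_self[OF _ , of M "K\<lparr>carrier := V\<rparr>" a]
      a abelian_subgroupI3[OF ideal.axioms(1)[OF M_ideal] V.is_abelian_group] by auto
qed

lemma res_inv [simp]: "a \<in> V \<Longrightarrow> a \<notin> M \<Longrightarrow> res (inv a) = inv\<^bsub>L\<^esub> (res a)"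
proof -
  assume a: "a \<in> V" "a \<notin> M"
  have "res a \<otimes>\<^bsub>L\<^esub> res (inv a) = res (a \<otimes> inv a)" using a V_inv by simp
  also have "\<dots> = \<one>\<^bsub>L\<^esub>" using a not_M by simp
  finally show ?thesis using a V_inv by (metis L.comm_inv_char res_closed)
qed

lemma res_finsum:
  assumes "finite S" "\<And>s. s \<in> S \<Longrightarrow> f s \<in> V"
  shows "(\<Oplus>s\<in>S. f s) \<in> V \<and> res (\<Oplus>s\<in>S. f s) = (\<Oplus>\<^bsub>L\<^esub>s\<in>S. res (f s))"
  using assms by (induction S rule: finite_induct) (auto simp: Pi_iff)

end

section \<open>Dominated rings\<close>

context ring
begin

text \<open>Ideals of a subring are treated as plain subsets of the big ring, so that ideals of
  different subrings can be intersected and compared without changing the ring structure. Negatives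
  come from multiplication by \<open>\<ominus> \<one>\<close>.\<close>

definition is_ideal_of :: "'a set \<Rightarrow> 'a set \<Rightarrow> bool" where
  "is_ideal_of A I \<longleftrightarrow> I \<subseteq> A \<and> \<zero> \<in> I \<and> (\<forall>a\<in>I. \<forall>b\<in>I. a \<oplus> b \<in> I) \<and> (\<forall>a\<in>I. \<forall>r\<in>A. r \<otimes> a \<in> I)"

definition is_prime_of :: "'a set \<Rightarrow> 'a set \<Rightarrow> bool" where
  "is_prime_of A I \<longleftrightarrow> is_ideal_of A I \<and> \<one> \<notin> I \<and> (\<forall>a\<in>A. \<forall>b\<in>A. a \<otimes> b \<in> I \<longrightarrow> a \<in> I \<or> b \<in> I)"

definition ascending_chain_condition :: "'a set \<Rightarrow> bool" where
  "ascending_chain_condition A \<longleftrightarrow> (\<forall>I :: nat \<Rightarrow> 'a set.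
     (\<forall>n. is_ideal_of A (I n) \<and> I n \<subseteq> I (Suc n)) \<longrightarrow> (\<exists>n. \<forall>m\<ge>n. I m = I n))"

end

context cring
begin

lemma ideal_iff:
  assumes A: "subring A R"
  shows "ideal I (R\<lparr>carrier := A\<rparr>) \<longleftrightarrow> is_ideal_of A I"
proof
  note A' = subringE[OF A]
  interpret A: ring "R\<lparr>carrier := A\<rparr>" by (rule subring_is_ring[OF A])
  {
    assume "ideal I (R\<lparr>carrier := A\<rparr>)"
    then interpret I: ideal I "R\<lparr>carrier := A\<rparr>" .
    show "is_ideal_of A I" unfolding is_ideal_of_def
      using I.a_subset I.zero_closed I.a_closed I.I_l_closed by auto
  }
  assume I: "is_ideal_of A I"
  show "ideal I (R\<lparr>carrier := A\<rparr>)"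
  proof (rule idealI)
    show "ring (R\<lparr>carrier := A\<rparr>)" ..
    show "subgroup I (add_monoid (R\<lparr>carrier := A\<rparr>))"
    proof (rule A.add.subgroupI)
      fix a assume a: "a \<in> I"
      have aA: "a \<in> A" "a \<in> carrier R" using a I A'(1) by (auto simp: is_ideal_of_def)
      have "(\<ominus> \<one>) \<otimes> a \<in> I" using I a A' by (auto simp: is_ideal_of_def)
      then have "\<ominus> a \<in> I" using aA by (simp add: l_minus)
      moreover have "\<ominus>\<^bsub>R\<lparr>carrier := A\<rparr>\<^esub> a = \<ominus> a"
        by (rule A.minus_equality) (use aA A' in \<open>auto simp: l_neg\<close>)
      ultimately show "\<ominus>\<^bsub>R\<lparr>carrier := A\<rparr>\<^esub> a \<in> I" by simp
    qed (use I in \<open>auto simp: is_ideal_of_def\<close>)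
  next
    fix a x assume "a \<in> I" and "x \<in> carrier (R\<lparr>carrier := A\<rparr>)"
    then have ax: "a \<in> I" "x \<in> A" by auto
    then show "x \<otimes>\<^bsub>R\<lparr>carrier := A\<rparr>\<^esub> a \<in> I" using I by (auto simp: is_ideal_of_def)
    moreover have "a \<otimes> x = x \<otimes> a" using ax I A'(1) by (intro m_comm) (auto simp: is_ideal_of_def)
    ultimately show "a \<otimes>\<^bsub>R\<lparr>carrier := A\<rparr>\<^esub> x \<in> I" by simp
  qed
qed

lemma subring_cring: "subring A R \<Longrightarrow> cring (R\<lparr>carrier := A\<rparr>)"
  using subcring_iff[OF subringE(1)] subcringI' by blast

lemma is_ideal_of_proper: "is_ideal_of A I \<Longrightarrow> subring A R \<Longrightarrow> A \<noteq> I \<longleftrightarrow> \<one> \<notin> I"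
  using subringE(1,3)[of A R] by (fastforce simp: is_ideal_of_def)

lemma primeideal_iff:
  assumes A: "subring A R"
  shows "primeideal I (R\<lparr>carrier := A\<rparr>) \<longleftrightarrow> is_prime_of A I"
  unfolding primeideal_def primeideal_axioms_def is_prime_of_def ideal_iff[OF A]
  using subring_cring[OF A] is_ideal_of_proper[OF _ A] by auto

lemma maximalideal_iff:
  assumes A: "subring A R"
  shows "maximalideal I (R\<lparr>carrier := A\<rparr>) \<longleftrightarrow>
    is_ideal_of A I \<and> \<one> \<notin> I \<and> (\<forall>J. is_ideal_of A J \<longrightarrow> I \<subseteq> J \<longrightarrow> \<one> \<notin> J \<longrightarrow> J = I)"
proof -
  have p: "A = J \<longleftrightarrow> \<one> \<in> J" "J \<subseteq> A" if "is_ideal_of A J" for J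
    using is_ideal_of_proper[OF that A] that by (auto simp: is_ideal_of_def)
  have "maximalideal I (R\<lparr>carrier := A\<rparr>) \<longleftrightarrow> is_ideal_of A I \<and> A \<noteq> I \<and>
    (\<forall>J. is_ideal_of A J \<longrightarrow> I \<subseteq> J \<longrightarrow> J \<subseteq> A \<longrightarrow> J = I \<or> J = A)"
    by (simp add: maximalideal_def maximalideal_axioms_def ideal_iff[OF A])
  then show ?thesis using p by metis
qed

text \<open>Without a maximal member, dependent choice would build a strictly increasing
  chain.\<close>

lemma acc_maximal:
  assumes acc: "ascending_chain_condition A" and F: "F \<noteq> {}" "\<And>I. I \<in> F \<Longrightarrow> is_ideal_of A I"
  shows "\<exists>I\<in>F. \<forall>J\<in>F. I \<subseteq> J \<longrightarrow> J = I"
proof (rule ccontr)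
  assume neg: "\<not> ?thesis"
  obtain I0 where "I0 \<in> F" using F by auto
  moreover have "\<exists>J. J \<in> F \<and> I \<subset> J" if "I \<in> F" for I using neg that by blast
  ultimately have "\<exists>f. \<forall>n :: nat. f n \<in> F \<and> f n \<subset> f (Suc n)"
    by (intro dependent_nat_choice) auto
  then obtain f where f: "\<And>n :: nat. f n \<in> F" "\<And>n. f n \<subset> f (Suc n)" by blast
  then obtain n where "f (Suc n) = f n"
    using acc F(2) unfolding ascending_chain_condition_def by (metis le_SucI order_refl psubset_imp_subset)
  with f(2)[of n] show False by auto
qed

lemma noetherian_iff:
  assumes A: "subring A R"
  shows "noetherian_ring (R\<lparr>carrier := A\<rparr>) \<longleftrightarrow> ascending_chain_condition A"
proof
  interpret A: ring "R\<lparr>carrier := A\<rparr>" by (rule subring_is_ring[OF A])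
  {
    assume "noetherian_ring (R\<lparr>carrier := A\<rparr>)"
    then interpret N: noetherian_ring "R\<lparr>carrier := A\<rparr>" .
    show "ascending_chain_condition A" unfolding ascending_chain_condition_def
    proof (intro allI impI)
      fix I :: "nat \<Rightarrow> 'a set" assume I: "\<forall>n. is_ideal_of A (I n) \<and> I n \<subseteq> I (Suc n)"
      then have step: "\<And>n. I n \<subseteq> I (Suc n)" by blast
      have mono: "m \<le> n \<Longrightarrow> I m \<subseteq> I n" for m n using step lift_Suc_mono_le[of I m n] by blast
      have tot: "I m \<subseteq> I n \<or> I n \<subseteq> I m" for m n using mono[of m n] mono[of n m] by linarith
      have idl: "ideal (I n) (R\<lparr>carrier := A\<rparr>)" for n using I ideal_iff[OF A] by blast
      have "\<Union>(range I) \<in> range I"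
      proof (rule N.ideal_chain_is_trivial)
        show "subset.chain {J. ideal J (R\<lparr>carrier := A\<rparr>)} (range I)"
          unfolding pred_on.chain_def using idl tot by blast
      qed auto
      then obtain n where "\<Union>(range I) = I n" by auto
      then have "\<forall>m\<ge>n. I m = I n" using mono by (metis UN_upper UNIV_I subset_antisym)
      then show "\<exists>n. \<forall>m\<ge>n. I m = I n" ..
    qed
  }
  assume acc: "ascending_chain_condition A"
  show "noetherian_ring (R\<lparr>carrier := A\<rparr>)"
  proof (rule A.noetherian_ringI)
    fix I assume I: "ideal I (R\<lparr>carrier := A\<rparr>)"
    then have IA: "I \<subseteq> A" using ideal_iff[OF A] by (auto simp: is_ideal_of_def)
    \<comment> \<open>Among the finitely generated ideals inside \<open>I\<close> a maximal one is
      taken; adjoining one more element of \<open>I\<close> to its generators cannot enlarge it, so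
      it is \<open>I\<close>.\<close>
    let ?F = "{Idl\<^bsub>R\<lparr>carrier := A\<rparr>\<^esub> S |S. finite S \<and> S \<subseteq> I}"
    have "\<exists>J\<in>?F. \<forall>J'\<in>?F. J \<subseteq> J' \<longrightarrow> J' = J"
    proof (rule acc_maximal[OF acc])
      show "\<And>J. J \<in> ?F \<Longrightarrow> is_ideal_of A J"
        using ideal_iff[OF A] A.genideal_ideal IA by auto
    qed auto
    then obtain J where J: "J \<in> ?F" and Jmax: "\<forall>J'\<in>?F. J \<subseteq> J' \<longrightarrow> J' = J" by (rule bexE)
    from J obtain S where S: "finite S" "S \<subseteq> I" and JS: "J = Idl\<^bsub>R\<lparr>carrier := A\<rparr>\<^esub> S" by fast
    have max: "Idl\<^bsub>R\<lparr>carrier := A\<rparr>\<^esub> S' = Idl\<^bsub>R\<lparr>carrier := A\<rparr>\<^esub> S"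
      if "finite S'" "S' \<subseteq> I" "Idl\<^bsub>R\<lparr>carrier := A\<rparr>\<^esub> S \<subseteq> Idl\<^bsub>R\<lparr>carrier := A\<rparr>\<^esub> S'" for S'
      using bspec[OF Jmax, of "Idl\<^bsub>R\<lparr>carrier := A\<rparr>\<^esub> S'"] that JS by auto
    have "I \<subseteq> Idl\<^bsub>R\<lparr>carrier := A\<rparr>\<^esub> S"
    proof
      fix a assume a: "a \<in> I"
      have sub: "insert a S \<subseteq> carrier (R\<lparr>carrier := A\<rparr>)" using a S IA by auto
      have ins: "insert a S \<subseteq> Idl\<^bsub>R\<lparr>carrier := A\<rparr>\<^esub> (insert a S)" by (rule A.genideal_self[OF sub])
      have "Idl\<^bsub>R\<lparr>carrier := A\<rparr>\<^esub> S \<subseteq> Idl\<^bsub>R\<lparr>carrier := A\<rparr>\<^esub> (insert a S)"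
        by (rule A.genideal_minimal[OF A.genideal_ideal[OF sub]]) (use ins in auto)
      then show "a \<in> Idl\<^bsub>R\<lparr>carrier := A\<rparr>\<^esub> S" using max[of "insert a S"] S a ins by auto
    qed
    moreover have "Idl\<^bsub>R\<lparr>carrier := A\<rparr>\<^esub> S \<subseteq> I" by (rule A.genideal_minimal[OF I S(2)])
    ultimately show "\<exists>S\<subseteq>carrier (R\<lparr>carrier := A\<rparr>). finite S \<and> I = Idl\<^bsub>R\<lparr>carrier := A\<rparr>\<^esub> S"
      using S IA by auto
  qed
qed

end

text \<open>The last two assumptions stand for a noetherian local ring with maximal ideal
  \<open>A \<inter> M\<close>. In this form they can be checked directly for localisations.\<close>

locale dominated_ring = valued_field +
  fixes A
  assumes sub: "subring A K"
    and A_V: "A \<subseteq> V"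
    and unit: "\<And>f. f \<in> A \<Longrightarrow> f \<notin> M \<Longrightarrow> inv f \<in> A"
    and acc: "ascending_chain_condition A"
begin

lemma A_carrier [simp]: "a \<in> A \<Longrightarrow> a \<in> carrier K" using subringE(1)[OF sub] by auto
lemma A_in_V: "a \<in> A \<Longrightarrow> a \<in> V" using A_V by auto
lemma A_closed [simp]:
  "\<zero> \<in> A" "\<one> \<in> A" "a \<in> A \<Longrightarrow> b \<in> A \<Longrightarrow> a \<oplus> b \<in> A" "a \<in> A \<Longrightarrow> b \<in> A \<Longrightarrow> a \<otimes> b \<in> A" "a \<in> A \<Longrightarrow> \<ominus> a \<in> A"
  using subringE[OF sub] by auto
lemma A_minus [simp]: "a \<in> A \<Longrightarrow> b \<in> A \<Longrightarrow> a \<ominus> b \<in> A" by (simp add: minus_eq)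
lemma A_pow [simp]: "a \<in> A \<Longrightarrow> a [^] (n :: nat) \<in> A" by (induction n) auto

lemma ideal_closed:
  assumes "is_ideal_of A I"
  shows "\<zero> \<in> I" "a \<in> I \<Longrightarrow> a \<in> A" "a \<in> I \<Longrightarrow> b \<in> I \<Longrightarrow> a \<oplus> b \<in> I" "a \<in> I \<Longrightarrow> r \<in> A \<Longrightarrow> r \<otimes> a \<in> I"
    "a \<in> I \<Longrightarrow> r \<in> A \<Longrightarrow> a \<otimes> r \<in> I" "a \<in> I \<Longrightarrow> b \<in> I \<Longrightarrow> a \<ominus> b \<in> I"
proof -
  show *: "\<zero> \<in> I" "a \<in> I \<Longrightarrow> a \<in> A" "a \<in> I \<Longrightarrow> b \<in> I \<Longrightarrow> a \<oplus> b \<in> I"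
    "a \<in> I \<Longrightarrow> r \<in> A \<Longrightarrow> r \<otimes> a \<in> I" for a b r
    using assms by (auto simp: is_ideal_of_def)
  show "a \<in> I \<Longrightarrow> r \<in> A \<Longrightarrow> a \<otimes> r \<in> I" using *(2)[of a] *(4)[of a r] by (simp add: m_comm)
  assume a: "a \<in> I" "b \<in> I"
  have "\<ominus> b = (\<ominus> \<one>) \<otimes> b" using *(2)[OF a(2)] by (simp add: l_minus)
  then show "a \<ominus> b \<in> I" using a *(3)[OF a(1)] *(4)[OF a(2), of "\<ominus> \<one>"] by (simp add: minus_eq)
qed

lemma principal_ideal: "t \<in> A \<Longrightarrow> is_ideal_of A {t \<otimes> c | c. c \<in> A}"
  unfolding is_ideal_of_def
proof (intro conjI ballI subsetI)
  assume t: "t \<in> A"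
  show "\<zero> \<in> {t \<otimes> c | c. c \<in> A}" using t by (auto intro!: exI[of _ \<zero>])
  fix a b assume "a \<in> {t \<otimes> c | c. c \<in> A}" "b \<in> {t \<otimes> c | c. c \<in> A}"
  then obtain c d where cd: "a = t \<otimes> c" "c \<in> A" "b = t \<otimes> d" "d \<in> A" by auto
  show "a \<oplus> b \<in> {t \<otimes> c | c. c \<in> A}" using cd t by (auto intro!: exI[of _ "c \<oplus> d"] simp: r_distr)
next
  assume t: "t \<in> A"
  fix a r assume "a \<in> {t \<otimes> c | c. c \<in> A}" and r: "r \<in> A"
  then obtain c where cd: "a = t \<otimes> c" "c \<in> A" by auto
  show "r \<otimes> a \<in> {t \<otimes> c | c. c \<in> A}" using cd t r by (auto intro!: exI[of _ "r \<otimes> c"] simp: m_lcomm)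
qed auto

lemma zero_ideal: "is_ideal_of A {\<zero>}" by (auto simp: is_ideal_of_def)

lemma maximal_ideal: "is_ideal_of A (A \<inter> M)"
  unfolding is_ideal_of_def using A_in_V by (auto intro!: M_mult)

lemma ideal_unit:
  assumes "is_ideal_of A I" "a \<in> I" "a \<notin> M" shows "\<one> \<in> I"
proof -
  have a: "a \<in> A" "a \<noteq> \<zero>" using assms ideal_closed(2) by auto
  then have "inv a \<otimes> a \<in> I" using assms unit ideal_closed(4) by blast
  then show ?thesis using a by simp
qed

lemma proper_ideal_M: "is_ideal_of A I \<Longrightarrow> \<one> \<notin> I \<Longrightarrow> I \<subseteq> A \<inter> M"
  using ideal_unit ideal_closed(2) by blast

lemma one_minus_unit:
  assumes "a \<in> A \<inter> M" shows "\<one> \<ominus> a \<in> A" "\<one> \<ominus> a \<notin> M"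
proof -
  show "\<one> \<ominus> a \<in> A" using assms by auto
  show "\<one> \<ominus> a \<notin> M"
  proof
    assume "\<one> \<ominus> a \<in> M"
    then have "(\<one> \<ominus> a) \<oplus> a \<in> M" using assms by simp
    moreover have "(\<one> \<ominus> a) \<oplus> a = \<one>" using assms by (simp add: minus_eq a_assoc l_neg)
    ultimately show False by simp
  qed
qed

text \<open>A form of Nakayama's lemma for a mere subset \<open>W\<close>. Iterating
  \<open>step\<close> gives \<open>r n\<close> congruent to \<open>t \<otimes> r (Suc n)\<close>
  modulo \<open>J\<close>, so the ideals \<open>J + A (r n)\<close> increase. Once they are
  stationary, \<open>r (Suc n)\<close> is congruent to \<open>c \<otimes> r n\<close>, hence to
  \<open>c \<otimes> t \<otimes> r (Suc n)\<close>, and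
  \<open>\<one> \<ominus> c \<otimes> t\<close> is a unit. So \<open>r (Suc n)\<close> lies in
  \<open>J\<close>, and the congruences carry this back to \<open>r 0\<close>.\<close>

lemma nakayama:
  assumes J: "is_ideal_of A J" and W: "W \<subseteq> A" and t: "t \<in> A" "t \<in> M"
    and step: "\<And>r. r \<in> W \<Longrightarrow> \<exists>r'\<in>W. r \<ominus> t \<otimes> r' \<in> J"
  shows "W \<subseteq> J"
proof
  fix r0 assume "r0 \<in> W"
  then have "\<exists>r. \<forall>n :: nat. (r n \<in> W \<and> (n = 0 \<longrightarrow> r n = r0)) \<and> r n \<ominus> t \<otimes> r (Suc n) \<in> J"
    using step by (intro dependent_nat_choice) auto
  then obtain r where r: "r 0 = r0" "\<And>n :: nat. r n \<in> W" "\<And>n. r n \<ominus> t \<otimes> r (Suc n) \<in> J" by blast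
  have rA [simp]: "r n \<in> A" for n using r(2) W by auto
  note Jc = ideal_closed[OF J]
  define I where "I n = {j \<oplus> c \<otimes> r n | j c. j \<in> J \<and> c \<in> A}" for n
  have "is_ideal_of A (I n) \<and> I n \<subseteq> I (Suc n)" for n
  proof
    show "is_ideal_of A (I n)" unfolding is_ideal_of_def
    proof (intro conjI ballI)
      show "I n \<subseteq> A" using Jc(2) by (auto simp: I_def)
      show "\<zero> \<in> I n" using Jc(1) by (auto simp: I_def intro!: exI[of _ \<zero>])
      fix a assume "a \<in> I n"
      then obtain j c where a: "a = j \<oplus> c \<otimes> r n" "j \<in> J" "c \<in> A" by (auto simp: I_def)
      have jc: "j \<in> carrier K" "c \<in> carrier K" "r n \<in> carrier K" using a Jc(2) by auto
      {
        fix b assume "b \<in> I n"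
        then obtain j' c' where b: "b = j' \<oplus> c' \<otimes> r n" "j' \<in> J" "c' \<in> A" by (auto simp: I_def)
        have jc': "j' \<in> carrier K" "c' \<in> carrier K" using b Jc(2) by auto
        have "a \<oplus> b = (j \<oplus> j') \<oplus> (c \<oplus> c') \<otimes> r n" unfolding a b using jc jc' by algebra
        then show "a \<oplus> b \<in> I n" using a b Jc(3) A_closed(3) unfolding I_def by blast
      }
      fix s assume s: "s \<in> A"
      then have "s \<otimes> a = s \<otimes> j \<oplus> (s \<otimes> c) \<otimes> r n" unfolding a using jc A_carrier[OF s] by algebra
      then show "s \<otimes> a \<in> I n" using a s Jc(4) A_closed(4) unfolding I_def by blast
    qed
    show "I n \<subseteq> I (Suc n)"
    proof
      fix a assume "a \<in> I n"
      then obtain j c where a: "a = j \<oplus> c \<otimes> r n" "j \<in> J" "c \<in> A" by (auto simp: I_def)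
      have jc: "j \<in> carrier K" "c \<in> carrier K" "r n \<in> carrier K" "r (Suc n) \<in> carrier K" "t \<in> carrier K"
        using a Jc(2) t by auto
      have "a = (j \<oplus> c \<otimes> (r n \<ominus> t \<otimes> r (Suc n))) \<oplus> (c \<otimes> t) \<otimes> r (Suc n)"
        unfolding a using jc by algebra
      moreover have "j \<oplus> c \<otimes> (r n \<ominus> t \<otimes> r (Suc n)) \<in> J" "c \<otimes> t \<in> A"
        using a r(3) t Jc(3,4) by auto
      ultimately show "a \<in> I (Suc n)" unfolding I_def by blast
    qed
  qed
  then obtain n where n: "\<And>m. n \<le> m \<Longrightarrow> I m = I n"
    using acc unfolding ascending_chain_condition_def by meson
  have "r (Suc n) = \<zero> \<oplus> \<one> \<otimes> r (Suc n)" by simp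
  then have "r (Suc n) \<in> I (Suc n)" unfolding I_def using Jc(1) A_closed(2) by blast
  then have "r (Suc n) \<in> I n" using n[of "Suc n"] by simp
  then obtain j c where jc: "r (Suc n) = j \<oplus> c \<otimes> r n" "j \<in> J" "c \<in> A" unfolding I_def by blast
  have car: "j \<in> carrier K" "c \<in> carrier K" "r n \<in> carrier K" "r (Suc n) \<in> carrier K" "t \<in> carrier K"
    using jc Jc(2) t by auto
  have ct: "c \<otimes> t \<in> A \<inter> M" using jc t A_in_V by auto
  have "(\<one> \<ominus> c \<otimes> t) \<otimes> r (Suc n) = r (Suc n) \<ominus> c \<otimes> t \<otimes> r (Suc n)" using car by algebra
  also have "\<dots> = (j \<oplus> c \<otimes> r n) \<ominus> c \<otimes> t \<otimes> r (Suc n)" using jc(1) by simp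
  also have "\<dots> = j \<oplus> c \<otimes> (r n \<ominus> t \<otimes> r (Suc n))" using car by algebra
  also have "\<dots> \<in> J" by (intro Jc(3,4) jc r(3))
  finally have *: "(\<one> \<ominus> c \<otimes> t) \<otimes> r (Suc n) \<in> J" .
  have "inv (\<one> \<ominus> c \<otimes> t) \<otimes> ((\<one> \<ominus> c \<otimes> t) \<otimes> r (Suc n)) \<in> J"
    using Jc(4)[OF * unit] one_minus_unit[OF ct] by blast
  moreover have "inv (\<one> \<ominus> c \<otimes> t) \<otimes> ((\<one> \<ominus> c \<otimes> t) \<otimes> r (Suc n)) = r (Suc n)"
    using one_minus_unit[OF ct] car A_in_V not_M by (intro divide_mult_cancel) auto
  ultimately have rn: "r (Suc n) \<in> J" by simp
  have down: "r (Suc k) \<in> J \<Longrightarrow> r k \<in> J" for k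
  proof -
    assume "r (Suc k) \<in> J"
    then have "(r k \<ominus> t \<otimes> r (Suc k)) \<oplus> t \<otimes> r (Suc k) \<in> J" using r(3) Jc t by blast
    moreover have "(r k \<ominus> t \<otimes> r (Suc k)) \<oplus> t \<otimes> r (Suc k) = r k"
      using A_carrier[OF rA[of k]] A_carrier[OF rA[of "Suc k"]] A_carrier[OF t(1)] by algebra
    ultimately show "r k \<in> J" by simp
  qed
  have "r m \<in> J \<Longrightarrow> r 0 \<in> J" for m by (induction m) (use down in auto)
  from this[OF rn] have "r 0 \<in> J" .
  then show "r0 \<in> J" using r(1) by simp
qed

end

section \<open>Two-dimensional regular local rings\<close>

lemma bounded_incseq_stationary:
  fixes f :: "nat \<Rightarrow> nat"
  assumes "\<And>k. f k \<le> f (Suc k)" "\<And>k. f k \<le> N"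
  shows "\<exists>k. f k = f (Suc k)"
proof (rule ccontr)
  assume "\<nexists>k. f k = f (Suc k)"
  then have "f k < f (Suc k)" for k using assms(1)[of k] by (metis le_neq_implies_less)
  then have "k \<le> f k" for k by (induction k) (auto intro: le_less_trans Suc_leI)
  then have "Suc N \<le> f (Suc N)" .
  with assms(2)[of "Suc N"] show False by simp
qed

locale two_generated = dominated_ring +
  fixes u v
  assumes u: "u \<in> A" "u \<in> M" and v: "v \<in> A" "v \<in> M"
    and generate: "\<And>f. f \<in> A \<Longrightarrow> f \<in> M \<Longrightarrow> \<exists>a\<in>A. \<exists>b\<in>A. f = a \<otimes> u \<oplus> b \<otimes> v"
begin

lemma not_M_unit:
  assumes "e \<in> A" "e \<notin> M" shows "e \<noteq> \<zero>" "inv e \<in> A" "inv e \<notin> M" "inv e \<otimes> e = \<one>"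
proof -
  show nz: "e \<noteq> \<zero>" using assms by auto
  show "inv e \<in> A" "inv e \<notin> M" using assms unit A_in_V inv_notin_M by blast+
  show "inv e \<otimes> e = \<one>" using assms nz by simp
qed

text \<open>Modulo \<open>u\<close> the ring looks like a discrete valuation ring with uniformiser
  \<open>v\<close>, or a truncation of one. An element of the exceptional set \<open>W\<close> is
  not a unit (that would be \<open>k = 0\<close>), so it is
  \<open>a \<otimes> u \<oplus> b \<otimes> v\<close>, and \<open>b\<close> is again exceptional;
  Nakayama with \<open>t = v\<close> puts all of \<open>W\<close> into the ideal of
  \<open>u\<close>.\<close>

lemma weierstrass_form:
  assumes "f \<in> A"
  shows "(\<exists>c\<in>A. f = u \<otimes> c) \<or> (\<exists>k :: nat. \<exists>e\<in>A. \<exists>c\<in>A. e \<notin> M \<and> f = e \<otimes> v [^] k \<oplus> u \<otimes> c)"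
proof (rule ccontr)
  define W where "W = {f \<in> A. \<not> (\<exists>k :: nat. \<exists>e\<in>A. \<exists>c\<in>A. e \<notin> M \<and> f = e \<otimes> v [^] k \<oplus> u \<otimes> c)}"
  have "W \<subseteq> {u \<otimes> c | c. c \<in> A}"
  proof (rule nakayama[OF principal_ideal[OF u(1)] _ v])
    show "W \<subseteq> A" by (auto simp: W_def)
    fix r assume r: "r \<in> W"
    then have rA: "r \<in> A" by (simp add: W_def)
    have "r \<in> M"
    proof (rule ccontr)
      assume "r \<notin> M"
      moreover have "r = r \<otimes> v [^] (0 :: nat) \<oplus> u \<otimes> \<zero>" using rA u by simp
      ultimately show False using r A_closed(1) unfolding W_def by blast
    qed
    from generate[OF rA this] obtain a b where ab: "a \<in> A" "b \<in> A" "r = a \<otimes> u \<oplus> b \<otimes> v" by blast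
    note car = A_carrier[OF ab(1)] A_carrier[OF ab(2)] A_carrier[OF u(1)] A_carrier[OF v(1)]
    have "b \<in> W"
    proof (rule ccontr)
      assume "b \<notin> W"
      then obtain k :: nat and e c where e: "e \<in> A" "c \<in> A" "e \<notin> M" "b = e \<otimes> v [^] k \<oplus> u \<otimes> c"
        using ab by (auto simp: W_def)
      have vk: "v [^] k \<in> carrier K" using car by simp
      have "r = e \<otimes> (v [^] k \<otimes> v) \<oplus> u \<otimes> (a \<oplus> c \<otimes> v)"
        unfolding ab(3) e(4) using car A_carrier[OF e(1)] A_carrier[OF e(2)] vk by algebra
      then have "r = e \<otimes> v [^] Suc k \<oplus> u \<otimes> (a \<oplus> c \<otimes> v)" by simp
      moreover have "a \<oplus> c \<otimes> v \<in> A" using ab e v by simp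
      ultimately show False using r e unfolding W_def by blast
    qed
    moreover have "r \<ominus> v \<otimes> b = u \<otimes> a" unfolding ab(3) using car by algebra
    ultimately show "\<exists>r'\<in>W. r \<ominus> v \<otimes> r' \<in> {u \<otimes> c |c. c \<in> A}" using ab by blast
  qed
  moreover assume "\<not> ?thesis"
  then have "f \<in> W" "f \<notin> {u \<otimes> c | c. c \<in> A}" using assms unfolding W_def by auto
  ultimately show False by auto
qed

lemma prime_contains_generators:
  assumes P: "is_prime_of A P" and "u \<in> P" "v \<in> P" shows "P = A \<inter> M"
proof
  have I: "is_ideal_of A P" and one: "\<one> \<notin> P" using P by (auto simp: is_prime_of_def)
  show "P \<subseteq> A \<inter> M" by (rule proper_ideal_M[OF I one])
  show "A \<inter> M \<subseteq> P"
  proof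
    fix f assume "f \<in> A \<inter> M"
    then obtain a b where "a \<in> A" "b \<in> A" "f = a \<otimes> u \<oplus> b \<otimes> v" using generate by blast
    then show "f \<in> P" using assms ideal_closed(3,4)[OF I] by blast
  qed
qed

lemma prime_pow:
  assumes P: "is_prime_of A P" and "a \<in> A" "a [^] (k :: nat) \<in> P" shows "a \<in> P"
  using assms(3)
proof (induction k)
  case 0 then show ?case using P by (simp add: is_prime_of_def)
next
  case (Suc k)
  then have "a [^] k \<in> P \<or> a \<in> P"
    using P A_pow[OF assms(2), of k] assms(2) unfolding is_prime_of_def by (metis nat_pow_Suc)
  then show ?case using Suc.IH by blast
qed

text \<open>A case of Krull's principal ideal theorem: if \<open>v\<close> is nilpotent modulo \<open>u\<close>, the maximal ideal
  is minimal over \<open>u\<close>. The ideals \<open>I k\<close> replace the symbolic powers of \<open>P\<close>.\<close>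

lemma no_small_prime:
  assumes P: "is_prime_of A P" "P \<noteq> {\<zero>}" "P \<noteq> A \<inter> M"
    and a: "a \<in> A" "v [^] (N :: nat) = u \<otimes> a"
  shows False
proof -
  have I: "is_ideal_of A P" and one: "\<one> \<notin> P"
    and prime: "\<And>a b. a \<in> A \<Longrightarrow> b \<in> A \<Longrightarrow> a \<otimes> b \<in> P \<Longrightarrow> a \<in> P \<or> b \<in> P"
    using P by (auto simp: is_prime_of_def)
  note Pc = ideal_closed[OF I]
  have uP: "u \<notin> P"
  proof
    assume uP: "u \<in> P"
    then have "v [^] N \<in> P" using a Pc(5) by simp
    then have "v \<in> P" by (rule prime_pow[OF P(1) v(1)])
    with uP show False using prime_contains_generators[OF P(1)] P(3) by simp
  qed
  obtain g where g: "g \<in> P" "g \<noteq> \<zero>" using P(2) Pc(1) by auto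
  then have gA: "g \<in> A" using Pc(2) by simp
  \<comment> \<open>\<open>I k\<close> is the contraction to \<open>A\<close> of the ideal generated
    by \<open>g^k\<close> in the localisation at \<open>P\<close>.\<close>
  define I where "I k = {r \<in> A. \<exists>s\<in>A. \<exists>c\<in>A. s \<notin> P \<and> s \<otimes> r = g [^] (k :: nat) \<otimes> c}" for k
  have II: "r \<in> I k" if "s \<otimes> r = g [^] k \<otimes> c" "s \<notin> P" "r \<in> A" "s \<in> A" "c \<in> A" for r s c k
    using that unfolding I_def by blast
  have I_ideal: "is_ideal_of A (I k)" for k unfolding is_ideal_of_def
  proof (intro conjI ballI)
    show "I k \<subseteq> A" by (auto simp: I_def)
    have "\<one> \<otimes> \<zero> = g [^] k \<otimes> \<zero>" using gA by simp
    then show "\<zero> \<in> I k" by (rule II) (use one in auto)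
    fix r assume "r \<in> I k"
    then obtain s c where s: "r \<in> A" "s \<in> A" "c \<in> A" "s \<notin> P" "s \<otimes> r = g [^] k \<otimes> c" by (auto simp: I_def)
    note car = A_carrier[OF s(1)] A_carrier[OF s(2)] A_carrier[OF s(3)] A_carrier[OF A_pow[OF gA, of k]]
    {
      fix r' assume "r' \<in> I k"
      then obtain s' c' where s': "r' \<in> A" "s' \<in> A" "c' \<in> A" "s' \<notin> P" "s' \<otimes> r' = g [^] k \<otimes> c'" by (auto simp: I_def)
      note car' = A_carrier[OF s'(1)] A_carrier[OF s'(2)] A_carrier[OF s'(3)]
      have "(s \<otimes> s') \<otimes> (r \<oplus> r') = s' \<otimes> (s \<otimes> r) \<oplus> s \<otimes> (s' \<otimes> r')" using car car' by algebra
      also have "\<dots> = g [^] k \<otimes> (s' \<otimes> c \<oplus> s \<otimes> c')" unfolding s(5) s'(5) using car car' by algebra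
      finally have eq: "(s \<otimes> s') \<otimes> (r \<oplus> r') = g [^] k \<otimes> (s' \<otimes> c \<oplus> s \<otimes> c')" .
      have "s \<otimes> s' \<notin> P" using prime[of s s'] s s' by blast
      with eq show "r \<oplus> r' \<in> I k" by (rule II) (use s s' in auto)
    }
    fix b assume b: "b \<in> A"
    have "s \<otimes> (b \<otimes> r) = b \<otimes> (s \<otimes> r)" using car A_carrier[OF b] by algebra
    also have "\<dots> = g [^] k \<otimes> (b \<otimes> c)" unfolding s(5) using car A_carrier[OF b] by algebra
    finally show "b \<otimes> r \<in> I k" by (rule II) (use s b in auto)
  qed
  note Ic = ideal_closed[OF I_ideal]
  have I_u: "c \<in> I k" if cA: "c \<in> A" and uc: "u \<otimes> c \<in> I k" for c k
  proof -
    obtain s d where s: "s \<in> A" "d \<in> A" "s \<notin> P" "s \<otimes> (u \<otimes> c) = g [^] k \<otimes> d"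
      using uc unfolding I_def by blast
    then have "(s \<otimes> u) \<otimes> c = g [^] k \<otimes> d" using u cA by (simp add: m_assoc)
    moreover have "s \<otimes> u \<notin> P" using prime[of s u] s u uP by blast
    ultimately show ?thesis by (rule II) (use s cA u in auto)
  qed
  have I_dec: "I (Suc k) \<subseteq> I k" for k
  proof
    fix r assume "r \<in> I (Suc k)"
    then obtain s c where s: "r \<in> A" "s \<in> A" "c \<in> A" "s \<notin> P" "s \<otimes> r = g [^] k \<otimes> g \<otimes> c" by (auto simp: I_def)
    then have "s \<otimes> r = g [^] k \<otimes> (g \<otimes> c)" using gA by (simp add: m_assoc)
    then show "r \<in> I k" by (rule II) (use s gA in auto)
  qed
  define Iu where "Iu k = {s \<oplus> u \<otimes> c | s c. s \<in> I k \<and> c \<in> A}" for k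
  have IuI: "r \<in> Iu k" if "r = s \<oplus> u \<otimes> c" "s \<in> I k" "c \<in> A" for r s c k
    using that unfolding Iu_def by blast
  have Iu_ideal: "is_ideal_of A (Iu k)" for k unfolding is_ideal_of_def
  proof (intro conjI ballI)
    show "Iu k \<subseteq> A" using Ic(2) u by (auto simp: Iu_def)
    have "\<zero> = \<zero> \<oplus> u \<otimes> \<zero>" using u by simp
    then show "\<zero> \<in> Iu k" by (rule IuI) (use Ic(1) in auto)
    fix r assume "r \<in> Iu k"
    then obtain s c where s: "s \<in> I k" "c \<in> A" "r = s \<oplus> u \<otimes> c" by (auto simp: Iu_def)
    note car = A_carrier[OF Ic(2)[OF s(1)]] A_carrier[OF s(2)] A_carrier[OF u(1)]
    {
      fix r' assume "r' \<in> Iu k"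
      then obtain s' c' where s': "s' \<in> I k" "c' \<in> A" "r' = s' \<oplus> u \<otimes> c'" by (auto simp: Iu_def)
      have "r \<oplus> r' = (s \<oplus> s') \<oplus> u \<otimes> (c \<oplus> c')"
        unfolding s(3) s'(3) using car A_carrier[OF Ic(2)[OF s'(1)]] A_carrier[OF s'(2)] by algebra
      then show "r \<oplus> r' \<in> Iu k" by (rule IuI) (use s s' Ic(3) in auto)
    }
    fix b assume b: "b \<in> A"
    have "b \<otimes> r = b \<otimes> s \<oplus> u \<otimes> (b \<otimes> c)" unfolding s(3) using car A_carrier[OF b] by algebra
    then show "b \<otimes> r \<in> Iu k" by (rule IuI) (use s b Ic(4) in auto)
  qed
  have I_Iu: "r \<in> Iu k" if "r \<in> I k" for r k
  proof -
    have "r = r \<oplus> u \<otimes> \<zero>" using Ic(2)[OF that] u by simp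
    then show ?thesis by (rule IuI) (use that in auto)
  qed
  have u_Iu: "u \<otimes> c \<in> Iu k" if "c \<in> A" for c k
  proof -
    have "u \<otimes> c = \<zero> \<oplus> u \<otimes> c" using that u by simp
    then show ?thesis by (rule IuI) (use that Ic(1) in auto)
  qed
  \<comment> \<open>By \<open>weierstrass_form\<close> the ideal \<open>I k + uA\<close> is
    determined by the least power of \<open>v\<close> it contains. This exponent grows with
    \<open>k\<close> and is bounded by \<open>N\<close>, so it is stationary somewhere.\<close>
  define j :: "nat \<Rightarrow> nat" where "j k = (LEAST i :: nat. v [^] i \<in> Iu k)" for k
  have vN: "v [^] N \<in> Iu k" for k using a u_Iu by simp
  have jI: "v [^] j k \<in> Iu k" for k unfolding j_def
    using LeastI[of "\<lambda>i :: nat. v [^] i \<in> Iu k" N] vN[of k] by simp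
  have "j k \<le> j (Suc k)" for k
  proof -
    have "Iu (Suc k) \<subseteq> Iu k" unfolding Iu_def using I_dec by blast
    then show ?thesis using jI[of "Suc k"] unfolding j_def[of k] by (intro Least_le) auto
  qed
  moreover have "j k \<le> N" for k unfolding j_def by (intro Least_le vN)
  ultimately obtain k where k: "j k = j (Suc k)" using bounded_incseq_stationary[of j N] by blast
  \<comment> \<open>Equal exponents give \<open>I k \<subseteq> I (Suc k) + uA\<close>. In
    \<open>r = s \<oplus> u \<otimes> c\<close> the factor \<open>c\<close> lies in
    \<open>I k\<close> because \<open>u\<close> is outside \<open>P\<close>, which is the situation
    of Nakayama with \<open>t = u\<close>.\<close>
  have "I k \<subseteq> I (Suc k)"
  proof (rule nakayama[OF I_ideal _ u])
    show "I k \<subseteq> A" using Ic(2) by auto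
    fix r assume r: "r \<in> I k"
    have rA: "r \<in> A" by (rule Ic(2)[OF r])
    have "r \<in> Iu (Suc k)"
    proof (cases "\<exists>c\<in>A. r = u \<otimes> c")
      case True
      then show ?thesis using u_Iu by auto
    next
      case False
      then obtain i :: nat and e c where e: "e \<in> A" "c \<in> A" "e \<notin> M" "r = e \<otimes> v [^] i \<oplus> u \<otimes> c"
        using weierstrass_form[OF rA] by blast
      note car = A_carrier[OF e(1)] A_carrier[OF e(2)] A_carrier[OF u(1)] A_carrier[OF A_pow[OF v(1), of i]]
      have "r \<ominus> u \<otimes> c \<in> Iu k" using ideal_closed(6)[OF Iu_ideal I_Iu[OF r] u_Iu[OF e(2)]] .
      moreover have "r \<ominus> u \<otimes> c = e \<otimes> v [^] i" unfolding e(4) using car by algebra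
      ultimately have "inv e \<otimes> (e \<otimes> v [^] i) \<in> Iu k"
        using ideal_closed(4)[OF Iu_ideal] not_M_unit(2)[OF e(1,3)] by simp
      then have "v [^] i \<in> Iu k" using not_M_unit[OF e(1,3)] car by simp
      then have "j k \<le> i" unfolding j_def by (rule Least_le)
      then have "j (Suc k) \<le> i" using k by simp
      then have "v [^] i = v [^] (i - j (Suc k)) \<otimes> v [^] j (Suc k)" using v by (simp add: nat_pow_mult)
      then have "v [^] i \<in> Iu (Suc k)"
        using ideal_closed(4)[OF Iu_ideal jI[of "Suc k"], of "v [^] (i - j (Suc k))"] v by simp
      then show ?thesis unfolding e(4) using ideal_closed(3,4)[OF Iu_ideal] u_Iu e by blast
    qed
    then obtain s c where s: "s \<in> I (Suc k)" "c \<in> A" "r = s \<oplus> u \<otimes> c" by (auto simp: Iu_def)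
    note car = A_carrier[OF Ic(2)[OF s(1)]] A_carrier[OF s(2)] A_carrier[OF u(1)]
    have "r \<ominus> s \<in> I k" using ideal_closed(6)[OF I_ideal r] I_dec s(1) by blast
    moreover have "r \<ominus> s = u \<otimes> c" unfolding s(3) using car by algebra
    ultimately have "c \<in> I k" using I_u s(2) by simp
    moreover have "r \<ominus> u \<otimes> c = s" unfolding s(3) using car by algebra
    ultimately show "\<exists>r'\<in>I k. r \<ominus> u \<otimes> r' \<in> I (Suc k)" using s(1) by auto
  qed
  moreover have "g [^] k \<in> I k"
  proof -
    have "\<one> \<otimes> g [^] k = g [^] k \<otimes> \<one>" using gA by simp
    then show ?thesis by (rule II) (use gA one in auto)
  qed
  \<comment> \<open>Membership of \<open>g^k\<close> in \<open>I (Suc k)\<close> cancels to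
    \<open>s = g \<otimes> c\<close> with \<open>s\<close> outside \<open>P\<close>, which is
    absurd.\<close>
  ultimately have "g [^] k \<in> I (Suc k)" by auto
  then obtain s c where s: "s \<in> A" "c \<in> A" "s \<notin> P" "s \<otimes> g [^] k = g [^] k \<otimes> g \<otimes> c" by (auto simp: I_def)
  have gk: "g [^] k \<in> carrier K" "g [^] k \<noteq> \<zero>" using gA g by auto
  have "g [^] k \<otimes> s = g [^] k \<otimes> (g \<otimes> c)" using s gA gk by (simp add: m_assoc m_comm[of s])
  then have "s = g \<otimes> c" using m_lcancel[OF gk(2,1)] s gA by simp
  then show False using s g Pc(5) by simp
qed

end

locale regular_surface = two_generated +
  assumes u_nonzero: "u \<noteq> \<zero>" and v_pow: "\<And>k :: nat. \<And>c. c \<in> A \<Longrightarrow> v [^] k \<noteq> u \<otimes> c"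
begin

lemma v_nonzero: "v \<noteq> \<zero>"
  using v_pow[of \<zero> 1] u by auto

lemma not_divisible:
  assumes "e \<in> A" "e \<notin> M" "c \<in> A" "d \<in> A" shows "e \<otimes> v [^] (k :: nat) \<oplus> u \<otimes> c \<noteq> u \<otimes> d"
proof
  assume eq: "e \<otimes> v [^] k \<oplus> u \<otimes> c = u \<otimes> d"
  note car = A_carrier[OF assms(1)] A_carrier[OF assms(3)] A_carrier[OF assms(4)] A_carrier[OF u(1)]
    A_carrier[OF A_pow[OF v(1), of k]]
  have "e \<otimes> v [^] k = (e \<otimes> v [^] k \<oplus> u \<otimes> c) \<ominus> u \<otimes> c" using car by algebra
  also have "\<dots> = u \<otimes> (d \<ominus> c)" unfolding eq using car by algebra
  finally have "inv e \<otimes> (e \<otimes> v [^] k) = inv e \<otimes> (u \<otimes> (d \<ominus> c))" by simp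
  then have "v [^] k = u \<otimes> (inv e \<otimes> (d \<ominus> c))"
    using car not_M_unit[OF assms(1,2)] by (simp add: m_lcomm)
  then show False using v_pow[of "inv e \<otimes> (d \<ominus> c)"] not_M_unit[OF assms(1,2)] assms by simp
qed

text \<open>Modulo \<open>u\<close>, a nonzero element is a unit times a power of \<open>v\<close>.
  A product of two such elements has the same shape, and no such element is divisible by
  \<open>u\<close>.\<close>

lemma u_prime:
  assumes "a \<in> A" "b \<in> A" "c \<in> A" "a \<otimes> b = u \<otimes> c"
  shows "(\<exists>d\<in>A. a = u \<otimes> d) \<or> (\<exists>d\<in>A. b = u \<otimes> d)"
proof (rule ccontr)
  assume neg: "\<not> ?thesis"
  obtain i :: nat and e s where e: "e \<in> A" "s \<in> A" "e \<notin> M" "a = e \<otimes> v [^] i \<oplus> u \<otimes> s"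
    using weierstrass_form[OF assms(1)] neg by blast
  obtain j :: nat and e' s' where e': "e' \<in> A" "s' \<in> A" "e' \<notin> M" "b = e' \<otimes> v [^] j \<oplus> u \<otimes> s'"
    using weierstrass_form[OF assms(2)] neg by blast
  note car = A_carrier[OF e(1)] A_carrier[OF e(2)] A_carrier[OF e'(1)] A_carrier[OF e'(2)] A_carrier[OF u(1)]
    A_carrier[OF A_pow[OF v(1), of i]] A_carrier[OF A_pow[OF v(1), of j]]
  have "a \<otimes> b = (e \<otimes> e') \<otimes> (v [^] i \<otimes> v [^] j) \<oplus> u \<otimes> (e \<otimes> v [^] i \<otimes> s' \<oplus> s \<otimes> (e' \<otimes> v [^] j \<oplus> u \<otimes> s'))"
    unfolding e(4) e'(4) using car by algebra
  then have "u \<otimes> c = (e \<otimes> e') \<otimes> v [^] (i + j) \<oplus> u \<otimes> (e \<otimes> v [^] i \<otimes> s' \<oplus> s \<otimes> (e' \<otimes> v [^] j \<oplus> u \<otimes> s'))"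
    unfolding assms(4) using v by (simp add: nat_pow_mult)
  moreover have "e \<otimes> e' \<notin> M" using M_prime e e' A_in_V by blast
  ultimately show False
    using not_divisible[of "e \<otimes> e'" "e \<otimes> v [^] i \<otimes> s' \<oplus> s \<otimes> (e' \<otimes> v [^] j \<oplus> u \<otimes> s')" c "i + j"]
      e e' u v assms by simp
qed

lemma u_ideal_prime: "is_prime_of A {u \<otimes> c | c. c \<in> A}"
  unfolding is_prime_of_def
proof (intro conjI ballI impI)
  show "is_ideal_of A {u \<otimes> c | c. c \<in> A}" by (rule principal_ideal[OF u(1)])
  show "\<one> \<notin> {u \<otimes> c | c. c \<in> A}" using v_pow[of _ 0] by auto
  fix a b assume ab: "a \<in> A" "b \<in> A" "a \<otimes> b \<in> {u \<otimes> c | c. c \<in> A}"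
  then show "a \<in> {u \<otimes> c | c. c \<in> A} \<or> b \<in> {u \<otimes> c | c. c \<in> A}" using u_prime[OF ab(1,2)] by blast
qed

text \<open>Infinitely divisible elements vanish: Nakayama with \<open>J = 0\<close>.\<close>

lemma descent_zero:
  assumes P: "P \<subseteq> A" and t: "t \<in> A" "t \<in> M" and "\<And>f. f \<in> P \<Longrightarrow> \<exists>c\<in>P. f = t \<otimes> c"
  shows "P \<subseteq> {\<zero>}"
proof (rule nakayama[OF zero_ideal P t])
  fix r assume "r \<in> P"
  then obtain c where "c \<in> P" "r = t \<otimes> c" using assms(4) by blast
  then show "\<exists>r'\<in>P. r \<ominus> t \<otimes> r' \<in> {\<zero>}" using P t by (intro bexI[of _ c]) (auto simp: minus_eq r_neg)
qed

text \<open>If \<open>u \<in> Q\<close>, then \<open>Q\<close> is not contained in \<open>uA\<close>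
  and so contains a unit times a power of \<open>v\<close> modulo \<open>u\<close>, hence
  \<open>v\<close>. If \<open>u \<notin> Q\<close>, then \<open>Q\<close> turns out to be principal,
  and a principal prime has no nonzero prime strictly below it.\<close>

lemma height_one:
  assumes P: "is_prime_of A P" "P \<noteq> {\<zero>}" and Q: "is_prime_of A Q" "P \<subset> Q"
  shows "Q = A \<inter> M"
proof -
  have PI: "is_ideal_of A P" and QI: "is_ideal_of A Q"
    and Pp: "\<And>a b. a \<in> A \<Longrightarrow> b \<in> A \<Longrightarrow> a \<otimes> b \<in> P \<Longrightarrow> a \<in> P \<or> b \<in> P"
    and Qp: "\<And>a b. a \<in> A \<Longrightarrow> b \<in> A \<Longrightarrow> a \<otimes> b \<in> Q \<Longrightarrow> a \<in> Q \<or> b \<in> Q"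
    using P Q by (auto simp: is_prime_of_def)
  note Pc = ideal_closed[OF PI] and Qc = ideal_closed[OF QI]
  have PA: "P \<subseteq> A" and QA: "Q \<subseteq> A" using Pc(2) Qc(2) by auto
  have QM: "Q \<subseteq> A \<inter> M" using Q(1) by (intro proper_ideal_M) (auto simp: is_prime_of_def)
  \<comment> \<open>If \<open>t\<close> were outside the prime \<open>P\<close>, each element of
    \<open>P\<close> would be \<open>t\<close> times another element of \<open>P\<close>, so
    \<open>P\<close> would be zero.\<close>
  have principal: "t \<in> P" if Pt: "P \<subseteq> {t \<otimes> c | c. c \<in> A}" and tA: "t \<in> A" "t \<in> M" for t
  proof (rule ccontr)
    assume t: "t \<notin> P"
    have "P \<subseteq> {\<zero>}"
    proof (rule descent_zero[OF PA tA])
      fix f assume f: "f \<in> P"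
      then obtain c where "c \<in> A" "f = t \<otimes> c" using Pt f by blast
      then show "\<exists>c\<in>P. f = t \<otimes> c" using Pp[of t c] t tA f by auto
    qed
    then show False using P(2) Pc(1) by auto
  qed
  show ?thesis
  proof (cases "u \<in> Q")
    case True
    have "\<not> Q \<subseteq> {u \<otimes> c | c. c \<in> A}"
    proof
      assume *: "Q \<subseteq> {u \<otimes> c | c. c \<in> A}"
      then have "u \<in> P" using principal[of u] Q(2) u by blast
      then have "{u \<otimes> c | c. c \<in> A} \<subseteq> P" using Pc(5) by blast
      then show False using * Q(2) by blast
    qed
    then obtain f where f: "f \<in> Q" "\<not> (\<exists>c\<in>A. f = u \<otimes> c)" by blast
    then obtain k :: nat and e c where e: "e \<in> A" "c \<in> A" "e \<notin> M" "f = e \<otimes> v [^] k \<oplus> u \<otimes> c"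
      using weierstrass_form QA by blast
    note car = A_carrier[OF e(1)] A_carrier[OF e(2)] A_carrier[OF u(1)] A_carrier[OF A_pow[OF v(1), of k]]
    have "f \<ominus> u \<otimes> c \<in> Q" using Qc(5,6) True e f by blast
    moreover have "f \<ominus> u \<otimes> c = e \<otimes> v [^] k" unfolding e(4) using car by algebra
    ultimately have "inv e \<otimes> (e \<otimes> v [^] k) \<in> Q" using Qc(4) not_M_unit[OF e(1,3)] by simp
    then have "v [^] k \<in> Q" using car not_M_unit[OF e(1,3)] by simp
    then have "v \<in> Q" by (rule prime_pow[OF Q(1) v(1)])
    then show ?thesis by (rule prime_contains_generators[OF Q(1) True])
  next
    case False
    \<comment> \<open>The orders in \<open>v\<close>, taken modulo \<open>u\<close>, that occur
      among the elements of \<open>Q\<close>. An element of minimal order will generate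
      \<open>Q\<close>.\<close>
    define S where "S k \<longleftrightarrow> (\<exists>f\<in>Q. \<exists>e\<in>A. \<exists>c\<in>A. e \<notin> M \<and> f = e \<otimes> v [^] (k :: nat) \<oplus> u \<otimes> c)" for k
    have "\<exists>k. S k"
    proof (rule ccontr)
      assume "\<nexists>k. S k"
      have "Q \<subseteq> {\<zero>}"
      proof (rule descent_zero[OF QA u])
        fix f assume f: "f \<in> Q"
        then obtain c where c: "c \<in> A" "f = u \<otimes> c"
          using weierstrass_form[of f] \<open>\<nexists>k. S k\<close> QA unfolding S_def by blast
        then show "\<exists>c\<in>Q. f = u \<otimes> c" using Qp[of u c] False f u by auto
      qed
      then show False using Q(2) P(2) Pc(1) by auto
    qed
    define k where "k = (LEAST k. S k)"
    have "S k" unfolding k_def using \<open>\<exists>k. S k\<close> by (rule LeastI_ex)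
    then obtain g e c where g: "g \<in> Q" "e \<in> A" "c \<in> A" "e \<notin> M" "g = e \<otimes> v [^] k \<oplus> u \<otimes> c"
      unfolding S_def by blast
    have gA: "g \<in> A" "g \<in> M" using g QM by auto
    \<comment> \<open>Subtracting a suitable multiple of \<open>g\<close> from \<open>f\<close>
      removes the term in \<open>v^i\<close> and leaves \<open>u \<otimes> d\<close>; here
      \<open>d \<in> Q\<close> because \<open>u \<notin> Q\<close>. Nakayama with
      \<open>t = u\<close> turns this congruence into divisibility by \<open>g\<close>.\<close>
    have "Q \<subseteq> {g \<otimes> c | c. c \<in> A}"
    proof (rule nakayama[OF principal_ideal[OF gA(1)] QA u])
      fix f assume f: "f \<in> Q"
      have fA: "f \<in> A" using f QA by auto
      have zero: "\<zero> \<in> {g \<otimes> c | c. c \<in> A}" using gA by (auto intro!: exI[of _ \<zero>])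
      show "\<exists>f'\<in>Q. f \<ominus> u \<otimes> f' \<in> {g \<otimes> c | c. c \<in> A}"
      proof (cases "\<exists>d\<in>A. f = u \<otimes> d")
        case True
        then obtain d where d: "d \<in> A" "f = u \<otimes> d" by blast
        then have "d \<in> Q" using Qp[of u d] False f u by auto
        moreover have "f \<ominus> u \<otimes> d = \<zero>" using d u by (simp add: minus_eq r_neg)
        with zero have "f \<ominus> u \<otimes> d \<in> {g \<otimes> c | c. c \<in> A}" by (simp only:)
        ultimately show ?thesis by (rule bexI[rotated])
      next
        case nd: False
        then obtain i :: nat and e' c' where e': "e' \<in> A" "c' \<in> A" "e' \<notin> M" "f = e' \<otimes> v [^] i \<oplus> u \<otimes> c'"
          using weierstrass_form[OF fA] by blast
        have "S i" unfolding S_def using f e' by blast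
        then have "k \<le> i" unfolding k_def by (rule Least_le)
        then have vi: "v [^] i = v [^] (i - k) \<otimes> v [^] k" using v by (simp add: nat_pow_mult)
        define q where "q = e' \<otimes> inv e \<otimes> v [^] (i - k)"
        have qA: "q \<in> A" unfolding q_def using e' not_M_unit[OF g(2,4)] v by simp
        have qe: "q \<otimes> e = e' \<otimes> v [^] (i - k)"
        proof -
          have "q \<otimes> e = (e' \<otimes> v [^] (i - k)) \<otimes> (inv e \<otimes> e)"
            unfolding q_def using e' g not_M_unit[OF g(2,4)] v by (simp add: m_ac del: mult_inv)
          then show ?thesis using not_M_unit[OF g(2,4)] e' v by simp
        qed
        note car = A_carrier[OF e'(1)] A_carrier[OF e'(2)] A_carrier[OF g(2)] A_carrier[OF g(3)] A_carrier[OF u(1)]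
          A_carrier[OF qA] A_carrier[OF A_pow[OF v(1), of k]] A_carrier[OF A_pow[OF v(1), of "i - k"]]
        define d where "d = c' \<ominus> q \<otimes> c"
        have dA: "d \<in> A" unfolding d_def using e' qA g by simp
        have "q \<otimes> g = (q \<otimes> e) \<otimes> v [^] k \<oplus> u \<otimes> (q \<otimes> c)" unfolding g(5) using car by algebra
        also have "\<dots> = e' \<otimes> v [^] i \<oplus> u \<otimes> (q \<otimes> c)" unfolding qe vi using car by algebra
        finally have qg: "q \<otimes> g = e' \<otimes> v [^] i \<oplus> u \<otimes> (q \<otimes> c)" .
        have "f \<ominus> q \<otimes> g = u \<otimes> d"
          unfolding qg unfolding e'(4) d_def using car A_carrier[OF A_pow[OF v(1), of i]] by algebra
        moreover have "f \<ominus> q \<otimes> g \<in> Q" using Qc(4,6) f g qA by blast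
        ultimately have "d \<in> Q" using Qp[of u d] False dA u by auto
        moreover have "f \<ominus> u \<otimes> d = g \<otimes> q"
        proof -
          have "f \<ominus> u \<otimes> d = f \<ominus> (f \<ominus> q \<otimes> g)" using \<open>f \<ominus> q \<otimes> g = u \<otimes> d\<close> by simp
          also have "\<dots> = g \<otimes> q" using A_carrier[OF fA] A_carrier[OF gA(1)] A_carrier[OF qA] by algebra
          finally show ?thesis .
        qed
        ultimately show ?thesis using qA by blast
      qed
    qed
    then have "g \<in> P" using principal[of g] gA Q(2) by blast
    then have "{g \<otimes> c | c. c \<in> A} \<subseteq> P" using Pc(5) by blast
    then show ?thesis using \<open>Q \<subseteq> {g \<otimes> c | c. c \<in> A}\<close> Q(2) by blast
  qed
qed

end

section \<open>Translation to local rings, regular parameters and Krull dimension\<close>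

context dominated_ring
begin

lemma maximalideal_A: "maximalideal I (K\<lparr>carrier := A\<rparr>) \<longleftrightarrow> I = A \<inter> M"
proof -
  have "is_ideal_of A J \<Longrightarrow> \<one> \<notin> J \<Longrightarrow> J \<subseteq> A \<inter> M" for J by (rule proper_ideal_M)
  moreover have "\<one> \<notin> A \<inter> M" by simp
  ultimately show ?thesis unfolding maximalideal_iff[OF sub] using maximal_ideal by blast
qed

lemma max_ideal_A: "max_ideal (K\<lparr>carrier := A\<rparr>) = A \<inter> M"
  unfolding max_ideal_def maximalideal_A by simp

lemma local_ring_A: "local_ring (K\<lparr>carrier := A\<rparr>)"
  unfolding local_ring_def maximalideal_A using subring_cring[OF sub] by simp

lemma noetherian_A: "noetherian_ring (K\<lparr>carrier := A\<rparr>)"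
  unfolding noetherian_iff[OF sub] by (rule acc)

lemma dominates_A: "dominates K \<nu> A"
  unfolding dominates_def max_ideal_A using A_V by auto

lemma Units_A: "f \<in> Units (K\<lparr>carrier := A\<rparr>) \<longleftrightarrow> f \<in> A \<and> f \<notin> M"
proof
  assume "f \<in> Units (K\<lparr>carrier := A\<rparr>)"
  then obtain g where g: "f \<in> A" "g \<in> A" "f \<otimes> g = \<one>" by (auto simp: Units_def)
  then have "f \<notin> M" using M_mult(1)[of f g] A_in_V by auto
  then show "f \<in> A \<and> f \<notin> M" using g by simp
next
  assume f: "f \<in> A \<and> f \<notin> M"
  then have "f \<noteq> \<zero>" "inv f \<in> A" using unit by auto
  then show "f \<in> Units (K\<lparr>carrier := A\<rparr>)" using f by (auto simp: Units_def intro!: bexI[of _ "inv f"])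
qed

lemma linear_combinations_ideal:
  assumes "u \<in> A" "v \<in> A" shows "is_ideal_of A {a \<otimes> u \<oplus> b \<otimes> v | a b. a \<in> A \<and> b \<in> A}" (is "is_ideal_of A ?I")
  unfolding is_ideal_of_def
proof (intro conjI ballI)
  show "?I \<subseteq> A" using assms by auto
  have "\<zero> = \<zero> \<otimes> u \<oplus> \<zero> \<otimes> v" using assms by simp
  then show "\<zero> \<in> ?I" using A_closed(1) by blast
  fix r assume "r \<in> ?I"
  then obtain a b where ab: "a \<in> A" "b \<in> A" "r = a \<otimes> u \<oplus> b \<otimes> v" by blast
  note car = A_carrier[OF ab(1)] A_carrier[OF ab(2)] A_carrier[OF assms(1)] A_carrier[OF assms(2)]
  {
    fix s assume "s \<in> ?I"
    then obtain c d where cd: "c \<in> A" "d \<in> A" "s = c \<otimes> u \<oplus> d \<otimes> v" by blast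
    have "r \<oplus> s = (a \<oplus> c) \<otimes> u \<oplus> (b \<oplus> d) \<otimes> v"
      unfolding ab(3) cd(3) using car A_carrier[OF cd(1)] A_carrier[OF cd(2)] by algebra
    then show "r \<oplus> s \<in> ?I" using ab cd A_closed(3) by blast
  }
  fix s assume s: "s \<in> A"
  have "s \<otimes> r = (s \<otimes> a) \<otimes> u \<oplus> (s \<otimes> b) \<otimes> v"
    unfolding ab(3) using car A_carrier[OF s] by algebra
  then show "s \<otimes> r \<in> ?I" using ab s A_closed(4) by blast
qed

lemma Idl_two:
  assumes "u \<in> A" "v \<in> A"
  shows "Idl\<^bsub>K\<lparr>carrier := A\<rparr>\<^esub> {u, v} = {a \<otimes> u \<oplus> b \<otimes> v | a b. a \<in> A \<and> b \<in> A}" (is "?L = ?I")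
proof
  interpret A: cring "K\<lparr>carrier := A\<rparr>" by (rule subring_cring[OF sub])
  have uv: "{u, v} \<subseteq> carrier (K\<lparr>carrier := A\<rparr>)" using assms by simp
  have "u = \<one> \<otimes> u \<oplus> \<zero> \<otimes> v" "v = \<zero> \<otimes> u \<oplus> \<one> \<otimes> v" using assms by simp_all
  then have "u \<in> ?I" "v \<in> ?I" using A_closed(1,2) by blast+
  then show "?L \<subseteq> ?I"
    using linear_combinations_ideal[OF assms] ideal_iff[OF sub] by (intro A.genideal_minimal) auto
  have L: "is_ideal_of A ?L" using A.genideal_ideal[OF uv] ideal_iff[OF sub] by blast
  have "u \<in> ?L" "v \<in> ?L" using A.genideal_self[OF uv] by auto
  then show "?I \<subseteq> ?L" using ideal_closed(3,4)[OF L] by blast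
qed

end

context valued_field
begin

lemma dominated_ringI:
  assumes A: "subring A K" and dom: "dominates K \<nu> A"
    and noeth: "noetherian_ring (K\<lparr>carrier := A\<rparr>)" and loc: "local_ring (K\<lparr>carrier := A\<rparr>)"
  shows "dominated_ring K \<nu> A"
proof -
  interpret A: cring "K\<lparr>carrier := A\<rparr>" by (rule subring_cring[OF A])
  have acc: "ascending_chain_condition A" using noeth noetherian_iff[OF A] by blast
  have ex1: "\<exists>!m. maximalideal m (K\<lparr>carrier := A\<rparr>)" using loc by (simp add: local_ring_def)
  have mM: "max_ideal (K\<lparr>carrier := A\<rparr>) = M \<inter> A" using dom by (simp add: dominates_def)
  have AV: "A \<subseteq> V" using dom by (simp add: dominates_def)
  show ?thesis
  proof (intro dominated_ring.intro dominated_ring_axioms.intro)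
    show "valued_field K \<nu>" ..
    show "subring A K" by (rule A)
    show "A \<subseteq> V" by (rule AV)
    show "ascending_chain_condition A" by (rule acc)
  next
    fix f assume f: "f \<in> A" "f \<notin> M"
    \<comment> \<open>If \<open>f\<close> were contained in a proper ideal, a maximal member of
      \<open>F\<close> would be a maximal ideal, hence \<open>M \<inter> A\<close> by locality; but
      \<open>f \<notin> M\<close>.\<close>
    define F where "F = {I. is_ideal_of A I \<and> \<one> \<notin> I \<and> f \<in> I}"
    have fc: "f \<in> carrier K" "f \<noteq> \<zero>" using f AV by auto
    have pf: "is_ideal_of A (PIdl\<^bsub>K\<lparr>carrier := A\<rparr>\<^esub> f)" "f \<in> PIdl\<^bsub>K\<lparr>carrier := A\<rparr>\<^esub> f"
      using A.cgenideal_ideal[of f] A.cgenideal_self[of f] f ideal_iff[OF A] by auto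
    have "F = {}"
    proof (rule ccontr)
      assume "F \<noteq> {}"
      then have "\<exists>I\<in>F. \<forall>J\<in>F. I \<subseteq> J \<longrightarrow> J = I" by (rule acc_maximal[OF acc]) (simp add: F_def)
      then obtain I where I: "I \<in> F" "\<forall>J\<in>F. I \<subseteq> J \<longrightarrow> J = I" by blast
      then have "maximalideal I (K\<lparr>carrier := A\<rparr>)"
        unfolding maximalideal_iff[OF A] F_def by blast
      then have "max_ideal (K\<lparr>carrier := A\<rparr>) = I" unfolding max_ideal_def by (rule the1_equality[OF ex1])
      then show False using I(1) f mM unfolding F_def by blast
    qed
    then have "\<one> \<in> PIdl\<^bsub>K\<lparr>carrier := A\<rparr>\<^esub> f" using pf unfolding F_def by blast
    then obtain c where c: "c \<in> A" "c \<otimes> f = \<one>" by (auto simp: cgenideal_def)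
    then have "inv f = c" using fc subringE(1)[OF A] by (intro comm_inv_char) (auto simp: m_comm)
    then show "inv f \<in> A" using c by simp
  qed
qed

text \<open>Dimension two enters only through the existence of a prime strictly between zero and the
  maximal ideal, which \<open>no_small_prime\<close> turns into the two conditions on
  \<open>u\<close> and \<open>v\<close>.\<close>

lemma regular_parameters_imp_surface:
  assumes A: "subring A K" and dom: "dominates K \<nu> A" and reg: "regular_parameters (K\<lparr>carrier := A\<rparr>) u v"
  shows "regular_surface K \<nu> A u v"
proof -
  have noeth: "noetherian_ring (K\<lparr>carrier := A\<rparr>)" and loc: "local_ring (K\<lparr>carrier := A\<rparr>)"
    and dim: "krull_dim (K\<lparr>carrier := A\<rparr>) = 2"
    and uv: "u \<in> A" "v \<in> A" "max_ideal (K\<lparr>carrier := A\<rparr>) = Idl\<^bsub>K\<lparr>carrier := A\<rparr>\<^esub> {u, v}"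
    using reg by (auto simp: regular_parameters_def regular_local_ring_def)
  interpret dominated_ring K \<nu> A by (rule dominated_ringI[OF A dom noeth loc])
  have gen: "A \<inter> M = {a \<otimes> u \<oplus> b \<otimes> v | a b. a \<in> A \<and> b \<in> A}"
    using uv(3) unfolding max_ideal_A Idl_two[OF uv(1,2)] .
  have "u = \<one> \<otimes> u \<oplus> \<zero> \<otimes> v" "v = \<zero> \<otimes> u \<oplus> \<one> \<otimes> v" using uv by simp_all
  then have uvM: "u \<in> M" "v \<in> M" using gen A_closed(1,2) by blast+
  interpret uv: two_generated K \<nu> A u v
    by unfold_locales (use uv uvM gen in blast)+
  interpret vu: two_generated K \<nu> A v u
  proof unfold_locales
    fix f assume "f \<in> A" "f \<in> M"
    then obtain a b where ab: "a \<in> A" "b \<in> A" "f = a \<otimes> u \<oplus> b \<otimes> v" using gen by blast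
    then have "f = b \<otimes> v \<oplus> a \<otimes> u" using uv by (simp add: a_comm)
    then show "\<exists>a\<in>A. \<exists>b\<in>A. f = a \<otimes> v \<oplus> b \<otimes> u" using ab by blast
  qed (use uv uvM in auto)
  \<comment> \<open>The dimension is a supremum of chain lengths, so some chain has length at least
    2; its member with index 1 is the prime wanted.\<close>
  obtain P where P: "is_prime_of A P" "P \<noteq> {\<zero>}" "P \<noteq> A \<inter> M"
  proof -
    define S where "S = {n. \<exists>p :: nat \<Rightarrow> 'a set. (\<forall>i\<le>n. primeideal (p i) (K\<lparr>carrier := A\<rparr>)) \<and> (\<forall>i<n. p i \<subset> p (Suc i))}"
    have "\<exists>n\<in>S. 2 \<le> n"
    proof (rule ccontr)
      assume "\<not> ?thesis"
      then have "n \<le> 1" if "n \<in> S" for n using that by (metis Suc_1 not_less_eq_eq)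
      then have "krull_dim (K\<lparr>carrier := A\<rparr>) \<le> enat 1"
        unfolding krull_dim_def S_def[symmetric] by (intro SUP_least) auto
      then show False unfolding dim by (simp add: numeral_eq_enat)
    qed
    then obtain n where n: "2 \<le> n" "n \<in> S" by auto
    then obtain p where p: "2 \<le> n" "\<And>i. i \<le> n \<Longrightarrow> is_prime_of A (p i)" "\<And>i. i < n \<Longrightarrow> p i \<subset> p (Suc i)"
      using primeideal_iff[OF A] unfolding S_def by blast
    have prime: "is_prime_of A (p 0)" "is_prime_of A (p 1)" "is_prime_of A (p 2)"
      and sub: "p 0 \<subset> p 1" "p 1 \<subset> p 2" using p(2)[of 0] p(2)[of 1] p(2)[of 2] p(3)[of 0] p(3)[of 1] p(1)
      by (auto simp: numeral_2_eq_2)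
    have "\<zero> \<in> p 0" using prime(1) by (auto simp: is_prime_of_def is_ideal_of_def)
    then have "p 1 \<noteq> {\<zero>}" using sub(1) by auto
    moreover have "p 2 \<subseteq> A \<inter> M" using prime(3) by (intro proper_ideal_M) (auto simp: is_prime_of_def)
    then have "p 1 \<noteq> A \<inter> M" using sub(2) by auto
    ultimately show thesis using that prime(2) by blast
  qed
  show ?thesis
  proof unfold_locales
    show "u \<noteq> \<zero>"
    proof
      assume "u = \<zero>"
      \<comment> \<open>With \<open>u = \<zero>\<close> the first power of \<open>u\<close> is a
        multiple of \<open>v\<close>, so \<open>no_small_prime\<close> applies with exchanged
        parameters.\<close>
      then have "u [^] (1 :: nat) = v \<otimes> \<zero>" using uv by simp
      then show False by (rule vu.no_small_prime[OF P A_closed(1)])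
    qed
  qed (use uv.no_small_prime[OF P] in blast)
qed

end

context regular_surface
begin

lemma zero_prime: "is_prime_of A {\<zero>}"
  unfolding is_prime_of_def using zero_ideal by (auto simp: integral_iff)

lemma maximal_prime: "is_prime_of A (A \<inter> M)"
  unfolding is_prime_of_def using maximal_ideal M_prime A_in_V by auto

text \<open>In a chain of four primes the second is nonzero, so the third is already maximal by
  \<open>height_one\<close>. Zero, the ideal of \<open>u\<close> and the maximal ideal form a chain
  of length 2.\<close>

lemma krull_dim_2: "krull_dim (K\<lparr>carrier := A\<rparr>) = 2"
proof (rule antisym)
  let ?S = "{n. \<exists>p :: nat \<Rightarrow> 'a set. (\<forall>i\<le>n. primeideal (p i) (K\<lparr>carrier := A\<rparr>)) \<and> (\<forall>i<n. p i \<subset> p (Suc i))}"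
  show "krull_dim (K\<lparr>carrier := A\<rparr>) \<le> 2" unfolding krull_dim_def
  proof (rule SUP_least, rule ccontr)
    fix n assume n: "n \<in> ?S" and "\<not> enat n \<le> 2"
    then have "\<not> n \<le> 2" by (metis enat_ord_simps(1) numeral_eq_enat)
    then have n3: "3 \<le> n" by simp
    from n obtain p where "(\<forall>i\<le>n. primeideal (p i) (K\<lparr>carrier := A\<rparr>)) \<and> (\<forall>i<n. p i \<subset> p (Suc i))"
      by (elim CollectE exE)
    then have p: "\<And>i. i \<le> n \<Longrightarrow> is_prime_of A (p i)" "\<And>i. i < n \<Longrightarrow> p i \<subset> p (Suc i)"
      using primeideal_iff[OF sub] by blast+
    have prime: "is_prime_of A (p 0)" "is_prime_of A (p 1)" "is_prime_of A (p 2)" "is_prime_of A (p 3)"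
      and sub: "p 0 \<subset> p 1" "p 1 \<subset> p 2" "p 2 \<subset> p 3"
      using p(1)[of 0] p(1)[of 1] p(1)[of 2] p(1)[of 3] p(2)[of 0] p(2)[of 1] p(2)[of 2] n3
      by (auto simp: numeral_2_eq_2 numeral_3_eq_3)
    have "\<zero> \<in> p 0" using prime(1) by (auto simp: is_prime_of_def is_ideal_of_def)
    then have "p 1 \<noteq> {\<zero>}" using sub(1) by auto
    from height_one[OF prime(2) this prime(3) sub(2)] have "p 2 = A \<inter> M" .
    moreover have "p 3 \<subseteq> A \<inter> M" using prime(4) by (intro proper_ideal_M) (auto simp: is_prime_of_def)
    ultimately show False using sub(3) by auto
  qed
  define p where "p i = (if i = 0 then {\<zero>} else if i = 1 then {u \<otimes> c | c. c \<in> A} else A \<inter> M)" for i :: nat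
  have "is_prime_of A (p i)" for i unfolding p_def using zero_prime u_ideal_prime maximal_prime by simp
  moreover have "p i \<subset> p (Suc i)" if "i < 2" for i
  proof (cases "i = 0")
    case True
    have "u \<in> {u \<otimes> c | c. c \<in> A}" using u by (auto intro!: exI[of _ \<one>])
    moreover have "\<zero> \<in> {u \<otimes> c | c. c \<in> A}" using u by (auto intro!: exI[of _ \<zero>])
    ultimately show ?thesis using True u_nonzero by (auto simp: p_def)
  next
    case False
    then have i: "i = 1" using that by simp
    have "v \<notin> {u \<otimes> c | c. c \<in> A}" using v_pow[of _ 1] v by auto
    moreover have "{u \<otimes> c | c. c \<in> A} \<subseteq> A \<inter> M" using u A_in_V by auto
    ultimately show ?thesis using v i by (auto simp: p_def)
  qed
  ultimately have "2 \<in> ?S" using primeideal_iff[OF sub] by blast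
  then have "enat 2 \<le> krull_dim (K\<lparr>carrier := A\<rparr>)" unfolding krull_dim_def by (rule SUP_upper)
  then show "2 \<le> krull_dim (K\<lparr>carrier := A\<rparr>)" by (simp add: numeral_eq_enat)
qed

lemma max_ideal_generated: "max_ideal (K\<lparr>carrier := A\<rparr>) = Idl\<^bsub>K\<lparr>carrier := A\<rparr>\<^esub> {u, v}"
  unfolding max_ideal_A Idl_two[OF u(1) v(1)]
proof
  show "A \<inter> M \<subseteq> {a \<otimes> u \<oplus> b \<otimes> v |a b. a \<in> A \<and> b \<in> A}" using generate by blast
  show "{a \<otimes> u \<oplus> b \<otimes> v |a b. a \<in> A \<and> b \<in> A} \<subseteq> A \<inter> M" using u v A_in_V by auto
qed

lemma regular_parameters: "regular_parameters (K\<lparr>carrier := A\<rparr>) u v"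
proof -
  have "u \<noteq> v" using v_pow[of \<one> 1] v u by auto
  then have "card {u, v} = 2" by simp
  then show ?thesis
    unfolding regular_parameters_def regular_local_ring_def krull_dim_2
    using noetherian_A local_ring_A max_ideal_generated u v
    by (auto intro!: exI[of _ "{u, v}"] simp: numeral_eq_enat)
qed

text \<open>The condition on the powers of \<open>v\<close> is not visibly symmetric; the Krull
  dimension is, so the exchange passes through it.\<close>

lemma swap: "regular_surface K \<nu> A v u"
proof (rule regular_parameters_imp_surface[OF sub dominates_A])
  show "regular_parameters (K\<lparr>carrier := A\<rparr>) v u"
    using regular_parameters by (simp add: regular_parameters_def insert_commute)
qed

lemma u_not_divisible: "c \<in> A \<Longrightarrow> u \<noteq> v \<otimes> c"
  using regular_surface.v_pow[OF swap, of c 1] u by auto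

lemma u_ring_prime: "ring_prime\<^bsub>K\<lparr>carrier := A\<rparr>\<^esub> u"
  unfolding ring_prime_def prime_def
proof (intro conjI ballI impI)
  show "u \<noteq> \<zero>\<^bsub>K\<lparr>carrier := A\<rparr>\<^esub>" using u_nonzero by simp
  show "u \<notin> Units (K\<lparr>carrier := A\<rparr>)" using Units_A u by simp
  fix a b assume "a \<in> carrier (K\<lparr>carrier := A\<rparr>)" "b \<in> carrier (K\<lparr>carrier := A\<rparr>)"
    "u divides\<^bsub>K\<lparr>carrier := A\<rparr>\<^esub> a \<otimes>\<^bsub>K\<lparr>carrier := A\<rparr>\<^esub> b"
  then show "u divides\<^bsub>K\<lparr>carrier := A\<rparr>\<^esub> a \<or> u divides\<^bsub>K\<lparr>carrier := A\<rparr>\<^esub> b"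
    using u_prime[of a b] by (auto simp: factor_def)
qed

lemma nat_pow_A: "p [^]\<^bsub>K\<lparr>carrier := A\<rparr>\<^esub> (n :: nat) = p [^] n"
  by (simp add: nat_pow_def)

lemma one_component_unit_power:
  assumes "e \<in> A" "e \<notin> M" "0 < n" shows "one_component (K\<lparr>carrier := A\<rparr>) (e \<otimes> u [^] (n :: nat))"
  unfolding one_component_def nat_pow_A
proof (rule bexI[of _ u], rule bexI[of _ e], rule exI[of _ n])
  show "0 < n \<and> ring_prime\<^bsub>K\<lparr>carrier := A\<rparr>\<^esub> u \<and> e \<otimes> u [^] n = e \<otimes>\<^bsub>K\<lparr>carrier := A\<rparr>\<^esub> u [^] n"
    using assms(3) u_ring_prime by simp
  show "e \<in> Units (K\<lparr>carrier := A\<rparr>)" using assms Units_A by simp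
  show "u \<in> carrier (K\<lparr>carrier := A\<rparr>)" using u by simp
qed

lemma prime_power_divides:
  assumes "a \<in> A" "c \<in> A" "a [^] (n :: nat) = u \<otimes> c" shows "\<exists>d\<in>A. a = u \<otimes> d"
proof -
  have "a [^] n \<in> {u \<otimes> c | c. c \<in> A}" using assms by auto
  from prime_pow[OF u_ideal_prime assms(1) this] show ?thesis by auto
qed

text \<open>Here \<open>v\<close> divides \<open>p\<close> because it is prime and does not divide
  the unit \<open>e\<close>; so \<open>v\<close> divides \<open>u\<close>, which is
  impossible.\<close>

lemma prime_factor_u:
  assumes p: "p \<in> A" "p \<in> M" and c: "c \<in> A" "u = p \<otimes> c"
    and e: "e \<in> A" "e \<notin> M" and d: "d \<in> A" "e \<otimes> p [^] (n :: nat) = v \<otimes> d"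
  shows False
proof -
  interpret vu: regular_surface K \<nu> A v u by (rule swap)
  have "(\<exists>s\<in>A. e = v \<otimes> s) \<or> (\<exists>s\<in>A. p [^] n = v \<otimes> s)" using vu.u_prime[OF e(1) _ d(1,2)] p by simp
  moreover have "e \<noteq> v \<otimes> s" if "s \<in> A" for s using that e(2) v A_in_V by auto
  ultimately obtain s where "s \<in> A" "p [^] n = v \<otimes> s" by blast
  then obtain r where "r \<in> A" "p = v \<otimes> r" using vu.prime_power_divides p by blast
  then have "u = v \<otimes> (r \<otimes> c)" using c v by (simp add: m_assoc)
  then show False using u_not_divisible[of "r \<otimes> c"] \<open>r \<in> A\<close> c by simp
qed

text \<open>The prime \<open>p\<close> divides one of the parameters. The other parameter divides a
  unit times a power of \<open>p\<close>, hence \<open>p\<close>, hence the first parameter.\<close>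

lemma not_one_component:
  assumes "0 < a" "0 < b" shows "\<not> one_component (K\<lparr>carrier := A\<rparr>) (u [^] (a :: nat) \<otimes> v [^] (b :: nat))"
proof
  interpret vu: regular_surface K \<nu> A v u by (rule swap)
  assume "one_component (K\<lparr>carrier := A\<rparr>) (u [^] a \<otimes> v [^] b)"
  then obtain p e and n :: nat where p: "p \<in> A" "e \<in> A" "e \<notin> M" "0 < n" "ring_prime\<^bsub>K\<lparr>carrier := A\<rparr>\<^esub> p"
    and eq: "u [^] a \<otimes> v [^] b = e \<otimes> p [^] n"
    unfolding one_component_def nat_pow_A using Units_A by auto
  have pM: "p \<in> M" using p(1,5) Units_A by (auto simp: ring_prime_def prime_def)
  have div: "(\<exists>c\<in>A. r = p \<otimes> c) \<or> (\<exists>c\<in>A. s = p \<otimes> c)" if "r \<in> A" "s \<in> A" "c \<in> A" "r \<otimes> s = p \<otimes> c" for r s c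
    using p(5) that by (auto simp: ring_prime_def prime_def factor_def)
  have divp: "\<exists>c\<in>A. r = p \<otimes> c" if "r \<in> A" "c \<in> A" "r [^] (k :: nat) = p \<otimes> c" for r c k
    using that(3,2)
  proof (induction k arbitrary: c)
    case 0
    then have "\<one> \<in> M" using M_mult(1)[OF pM, of c] A_in_V by simp
    then show ?case by simp
  next
    case (Suc k)
    then show ?case using div[of "r [^] k" r c] that(1) by auto
  qed
  have "u [^] a \<otimes> v [^] b = p \<otimes> (e \<otimes> p [^] (n - 1))"
    unfolding eq using p by (cases n) (simp_all add: m_ac)
  then have "(\<exists>c\<in>A. u [^] a = p \<otimes> c) \<or> (\<exists>c\<in>A. v [^] b = p \<otimes> c)"
    using div[of "u [^] a" "v [^] b" "e \<otimes> p [^] (n - 1)"] p u v by simp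
  then have "(\<exists>c\<in>A. u = p \<otimes> c) \<or> (\<exists>c\<in>A. v = p \<otimes> c)" using divp u v by blast
  moreover have "e \<otimes> p [^] n = v \<otimes> (u [^] a \<otimes> v [^] (b - 1))"
    unfolding eq[symmetric] using assms(2) u v by (cases b) (simp_all add: m_ac)
  moreover have "e \<otimes> p [^] n = u \<otimes> (u [^] (a - 1) \<otimes> v [^] b)"
    unfolding eq[symmetric] using assms(1) u v by (cases a) (simp_all add: m_ac)
  ultimately show False
    using prime_factor_u[OF p(1) pM _ _ p(2,3)] vu.prime_factor_u[OF p(1) pM _ _ p(2,3)] u v
    by (meson A_closed(4) A_pow)
qed

text \<open>The ideal of \<open>u\<close> is itself a prime over the closed point. Conversely, a
  prime over the closed point contains \<open>e \<otimes> u^n\<close>, a unit times a power of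
  \<open>u\<close>, hence \<open>u\<close>.\<close>

lemma exceptional_ideal_u:
  assumes S: "S \<subseteq> A" "M \<inter> S = max_ideal (K\<lparr>carrier := S\<rparr>)"
    and gen: "\<And>f. f \<in> S \<Longrightarrow> f \<in> M \<Longrightarrow> \<exists>c\<in>A. f = u \<otimes> c" and e: "e \<in> A" "e \<notin> M" "e \<otimes> u [^] (n :: nat) \<in> S" "0 < n"
  shows "PIdl\<^bsub>K\<lparr>carrier := A\<rparr>\<^esub> u = exceptional_ideal K S A"
proof -
  have P: "PIdl\<^bsub>K\<lparr>carrier := A\<rparr>\<^esub> u = {u \<otimes> c | c. c \<in> A}"
  proof -
    have *: "c \<otimes> u = u \<otimes> c" if "c \<in> A" for c using that u by (intro m_comm) auto
    show ?thesis unfolding cgenideal_def by (auto simp: * intro: exI[of _ "_ :: 'a"] *[symmetric])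
  qed
  have "{u \<otimes> c | c. c \<in> A} \<inter> S = M \<inter> S"
  proof (intro equalityI subsetI)
    fix f assume "f \<in> {u \<otimes> c | c. c \<in> A} \<inter> S"
    then show "f \<in> M \<inter> S" using u A_in_V by auto
  next
    fix f assume "f \<in> M \<inter> S"
    then show "f \<in> {u \<otimes> c | c. c \<in> A} \<inter> S" using gen[of f] by blast
  qed
  then have 1: "exceptional_ideal K S A \<subseteq> {u \<otimes> c | c. c \<in> A}"
    unfolding exceptional_ideal_def primeideal_iff[OF sub] using u_ideal_prime S(2) by blast
  have "{u \<otimes> c | c. c \<in> A} \<subseteq> p" if p: "is_prime_of A p" "p \<inter> S = max_ideal (K\<lparr>carrier := S\<rparr>)" for p
  proof -
    have I: "is_ideal_of A p" using p by (simp add: is_prime_of_def)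
    have "u \<in> M" by (rule u)
    then have "u [^] n \<in> M" using e(4) A_in_V[OF A_pow[OF u(1), of "n - 1"]] by (cases n) (auto intro: M_mult)
    then have "e \<otimes> u [^] n \<in> M" using e A_in_V by auto
    then have "e \<otimes> u [^] n \<in> p" using e(3) p(2) S(2) by blast
    then have "inv e \<otimes> (e \<otimes> u [^] n) \<in> p" using ideal_closed(4)[OF I] not_M_unit[OF e(1,2)] by blast
    then have "u [^] n \<in> p" using not_M_unit[OF e(1,2)] e u by simp
    then have "u \<in> p" by (rule prime_pow[OF p(1) u(1)])
    then show ?thesis using ideal_closed(5)[OF I] by blast
  qed
  then show ?thesis unfolding P using 1
    unfolding exceptional_ideal_def primeideal_iff[OF sub] by blast
qed

end

section \<open>Polynomials in one element\<close>

text \<open>Values of polynomials are sums over coefficient functions. This form serves subrings of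
  the field \<open>K\<close> and of its residue field alike, and the length \<open>n\<close> bounds
  the degree without fixing it.\<close>

primrec (in ring) psum :: "(nat \<Rightarrow> 'a) \<Rightarrow> 'a \<Rightarrow> nat \<Rightarrow> 'a" where
  "psum c z 0 = \<zero>"
| "psum c z (Suc n) = psum c z n \<oplus> c n \<otimes> z [^] n"

definition (in ring) poly_span :: "'a set \<Rightarrow> 'a \<Rightarrow> nat \<Rightarrow> 'a set" where
  "poly_span A z n = {psum c z n | c. \<forall>i. c i \<in> A}"

context cring
begin

lemma psum_closed [simp]: "(\<And>i. c i \<in> carrier R) \<Longrightarrow> z \<in> carrier R \<Longrightarrow> psum c z n \<in> carrier R"
  by (induction n) auto

lemma psum_cong: "(\<And>i. i < n \<Longrightarrow> c i = d i) \<Longrightarrow> psum c z n = psum d z n"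
  by (induction n) auto

lemma psum_add:
  assumes "\<And>i. c i \<in> carrier R" "\<And>i. d i \<in> carrier R" "z \<in> carrier R"
  shows "psum c z n \<oplus> psum d z n = psum (\<lambda>i. c i \<oplus> d i) z n"
proof (induction n)
  case (Suc n)
  have "psum c z (Suc n) \<oplus> psum d z (Suc n) = (psum c z n \<oplus> psum d z n) \<oplus> (c n \<oplus> d n) \<otimes> z [^] n"
    using assms by (simp add: l_distr a_ac)
  then show ?case using Suc by simp
qed simp

lemma psum_smult:
  assumes "\<And>i. c i \<in> carrier R" "a \<in> carrier R" "z \<in> carrier R"
  shows "a \<otimes> psum c z n = psum (\<lambda>i. a \<otimes> c i) z n"
  using assms by (induction n) (simp_all add: r_distr m_assoc)

lemma psum_Suc_shift:
  assumes "\<And>i. c i \<in> carrier R" "z \<in> carrier R"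
  shows "psum c z (Suc n) = c 0 \<oplus> z \<otimes> psum (\<lambda>i. c (Suc i)) z n"
  using assms by (induction n) (simp_all add: r_distr a_ac m_ac)

lemma psum_extend:
  assumes "n \<le> m" "\<And>i. c i \<in> carrier R" "z \<in> carrier R" "\<And>i. n \<le> i \<Longrightarrow> c i = \<zero>"
  shows "psum c z m = psum c z n"
  using assms(1)
proof (induction m rule: dec_induct)
  case (step m)
  then show ?case using assms(2)[of m] assms(3) assms(4)[of m] psum_closed[of c z n] assms(2) by simp
qed simp

lemma psum_pow:
  assumes "\<And>i. c i \<in> carrier R" "z \<in> carrier R" "a \<in> carrier R"
  shows "psum (\<lambda>i. a [^] i \<otimes> c i) z n = psum c (a \<otimes> z) n"
  using assms by (induction n) (simp_all add: nat_pow_distrib m_ac)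

end

section \<open>The ring \<open>A[z]\<close> and Hilbert's basis theorem\<close>

locale adjunction = cring K for K (structure) +
  fixes A z
  assumes A: "subring A K" and z: "z \<in> carrier K"
begin

lemma A_car [simp]: "a \<in> A \<Longrightarrow> a \<in> carrier K" using subringE(1)[OF A] by auto
lemmas z_car [simp] = z
lemma A_cl [simp]:
  "\<zero> \<in> A" "\<one> \<in> A" "a \<in> A \<Longrightarrow> b \<in> A \<Longrightarrow> a \<oplus> b \<in> A" "a \<in> A \<Longrightarrow> b \<in> A \<Longrightarrow> a \<otimes> b \<in> A" "a \<in> A \<Longrightarrow> \<ominus> a \<in> A"
  using subringE[OF A] by auto

abbreviation "S \<equiv> poly_span A z"

lemma S_zero_iff: "f \<in> S 0 \<longleftrightarrow> f = \<zero>"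
  unfolding poly_span_def by (auto intro!: exI[of _ "\<lambda>_. \<zero>"])

lemma S_Suc_iff: "f \<in> S (Suc n) \<longleftrightarrow> (\<exists>a\<in>A. \<exists>s\<in>S n. f = s \<oplus> a \<otimes> z [^] n)"
proof
  assume "f \<in> S (Suc n)"
  then show "\<exists>a\<in>A. \<exists>s\<in>S n. f = s \<oplus> a \<otimes> z [^] n" unfolding poly_span_def by auto
next
  assume "\<exists>a\<in>A. \<exists>s\<in>S n. f = s \<oplus> a \<otimes> z [^] n"
  then obtain a c where a: "a \<in> A" "\<forall>i. c i \<in> A" "f = psum c z n \<oplus> a \<otimes> z [^] n"
    unfolding poly_span_def by auto
  have "psum c z n = psum (c(n := a)) z n" by (rule psum_cong) auto
  then have "f = psum (c(n := a)) z (Suc n)" using a by simp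
  then show "f \<in> S (Suc n)" unfolding poly_span_def using a by (auto intro!: exI[of _ "c(n := a)"])
qed

lemma S_car [simp]: "f \<in> S n \<Longrightarrow> f \<in> carrier K"
  unfolding poly_span_def by auto

lemma S_add: "f \<in> S n \<Longrightarrow> g \<in> S n \<Longrightarrow> f \<oplus> g \<in> S n"
proof -
  assume "f \<in> S n" "g \<in> S n"
  then obtain c d where "\<forall>i. c i \<in> A" "\<forall>i. d i \<in> A" "f = psum c z n" "g = psum d z n"
    unfolding poly_span_def by auto
  then show ?thesis unfolding poly_span_def by (auto simp: psum_add intro!: exI[of _ "\<lambda>i. c i \<oplus> d i"])
qed

lemma S_smult: "a \<in> A \<Longrightarrow> f \<in> S n \<Longrightarrow> a \<otimes> f \<in> S n"
proof -
  assume a: "a \<in> A" and "f \<in> S n"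
  then obtain c where "\<forall>i. c i \<in> A" "f = psum c z n" unfolding poly_span_def by auto
  then show ?thesis using a unfolding poly_span_def by (auto simp: psum_smult intro!: exI[of _ "\<lambda>i. a \<otimes> c i"])
qed

lemma S_uminus: "f \<in> S n \<Longrightarrow> \<ominus> f \<in> S n"
  using S_smult[of "\<ominus> \<one>" f n] by (simp add: l_minus)

lemma S_minus: "f \<in> S n \<Longrightarrow> g \<in> S n \<Longrightarrow> f \<ominus> g \<in> S n"
  by (simp add: minus_eq S_add S_uminus)

lemma S_zero [simp]: "\<zero> \<in> S n"
  by (induction n) (auto simp: S_zero_iff S_Suc_iff intro!: bexI[of _ \<zero>])

lemma S_mono: "n \<le> m \<Longrightarrow> S n \<subseteq> S m"
proof (induction m rule: dec_induct)
  case (step m)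
  have "f = f \<oplus> \<zero> \<otimes> z [^] m" if "f \<in> S m" for f using that by simp
  then have "S m \<subseteq> S (Suc m)" using S_Suc_iff A_cl(1) by blast
  then show ?case using step by auto
qed simp

lemma S_z: "f \<in> S n \<Longrightarrow> z \<otimes> f \<in> S (Suc n)"
proof (induction n arbitrary: f)
  case 0 then show ?case by (simp add: S_zero_iff)
next
  case (Suc n)
  then obtain a s where as: "a \<in> A" "s \<in> S n" "f = s \<oplus> a \<otimes> z [^] n" by (auto simp: S_Suc_iff)
  then have "z \<otimes> f = z \<otimes> s \<oplus> a \<otimes> z [^] Suc n" by (simp add: r_distr m_ac)
  then show ?case using S_Suc_iff[of "z \<otimes> f" "Suc n"] Suc.IH[OF as(2)] as(1) by blast
qed

lemma S_zpow: "f \<in> S n \<Longrightarrow> z [^] k \<otimes> f \<in> S (k + n)"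
proof (induction k)
  case (Suc k)
  then have "z \<otimes> (z [^] k \<otimes> f) \<in> S (Suc (k + n))" by (intro S_z) simp
  moreover have "z \<otimes> (z [^] k \<otimes> f) = z [^] Suc k \<otimes> f" using Suc by (simp add: m_ac)
  ultimately show ?case by simp
qed simp

lemma S_mult: "f \<in> S n \<Longrightarrow> g \<in> S m \<Longrightarrow> f \<otimes> g \<in> S (n + m)"
proof (induction n arbitrary: f)
  case 0 then show ?case by (simp add: S_zero_iff)
next
  case (Suc n)
  then obtain a s where as: "a \<in> A" "s \<in> S n" "f = s \<oplus> a \<otimes> z [^] n" by (auto simp: S_Suc_iff)
  then have "f \<otimes> g = s \<otimes> g \<oplus> a \<otimes> (z [^] n \<otimes> g)" using Suc by (simp add: l_distr m_assoc)
  moreover have "s \<otimes> g \<in> S (n + m)" "a \<otimes> (z [^] n \<otimes> g) \<in> S (n + m)"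
    using Suc as by (auto intro: S_smult S_zpow)
  ultimately show ?case using S_add S_mono[of "n + m" "Suc n + m"] by auto
qed

lemma S_pow: "z [^] n \<in> S (Suc n)"
proof -
  have "z [^] n = \<zero> \<oplus> \<one> \<otimes> z [^] n" by simp
  then show ?thesis using S_Suc_iff A_cl(2) S_zero by blast
qed

definition B where "B = (\<Union>n. S n)"

lemma S_B: "f \<in> S n \<Longrightarrow> f \<in> B" by (auto simp: B_def)

lemma S_Suc_0: "a \<in> A \<Longrightarrow> a \<in> S (Suc 0)"
  unfolding S_Suc_iff by (auto simp: S_zero_iff)

lemma B_subring: "subring B K"
proof (rule subringI)
  show "B \<subseteq> carrier K" by (auto simp: B_def)
  show "\<one> \<in> B" using S_Suc_0[of \<one>] by (auto intro: S_B)
  fix f assume "f \<in> B"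
  then show "\<ominus> f \<in> B" by (auto simp: B_def intro: S_uminus)
next
  fix f g assume "f \<in> B" "g \<in> B"
  then obtain n m where f: "f \<in> S n" and g: "g \<in> S m" by (auto simp: B_def)
  show "f \<otimes> g \<in> B" using S_B[OF S_mult[OF f g]] .
  have "f \<in> S (n + m)" "g \<in> S (n + m)" using f g S_mono[of n "n + m"] S_mono[of m "n + m"] by auto
  then show "f \<oplus> g \<in> B" using S_add S_B by blast
qed

lemma A_B: "A \<subseteq> B" using S_Suc_0 S_B by blast

lemma z_B: "z \<in> B" using S_B[OF S_pow[of 1]] by simp

lemma generate_ring_eq: "generate_ring K (A \<union> {z}) = B"
proof
  have sub: "A \<union> {z} \<subseteq> carrier K" by auto
  show "generate_ring K (A \<union> {z}) \<subseteq> B"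
    by (rule generate_ring_min_subring1[OF sub B_subring]) (use A_B z_B in auto)
  note G = subringE[OF generate_ring_is_subring[OF sub]]
  have gen: "A \<subseteq> generate_ring K (A \<union> {z})" "z \<in> generate_ring K (A \<union> {z})"
    by (auto intro: generate_ring.incl)
  have "z [^] (n :: nat) \<in> generate_ring K (A \<union> {z})" for n
    by (induction n) (use G(3,6) gen(2) in auto)
  then have "S n \<subseteq> generate_ring K (A \<union> {z})" for n
  proof (induction n)
    case 0 then show ?case using G(2) by (auto simp: S_zero_iff)
  next
    case (Suc n) then show ?case using G(6,7) gen(1) by (auto simp: S_Suc_iff) blast
  qed
  then show "B \<subseteq> generate_ring K (A \<union> {z})" by (auto simp: B_def)
qed

text \<open>As \<open>z\<close> may be algebraic over \<open>A\<close>, an element can have several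
  representations and so several leading coefficients. The proof of the basis theorem only needs
  that the set of all of them is an ideal.\<close>

definition lead where "lead J n = {a \<in> A. \<exists>s\<in>S n. s \<oplus> a \<otimes> z [^] (n :: nat) \<in> J}"

lemma lead_ideal:
  assumes J: "is_ideal_of B J" shows "is_ideal_of A (lead J n)"
  unfolding is_ideal_of_def
proof (intro conjI ballI)
  have J': "\<zero> \<in> J" "\<And>f g. f \<in> J \<Longrightarrow> g \<in> J \<Longrightarrow> f \<oplus> g \<in> J" "\<And>f b. f \<in> J \<Longrightarrow> b \<in> B \<Longrightarrow> b \<otimes> f \<in> J"
    using J by (auto simp: is_ideal_of_def)
  show "lead J n \<subseteq> A" by (auto simp: lead_def)
  show "\<zero> \<in> lead J n" using J'(1) by (auto simp: lead_def intro!: bexI[of _ \<zero>])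
  fix a assume "a \<in> lead J n"
  then obtain s where s: "a \<in> A" "s \<in> S n" "s \<oplus> a \<otimes> z [^] n \<in> J" by (auto simp: lead_def)
  {
    fix b assume "b \<in> lead J n"
    then obtain t where t: "b \<in> A" "t \<in> S n" "t \<oplus> b \<otimes> z [^] n \<in> J" by (auto simp: lead_def)
    have "(s \<oplus> a \<otimes> z [^] n) \<oplus> (t \<oplus> b \<otimes> z [^] n) = (s \<oplus> t) \<oplus> (a \<oplus> b) \<otimes> z [^] n"
      using s t by (simp add: l_distr a_ac)
    then have "(s \<oplus> t) \<oplus> (a \<oplus> b) \<otimes> z [^] n \<in> J" using J'(2)[OF s(3) t(3)] by simp
    then show "a \<oplus> b \<in> lead J n" using S_add[OF s(2) t(2)] s t by (auto simp: lead_def)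
  }
  fix r assume r: "r \<in> A"
  have "r \<otimes> (s \<oplus> a \<otimes> z [^] n) = r \<otimes> s \<oplus> (r \<otimes> a) \<otimes> z [^] n"
    using s r by (simp add: r_distr m_assoc)
  then have "r \<otimes> s \<oplus> (r \<otimes> a) \<otimes> z [^] n \<in> J" using J'(3)[OF s(3), of r] r A_B by auto
  then show "r \<otimes> a \<in> lead J n" using S_smult[OF r s(2)] s r by (auto simp: lead_def)
qed

lemma lead_Suc:
  assumes J: "is_ideal_of B J" shows "lead J n \<subseteq> lead J (Suc n)"
proof
  fix a assume "a \<in> lead J n"
  then obtain s where s: "a \<in> A" "s \<in> S n" "s \<oplus> a \<otimes> z [^] n \<in> J" by (auto simp: lead_def)
  have "z \<otimes> (s \<oplus> a \<otimes> z [^] n) = z \<otimes> s \<oplus> a \<otimes> z [^] Suc n" using s by (simp add: r_distr m_ac)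
  moreover have "z \<otimes> (s \<oplus> a \<otimes> z [^] n) \<in> J" using J s z_B by (auto simp: is_ideal_of_def)
  ultimately show "a \<in> lead J (Suc n)" using S_z[OF s(2)] s(1) by (auto simp: lead_def)
qed

lemma lead_mono: "J \<subseteq> J' \<Longrightarrow> lead J n \<subseteq> lead J' n" by (auto simp: lead_def)

text \<open>Induction on the degree: subtracting an element of \<open>J\<close> with the same
  leading coefficient leaves an element of \<open>J'\<close> of smaller degree.\<close>

lemma ideal_eq_lead:
  assumes J: "is_ideal_of B J" and J': "is_ideal_of B J'" and sub: "J \<subseteq> J'" and eq: "\<And>n. lead J' n = lead J n"
  shows "J' = J"
proof -
  have J'c: "f \<oplus> g \<in> J'" if "f \<in> J'" "g \<in> J'" for f g using J' that by (auto simp: is_ideal_of_def)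
  have Jc: "f \<oplus> g \<in> J" if "f \<in> J" "g \<in> J" for f g using J that by (auto simp: is_ideal_of_def)
  have "J' \<inter> S n \<subseteq> J" for n
  proof (induction n)
    case 0 then show ?case using J by (auto simp: S_zero_iff is_ideal_of_def)
  next
    case (Suc n)
    show ?case
    proof
      fix f assume "f \<in> J' \<inter> S (Suc n)"
      then obtain a s where s: "a \<in> A" "s \<in> S n" "f = s \<oplus> a \<otimes> z [^] n" and f: "f \<in> J'" by (auto simp: S_Suc_iff)
      then have "a \<in> lead J n" unfolding eq[symmetric] by (auto simp: lead_def)
      then obtain t where t: "t \<in> S n" "t \<oplus> a \<otimes> z [^] n \<in> J" by (auto simp: lead_def)
      have m: "(\<ominus> \<one>) \<otimes> (t \<oplus> a \<otimes> z [^] n) \<in> J"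
        using J t(2) A_B A_cl(2,5) unfolding is_ideal_of_def by blast
      then have "f \<oplus> (\<ominus> \<one>) \<otimes> (t \<oplus> a \<otimes> z [^] n) \<in> J'" using J'c f sub by blast
      moreover have zc: "z [^] n \<in> carrier K" by simp
      have "f \<oplus> (\<ominus> \<one>) \<otimes> (t \<oplus> a \<otimes> z [^] n) = s \<ominus> t"
        unfolding s(3) using S_car[OF s(2)] A_car[OF s(1)] S_car[OF t(1)] zc by algebra
      ultimately have "s \<ominus> t \<in> J" using Suc S_minus[OF s(2) t(1)] by auto
      then have "(s \<ominus> t) \<oplus> (t \<oplus> a \<otimes> z [^] n) \<in> J" using Jc t(2) by blast
      moreover have "(s \<ominus> t) \<oplus> (t \<oplus> a \<otimes> z [^] n) = f"
        unfolding s(3) using S_car[OF s(2)] A_car[OF s(1)] S_car[OF t(1)] zc by algebra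
      ultimately show "f \<in> J" by simp
    qed
  qed
  moreover have "J' \<subseteq> B" using J' by (auto simp: is_ideal_of_def)
  ultimately show ?thesis using sub unfolding B_def by blast
qed

text \<open>The diagonal sequence takes care of all large degrees at once.\<close>

lemma hilbert_basis:
  assumes acc: "ascending_chain_condition A" shows "ascending_chain_condition B"
  unfolding ascending_chain_condition_def
proof (intro allI impI)
  fix I :: "nat \<Rightarrow> 'a set" assume I: "\<forall>n. is_ideal_of B (I n) \<and> I n \<subseteq> I (Suc n)"
  then have id: "is_ideal_of B (I k)" and step: "I k \<subseteq> I (Suc k)" for k by blast+
  have I_mono: "k \<le> k' \<Longrightarrow> I k \<subseteq> I k'" for k k' using lift_Suc_mono_le[of I k k'] step by blast
  have mono: "lead (I k) n \<subseteq> lead (I k') n'" if "k \<le> k'" "n \<le> n'" for k k' n n'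
  proof -
    have "lead (I k') n \<subseteq> lead (I k') n'"
      using lift_Suc_mono_le[of "lead (I k')" n n'] lead_Suc[OF id] that(2) by blast
    then show ?thesis using lead_mono[OF I_mono[OF that(1)], of n] by blast
  qed
  have stat: "\<exists>n. \<forall>m\<ge>n. D m = D n" if "\<And>n. is_ideal_of A (D n)" "\<And>n. D n \<subseteq> D (Suc n)" for D :: "nat \<Rightarrow> 'a set"
    using acc that unfolding ascending_chain_condition_def by blast
  obtain k0 where k0: "\<And>m. k0 \<le> m \<Longrightarrow> lead (I m) m = lead (I k0) k0"
    using stat[of "\<lambda>k. lead (I k) k"] lead_ideal[OF id] mono by (metis Suc_n_not_le_n nat_le_linear)
  have "\<exists>s. \<forall>m\<ge>s. lead (I m) n = lead (I s) n" for n
    using stat[of "\<lambda>k. lead (I k) n"] lead_ideal[OF id] lead_mono[OF step] by blast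
  then obtain s where s: "\<And>n m. s n \<le> m \<Longrightarrow> lead (I m) n = lead (I (s n)) n" by metis
  \<comment> \<open>Each of the finitely many degrees below \<open>k0\<close> has its own stage
    \<open>s n\<close>; the sum is a common bound.\<close>
  define N where "N = k0 + (\<Sum>n<k0. s n)"
  have sN: "s n \<le> N" if "n < k0" for n
    unfolding N_def using member_le_sum[of n "{..<k0}" s] that by auto
  have "lead (I m) n = lead (I N) n" if m: "N \<le> m" for m n
  proof (cases "n < k0")
    case True
    then show ?thesis using s[of n m] s[of n N] sN[of n] m by auto
  next
    case False
    \<comment> \<open>Monotonicity squeezes \<open>lead (I k) n\<close> between the stable diagonal
      value at \<open>k0\<close> and the diagonal value at \<open>max k n\<close>, which are
      equal.\<close>
    have "lead (I k) n = lead (I k0) k0" if "k0 \<le> k" for k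
      using mono[of k0 k k0 n] mono[of k "max k n" n "max k n"] k0[of "max k n"] that False by auto
    then show ?thesis using m unfolding N_def by auto
  qed
  then have "I m = I N" if "N \<le> m" for m
    using ideal_eq_lead[OF id id I_mono[OF that]] that by blast
  then show "\<exists>n. \<forall>m\<ge>n. I m = I n" by blast
qed

end

context valued_field
begin

text \<open>Clearing the denominator shows that an ideal of the localisation is determined by its
  intersection with \<open>B\<close>, so the chain condition is inherited.\<close>

lemma local_subring_dominated:
  assumes B: "subring B K" "B \<subseteq> V" and acc: "ascending_chain_condition B"
  shows "dominated_ring K \<nu> (local_subring K B (B \<inter> M))"
proof -
  define C where "C = local_subring K B (B \<inter> M)"
  note B' = subringE[OF B(1)]
  have C_iff: "f \<in> C \<longleftrightarrow> (\<exists>a\<in>B. \<exists>b\<in>B. b \<notin> M \<and> f = a \<otimes> inv b)" for f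
    unfolding C_def local_subring_def by auto
  have bp: "b \<in> carrier K" "b \<noteq> \<zero>" "b \<in> V" if "b \<in> B" "b \<notin> M" for b using that B by auto
  have Bc: "a \<in> carrier K" "a \<in> V" if "a \<in> B" for a using that B by auto
  have bb: "b \<otimes> d \<in> B" "b \<otimes> d \<notin> M" if "b \<in> B" "d \<in> B" "b \<notin> M" "d \<notin> M" for b d
    using that B'(6) M_prime Bc by auto
  have BC: "a \<in> C" if "a \<in> B" for a unfolding C_iff
    using that Bc B'(3) by (intro bexI[of _ a] bexI[of _ \<one>]) auto
  have C_car: "f \<in> carrier K" if "f \<in> C" for f using that bp Bc by (auto simp: C_iff)
  have inv_C: "inv b \<in> C" if "b \<in> B" "b \<notin> M" for b unfolding C_iff
    using that bp B'(3) by (intro bexI[of _ \<one>] bexI[of _ b]) auto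
  have "subring C K"
  proof (rule subringI)
    show "C \<subseteq> carrier K" using C_car by blast
    show "\<one> \<in> C" using BC B'(3) by blast
    fix f assume "f \<in> C"
    then obtain a b where ab: "a \<in> B" "b \<in> B" "b \<notin> M" "f = a \<otimes> inv b" by (auto simp: C_iff)
    have "\<ominus> f = (\<ominus> a) \<otimes> inv b" unfolding ab(4) using bp[OF ab(2,3)] Bc[OF ab(1)] by (simp add: l_minus)
    then show "\<ominus> f \<in> C" unfolding C_iff using ab B'(5) by blast
    fix g assume "g \<in> C"
    then obtain c d where cd: "c \<in> B" "d \<in> B" "d \<notin> M" "g = c \<otimes> inv d" by (auto simp: C_iff)
    have "f \<otimes> g = (a \<otimes> c) \<otimes> inv (b \<otimes> d)"
      unfolding ab(4) cd(4) using bp[OF ab(2,3)] Bc[OF ab(1)] bp[OF cd(2,3)] Bc[OF cd(1)] by (intro mult_divide_mult)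
    then show "f \<otimes> g \<in> C" unfolding C_iff using bb[OF ab(2) cd(2) ab(3) cd(3)] B'(6)[OF ab(1) cd(1)] by blast
    have "f \<oplus> g = (a \<otimes> d \<oplus> c \<otimes> b) \<otimes> inv (b \<otimes> d)"
      unfolding ab(4) cd(4) using bp[OF ab(2,3)] Bc[OF ab(1)] bp[OF cd(2,3)] Bc[OF cd(1)] by (intro add_divide)
    moreover have "a \<otimes> d \<oplus> c \<otimes> b \<in> B" using ab cd B'(6,7) by simp
    ultimately show "f \<oplus> g \<in> C" unfolding C_iff using bb[OF ab(2) cd(2) ab(3) cd(3)] by blast
  qed
  moreover have "C \<subseteq> V"
  proof
    fix f assume "f \<in> C"
    then obtain a b where ab: "a \<in> B" "b \<in> B" "b \<notin> M" "f = a \<otimes> inv b" by (auto simp: C_iff)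
    then show "f \<in> V" using V_inv[OF bp(3)[OF ab(2,3)] ab(3)] Bc(2)[OF ab(1)] by simp
  qed
  moreover have "inv f \<in> C" if "f \<in> C" "f \<notin> M" for f
  proof -
    obtain a b where ab: "a \<in> B" "b \<in> B" "b \<notin> M" "f = a \<otimes> inv b" using \<open>f \<in> C\<close> by (auto simp: C_iff)
    have "a \<notin> M" using M_mult(1)[of a "inv b"] V_inv[OF bp(3)[OF ab(2,3)] ab(3)] ab that by auto
    then have "inv f = b \<otimes> inv a" unfolding ab(4) using bp[OF ab(2,3)] bp[OF ab(1)] by (intro inv_divide)
    then show ?thesis unfolding C_iff using ab \<open>a \<notin> M\<close> by blast
  qed
  moreover have "ascending_chain_condition C" unfolding ascending_chain_condition_def
  proof (intro allI impI)
    fix I :: "nat \<Rightarrow> 'a set" assume I: "\<forall>n. is_ideal_of C (I n) \<and> I n \<subseteq> I (Suc n)"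
    then have id: "I k \<subseteq> C" "\<zero> \<in> I k" "\<And>f g. f \<in> I k \<Longrightarrow> g \<in> I k \<Longrightarrow> f \<oplus> g \<in> I k"
      "\<And>f g. f \<in> I k \<Longrightarrow> g \<in> C \<Longrightarrow> g \<otimes> f \<in> I k" and step: "I k \<subseteq> I (Suc k)" for k
      by (auto simp: is_ideal_of_def)
    have "is_ideal_of B (I k \<inter> B)" for k unfolding is_ideal_of_def
      using id(2-4) BC B'(2,6,7) by simp
    moreover have "I k \<inter> B \<subseteq> I (Suc k) \<inter> B" for k using step by auto
    ultimately obtain n where n: "\<And>m. n \<le> m \<Longrightarrow> I m \<inter> B = I n \<inter> B"
      using spec[OF acc[unfolded ascending_chain_condition_def], of "\<lambda>k. I k \<inter> B"] by blast
    have contr: "I m \<subseteq> I n" if "I m \<inter> B \<subseteq> I n" for m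
    proof
      fix f assume f: "f \<in> I m"
      then have "f \<in> C" using id(1)[of m] by blast
      then obtain a b where ab: "a \<in> B" "b \<in> B" "b \<notin> M" "f = a \<otimes> inv b" unfolding C_iff by blast
      have "b \<otimes> f \<in> I m" by (rule id(4)[OF f BC[OF ab(2)]])
      moreover have "b \<otimes> f = a" unfolding ab(4) using bp[OF ab(2,3)] Bc[OF ab(1)] by simp
      ultimately have "a \<in> I n" using that ab(1) by auto
      then have "inv b \<otimes> a \<in> I n" using id(4) inv_C[OF ab(2,3)] by blast
      then show "f \<in> I n" unfolding ab(4) using bp[OF ab(2,3)] Bc[OF ab(1)] by (simp add: m_comm)
    qed
    have "I m = I n" if "n \<le> m" for m
      using contr[of m] n[OF that] lift_Suc_mono_le[of I n m] step that by blast
    then show "\<exists>n. \<forall>m\<ge>n. I m = I n" by blast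
  qed
  ultimately show ?thesis unfolding C_def[symmetric]
    by (intro dominated_ring.intro dominated_ring_axioms.intro valued_field_axioms)
qed

end

section \<open>Quadratic transforms\<close>

text \<open>The relation \<open>quadratic_transform\<close> quantifies over the parameters; here the
  quotient \<open>z\<close> is fixed. The two agree by
  \<open>quadratic_transform_eq\<close>.\<close>

definition (in valued_field) blowup where
  "blowup A z = (let C = generate_ring K (A \<union> {z}) in local_subring K C (C \<inter> M))"

lemma (in dominated_ring) residue_subfield: "subfield (residue_subfield K \<nu> A) L"
proof (rule L.subfieldI')
  note rs = residue_subfield_def
  show "subring (residue_subfield K \<nu> A) L"
  proof (rule L.subringI)
    show "residue_subfield K \<nu> A \<subseteq> carrier L" using A_in_V by (auto simp: rs)
    have "\<one>\<^bsub>L\<^esub> = res \<one>" by simp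
    then show "\<one>\<^bsub>L\<^esub> \<in> residue_subfield K \<nu> A" unfolding rs using A_closed(2) by blast
    fix h assume "h \<in> residue_subfield K \<nu> A"
    then obtain a where a: "a \<in> A" "h = res a" by (auto simp: rs)
    then have "\<ominus>\<^bsub>L\<^esub> h = res (\<ominus> a)" using A_in_V by simp
    then show "\<ominus>\<^bsub>L\<^esub> h \<in> residue_subfield K \<nu> A" unfolding rs using A_closed(5)[OF a(1)] by blast
    fix h' assume "h' \<in> residue_subfield K \<nu> A"
    then obtain b where b: "b \<in> A" "h' = res b" by (auto simp: rs)
    have "h \<otimes>\<^bsub>L\<^esub> h' = res (a \<otimes> b)" "h \<oplus>\<^bsub>L\<^esub> h' = res (a \<oplus> b)" using a b A_in_V by auto
    then show "h \<otimes>\<^bsub>L\<^esub> h' \<in> residue_subfield K \<nu> A" "h \<oplus>\<^bsub>L\<^esub> h' \<in> residue_subfield K \<nu> A"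
      unfolding rs using A_closed(3,4)[OF a(1) b(1)] by blast+
  qed
  fix k assume "k \<in> residue_subfield K \<nu> A - {\<zero>\<^bsub>L\<^esub>}"
  then obtain a where a: "a \<in> A" "k = res a" "k \<noteq> \<zero>\<^bsub>L\<^esub>" by (auto simp: rs)
  then have "a \<notin> M" using res_zero_iff A_in_V by auto
  then have "inv\<^bsub>L\<^esub> k = res (inv a)" using a A_in_V by simp
  then show "inv\<^bsub>L\<^esub> k \<in> residue_subfield K \<nu> A" unfolding rs using unit[OF a(1) \<open>a \<notin> M\<close>] by blast
qed

section \<open>The localisation of \<open>A[z]\<close> at the centre of \<nu>\<close>

locale dominated_adjunction = dominated_ring K \<nu> A + adj: adjunction K A z for K (structure) and \<nu> and A and z +
  assumes zV: "z \<in> V"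
begin

lemma B_V: "adj.B \<subseteq> V"
proof -
  have "f \<in> V" if "f \<in> adj.S n" for f n
    using that
  proof (induction n arbitrary: f)
    case 0 then show ?case by (simp add: adj.S_zero_iff)
  next
    case (Suc n) then show ?case using zV A_in_V by (auto simp: adj.S_Suc_iff)
  qed
  then show ?thesis by (auto simp: adj.B_def)
qed

lemma B_simps [simp]:
  "a \<in> A \<Longrightarrow> a \<in> adj.B" "z \<in> adj.B" "z [^] (n :: nat) \<in> adj.B"
  "a \<in> adj.B \<Longrightarrow> b \<in> adj.B \<Longrightarrow> a \<oplus> b \<in> adj.B" "a \<in> adj.B \<Longrightarrow> b \<in> adj.B \<Longrightarrow> a \<otimes> b \<in> adj.B"
  "\<zero> \<in> adj.B" "\<one> \<in> adj.B"
  using adj.A_B adj.z_B adj.S_B[OF adj.S_pow[of n]] subringE[OF adj.B_subring] by auto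

lemma blowup_eq: "blowup A z = local_subring K adj.B (adj.B \<inter> M)"
  unfolding blowup_def adj.generate_ring_eq Let_def ..

lemma blowup_iff: "f \<in> blowup A z \<longleftrightarrow> (\<exists>a\<in>adj.B. \<exists>b\<in>adj.B. b \<notin> M \<and> f = a \<otimes> inv b)"
  unfolding blowup_eq local_subring_def by auto

lemma blowup_dominated: "dominated_ring K \<nu> (blowup A z)"
  unfolding blowup_eq by (rule local_subring_dominated[OF adj.B_subring B_V adj.hilbert_basis[OF acc]])

lemma B_blowup: "adj.B \<subseteq> blowup A z"
proof
  fix f assume f: "f \<in> adj.B"
  then have "f = f \<otimes> inv \<one>" using B_V by auto
  then show "f \<in> blowup A z" unfolding blowup_iff using f subringE(3)[OF adj.B_subring] one_notin_M by blast
qed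

text \<open>Numerators and denominators are polynomials in \<open>z\<close> over \<open>A\<close>,
  and an admissible denominator has nonzero residue.\<close>

lemma blowup_residue: "residue_subfield K \<nu> (blowup A z) = generate_field L (residue_subfield K \<nu> A \<union> {res z})"
proof
  interpret C: dominated_ring K \<nu> "blowup A z" by (rule blowup_dominated)
  let ?G = "generate_field L (residue_subfield K \<nu> A \<union> {res z})"
  have sub: "residue_subfield K \<nu> A \<union> {res z} \<subseteq> carrier L" using zV A_in_V by (auto simp: residue_subfield_def)
  note G = subfieldE(1)[OF L.generate_field_is_subfield[OF sub]]
  have zG: "res z [^]\<^bsub>L\<^esub> (n :: nat) \<in> ?G" for n
    using subringE(3,6)[OF G] by (induction n) (auto intro: generate_field.incl)
  have "res f \<in> ?G" if "f \<in> adj.S n" for f n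
    using that
  proof (induction n arbitrary: f)
    case 0 then show ?case using subringE(2)[OF G] by (simp add: adj.S_zero_iff)
  next
    case (Suc n)
    then obtain a s where as: "a \<in> A" "s \<in> adj.S n" "f = s \<oplus> a \<otimes> z [^] n" by (auto simp: adj.S_Suc_iff)
    have "s \<in> V" using as(2) adj.S_B B_V by blast
    then have "res f = res s \<oplus>\<^bsub>L\<^esub> res a \<otimes>\<^bsub>L\<^esub> res z [^]\<^bsub>L\<^esub> n" using as A_in_V zV by simp
    moreover have "res a \<in> ?G" using as by (auto intro!: generate_field.incl simp: residue_subfield_def)
    ultimately show ?case using subringE(6,7)[OF G] Suc.IH[OF as(2)] zG by simp
  qed
  then have BG: "res f \<in> ?G" if "f \<in> adj.B" for f using that by (auto simp: adj.B_def)
  show "residue_subfield K \<nu> (blowup A z) \<subseteq> ?G"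
  proof
    fix h assume "h \<in> residue_subfield K \<nu> (blowup A z)"
    then obtain a b where ab: "a \<in> adj.B" "b \<in> adj.B" "b \<notin> M" "h = res (a \<otimes> inv b)"
      by (auto simp: residue_subfield_def blowup_iff)
    have V: "a \<in> V" "b \<in> V" "inv b \<in> V" using ab B_V V_inv by auto
    then have "h = res a \<otimes>\<^bsub>L\<^esub> inv\<^bsub>L\<^esub> (res b)" using ab by simp
    moreover have "inv\<^bsub>L\<^esub> (res b) \<in> ?G"
      using BG[OF ab(2)] V(2) ab(3) res_zero_iff by (intro generate_field.m_inv) auto
    ultimately show "h \<in> ?G" using BG[OF ab(1)] subringE(6)[OF G] by simp
  qed
  have "A \<subseteq> blowup A z" "z \<in> blowup A z" using B_blowup adj.A_B adj.z_B by auto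
  then show "?G \<subseteq> residue_subfield K \<nu> (blowup A z)"
    by (intro L.generate_field_min_subfield1[OF sub C.residue_subfield]) (auto simp: residue_subfield_def)
qed

lemma blowup_residue_M:
  assumes "z \<in> M" shows "residue_subfield K \<nu> (blowup A z) = residue_subfield K \<nu> A"
proof -
  have rz: "res z = \<zero>\<^bsub>L\<^esub>" using assms zV res_zero_iff by simp
  have zero: "\<zero>\<^bsub>L\<^esub> \<in> residue_subfield K \<nu> A" by (rule subringE(2)[OF subfieldE(1)[OF residue_subfield]])
  have "generate_field L (residue_subfield K \<nu> A) = residue_subfield K \<nu> A"
    using L.generate_field_min_subfield1[OF _ residue_subfield order.refl] subfieldE(3)[OF residue_subfield]
    by (auto intro: generate_field.incl)
  then show ?thesis unfolding blowup_residue rz using zero by (simp add: insert_absorb)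
qed

end

context regular_surface
begin

lemma blowup_adjunction:
  assumes "\<nu> u \<le> \<nu> v" shows "dominated_adjunction K \<nu> A (v \<otimes> inv u)"
proof -
  have "v \<otimes> inv u \<in> V" using assms u v u_nonzero by (intro V_divide) auto
  then show ?thesis using sub
    by (intro dominated_adjunction.intro adjunction.intro adjunction_axioms.intro dominated_adjunction_axioms.intro
        dominated_ring_axioms is_cring) auto
qed

text \<open>Both \<open>u\<close> and \<open>u'\<close> have the smallest value in the maximal
  ideal. So \<open>u' / u\<close> is a unit after localisation, and \<open>v' / u'\<close> is the
  quotient of \<open>v' / u\<close> by it. Exchanging the roles gives independence of the
  parameters.\<close>

lemma blowup_subset:
  assumes le: "\<nu> u \<le> \<nu> v" and reg: "regular_surface K \<nu> A u' v'" and le': "\<nu> u' \<le> \<nu> v'"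
  shows "blowup A (v' \<otimes> inv u') \<subseteq> blowup A (v \<otimes> inv u)"
proof -
  let ?z = "v \<otimes> inv u" and ?z' = "v' \<otimes> inv u'"
  interpret T': regular_surface K \<nu> A u' v' by (rule reg)
  interpret z: dominated_adjunction K \<nu> A ?z by (rule blowup_adjunction[OF le])
  interpret z': dominated_adjunction K \<nu> A ?z' by (rule T'.blowup_adjunction[OF le'])
  interpret C: dominated_ring K \<nu> "blowup A ?z" by (rule z.blowup_dominated)
  have uc: "u \<in> carrier K" "v \<in> carrier K" "u' \<in> carrier K" "v' \<in> carrier K" using u v T'.u T'.v by auto
  \<comment> \<open>The maximal ideal of \<open>A\<close> becomes principal in \<open>A[z]\<close>,
    generated by \<open>u\<close>, since \<open>v = u \<otimes> z\<close>.\<close>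
  have quot: "f \<otimes> inv u \<in> z.adj.B" if fA: "f \<in> A" and fM: "f \<in> M" for f
  proof -
    obtain a b where ab: "a \<in> A" "b \<in> A" "f = a \<otimes> u \<oplus> b \<otimes> v" using generate[OF fA fM] by blast
    have iu: "inv u \<in> carrier K" using uc u_nonzero by simp
    have "f \<otimes> inv u = a \<otimes> (u \<otimes> inv u) \<oplus> b \<otimes> (v \<otimes> inv u)"
      unfolding ab(3) using A_carrier[OF ab(1)] A_carrier[OF ab(2)] uc iu by algebra
    also have "\<dots> = a \<oplus> b \<otimes> ?z" using ab uc u_nonzero by simp
    finally show ?thesis
      using ab by simp
  qed
  have "\<nu> u \<le> \<nu> f" if "f \<in> A" "f \<in> M" "f \<noteq> \<zero>" for f
    using quot[OF that(1,2)] z.B_V that uc u_nonzero V_iff[of "f \<otimes> inv u"] by auto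
  moreover have "\<nu> u' \<le> \<nu> u"
  proof -
    obtain a b where ab: "a \<in> A" "b \<in> A" "u = a \<otimes> u' \<oplus> b \<otimes> v'" using T'.generate[OF u] by blast
    have iu: "inv u' \<in> carrier K" using uc T'.u_nonzero by simp
    have "u \<otimes> inv u' = a \<otimes> (u' \<otimes> inv u') \<oplus> b \<otimes> (v' \<otimes> inv u')"
      unfolding ab(3) using A_carrier[OF ab(1)] A_carrier[OF ab(2)] uc iu by algebra
    also have "\<dots> = a \<oplus> b \<otimes> ?z'" using ab uc T'.u_nonzero by simp
    finally have "u \<otimes> inv u' \<in> V" using ab A_in_V z'.zV by simp
    then show ?thesis using uc u_nonzero T'.u_nonzero V_iff[of "u \<otimes> inv u'"] by auto
  qed
  ultimately have uu: "\<nu> u' = \<nu> u" using T'.u T'.u_nonzero by (meson order.antisym)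
  define s where "s = u' \<otimes> inv u"
  define t where "t = v' \<otimes> inv u"
  have s: "s \<in> z.adj.B" "s \<notin> M" "s \<noteq> \<zero>" and t: "t \<in> z.adj.B"
    using quot[OF T'.u] quot[OF T'.v] uu uc u_nonzero T'.u_nonzero not_M[of s] z.B_V unfolding s_def t_def by auto
  have stc: "s \<in> carrier K" "t \<in> carrier K" using s t z.B_V by auto
  have "?z' = t \<otimes> inv s"
    unfolding s_def t_def using uc u_nonzero T'.u_nonzero
    by (simp add: inv_divide) (simp add: m_assoc)
  then have zC: "?z' \<in> blowup A ?z" unfolding z.blowup_iff using s t by blast
  have "z'.adj.S n \<subseteq> blowup A ?z" for n
  proof (induction n)
    case 0 then show ?case using C.A_closed(1) by (auto simp: z'.adj.S_zero_iff)
  next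
    case (Suc n)
    then show ?case using zC z.B_blowup z.adj.A_B by (fastforce simp: z'.adj.S_Suc_iff)
  qed
  then have BC: "z'.adj.B \<subseteq> blowup A ?z" by (auto simp: z'.adj.B_def)
  show ?thesis
  proof
    fix f assume "f \<in> blowup A ?z'"
    then obtain a b where "a \<in> z'.adj.B" "b \<in> z'.adj.B" "b \<notin> M" "f = a \<otimes> inv b" by (auto simp: z'.blowup_iff)
    then show "f \<in> blowup A ?z" using C.unit[of b] C.A_closed(4)[of a "inv b"] BC by blast
  qed
qed

lemma quadratic_transform_eq:
  assumes le: "\<nu> u \<le> \<nu> v" and qt: "quadratic_transform K \<nu> A A'"
  shows "A' = blowup A (v \<otimes> inv u)"
proof -
  obtain u' v' where reg: "regular_parameters (K\<lparr>carrier := A\<rparr>) u' v'" and le': "\<nu> u' \<le> \<nu> v'"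
    and A': "A' = blowup A (v' \<otimes> inv u')"
    using qt unfolding quadratic_transform_def blowup_def Let_def by blast
  interpret T': regular_surface K \<nu> A u' v' by (rule regular_parameters_imp_surface[OF sub dominates_A reg])
  show ?thesis unfolding A'
    using blowup_subset[OF le T'.regular_surface_axioms le'] T'.blowup_subset[OF le' regular_surface_axioms le] by blast
qed

end

text \<open>\<open>g\<close> is the lift of a monic polynomial that vanishes at the residue of
  \<open>z\<close>, and \<open>minimal\<close> expresses through lifts that the lower powers of this
  residue are linearly independent. The case \<open>z \<in> M\<close> is included, with
  \<open>d = 1\<close> and \<open>g = z\<close>.\<close>

locale blowup_surface = regular_surface K \<nu> A u v for K (structure) and \<nu> A u v +
  fixes z g d c
  assumes le: "\<nu> u \<le> \<nu> v" and z_def: "z = v \<otimes> inv u"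
    and g_def: "g = z [^] (d :: nat) \<oplus> psum c z d" and c: "\<And>i. c i \<in> A" and gM: "g \<in> M"
    and minimal: "\<And>r i. (\<And>i. r i \<in> A) \<Longrightarrow> psum r z d \<in> M \<Longrightarrow> i < d \<Longrightarrow> r i \<in> M"
begin

sublocale dominated_adjunction K \<nu> A z
  unfolding z_def by (rule blowup_adjunction[OF le])

lemma uz: "u \<otimes> z = v" unfolding z_def using u v u_nonzero by simp

lemma z_carrier [simp]: "z \<in> carrier K" by (rule adj.z)

lemmas B_cl = subringE[OF adj.B_subring]

lemma B_carrier [simp]: "b \<in> adj.B \<Longrightarrow> b \<in> carrier K" using B_cl(1) by auto

lemma u_B: "u \<in> adj.B" using u adj.A_B by auto

text \<open>The degree is below \<open>n\<close>, so \<open>u^n\<close> clears all denominators of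
  the powers of \<open>z = v / u\<close> and one factor \<open>u\<close> is left over.\<close>

lemma u_psum: "psum r z n \<in> carrier K \<and> (\<exists>a\<in>A. u [^] n \<otimes> psum r z n = u \<otimes> a)" if "\<And>i. r i \<in> A"
proof (induction n)
  case 0 then show ?case using u by (auto intro!: bexI[of _ \<zero>])
next
  case (Suc n)
  then obtain a where a: "a \<in> A" "u [^] n \<otimes> psum r z n = u \<otimes> a" and pc: "psum r z n \<in> carrier K" by auto
  have "u [^] n \<otimes> z [^] n = v [^] n" using u by (simp add: nat_pow_distrib[symmetric] uz)
  moreover have car: "u \<in> carrier K" "u [^] n \<in> carrier K" "z [^] n \<in> carrier K" "r n \<in> carrier K" using u that by auto
  have "u [^] Suc n \<otimes> psum r z (Suc n) = u \<otimes> (u [^] n \<otimes> psum r z n) \<oplus> u \<otimes> (r n \<otimes> (u [^] n \<otimes> z [^] n))"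
    using car pc by (simp, algebra)
  ultimately have "u [^] Suc n \<otimes> psum r z (Suc n) = u \<otimes> (u \<otimes> a \<oplus> r n \<otimes> v [^] n)"
    using a(2) u v that[of n] a(1) by (simp add: r_distr)
  moreover have "u \<otimes> a \<oplus> r n \<otimes> v [^] n \<in> A" using a u v that by simp
  ultimately show ?case using pc car by auto
qed

text \<open>This says that \<open>A[z]\<close> modulo \<open>u\<close> is a polynomial ring over the
  residue field. Clearing denominators shows that \<open>u\<close> divides
  \<open>r n \<otimes> v^n\<close>, hence \<open>r n\<close>, because \<open>u\<close> is prime and
  divides no power of \<open>v\<close>. The top term is then absorbed into the next one, and the
  relation becomes shorter.\<close>

lemma psum_zero:
  assumes "\<And>i. r i \<in> A" "psum r z n = \<zero>" "i < n" shows "r i \<in> M"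
  using assms
proof (induction n arbitrary: r i)
  case (Suc n)
  have car: "r n \<in> carrier K" "u [^] n \<in> carrier K" "z [^] n \<in> carrier K" using Suc.prems(1) u by auto
  obtain a where a: "a \<in> A" "u [^] n \<otimes> psum r z n = u \<otimes> a" and pc: "psum r z n \<in> carrier K"
    using u_psum[of r n] Suc.prems(1) by blast
  have "u [^] n \<otimes> z [^] n = v [^] n" using u by (simp add: nat_pow_distrib[symmetric] uz)
  then have "u [^] n \<otimes> psum r z (Suc n) = u \<otimes> a \<oplus> r n \<otimes> v [^] n"
    using car pc a by (simp add: r_distr m_lcomm)
  then have "u \<otimes> a \<oplus> r n \<otimes> v [^] n = \<zero>" using Suc.prems(2) car by simp
  then have "r n \<otimes> v [^] n = \<ominus> (u \<otimes> a)"
    using car a u v by (metis A_carrier A_pow a_comm m_closed sum_zero_eq_neg)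
  then have "r n \<otimes> v [^] n = u \<otimes> (\<ominus> a)" using a u by (simp add: r_minus)
  then obtain h where h: "h \<in> A" "r n = u \<otimes> h"
    using u_prime[of "r n" "v [^] n" "\<ominus> a"] v_pow Suc.prems(1) v a by auto
  have hc: "h \<in> carrier K" "u \<in> carrier K" "v \<in> carrier K" using h u v by auto
  have rn: "r n \<in> M" unfolding h(2) using u h A_in_V by simp
  show ?case
  proof (cases n)
    case 0
    then show ?thesis using Suc.prems(3) rn by simp
  next
    case (Suc n')
    \<comment> \<open>With \<open>r n = u \<otimes> h\<close> and \<open>u \<otimes> z = v\<close>
      the top term equals \<open>h \<otimes> v \<otimes> z^n'\<close>. The correction
      \<open>h \<otimes> v\<close> lies in \<open>M\<close> and does not affect membership of
      \<open>r n'\<close>.\<close>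
    define r' where "r' = r(n' := r n' \<oplus> h \<otimes> v)"
    have r'A: "r' j \<in> A" for j using Suc.prems(1) h v by (simp add: r'_def)
    have c': "r n' \<in> carrier K" "z [^] n' \<in> carrier K" "psum r z n' \<in> carrier K" using Suc.prems(1) u_psum[of r n'] Suc.prems(1) by auto
    have "psum r' z n' = psum r z n'" by (rule psum_cong) (simp add: r'_def)
    then have "psum r' z n = psum r z n' \<oplus> (r n' \<oplus> h \<otimes> v) \<otimes> z [^] n'" unfolding Suc by (simp add: r'_def)
    also have "\<dots> = (psum r z n' \<oplus> r n' \<otimes> z [^] n') \<oplus> (u \<otimes> h) \<otimes> (z [^] n' \<otimes> z)"
      unfolding uz[symmetric] using c' hc z_carrier by algebra
    also have "\<dots> = psum r z (Suc n)" using h(2) Suc by simp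
    finally have z0: "psum r' z n = \<zero>" using Suc.prems(2) by simp
    have IH: "r' j \<in> M" if "j < n" for j by (rule Suc.IH[OF r'A z0 that])
    show ?thesis
    proof (cases "i = n \<or> i = n'")
      case False
      then have "i < n" using Suc.prems(3) by simp
      then show ?thesis using IH[of i] False by (simp add: r'_def)
    next
      case True
      have "r n' \<oplus> h \<otimes> v \<in> M" using IH[of n'] Suc by (simp add: r'_def)
      moreover have "h \<otimes> v \<in> M" using h v A_in_V by simp
      ultimately have "(r n' \<oplus> h \<otimes> v) \<oplus> \<ominus> (h \<otimes> v) \<in> M" by simp
      moreover have "(r n' \<oplus> h \<otimes> v) \<oplus> \<ominus> (h \<otimes> v) = r n'" using c' hc by algebra
      ultimately show ?thesis using True rn by auto
    qed
  qed
qed simp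

text \<open>In the polynomial ring \<open>A[z]\<close> modulo \<open>u\<close>, an element with a
  unit as leading coefficient is not zero.\<close>

lemma monic_not_divisible:
  assumes e: "e \<in> A" "e \<notin> M" and m: "m \<in> adj.S D" and h: "h \<in> adj.B"
  shows "m \<oplus> e \<otimes> z [^] D \<noteq> u \<otimes> h"
proof
  assume eq: "m \<oplus> e \<otimes> z [^] D = u \<otimes> h"
  obtain cm where cm: "\<And>i. cm i \<in> A" "m = psum cm z D" using m by (auto simp: poly_span_def)
  obtain n ch where ch: "\<And>i. ch i \<in> A" "h = psum ch z n" using h by (auto simp: poly_span_def adj.B_def)
  \<comment> \<open>\<open>p\<close> and \<open>q\<close> are the coefficients of the two sides, the
    second with opposite sign, padded with zeros to the common length \<open>N\<close>. The sum of
    the coefficients at \<open>D\<close> is \<open>e\<close> plus an element of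
    \<open>M\<close>.\<close>
  define p where "p i = (if i < D then cm i else if i = D then e else \<zero>)" for i
  define q where "q i = (if i < n then \<ominus> u \<otimes> ch i else \<zero>)" for i
  have pA: "p i \<in> A" and qA: "q i \<in> A" for i using cm ch e u by (auto simp: p_def q_def)
  define N where "N = max (Suc D) n"
  have "psum p z N = psum p z (Suc D)" using pA by (intro psum_extend) (auto simp: N_def p_def)
  also have "psum p z D = m" unfolding cm(2) by (rule psum_cong) (simp add: p_def)
  then have "psum p z (Suc D) = m \<oplus> e \<otimes> z [^] D" by (simp add: p_def)
  finally have 1: "psum p z N = u \<otimes> h" using eq by simp
  have "psum q z N = psum q z n" using qA by (intro psum_extend) (auto simp: N_def q_def)
  also have "\<dots> = psum (\<lambda>i. \<ominus> u \<otimes> ch i) z n" by (rule psum_cong) (simp add: q_def)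
  also have "\<dots> = \<ominus> u \<otimes> h" unfolding ch(2) using ch u by (intro psum_smult[symmetric]) auto
  finally have "psum (\<lambda>i. p i \<oplus> q i) z N = u \<otimes> h \<oplus> \<ominus> u \<otimes> h"
    using psum_add[of p q z N] pA qA 1 by simp
  also have "\<dots> = \<zero>" using u B_carrier[OF h] by (simp add: l_minus r_neg)
  finally have "p D \<oplus> q D \<in> M" using psum_zero[of "\<lambda>i. p i \<oplus> q i" N D] pA qA by (simp add: N_def)
  moreover have qM: "q D \<in> M" unfolding q_def using u ch A_in_V by (auto intro: M_mult)
  ultimately have "(p D \<oplus> q D) \<oplus> \<ominus> q D \<in> M" by simp
  moreover have "(p D \<oplus> q D) \<oplus> \<ominus> q D = p D" using A_carrier[OF pA] A_carrier[OF qA] by algebra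
  ultimately show False using e by (simp add: p_def)
qed

text \<open>A coefficient \<open>a \<otimes> u \<oplus> b \<otimes> v\<close> equals
  \<open>u \<otimes> (a \<oplus> b \<otimes> z)\<close>.\<close>

lemma coefficients_M: "s \<in> adj.S n \<Longrightarrow> (\<exists>r. s = psum r z n \<and> (\<forall>i. r i \<in> A) \<and> (\<forall>i<n. r i \<in> M)) \<Longrightarrow> \<exists>h\<in>adj.B. s = u \<otimes> h"
proof -
  assume "\<exists>r. s = psum r z n \<and> (\<forall>i. r i \<in> A) \<and> (\<forall>i<n. r i \<in> M)"
  then obtain r where r: "s = psum r z n" "\<And>i. r i \<in> A" "\<And>i. i < n \<Longrightarrow> r i \<in> M" by blast
  have "\<exists>h\<in>adj.B. psum r z n = u \<otimes> h" using r(3)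
  proof (induction n)
    case 0 then show ?case using u B_cl(2) by (auto intro!: bexI[of _ \<zero>])
  next
    case (Suc n)
    then obtain h where h: "h \<in> adj.B" "psum r z n = u \<otimes> h" by auto
    obtain a b where ab: "a \<in> A" "b \<in> A" "r n = a \<otimes> u \<oplus> b \<otimes> v" using generate[OF r(2) Suc.prems[of n]] by auto
    have zn: "z [^] n \<in> carrier K" "u \<in> carrier K" using u by auto
    have "psum r z (Suc n) = u \<otimes> (h \<oplus> (a \<oplus> b \<otimes> z) \<otimes> z [^] n)"
      unfolding psum.simps h(2) ab(3) uz[symmetric]
      using B_carrier[OF h(1)] A_carrier[OF ab(1)] A_carrier[OF ab(2)] zn z_carrier by algebra
    moreover have "h \<oplus> (a \<oplus> b \<otimes> z) \<otimes> z [^] n \<in> adj.B"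
      using h(1) ab by simp
    ultimately show ?case by blast
  qed
  then show ?thesis using r(1) by simp
qed

text \<open>Leading terms with coefficient in the maximal ideal are moved into
  \<open>u A[z]\<close>. As \<open>b\<close> itself is not in \<open>M\<close>, a unit coefficient
  must remain.\<close>

lemma unit_mod_u:
  assumes "b \<in> adj.S n" "b \<notin> M"
  shows "\<exists>N. \<exists>e\<in>A. \<exists>m\<in>adj.S N. \<exists>h\<in>adj.B. e \<notin> M \<and> b = (m \<oplus> e \<otimes> z [^] N) \<oplus> u \<otimes> h"
  using assms
proof (induction n arbitrary: b)
  case 0 then show ?case by (simp add: adj.S_zero_iff)
next
  case (Suc n)
  then obtain a s where as: "a \<in> A" "s \<in> adj.S n" "b = s \<oplus> a \<otimes> z [^] n" by (auto simp: adj.S_Suc_iff)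
  have zn: "z [^] n \<in> carrier K" "u \<in> carrier K" "s \<in> carrier K" using u as by auto
  show ?case
  proof (cases "a \<in> M")
    case False
    have "b = (s \<oplus> a \<otimes> z [^] n) \<oplus> u \<otimes> \<zero>" unfolding as(3) using as zn by simp
    then show ?thesis using as False B_cl(2) by blast
  next
    case True
    then obtain p q where pq: "p \<in> A" "q \<in> A" "a = p \<otimes> u \<oplus> q \<otimes> v" using generate as by blast
    define h where "h = (p \<oplus> q \<otimes> z) \<otimes> z [^] n"
    have hB: "h \<in> adj.B"
      unfolding h_def using pq by simp
    have bs: "b = s \<oplus> u \<otimes> h" unfolding as(3) pq(3) h_def uz[symmetric]
      using A_carrier[OF pq(1)] A_carrier[OF pq(2)] zn z_carrier by algebra
    have "u \<otimes> h \<in> M" using u hB B_V by (auto intro: M_mult)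
    then have "s \<notin> M" using Suc.prems(2) bs by auto
    from Suc.IH[OF as(2) this] obtain N e m h' where
      *: "e \<in> A" "m \<in> adj.S N" "h' \<in> adj.B" "e \<notin> M" "s = (m \<oplus> e \<otimes> z [^] N) \<oplus> u \<otimes> h'" by blast
    have "b = (m \<oplus> e \<otimes> z [^] N) \<oplus> u \<otimes> (h' \<oplus> h)"
      unfolding bs *(5) using * adj.S_car[OF *(2)] B_carrier[OF *(3)] B_carrier[OF hB] zn
      by (simp add: r_distr a_assoc)
    then show ?thesis using * B_cl(7)[OF *(3) hB] by blast
  qed
qed

lemma monic_pow: "\<exists>m\<in>adj.S (d * k). g [^] k = m \<oplus> z [^] (d * k)"
proof (induction k)
  case 0
  then show ?case by (auto intro!: bexI[of _ \<zero>])
next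
  case (Suc k)
  then obtain m where m: "m \<in> adj.S (d * k)" "g [^] k = m \<oplus> z [^] (d * k)" by blast
  have p: "psum c z d \<in> adj.S d" using c by (auto simp: poly_span_def)
  define m' where "m' = (m \<otimes> z [^] d \<oplus> m \<otimes> psum c z d) \<oplus> z [^] (d * k) \<otimes> psum c z d"
  have car: "m \<in> carrier K" "psum c z d \<in> carrier K" "z [^] d \<in> carrier K" "z [^] (d * k) \<in> carrier K"
    using adj.S_car[OF m(1)] adj.S_car[OF p] by auto
  have zm: "z [^] d \<otimes> m \<in> adj.S (d + d * k)" by (rule adj.S_zpow[OF m(1)])
  have "z [^] (d * k) \<otimes> psum c z d \<in> adj.S (d * k + d)" by (rule adj.S_zpow[OF p])
  moreover have "m \<otimes> psum c z d \<in> adj.S (d * k + d)" by (rule adj.S_mult[OF m(1) p])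
  ultimately have m'S: "m' \<in> adj.S (d * Suc k)"
    unfolding m'_def using zm car by (intro adj.S_add) (auto simp: m_comm add.commute)
  have "g [^] Suc k = (m \<oplus> z [^] (d * k)) \<otimes> (z [^] d \<oplus> psum c z d)" using m(2) g_def by simp
  also have "\<dots> = m' \<oplus> z [^] (d * k) \<otimes> z [^] d" unfolding m'_def using car by algebra
  also have "z [^] (d * k) \<otimes> z [^] d = z [^] (d * Suc k)" by (simp add: nat_pow_mult add.commute)
  finally show ?case using m'S by blast
qed

lemma gB: "g \<in> adj.B"
proof -
  have "psum c z d \<in> adj.B" using c by (intro adj.S_B[of _ d]) (auto simp: poly_span_def)
  then show ?thesis unfolding g_def using adj.S_B[OF adj.S_pow[of d]] B_cl(7) by simp
qed

text \<open>Euclidean division works because \<open>g\<close> is monic: a top term of degree at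
  least \<open>d\<close> is cancelled by a multiple of \<open>g\<close>.\<close>

lemma division: "s \<in> adj.S n \<Longrightarrow> \<exists>r\<in>adj.S d. \<exists>q\<in>adj.B. s = r \<oplus> g \<otimes> q"
proof (induction n arbitrary: s rule: less_induct)
  case (less n)
  show ?case
  proof (cases "n \<le> d")
    case True
    then have "s \<in> adj.S d" using adj.S_mono less.prems by blast
    moreover have "s = s \<oplus> g \<otimes> \<zero>" using adj.S_car[OF less.prems] B_carrier[OF gB] by simp
    ultimately show ?thesis using B_cl(2) by blast
  next
    case False
    then obtain n' where n': "n = Suc n'" "d \<le> n'" by (cases n) auto
    then obtain a t where t: "a \<in> A" "t \<in> adj.S n'" "s = t \<oplus> a \<otimes> z [^] n'" using less.prems by (auto simp: adj.S_Suc_iff)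
    have p: "psum c z d \<in> adj.S d" using c by (auto simp: poly_span_def)
    define y where "y = z [^] (n' - d)"
    have yB: "y \<in> adj.B" unfolding y_def by (rule adj.S_B[OF adj.S_pow])
    have "y \<otimes> psum c z d \<in> adj.S n'" unfolding y_def using adj.S_zpow[OF p, of "n' - d"] n' by simp
    then have t': "t \<ominus> a \<otimes> (y \<otimes> psum c z d) \<in> adj.S n'" using adj.S_minus[OF t(2) adj.S_smult[OF t(1)]] by blast
    then obtain r q where rq: "r \<in> adj.S d" "q \<in> adj.B" "t \<ominus> a \<otimes> (y \<otimes> psum c z d) = r \<oplus> g \<otimes> q"
      using less.IH[of n'] n' by blast
    have zn: "z [^] n' = y \<otimes> z [^] d" unfolding y_def using n' by (simp add: nat_pow_mult)
    have car: "t \<in> carrier K" "a \<in> carrier K" "y \<in> carrier K" "psum c z d \<in> carrier K" "z [^] d \<in> carrier K"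
      "r \<in> carrier K" "q \<in> carrier K" "g \<in> carrier K"
      using adj.S_car[OF t(2)] t(1) yB adj.S_car[OF p] adj.S_car[OF rq(1)] rq(2) gB by auto
    have "s = (t \<ominus> a \<otimes> (y \<otimes> psum c z d)) \<oplus> (z [^] d \<oplus> psum c z d) \<otimes> (a \<otimes> y)"
      unfolding t(3) zn using car by algebra
    also have "\<dots> = r \<oplus> g \<otimes> (q \<oplus> a \<otimes> y)"
      unfolding rq(3) g_def[symmetric] using car by algebra
    finally have "s = r \<oplus> g \<otimes> (q \<oplus> a \<otimes> y)" .
    moreover have "q \<oplus> a \<otimes> y \<in> adj.B" using rq(2) yB t(1) adj.A_B B_cl(6,7) by auto
    ultimately show ?thesis using rq(1) by blast
  qed
qed

text \<open>For generation, the numerator is divided by \<open>g\<close>; the remainder lies in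
  \<open>M\<close>, so by minimality its coefficients do, and it is a multiple of \<open>u\<close>.
  For the second condition, \<open>g^k = u \<otimes> f\<close> would become, after clearing a
  denominator with unit leading coefficient modulo \<open>u\<close>, a polynomial with unit leading
  coefficient divisible by \<open>u\<close>.\<close>

lemma blowup_regular: "regular_surface K \<nu> (blowup A z) u g"
proof -
  interpret C: dominated_ring K \<nu> "blowup A z" by (rule blowup_dominated)
  have uc: "u \<in> carrier K" "g \<in> carrier K" using u gB by auto
  show ?thesis
  proof (intro regular_surface.intro two_generated.intro two_generated_axioms.intro regular_surface_axioms.intro C.dominated_ring_axioms)
    show "u \<in> blowup A z" "g \<in> blowup A z" using B_blowup u_B gB by auto
    show "u \<in> M" "g \<in> M" "u \<noteq> \<zero>" using u gM u_nonzero by auto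
    fix f assume f: "f \<in> blowup A z" "f \<in> M"
    then obtain a b where ab: "a \<in> adj.B" "b \<in> adj.B" "b \<notin> M" "f = a \<otimes> inv b" by (auto simp: blowup_iff)
    have bc: "b \<in> carrier K" "b \<noteq> \<zero>" "a \<in> carrier K" "b \<in> V" using ab B_V by auto
    have ib: "inv b \<in> blowup A z" using C.unit[of b] B_blowup ab by auto
    have "a = f \<otimes> b" unfolding ab(4) using bc by simp
    then have aM: "a \<in> M" using f(2) bc by simp
    obtain n where "a \<in> adj.S n" using ab(1) by (auto simp: adj.B_def)
    then obtain r q where rq: "r \<in> adj.S d" "q \<in> adj.B" "a = r \<oplus> g \<otimes> q" using division by blast
    have rqc: "r \<in> carrier K" "q \<in> carrier K" using adj.S_car[OF rq(1)] rq(2) by auto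
    have gq: "g \<otimes> q \<in> M" using gM rq(2) B_V by auto
    then have "a \<oplus> \<ominus> (g \<otimes> q) \<in> M" using aM by simp
    moreover have "a \<oplus> \<ominus> (g \<otimes> q) = r" unfolding rq(3) using rqc uc by algebra
    ultimately have rM: "r \<in> M" by simp
    obtain cr where cr: "\<And>i. cr i \<in> A" "r = psum cr z d" using rq(1) by (auto simp: poly_span_def)
    have "\<And>i. i < d \<Longrightarrow> cr i \<in> M" using minimal[of cr] cr rM by simp
    then obtain h where h: "h \<in> adj.B" "r = u \<otimes> h" using coefficients_M[OF rq(1)] cr by blast
    have ibc: "inv b \<in> carrier K" using bc by simp
    have "f = (h \<otimes> inv b) \<otimes> u \<oplus> (q \<otimes> inv b) \<otimes> g"
      unfolding ab(4) rq(3) h(2) using B_carrier[OF h(1)] rqc uc ibc by algebra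
    moreover have "h \<otimes> inv b \<in> blowup A z" "q \<otimes> inv b \<in> blowup A z" using h(1) rq(2) ib B_blowup by auto
    ultimately show "\<exists>a\<in>blowup A z. \<exists>b\<in>blowup A z. f = a \<otimes> u \<oplus> b \<otimes> g" by blast
  next
    fix k :: nat and f assume "f \<in> blowup A z"
    then obtain a b where ab: "a \<in> adj.B" "b \<in> adj.B" "b \<notin> M" "f = a \<otimes> inv b" by (auto simp: blowup_iff)
    have bc: "b \<in> carrier K" "b \<noteq> \<zero>" "a \<in> carrier K" using ab B_V by auto
    show "g [^] k \<noteq> u \<otimes> f"
    proof
      assume eq: "g [^] k = u \<otimes> f"
      obtain m where m: "m \<in> adj.S (d * k)" "g [^] k = m \<oplus> z [^] (d * k)" using monic_pow by blast
      obtain n where "b \<in> adj.S n" using ab(2) by (auto simp: adj.B_def)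
      then obtain N e m' h where b: "e \<in> A" "m' \<in> adj.S N" "h \<in> adj.B" "e \<notin> M"
        "b = (m' \<oplus> e \<otimes> z [^] N) \<oplus> u \<otimes> h" using unit_mod_u ab(3) by blast
      have gb: "g [^] k \<otimes> b = u \<otimes> a" unfolding eq ab(4) using bc uc by (simp add: m_assoc)
      \<comment> \<open>The part of degree below \<open>d * k + N\<close> of the product of
        \<open>g^k\<close> with \<open>m' \<oplus> e \<otimes> z^N\<close>, whose leading
        coefficient is \<open>e\<close>.\<close>
      define m'' where "m'' = (z [^] N \<otimes> (e \<otimes> m) \<oplus> m \<otimes> m') \<oplus> z [^] (d * k) \<otimes> m'"
      have car: "m \<in> carrier K" "m' \<in> carrier K" "h \<in> carrier K" "e \<in> carrier K" "z [^] N \<in> carrier K"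
        "z [^] (d * k) \<in> carrier K" "g [^] k \<in> carrier K"
        using adj.S_car[OF m(1)] adj.S_car[OF b(2)] b uc by auto
      have "g [^] k \<otimes> b = g [^] k \<otimes> (m' \<oplus> e \<otimes> z [^] N) \<oplus> u \<otimes> (g [^] k \<otimes> h)"
        unfolding b(5) using car uc by algebra
      also have "g [^] k \<otimes> (m' \<oplus> e \<otimes> z [^] N) = m'' \<oplus> e \<otimes> (z [^] (d * k) \<otimes> z [^] N)"
        unfolding m(2) m''_def using car by algebra
      finally have gb': "g [^] k \<otimes> b = (m'' \<oplus> e \<otimes> z [^] (d * k + N)) \<oplus> u \<otimes> (g [^] k \<otimes> h)"
        by (simp add: nat_pow_mult)
      have eq': "(m'' \<oplus> e \<otimes> z [^] (d * k + N)) \<oplus> u \<otimes> (g [^] k \<otimes> h) = u \<otimes> a" using gb gb' by simp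
      have m''S: "m'' \<in> adj.S (d * k + N)" unfolding m''_def
        using adj.S_zpow[OF adj.S_smult[OF b(1) m(1)], of N] adj.S_mult[OF m(1) b(2)] adj.S_zpow[OF b(2), of "d * k"]
        by (intro adj.S_add) (auto simp: add.commute)
      have m''c: "m'' \<in> carrier K" "z [^] (d * k + N) \<in> carrier K" using adj.S_car[OF m''S] by auto
      have "m'' \<oplus> e \<otimes> z [^] (d * k + N) = ((m'' \<oplus> e \<otimes> z [^] (d * k + N)) \<oplus> u \<otimes> (g [^] k \<otimes> h)) \<ominus> u \<otimes> (g [^] k \<otimes> h)"
        using m''c car uc by algebra
      also have "\<dots> = u \<otimes> (a \<ominus> g [^] k \<otimes> h)" unfolding eq' using bc car uc by algebra
      finally have "m'' \<oplus> e \<otimes> z [^] (d * k + N) = u \<otimes> (a \<ominus> g [^] k \<otimes> h)" .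
      moreover have "g [^] k \<in> adj.B" using gB B_cl(3,6) by (induction k) auto
      then have "a \<ominus> g [^] k \<otimes> h \<in> adj.B" using ab(1) b(3) B_cl(5,6,7) by (auto simp: minus_eq)
      ultimately show False using monic_not_divisible[OF b(1,4) m''S] by blast
    qed
  qed
qed

end

section \<open>Value groups and minimal polynomials\<close>

lemma group_closure_nsm: "g \<in> group_closure S \<Longrightarrow> nsm n g \<in> group_closure S"
  by (induction n) (auto intro: group_closure_add)

lemma group_closure_least:
  assumes "S \<subseteq> group_closure T" shows "group_closure S \<subseteq> group_closure T"
proof
  fix g assume "g \<in> group_closure S"
  then show "g \<in> group_closure T"
    by (induction g rule: group_closure.induct) (use assms in \<open>auto intro: group_closure.diff\<close>)
qed

text \<open>An integer multiple of \<open>b\<close> appears as a difference of two natural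
  multiples.\<close>

lemma group_closure_insert:
  "g \<in> group_closure (insert b S) \<longleftrightarrow> (\<exists>h\<in>group_closure S. \<exists>k j. g = h + nsm k b - nsm j b)"
proof
  assume "g \<in> group_closure (insert b S)"
  then show "\<exists>h\<in>group_closure S. \<exists>k j. g = h + nsm k b - nsm j b"
  proof (induction g rule: group_closure.induct)
    case (base s)
    then consider "s = b" | "s \<in> insert 0 S" by auto
    then show ?case
    proof cases
      case 1
      then have "s = 0 + nsm 1 b - nsm 0 b" by simp
      then show ?thesis using zero_in_group_closure by blast
    next
      case 2
      then have "s \<in> group_closure S" "s = s + nsm 0 b - nsm 0 b" by (auto intro: group_closure.base)
      then show ?thesis by blast
    qed
  next
    case (diff s t)
    then obtain h k j h' k' j' where *: "h \<in> group_closure S" "s = h + nsm k b - nsm j b"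
      "h' \<in> group_closure S" "t = h' + nsm k' b - nsm j' b" by blast
    have "s - t = (h - h') + nsm (k + j') b - nsm (j + k') b"
      unfolding *(2,4) nsm_add by (simp add: algebra_simps)
    then show ?case using group_closure.diff[OF *(1,3)] by blast
  qed
next
  assume "\<exists>h\<in>group_closure S. \<exists>k j. g = h + nsm k b - nsm j b"
  then obtain h k j where *: "h \<in> group_closure S" "g = h + nsm k b - nsm j b" by blast
  have "S \<subseteq> group_closure (insert b S)" by (intro subsetI group_closure.base) simp
  from group_closure_least[OF this] have "h \<in> group_closure (insert b S)" using *(1) by blast
  moreover have "b \<in> group_closure (insert b S)" by (auto intro: group_closure.base)
  ultimately show "g \<in> group_closure (insert b S)"
    unfolding *(2) by (intro group_closure.diff group_closure_add group_closure_nsm)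
qed

lemma coset_eq_iff:
  "(+) g ` group_closure S = (+) g' ` group_closure S \<longleftrightarrow> g - g' \<in> group_closure S"
proof
  assume eq: "(+) g ` group_closure S = (+) g' ` group_closure S"
  have "g + 0 \<in> (+) g ` group_closure S" by (rule imageI) simp
  then obtain h where "h \<in> group_closure S" "g = g' + h" unfolding eq by auto
  then show "g - g' \<in> group_closure S" by simp
next
  have *: "(+) a ` group_closure S \<subseteq> (+) b ` group_closure S" if "a - b \<in> group_closure S" for a b
  proof
    fix x assume "x \<in> (+) a ` group_closure S"
    then obtain h where "h \<in> group_closure S" "x = a + h" by auto
    then have "x = b + ((a - b) + h)" "(a - b) + h \<in> group_closure S" using that group_closure_add by auto
    then show "x \<in> (+) b ` group_closure S" by blast
  qed
  assume "g - g' \<in> group_closure S"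
  moreover from this have "g' - g \<in> group_closure S" using group_closure_minus_iff[of "g - g'" S] by simp
  ultimately show "(+) g ` group_closure S = (+) g' ` group_closure S" using * by blast
qed

text \<open>The quotient group is cyclic, generated by the class of \<open>b\<close>. Its order is
  the least positive \<open>m0\<close> for which \<open>nsm m0 b\<close> lies in the subgroup, and
  this \<open>m0\<close> is compared with the number of cosets.\<close>

lemma group_index_insert:
  assumes fin: "group_index (group_closure (insert b S)) (group_closure S) \<noteq> \<infinity>"
  defines "m \<equiv> the_enat (group_index (group_closure (insert b S)) (group_closure S))"
  shows "0 < m" "nsm m b \<in> group_closure S" "nsm k b \<in> group_closure S \<Longrightarrow> m dvd k"
proof -
  define H where "H = group_closure S"
  define C where "C = (\<lambda>g. (+) g ` H) ` group_closure (insert b S)"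
  have C: "finite C" "m = card C"
    using fin unfolding m_def group_index_def C_def[unfolded H_def] Let_def by (auto split: if_splits)
  have bG: "nsm k b \<in> group_closure (insert b S)" for k
    by (intro group_closure_nsm group_closure.base) simp
  have eq_iff: "(+) (nsm i b) ` H = (+) (nsm j b) ` H \<longleftrightarrow> nsm (j - i) b \<in> H" if "i \<le> j" for i j
    unfolding H_def coset_eq_iff using group_closure_minus_iff[of "nsm i b - nsm j b" S] nsm_diff[OF that, of b] by simp
  have "\<exists>k>0. nsm k b \<in> H"
  proof -
    have "range (\<lambda>k. (+) (nsm k b) ` H) \<subseteq> C" unfolding C_def using bG by blast
    then have "\<not> inj (\<lambda>k. (+) (nsm k b) ` H)" using C(1) finite_subset range_inj_infinite by blast
    then obtain i j where "i < j" "(+) (nsm i b) ` H = (+) (nsm j b) ` H"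
      unfolding inj_def by (metis linorder_neqE_nat)
    then show ?thesis using eq_iff[of i j] by (intro exI[of _ "j - i"]) simp
  qed
  then obtain m0 where m0: "0 < m0" "nsm m0 b \<in> H" and least: "\<And>k. 0 < k \<Longrightarrow> nsm k b \<in> H \<Longrightarrow> m0 \<le> k"
    using LeastI_ex[of "\<lambda>k. 0 < k \<and> nsm k b \<in> H"] Least_le[of "\<lambda>k. 0 < k \<and> nsm k b \<in> H"] by blast
  have mult: "nsm (m0 * q) b \<in> H" for q
    unfolding mult.commute[of m0 q] nsm_mult unfolding H_def
    by (rule group_closure_nsm) (use m0(2) in \<open>simp add: H_def\<close>)
  have dvd: "m0 dvd k" if "nsm k b \<in> H" for k
  proof -
    have "nsm k b = nsm (m0 * (k div m0)) b + nsm (k mod m0) b"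
      unfolding nsm_add[symmetric] by simp
    then have "nsm (k mod m0) b = nsm k b - nsm (m0 * (k div m0)) b" by simp
    then have "nsm (k mod m0) b \<in> H"
      using that mult[of "k div m0"] unfolding H_def by (simp add: group_closure.diff)
    then have "k mod m0 = 0" using least[of "k mod m0"] m0(1) by (metis bot_nat_0.not_eq_extremum mod_less_divisor not_le)
    then show ?thesis by auto
  qed
  have "C = (\<lambda>k. (+) (nsm k b) ` H) ` {..<m0}"
  proof
    show "(\<lambda>k. (+) (nsm k b) ` H) ` {..<m0} \<subseteq> C" unfolding C_def using bG by blast
    show "C \<subseteq> (\<lambda>k. (+) (nsm k b) ` H) ` {..<m0}"
    proof
      fix D assume "D \<in> C"
      then obtain g where g: "g \<in> group_closure (insert b S)" "D = (+) g ` H" by (auto simp: C_def)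
      then obtain h k j where h: "h \<in> H" "g = h + nsm k b - nsm j b" unfolding group_closure_insert H_def by blast
      \<comment> \<open>A natural number congruent to \<open>k - j\<close> modulo
        \<open>m0\<close>.\<close>
      define l where "l = k + (m0 - 1) * j"
      have "nsm l b = nsm k b - nsm j b + nsm (m0 * j) b"
        unfolding l_def nsm_add using m0(1) by (cases m0) (simp_all add: nsm_add algebra_simps)
      moreover have "nsm l b = nsm (m0 * (l div m0)) b + nsm (l mod m0) b" unfolding nsm_add[symmetric] by simp
      ultimately have "g - nsm (l mod m0) b = (h + nsm (m0 * (l div m0)) b) - nsm (m0 * j) b"
        unfolding h(2) by (simp add: algebra_simps)
      also have "\<dots> \<in> H" using h(1) mult unfolding H_def by (intro group_closure.diff group_closure_add)
      finally have "D = (+) (nsm (l mod m0) b) ` H" unfolding g(2) H_def coset_eq_iff .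
      then show "D \<in> (\<lambda>k. (+) (nsm k b) ` H) ` {..<m0}" using m0(1) by auto
    qed
  qed
  moreover have "inj_on (\<lambda>k. (+) (nsm k b) ` H) {..<m0}"
  proof (rule linorder_inj_onI)
    fix i j assume "i < j" "i \<in> {..<m0}" "j \<in> {..<m0}"
    then show "(+) (nsm i b) ` H \<noteq> (+) (nsm j b) ` H" using eq_iff[of i j] least[of "j - i"] by auto
  qed auto
  ultimately have "m = m0" unfolding C(2) by (simp add: card_image)
  then show "0 < m" "nsm m b \<in> group_closure S" "nsm k b \<in> group_closure S \<Longrightarrow> m dvd k"
    using m0 dvd unfolding H_def by auto
qed

lemma value_index_finite:
  assumes "value_index \<nu> Q i \<noteq> \<infinity>"
  defines "m \<equiv> the_enat (value_index \<nu> Q i)"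
  shows "0 < m" "nsm m (\<nu> (Q i)) \<in> group_closure ((\<lambda>k. \<nu> (Q k)) ` {..<i})"
    "nsm k (\<nu> (Q i)) \<in> group_closure ((\<lambda>k. \<nu> (Q k)) ` {..<i}) \<Longrightarrow> m dvd k"
proof -
  have "(\<lambda>k. \<nu> (Q k)) ` {..i} = insert (\<nu> (Q i)) ((\<lambda>k. \<nu> (Q k)) ` {..<i})"
    by (simp add: lessThan_Suc lessThan_Suc_atMost[symmetric])
  then show "0 < m" "nsm m (\<nu> (Q i)) \<in> group_closure ((\<lambda>k. \<nu> (Q k)) ` {..<i})"
    "nsm k (\<nu> (Q i)) \<in> group_closure ((\<lambda>k. \<nu> (Q k)) ` {..<i}) \<Longrightarrow> m dvd k"
    using group_index_insert[of "\<nu> (Q i)" "(\<lambda>k. \<nu> (Q k)) ` {..<i}"] assms unfolding value_index_def by auto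
qed

section \<open>Minimal polynomials as linear relations between powers\<close>

context field
begin

lemma eval_map_rev:
  assumes "\<And>i. i < d \<Longrightarrow> b i \<in> carrier R" "x \<in> carrier R"
  shows "eval (map b (rev [0..<d])) x = psum b x d"
  using assms(1)
proof (induction d)
  case (Suc d)
  have "psum b x d \<in> carrier R"
    using Suc.prems assms(2) psum_closed[of "\<lambda>i. if i < d then b i else \<zero>" x d] psum_cong[of d "\<lambda>i. if i < d then b i else \<zero>" b x]
    by (simp add: less_Suc_eq)
  then show ?case using Suc assms(2) by (simp add: a_comm)
qed simp

text \<open>Minimal polynomials are used only through these facts of linear algebra and through the
  converse \<open>has_minimal_polynomialI\<close>.\<close>

lemma minimal_polynomial_props:
  assumes F: "subfield F R" and x: "x \<in> carrier R" and mp: "has_minimal_polynomial R F x d b"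
  shows "0 < d" "\<And>t. t < d \<Longrightarrow> b t \<in> F" "x [^] d \<oplus> psum b x d = \<zero>"
    "\<And>c. (\<And>t. c t \<in> F) \<Longrightarrow> psum c x d = \<zero> \<Longrightarrow> \<forall>t<d. c t = \<zero>"
proof -
  have alg: "(algebraic over F) x" and Irr: "Irr F x = \<one> # map b (rev [0..<d])"
    using mp by (auto simp: has_minimal_polynomial_def over_def)
  note I = IrrE[OF F x alg]
  note FR = subfieldE(3)[OF F]
  have "set (Irr F x) \<subseteq> F" using I(1) polynomial_incl by (simp add: univ_poly_carrier)
  then show bF: "\<And>t. t < d \<Longrightarrow> b t \<in> F" unfolding Irr by auto
  have "eval (Irr F x) x = x [^] d \<oplus> psum b x d"
    unfolding Irr using bF FR x by (simp add: eval_map_rev subset_iff)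
  then show eq: "x [^] d \<oplus> psum b x d = \<zero>" using I(4) by simp
  show "0 < d" using eq by (cases d) auto
  fix c assume c: "\<And>t. c t \<in> F" "psum c x d = \<zero>"
  let ?Ks = "map c (rev [0..<d])"
  have ind: "independent F (exp_base x d)" using exp_base_independent[OF F x alg] unfolding Irr by simp
  have "combine ?Ks (exp_base x d) = eval ?Ks x" using combine_eq_eval[of ?Ks x] by simp
  also have "\<dots> = \<zero>" using c FR x by (simp add: eval_map_rev subset_iff)
  finally have "set (take (length (exp_base x d)) ?Ks) \<subseteq> {\<zero>}"
    using independent_imp_trivial_combine[OF F ind, of ?Ks] c(1) by auto
  then have "set ?Ks \<subseteq> {\<zero>}" by (simp add: exp_base_def)
  then show "\<forall>t<d. c t = \<zero>" by (simp add: image_subset_iff)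
qed

text \<open>The minimal polynomial divides the given monic relation, so its degree is at most
  \<open>d\<close>; a smaller degree would contradict the independence of the lower powers. Two
  monic relations of degree \<open>d\<close> differ by a relation between these powers, so they
  coincide.\<close>

lemma has_minimal_polynomialI:
  assumes F: "subfield F R" and x: "x \<in> carrier R" and b: "\<And>t. b t \<in> F"
    and eq: "x [^] d \<oplus> psum b x d = \<zero>"
    and ind: "\<And>c. (\<And>t. c t \<in> F) \<Longrightarrow> psum c x d = \<zero> \<Longrightarrow> \<forall>t<d. c t = \<zero>"
  shows "has_minimal_polynomial R F x d b"
proof -
  note FR = subfieldE(3)[OF F]
  note Fr = subringE[OF subfieldE(1)[OF F]]
  let ?p = "\<one> # map b (rev [0..<d])"
  have p: "?p \<in> carrier (F[X])" unfolding univ_poly_carrier[symmetric] polynomial_def using b Fr(3) by auto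
  have ep: "eval ?p x = \<zero>" using eq b FR x by (simp add: eval_map_rev subset_iff)
  have alg: "(algebraic over F) x" by (rule algebraicI[OF p _ ep]) simp
  note I = IrrE[OF F x alg]
  define q where "q = Irr F x"
  \<comment> \<open>Coefficients in ascending order, whereas the list \<open>q\<close> starts with
    the leading one.\<close>
  define cq where "cq i = (if i < length q then rev q ! i else \<zero>)" for i
  have q: "q \<in> carrier (F[X])" "lead_coeff q = \<one>" "eval q x = \<zero>" using I by (auto simp: q_def)
  have qn: "q \<noteq> []" using I(1,2) pirreducibleE(1)[OF subfieldE(1)[OF F]] unfolding q_def by auto
  have setq: "set q \<subseteq> F" using q(1) polynomial_incl by (simp add: univ_poly_carrier)
  have cqF: "cq i \<in> F" for i using setq Fr(2) unfolding cq_def by (metis length_rev nth_mem set_rev subsetD)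
  have cqc: "cq i \<in> carrier R" for i using cqF FR by blast
  have bc: "b i \<in> carrier R" for i using b FR by blast
  have cq0: "length q \<le> i \<Longrightarrow> cq i = \<zero>" for i by (simp add: cq_def)
  have qmap: "q = map cq (rev [0..<length q])"
    by (rule nth_equalityI) (auto simp: cq_def rev_nth)
  have "eval (map cq (rev [0..<length q])) x = psum cq x (length q)"
    using cqF FR x by (intro eval_map_rev) auto
  then have zero: "psum cq x (length q) = \<zero>" using q(3) qmap by simp
  have lead: "cq (length q - 1) = \<one>"
    using q(2) qn by (auto simp: cq_def rev_nth hd_conv_nth)
  have "?p \<noteq> []" by simp
  have "degree q \<le> degree ?p"
    using pdivides_imp_degree_le[OF subfieldE(1)[OF F] q(1) p _ Irr_minimal[OF F x alg p ep, folded q_def]] by simp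
  then have le: "length q \<le> Suc d" by simp
  have "length q = Suc d"
  proof (rule ccontr)
    assume "length q \<noteq> Suc d"
    then have "length q \<le> d" using le by simp
    then have "psum cq x d = psum cq x (length q)" using cqc cq0 x by (intro psum_extend) auto
    then have "\<forall>t<d. cq t = \<zero>" using ind[OF cqF] zero by simp
    then show False using lead qn \<open>length q \<le> d\<close> by (cases q) auto
  qed
  then have len: "length q = Suc d" and cqd: "cq d = \<one>" using lead by auto
  have car: "psum cq x d \<in> carrier R" "psum b x d \<in> carrier R" "x [^] d \<in> carrier R"
    using cqc bc x by auto
  have "psum cq x d \<oplus> x [^] d = \<zero>" using zero cqd car unfolding len by simp
  then have "psum cq x d = psum b x d" using eq car by (metis a_comm add.r_cancel)
  have cbF: "cq i \<oplus> \<ominus> \<one> \<otimes> b i \<in> F" for i by (intro Fr(3,5,6,7) cqF b)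
  have "psum cq x d \<oplus> \<ominus> \<one> \<otimes> psum b x d = \<zero>" using \<open>psum cq x d = psum b x d\<close> car by (simp add: l_minus r_neg)
  moreover have "\<ominus> \<one> \<otimes> psum b x d = psum (\<lambda>i. \<ominus> \<one> \<otimes> b i) x d"
    using bc x by (intro psum_smult) auto
  moreover have "psum cq x d \<oplus> psum (\<lambda>i. \<ominus> \<one> \<otimes> b i) x d = psum (\<lambda>i. cq i \<oplus> \<ominus> \<one> \<otimes> b i) x d"
    using cqc bc x by (intro psum_add) auto
  ultimately have "\<forall>t<d. cq t \<oplus> \<ominus> \<one> \<otimes> b t = \<zero>"
    using ind[OF cbF] car by (simp add: l_minus r_neg)
  then have cz: "cq t \<oplus> \<ominus> \<one> \<otimes> b t = \<zero>" if "t < d" for t using that by blast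
  have "cq t = b t" if "t < d" for t
    using sum_zero_eq_neg[OF _ _ cz[OF that]] cqc[of t] bc[of t] by (simp add: l_minus)
  moreover have "q = map cq (rev [0..<Suc d])" using qmap len by simp
  ultimately have "q = ?p" using cqd by simp
  then show ?thesis using alg unfolding has_minimal_polynomial_def q_def over_def by simp
qed

text \<open>The relation for \<open>x\<close> is multiplied by \<open>y^d\<close> and each power
  \<open>x^t\<close> absorbs \<open>y^t\<close>. This is how a change of \<alpha>_i by a power of
  \<alpha>_1 acts on its minimal polynomial.\<close>

lemma minimal_polynomial_scale:
  assumes F: "subfield F R" and x: "x \<in> carrier R" and mp: "has_minimal_polynomial R F x d b"
    and y: "y \<in> F" "y \<noteq> \<zero>" and b': "\<And>t. t < d \<Longrightarrow> b' t = y [^] (d - t) \<otimes> b t"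
  shows "has_minimal_polynomial R F (y \<otimes> x) d b'"
proof -
  note P = minimal_polynomial_props[OF F x mp]
  note FR = subfieldE(3)[OF F]
  note Fr = subringE[OF subfieldE(1)[OF F]]
  have pow: "y [^] (n :: nat) \<in> F" for n by (induction n) (use Fr y in auto)
  \<comment> \<open>The coefficients are known to lie in \<open>F\<close> only below
    \<open>d\<close>; zeros continue them to all indices.\<close>
  define b0 where "b0 t = (if t < d then b t else \<zero>)" for t
  define b1 where "b1 t = (if t < d then b' t else \<zero>)" for t
  have b0F: "b0 t \<in> F" and b1F: "b1 t \<in> F" for t
    using P(2) Fr(2,6) b' pow by (auto simp: b0_def b1_def)
  have yc: "y \<in> carrier R" using y FR by auto
  have b0c: "b0 t \<in> carrier R" and b1c: "b1 t \<in> carrier R" for t using b0F b1F FR by auto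
  have "has_minimal_polynomial R F (y \<otimes> x) d b1"
  proof (rule has_minimal_polynomialI[OF F _ b1F])
    show "y \<otimes> x \<in> carrier R" using yc x by simp
    have "psum b1 (y \<otimes> x) d = psum (\<lambda>i. y [^] i \<otimes> b1 i) x d" using b1c x yc by (simp add: psum_pow)
    also have "\<dots> = psum (\<lambda>i. y [^] d \<otimes> b0 i) x d"
    proof (rule psum_cong)
      fix i assume i: "i < d"
      then have bi: "b i \<in> carrier R" using P(2) FR by auto
      have "y [^] i \<otimes> (y [^] (d - i) \<otimes> b i) = (y [^] i \<otimes> y [^] (d - i)) \<otimes> b i"
        using yc bi by (simp add: m_assoc)
      then show "y [^] i \<otimes> b1 i = y [^] d \<otimes> b0 i"
        using i b'[of i] yc by (simp add: b1_def b0_def nat_pow_mult)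
    qed
    also have "\<dots> = y [^] d \<otimes> psum b0 x d" using b0c x yc by (intro psum_smult[symmetric]) auto
    also have "psum b0 x d = psum b x d" by (rule psum_cong) (simp add: b0_def)
    finally have "(y \<otimes> x) [^] d \<oplus> psum b1 (y \<otimes> x) d = y [^] d \<otimes> x [^] d \<oplus> y [^] d \<otimes> psum b x d"
      using yc x by (simp add: nat_pow_distrib)
    also have "\<dots> = y [^] d \<otimes> (x [^] d \<oplus> psum b x d)"
      using yc x psum_closed[of b0 x d, OF b0c x] psum_cong[of d b0 b x] by (simp add: r_distr b0_def)
    finally show "(y \<otimes> x) [^] d \<oplus> psum b1 (y \<otimes> x) d = \<zero>" using P(3) yc by simp
    fix c assume c: "\<And>t. c t \<in> F" "psum c (y \<otimes> x) d = \<zero>"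
    then have "psum (\<lambda>i. y [^] i \<otimes> c i) x d = \<zero>" using FR x yc by (subst psum_pow) auto
    then have "\<forall>t<d. y [^] t \<otimes> c t = \<zero>" by (rule P(4)[rotated]) (intro Fr(6) pow c(1))
    moreover have "y [^] t \<otimes> c t = \<zero> \<longleftrightarrow> c t = \<zero>" for t
      using integral_iff[of "y [^] t" "c t"] yc y(2) subsetD[OF FR c(1)[of t]] by simp
    ultimately show "\<forall>t<d. c t = \<zero>" by simp
  qed
  moreover have "map b1 (rev [0..<d]) = map b' (rev [0..<d])" by (simp add: b1_def)
  ultimately show ?thesis unfolding has_minimal_polynomial_def by simp
qed

end

section \<open>Monomials of key sequences\<close>

context valued_field
begin

lemma unitI: "a \<in> carrier K \<Longrightarrow> a \<noteq> \<zero> \<Longrightarrow> \<nu> a = 0 \<Longrightarrow> a \<in> V - M"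
  by (simp add: val_ring_def val_ideal_def del: V_carrier)

lemma unit_val: "a \<in> V - M \<Longrightarrow> \<nu> a = 0"
  using not_M by blast

lemma power_product_0 [simp]: "power_product K Q 0 e = \<one>"
  by (simp add: power_product_def)

lemma power_product_Suc:
  assumes "\<And>k. k \<le> r \<Longrightarrow> Q k \<in> carrier K"
  shows "power_product K Q (Suc r) e = power_product K Q r e \<otimes> Q r [^] e r"
proof -
  have "power_product K Q (Suc r) e = Q r [^] e r \<otimes> power_product K Q r e"
    unfolding power_product_def lessThan_Suc
    using assms by (subst finprod_insert) (auto simp: Pi_iff)
  then show ?thesis using assms unfolding power_product_def by (simp add: m_comm finprod_closed Pi_iff)
qed

lemma power_product_closed [simp]:
  "(\<And>k. k < r \<Longrightarrow> Q k \<in> carrier K) \<Longrightarrow> power_product K Q r e \<in> carrier K"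
  unfolding power_product_def by (intro finprod_closed) auto

lemma power_product_cong:
  assumes "\<And>k. k < r \<Longrightarrow> Q k \<in> carrier K" "\<And>k. k < r \<Longrightarrow> e k = f k"
  shows "power_product K Q r e = power_product K Q r f"
  unfolding power_product_def using assms by (intro finprod_cong') auto

lemma power_product_nonzero:
  "(\<And>k. k < r \<Longrightarrow> Q k \<in> carrier K \<and> Q k \<noteq> \<zero>) \<Longrightarrow> power_product K Q r e \<noteq> \<zero>"
proof (induction r)
  case (Suc r) then show ?case by (simp add: power_product_Suc)
qed simp

lemma power_product_add:
  "(\<And>k. k < r \<Longrightarrow> Q k \<in> carrier K) \<Longrightarrow>
    power_product K Q r (\<lambda>k. e k + f k) = power_product K Q r e \<otimes> power_product K Q r f"
proof (induction r)
  case (Suc r)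
  have "Q r [^] (e r + f r) = Q r [^] e r \<otimes> Q r [^] f r" using Suc.prems by (simp add: nat_pow_mult)
  then show ?case using Suc by (simp add: power_product_Suc m_ac)
qed simp

lemma power_product_mult:
  "(\<And>k. k < r \<Longrightarrow> Q k \<in> carrier K) \<Longrightarrow>
    power_product K Q r (\<lambda>k. n * e k) = power_product K Q r e [^] (n :: nat)"
proof (induction r)
  case (Suc r)
  have "Q r [^] (n * e r) = (Q r [^] e r) [^] n" using Suc.prems by (simp add: nat_pow_pow mult.commute)
  then show ?case using Suc by (simp add: power_product_Suc nat_pow_distrib)
qed simp

lemma val_power_product:
  "(\<And>k. k < r \<Longrightarrow> Q k \<in> carrier K \<and> Q k \<noteq> \<zero>) \<Longrightarrow>
    \<nu> (power_product K Q r e) \<in> group_closure ((\<lambda>k. \<nu> (Q k)) ` {..<r})"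
proof (induction r)
  case (Suc r)
  have "group_closure ((\<lambda>k. \<nu> (Q k)) ` {..<r}) \<subseteq> group_closure ((\<lambda>k. \<nu> (Q k)) ` {..<Suc r})"
    by (intro group_closure_least subsetI group_closure.base) auto
  moreover have "\<nu> (Q r) \<in> group_closure ((\<lambda>k. \<nu> (Q k)) ` {..<Suc r})" by (intro group_closure.base) auto
  ultimately show ?case
    using Suc by (auto simp: power_product_Suc power_product_nonzero intro!: group_closure_add group_closure_nsm)
qed simp

end

text \<open>The data entering conditions (2) and (4) of a key sequence, up to index \<open>r\<close>.\<close>

locale key_monomials = dominated_ring K \<nu> T for K (structure) and \<nu> T +
  fixes Q and m e :: "nat \<Rightarrow> nat" and b and v :: "nat \<Rightarrow> nat \<Rightarrow> nat" and r :: nat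
  assumes Q: "\<And>k. k \<le> r \<Longrightarrow> Q k \<in> carrier K" "\<And>k. k \<le> r \<Longrightarrow> Q k \<noteq> \<zero>" "0 < \<nu> (Q 0)"
    and index: "\<And>i. 1 \<le> i \<Longrightarrow> i \<le> r \<Longrightarrow> value_index \<nu> Q i \<noteq> \<infinity>"
    and balance: "\<And>i. 1 \<le> i \<Longrightarrow> i \<le> r \<Longrightarrow>
      \<nu> (power_product K Q i (v i)) = \<nu> (Q i [^] the_enat (value_index \<nu> Q i))"
    and degree: "\<And>i. 1 \<le> i \<Longrightarrow> i \<le> r \<Longrightarrow> m i = the_enat (value_index \<nu> Q i) * e i"
    and minimal: "\<And>i. 1 \<le> i \<Longrightarrow> i \<le> r \<Longrightarrow>
      has_minimal_polynomial L (adjoin K \<nu> T (alpha K \<nu> Q v) (i - 1)) (alpha K \<nu> Q v i) (e i) (b i)"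
begin

abbreviation "pp \<equiv> power_product K Q"
abbreviation "\<alpha> \<equiv> alpha K \<nu> Q v"
abbreviation "F \<equiv> adjoin K \<nu> T \<alpha>"
abbreviation "mbar i \<equiv> the_enat (value_index \<nu> Q i)"

lemma pp_closed [simp]: "i \<le> Suc r \<Longrightarrow> pp i f \<in> carrier K"
  using Q by (intro power_product_closed) auto

lemma pp_nonzero [simp]: "i \<le> Suc r \<Longrightarrow> pp i f \<noteq> \<zero>"
  using Q by (intro power_product_nonzero) auto

lemma pp_Suc: "i \<le> r \<Longrightarrow> pp (Suc i) f = pp i f \<otimes> Q i [^] f i"
  using Q by (intro power_product_Suc) auto

lemma pp_add: "i \<le> Suc r \<Longrightarrow> pp i (\<lambda>k. f k + h k) = pp i f \<otimes> pp i h"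
  using Q by (intro power_product_add) auto

lemma pp_mult: "i \<le> Suc r \<Longrightarrow> pp i (\<lambda>k. n * f k) = pp i f [^] (n :: nat)"
  using Q by (intro power_product_mult) auto

lemma ratio_V: "1 \<le> i \<Longrightarrow> i \<le> r \<Longrightarrow> Q i [^] mbar i \<otimes> inv (pp i (v i)) \<in> V - M"
  using balance[of i] Q(1,2)[of i] by (intro unitI) simp_all

lemma alpha_carrier: "1 \<le> i \<Longrightarrow> i \<le> r \<Longrightarrow> \<alpha> i \<in> carrier L"
  unfolding alpha_def using ratio_V by auto

lemma generators: "i \<le> r \<Longrightarrow> residue_subfield K \<nu> T \<union> \<alpha> ` {1..i} \<subseteq> carrier L"
  using alpha_carrier subfieldE(3)[OF residue_subfield] by auto

lemma F_subfield: "i \<le> r \<Longrightarrow> subfield (F i) L"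
  unfolding adjoin_def by (rule L.generate_field_is_subfield[OF generators])

lemma F_mono: "i \<le> j \<Longrightarrow> j \<le> r \<Longrightarrow> F i \<subseteq> F j"
  unfolding adjoin_def by (rule L.mono_generate_field[OF _ generators]) auto

lemma alpha_F: "1 \<le> i \<Longrightarrow> i \<le> r \<Longrightarrow> \<alpha> i \<in> F i"
  unfolding adjoin_def by (intro generate_field.incl) auto

lemma residue_F: "residue_subfield K \<nu> T \<subseteq> F i"
  unfolding adjoin_def by (auto intro: generate_field.incl)

lemma mbar_props:
  assumes "1 \<le> i" "i \<le> r"
  shows "0 < mbar i" "nsm k (\<nu> (Q i)) \<in> group_closure ((\<lambda>k. \<nu> (Q k)) ` {..<i}) \<Longrightarrow> mbar i dvd k"
  using value_index_finite[OF index[OF assms]] by auto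

text \<open>The value of the surplus power of \<open>Q i\<close> is a difference of values of
  monomials in the earlier elements, so it lies in the preceding value group.\<close>

lemma exponent_difference:
  assumes i: "1 \<le> i" "i \<le> r" and eq: "\<nu> (pp (Suc i) f) = \<nu> (pp (Suc i) h)" and le: "h i \<le> f i"
  shows "mbar i dvd f i - h i"
proof (rule mbar_props(2)[OF i])
  have "\<nu> (pp i f) + nsm (f i) (\<nu> (Q i)) = \<nu> (pp i h) + nsm (h i) (\<nu> (Q i))"
    using eq i Q by (simp add: pp_Suc)
  then have "nsm (f i - h i) (\<nu> (Q i)) = \<nu> (pp i h) - \<nu> (pp i f)"
    unfolding nsm_diff[OF le] by (simp add: algebra_simps)
  moreover have "\<nu> (pp i f) \<in> group_closure ((\<lambda>k. \<nu> (Q k)) ` {..<i})" for f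
    using Q i by (intro val_power_product) auto
  ultimately show "nsm (f i - h i) (\<nu> (Q i)) \<in> group_closure ((\<lambda>k. \<nu> (Q k)) ` {..<i})"
    by (simp add: group_closure.diff)
qed

lemma alpha_pow:
  assumes "1 \<le> i" "i \<le> r"
  shows "\<alpha> i [^]\<^bsub>L\<^esub> (t :: nat) = res (Q i [^] (t * mbar i) \<otimes> inv (pp i (\<lambda>k. t * v i k)))"
proof -
  have *: "Q i [^] mbar i \<otimes> inv (pp i (v i)) \<in> V" using ratio_V[OF assms] by blast
  have "\<alpha> i [^]\<^bsub>L\<^esub> t = res ((Q i [^] mbar i \<otimes> inv (pp i (v i))) [^] t)"
    unfolding alpha_def using * by simp
  also have "(Q i [^] mbar i \<otimes> inv (pp i (v i))) [^] t = Q i [^] (t * mbar i) \<otimes> inv (pp i (\<lambda>k. t * v i k))"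
    using assms Q by (simp add: divide_pow pp_mult nat_pow_pow mult.commute)
  finally show ?thesis .
qed

lemma ratio_unit:
  assumes "i \<le> Suc r" "\<nu> (pp i f) = \<nu> g" "g \<in> carrier K" "g \<noteq> \<zero>"
  shows "pp i f \<otimes> inv g \<in> V - M"
  using assms by (intro unitI) simp_all

text \<open>The factor \<open>Q i ^ (t * mbar i)\<close> is traded for the \<open>t\<close>-th power
  of the comparison monomial, which has the same value. The quotient contributes
  \<open>\<alpha> i\<close> to the power \<open>t\<close>, and only \<rho> factors
  \<open>Q i\<close> remain.\<close>

lemma split_monomial:
  assumes i: "1 \<le> i" "i \<le> r" and f: "f i = t * mbar i + \<rho>"
    and g: "\<nu> (pp (Suc i) f) = \<nu> g" "g \<in> carrier K" "g \<noteq> \<zero>"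
  defines "h \<equiv> pp i (\<lambda>k. f k + t * v i k) \<otimes> Q i [^] \<rho> \<otimes> inv g"
  shows "h \<in> V - M" "res (pp (Suc i) f \<otimes> inv g) = \<alpha> i [^]\<^bsub>L\<^esub> t \<otimes>\<^bsub>L\<^esub> res h"
proof -
  define A where "A = Q i [^] (t * mbar i)"
  define B where "B = pp i (\<lambda>k. t * v i k)"
  define C where "C = Q i [^] \<rho>"
  have car: "A \<in> carrier K" "B \<in> carrier K" "C \<in> carrier K" "pp i f \<in> carrier K" "inv g \<in> carrier K" "inv B \<in> carrier K"
    and nz: "A \<noteq> \<zero>" "B \<noteq> \<zero>" "C \<noteq> \<zero>"
    using Q i g by (auto simp: A_def B_def C_def)
  have "Q i [^] f i = A \<otimes> C" unfolding f A_def C_def using Q i by (simp add: nat_pow_mult)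
  then have p: "pp (Suc i) f = pp i f \<otimes> (A \<otimes> C)" using pp_Suc i by simp
  have h: "h = (pp i f \<otimes> B) \<otimes> C \<otimes> inv g" unfolding h_def B_def C_def using pp_add i by simp
  have vB: "\<nu> B = \<nu> A"
    unfolding A_def B_def using i Q balance[OF i] by (simp add: pp_mult nsm_mult)
  have "\<nu> h = 0" unfolding h using car nz i g p vB by (simp add: algebra_simps)
  moreover have "h \<noteq> \<zero>" "h \<in> carrier K" unfolding h using car nz i g by auto
  ultimately show hV: "h \<in> V - M" by (intro unitI)
  have AB: "A \<otimes> inv B \<in> V" using unitI[of "A \<otimes> inv B"] car nz vB by simp
  have "A \<otimes> inv B \<otimes> h = (B \<otimes> inv B) \<otimes> (pp i f \<otimes> (A \<otimes> C) \<otimes> inv g)"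
    unfolding h using car by algebra
  also have "\<dots> = pp (Suc i) f \<otimes> inv g" unfolding p using car nz by simp
  finally have "res (pp (Suc i) f \<otimes> inv g) = res (A \<otimes> inv B) \<otimes>\<^bsub>L\<^esub> res h" using AB hV by (metis DiffD1 res_mult)
  then show "res (pp (Suc i) f \<otimes> inv g) = \<alpha> i [^]\<^bsub>L\<^esub> t \<otimes>\<^bsub>L\<^esub> res h"
    unfolding alpha_pow[OF i] A_def B_def .
qed

text \<open>Trading the surplus power of the last element yields a power of the last \<alpha> times
  a ratio of monomials in fewer elements. At index 0 equal values force equal exponents.\<close>

lemma ratio_in_F:
  "i \<le> r \<Longrightarrow> \<nu> (pp (Suc i) f) = \<nu> (pp (Suc i) h) \<Longrightarrow> res (pp (Suc i) f \<otimes> inv (pp (Suc i) h)) \<in> F i"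
proof (induction i arbitrary: f h)
  case 0
  have p: "pp (Suc 0) f = Q 0 [^] f 0" for f using pp_Suc[of 0 f] Q(1)[of 0] by simp
  have "nsm (f 0) (\<nu> (Q 0)) = nsm (h 0) (\<nu> (Q 0))" using 0 Q(1,2)[of 0] unfolding p by simp
  then have "f 0 = h 0" using nsm_inj[OF Q(3)] by simp
  then have "pp (Suc 0) f \<otimes> inv (pp (Suc 0) h) = \<one>" unfolding p using Q(1,2)[of 0] by simp
  then show ?case using generate_field.one by (simp add: adjoin_def)
next
  case (Suc i)
  have Sr: "1 \<le> Suc i" using Suc by simp
  have main: "res (pp (Suc (Suc i)) f \<otimes> inv (pp (Suc (Suc i)) h)) \<in> F (Suc i)"
    if eq: "\<nu> (pp (Suc (Suc i)) f) = \<nu> (pp (Suc (Suc i)) h)" and le: "h (Suc i) \<le> f (Suc i)" for f h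
  proof -
    obtain t where "f (Suc i) - h (Suc i) = mbar (Suc i) * t"
      using exponent_difference[OF Sr Suc.prems(1) eq le] by (rule dvdE)
    then have t: "f (Suc i) = t * mbar (Suc i) + h (Suc i)" using le by (simp add: mult.commute)
    have ph: "pp (Suc (Suc i)) h \<in> carrier K" "pp (Suc (Suc i)) h \<noteq> \<zero>" using Suc.prems by auto
    define B where "B = pp (Suc i) (\<lambda>k. f k + t * v (Suc i) k)"
    note S = split_monomial[OF Sr Suc.prems(1) t eq ph, folded B_def]
    have car: "B \<in> carrier K" "B \<noteq> \<zero>" "pp (Suc i) h \<in> carrier K" "pp (Suc i) h \<noteq> \<zero>"
      "Q (Suc i) [^] h (Suc i) \<in> carrier K" "Q (Suc i) [^] h (Suc i) \<noteq> \<zero>"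
      unfolding B_def using Suc.prems Q by auto
    have hB: "B \<otimes> Q (Suc i) [^] h (Suc i) \<otimes> inv (pp (Suc (Suc i)) h) = B \<otimes> inv (pp (Suc i) h)"
      using car by (subst divide_eq_divide_iff) (auto simp: pp_Suc Suc.prems m_ac)
    have "B \<otimes> inv (pp (Suc i) h) \<in> V - M" using S(1) unfolding hB .
    then have "\<nu> B = \<nu> (pp (Suc i) h)" using unit_val[of "B \<otimes> inv (pp (Suc i) h)"] car by simp
    then have "res (B \<otimes> inv (pp (Suc i) h)) \<in> F i" unfolding B_def using Suc.IH Suc.prems by simp
    then have 1: "res (B \<otimes> inv (pp (Suc i) h)) \<in> F (Suc i)" using F_mono[of i "Suc i"] Suc.prems by auto
    note Fr = subringE[OF subfieldE(1)[OF F_subfield[OF Suc.prems(1)]]]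
    have "\<alpha> (Suc i) [^]\<^bsub>L\<^esub> t \<in> F (Suc i)"
      by (induction t) (use Fr(3,6) alpha_F[OF Sr Suc.prems(1)] in auto)
    then show ?thesis unfolding S(2) hB using 1 by (rule Fr(6))
  qed
  show ?case
  \<comment> \<open>The surplus exponent must be natural; in the opposite case the inverse ratio is
    treated.\<close>
  proof (cases "h (Suc i) \<le> f (Suc i)")
    case True
    then show ?thesis using main[OF Suc.prems(2)] by simp
  next
    case False
    have *: "res (pp (Suc (Suc i)) h \<otimes> inv (pp (Suc (Suc i)) f)) \<in> F (Suc i)"
      using False main[OF Suc.prems(2)[symmetric]] by simp
    have p: "pp (Suc (Suc i)) f \<in> carrier K" "pp (Suc (Suc i)) f \<noteq> \<zero>" "pp (Suc (Suc i)) h \<in> carrier K" "pp (Suc (Suc i)) h \<noteq> \<zero>"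
      using Suc.prems by auto
    have u: "pp (Suc (Suc i)) h \<otimes> inv (pp (Suc (Suc i)) f) \<in> V - M"
      using ratio_unit[of "Suc (Suc i)" h "pp (Suc (Suc i)) f"] Suc.prems p by simp
    have "res (pp (Suc (Suc i)) f \<otimes> inv (pp (Suc (Suc i)) h)) = inv\<^bsub>L\<^esub> res (pp (Suc (Suc i)) h \<otimes> inv (pp (Suc (Suc i)) f))"
      using u p by (simp add: res_inv[symmetric] inv_divide del: res_inv)
    moreover have "res (pp (Suc (Suc i)) h \<otimes> inv (pp (Suc (Suc i)) f)) \<noteq> \<zero>\<^bsub>L\<^esub>" using u res_zero_iff by blast
    ultimately show ?thesis using * unfolding adjoin_def by (simp add: generate_field.m_inv)
  qed
qed

end

section \<open>Finite sums written as polynomial values\<close>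

context cring
begin

lemma psum_eq_finsum:
  assumes "\<And>i. i < n \<Longrightarrow> c i \<in> carrier R" "z \<in> carrier R"
  shows "psum c z n = (\<Oplus>i\<in>{..<n}. c i \<otimes> z [^] i)"
  using assms(1)
proof (induction n)
  case (Suc n)
  have "(\<Oplus>i\<in>{..<Suc n}. c i \<otimes> z [^] i) = c n \<otimes> z [^] n \<oplus> (\<Oplus>i\<in>{..<n}. c i \<otimes> z [^] i)"
    unfolding lessThan_Suc using Suc.prems assms(2) by (subst finsum_insert) (auto simp: Pi_iff)
  moreover have "(\<Oplus>i\<in>{..<n}. c i \<otimes> z [^] i) \<in> carrier R"
    using Suc.prems assms(2) by (intro finsum_closed) auto
  ultimately show ?case using Suc assms(2) by (simp add: a_comm)
qed simp

lemma psum_grouped: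
  assumes I: "finite I" and h: "\<And>l. l \<in> I \<Longrightarrow> h l \<in> carrier R" and z: "z \<in> carrier R"
  shows "psum (\<lambda>s. \<Oplus>l\<in>{l \<in> I. t l = s}. h l) z n = (\<Oplus>l\<in>{l \<in> I. t l < n}. h l \<otimes> z [^] t l)"
proof (induction n)
  case (Suc n)
  have *: "{l \<in> I. t l < Suc n} = {l \<in> I. t l < n} \<union> {l \<in> I. t l = n}" by auto
  have "(\<Oplus>l\<in>{l \<in> I. t l < Suc n}. h l \<otimes> z [^] t l) =
      (\<Oplus>l\<in>{l \<in> I. t l < n}. h l \<otimes> z [^] t l) \<oplus> (\<Oplus>l\<in>{l \<in> I. t l = n}. h l \<otimes> z [^] t l)"
    unfolding * using I h z by (intro finsum_Un_disjoint) auto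
  also have "(\<Oplus>l\<in>{l \<in> I. t l = n}. h l \<otimes> z [^] t l) = (\<Oplus>l\<in>{l \<in> I. t l = n}. h l \<otimes> z [^] n)"
    using h z by (intro finsum_cong') auto
  also have "\<dots> = (\<Oplus>l\<in>{l \<in> I. t l = n}. h l) \<otimes> z [^] n"
    using I h z by (intro finsum_ldistr[symmetric]) auto
  finally show ?case using Suc by simp
qed simp

text \<open>\<open>combine\<close> stops at the end of the shorter list, which explains the guard in
  the coefficients.\<close>

lemma combine_eq_psum:
  assumes "set Ks \<subseteq> carrier R" "set Us \<subseteq> carrier R"
  shows "combine Ks Us = psum (\<lambda>l. if l < length Ks \<and> l < length Us then Ks ! l \<otimes> Us ! l else \<zero>) \<one> (length Us)"
  using assms
proof (induction Ks Us rule: combine.induct)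
  case (1 k Ks u Us)
  let ?f = "\<lambda>Ks Us l. if l < length Ks \<and> l < length Us then Ks ! l \<otimes> Us ! l else \<zero>"
  have c: "?f (k # Ks) (u # Us) l \<in> carrier R" for l
  proof -
    have "l < length (k # Ks) \<Longrightarrow> (k # Ks) ! l \<in> carrier R" "l < length (u # Us) \<Longrightarrow> (u # Us) ! l \<in> carrier R"
      using nth_mem[of l "k # Ks"] nth_mem[of l "u # Us"] 1(2,3) by blast+
    then show ?thesis by simp
  qed
  have sh: "?f (k # Ks) (u # Us) (Suc l) = ?f Ks Us l" for l by simp
  have c': "?f Ks Us l \<in> carrier R" for l using c[of "Suc l"] unfolding sh .
  have IH: "combine Ks Us = psum (?f Ks Us) \<one> (length Us)" using 1 by simp
  have "psum (?f (k # Ks) (u # Us)) \<one> (length (u # Us)) =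
      ?f (k # Ks) (u # Us) 0 \<oplus> \<one> \<otimes> psum (\<lambda>l. ?f (k # Ks) (u # Us) (Suc l)) \<one> (length Us)"
    unfolding length_Cons by (rule psum_Suc_shift[OF c[unfolded length_Cons] one_closed])
  also have "\<dots> = k \<otimes> u \<oplus> \<one> \<otimes> psum (?f Ks Us) \<one> (length Us)" unfolding sh by simp
  also have "\<dots> = combine (k # Ks) (u # Us)" using IH psum_closed[of "?f Ks Us" \<one> "length Us", OF c'] by simp
  finally show ?case by simp
next
  case ("2_1" Us)
  have "psum (\<lambda>l. \<zero>) \<one> n = \<zero>" for n by (induction n) auto
  then show ?case by simp
next
  case ("2_2" Ks)
  then show ?case by simp
qed

end

context key_monomials
begin

text \<open>The reference element \<open>g\<close> is arbitrary: in the induction it becomes an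
  element of the right value that need not be a monomial of the family. Equal values give last
  exponents \<open>t l * mb + \<rho>\<close> with a common \<rho> and with \<open>t l\<close> below
  the degree of the last \<alpha>. Sorting by \<open>t l\<close> produces a polynomial relation of
  too small degree for this \<alpha>, so each group vanishes separately and concerns one element
  fewer.\<close>

lemma independent_family:
  assumes "i \<le> r" "finite I"
    and "\<And>l k. l \<in> I \<Longrightarrow> k \<in> {1..i} \<Longrightarrow> E l k < m k"
    and "\<And>l l'. l \<in> I \<Longrightarrow> l' \<in> I \<Longrightarrow> l \<noteq> l' \<Longrightarrow> \<exists>k\<le>i. E l k \<noteq> E l' k"
    and "g \<in> carrier K" "g \<noteq> \<zero>"
    and "\<And>l. l \<in> I \<Longrightarrow> \<nu> (pp (Suc i) (E l)) = \<nu> g"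
    and "\<And>l. l \<in> I \<Longrightarrow> a l \<in> residue_subfield K \<nu> T"
    and "(\<Oplus>\<^bsub>L\<^esub>l\<in>I. a l \<otimes>\<^bsub>L\<^esub> res (pp (Suc i) (E l) \<otimes> inv g)) = \<zero>\<^bsub>L\<^esub>"
  shows "\<forall>l\<in>I. a l = \<zero>\<^bsub>L\<^esub>"
  using assms
proof (induction i arbitrary: I g)
  case (0 I g)
  have ac: "l \<in> I \<Longrightarrow> a l \<in> carrier L" for l using 0(8) subfieldE(3)[OF residue_subfield] by blast
  have p: "pp (Suc 0) f = Q 0 [^] f 0" for f using pp_Suc[of 0 f] Q(1)[of 0] by simp
  have "l = l'" if "l \<in> I" "l' \<in> I" for l l'
  proof (rule ccontr)
    assume "l \<noteq> l'"
    then have "E l 0 \<noteq> E l' 0" using 0(4)[OF that] by auto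
    moreover have "nsm (E l 0) (\<nu> (Q 0)) = nsm (E l' 0) (\<nu> (Q 0))"
      using 0(7)[OF that(1)] 0(7)[OF that(2)] Q(1,2)[of 0] unfolding p by simp
    ultimately show False using nsm_inj[OF Q(3)] by simp
  qed
  then consider "I = {}" | l where "I = {l}" by blast
  then show ?case
  proof cases
    case (2 l)
    have u: "pp (Suc 0) (E l) \<otimes> inv g \<in> V - M" using ratio_unit[of "Suc 0" "E l" g] 0 2 by simp
    then have nz: "res (pp (Suc 0) (E l) \<otimes> inv g) \<noteq> \<zero>\<^bsub>L\<^esub>" "res (pp (Suc 0) (E l) \<otimes> inv g) \<in> carrier L"
      using res_zero_iff by auto
    have "a l \<otimes>\<^bsub>L\<^esub> res (pp (Suc 0) (E l) \<otimes> inv g) = \<zero>\<^bsub>L\<^esub>"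
      using 0(9) 2 ac[of l] nz by (simp add: L.finsum_insert)
    then show ?thesis using L.integral_iff[OF ac nz(2)] nz(1) 2 by auto
  qed simp
next
  case (Suc i I g)
  note i = Suc.prems(1) and I = Suc.prems(2) and Em = Suc.prems(3) and dist = Suc.prems(4)
    and g = Suc.prems(5,6) and val = Suc.prems(7) and a = Suc.prems(8) and sum0 = Suc.prems(9)
  have i1: "1 \<le> Suc i" by simp
  have ac: "l \<in> I \<Longrightarrow> a l \<in> carrier L" for l using a subfieldE(3)[OF residue_subfield] by blast
  show ?case
  proof (cases "I = {}")
    case False
    then obtain l0 where l0: "l0 \<in> I" by blast
    define mb where "mb = mbar (Suc i)"
    have mb: "0 < mb" unfolding mb_def by (rule mbar_props(1)[OF i1 i])
    \<comment> \<open>The common remainder of all last exponents, read off at an arbitrary member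
      \<open>l0\<close>.\<close>
    define \<rho> where "\<rho> = E l0 (Suc i) mod mb"
    define t where "t l = E l (Suc i) div mb" for l
    have El: "E l (Suc i) = t l * mb + \<rho>" if l: "l \<in> I" for l
    proof -
      have "E l (Suc i) mod mb = E l0 (Suc i) mod mb"
      proof (cases "E l (Suc i) \<le> E l0 (Suc i)")
        case True
        then have "mb dvd E l0 (Suc i) - E l (Suc i)"
          using exponent_difference[OF i1 i, of "E l0" "E l"] val[OF l] val[OF l0] unfolding mb_def by simp
        then show ?thesis using True by (metis mod_eq_dvd_iff_nat)
      next
        case False
        then have "mb dvd E l (Suc i) - E l0 (Suc i)"
          using exponent_difference[OF i1 i, of "E l" "E l0"] val[OF l] val[OF l0] unfolding mb_def by simp
        then show ?thesis using False by (metis mod_eq_dvd_iff_nat nat_le_linear)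
      qed
      then show ?thesis unfolding t_def \<rho>_def by (metis div_mult_mod_eq)
    qed
    have te: "t l < e (Suc i)" if "l \<in> I" for l
      using Em[OF that, of "Suc i"] degree[OF i1 i] mb unfolding t_def mb_def[symmetric]
      by (simp add: less_mult_imp_div_less mult.commute)
    define B where "B l = pp (Suc i) (\<lambda>k. E l k + t l * v (Suc i) k)" for l
    define h where "h l = B l \<otimes> Q (Suc i) [^] \<rho> \<otimes> inv g" for l
    have S: "h l \<in> V - M" "res (pp (Suc (Suc i)) (E l) \<otimes> inv g) = \<alpha> (Suc i) [^]\<^bsub>L\<^esub> t l \<otimes>\<^bsub>L\<^esub> res (h l)"
      if "l \<in> I" for l
      using split_monomial[where f = "E l", OF i1 i _ val[OF that] g, of "t l" \<rho>] El[OF that]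
      unfolding h_def B_def mb_def by auto
    have hL: "res (h l) \<in> carrier L" "res (h l) \<noteq> \<zero>\<^bsub>L\<^esub>" if "l \<in> I" for l
      using S(1)[OF that] res_zero_iff by auto
    have Bc: "B l \<in> carrier K" "B l \<noteq> \<zero>" for l unfolding B_def using i by auto
    define q where "q = Q (Suc i) [^] \<rho>"
    have qc: "q \<in> carrier K" "q \<noteq> \<zero>" unfolding q_def using Q i by auto
    have ratio: "res (h l) \<otimes>\<^bsub>L\<^esub> inv\<^bsub>L\<^esub> res (h l0) \<in> F i" if l: "l \<in> I" for l
    proof -
      have hc: "h k \<in> carrier K" "h k \<noteq> \<zero>" if "k \<in> I" for k using S(1)[OF that] by auto
      have "res (h l) \<otimes>\<^bsub>L\<^esub> inv\<^bsub>L\<^esub> res (h l0) = res (h l \<otimes> inv (h l0))"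
        using S(1)[OF l] S(1)[OF l0] V_inv by simp
      also have "h l \<otimes> inv (h l0) = B l \<otimes> inv (B l0)"
        using hc[OF l] hc[OF l0] Bc qc g unfolding h_def q_def[symmetric]
        by (subst divide_eq_divide_iff) (auto simp: m_ac)
      finally have eq: "res (h l) \<otimes>\<^bsub>L\<^esub> inv\<^bsub>L\<^esub> res (h l0) = res (B l \<otimes> inv (B l0))" .
      have "\<nu> (B k) = \<nu> g - \<nu> q" if "k \<in> I" for k
        using unit_val[OF S(1)[OF that]] Bc qc g unfolding h_def q_def[symmetric] by (simp add: algebra_simps)
      then have "\<nu> (B l) = \<nu> (B l0)" using l l0 by simp
      then show ?thesis unfolding eq B_def using ratio_in_F i by simp
    qed
    have aF: "\<alpha> (Suc i) \<in> carrier L" by (rule alpha_carrier[OF i1 i])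
    have ir: "i \<le> r" using i by simp
    note Fi = F_subfield[OF ir]
    note Fr = subringE[OF subfieldE(1)[OF Fi]]
    \<comment> \<open>Only ratios of the \<open>res (h l)\<close> are known to lie in
      \<open>F i\<close>, so the whole relation is divided by \<open>res (h l0)\<close>.\<close>
    define c where "c s = (\<Oplus>\<^bsub>L\<^esub>l\<in>{l \<in> I. t l = s}. a l \<otimes>\<^bsub>L\<^esub> (res (h l) \<otimes>\<^bsub>L\<^esub> inv\<^bsub>L\<^esub> res (h l0)))" for s
    have cF: "c s \<in> F i" for s
    proof -
      have sumF: "(\<Oplus>\<^bsub>L\<^esub>l\<in>J. a l \<otimes>\<^bsub>L\<^esub> (res (h l) \<otimes>\<^bsub>L\<^esub> inv\<^bsub>L\<^esub> res (h l0))) \<in> F i" if "J \<subseteq> I" for J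
      proof -
        have "finite J" using that I finite_subset by blast
        then show ?thesis using that
        proof (induction J rule: finite_induct)
          case empty then show ?case using Fr(2) by simp
        next
          case (insert l J)
          have mem: "a k \<otimes>\<^bsub>L\<^esub> (res (h k) \<otimes>\<^bsub>L\<^esub> inv\<^bsub>L\<^esub> res (h l0)) \<in> F i" if "k \<in> I" for k
            by (rule Fr(6)[OF subsetD[OF residue_F a[OF that]] ratio[OF that]])
          have car: "F i \<subseteq> carrier L" by (rule subfieldE(3)[OF Fi])
          have "(\<Oplus>\<^bsub>L\<^esub>l\<in>insert l J. a l \<otimes>\<^bsub>L\<^esub> (res (h l) \<otimes>\<^bsub>L\<^esub> inv\<^bsub>L\<^esub> res (h l0))) =
            a l \<otimes>\<^bsub>L\<^esub> (res (h l) \<otimes>\<^bsub>L\<^esub> inv\<^bsub>L\<^esub> res (h l0)) \<oplus>\<^bsub>L\<^esub> (\<Oplus>\<^bsub>L\<^esub>l\<in>J. a l \<otimes>\<^bsub>L\<^esub> (res (h l) \<otimes>\<^bsub>L\<^esub> inv\<^bsub>L\<^esub> res (h l0)))"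
            using insert.hyps insert.prems mem car by (intro L.finsum_insert) blast+
          then show ?case using Fr(7)[OF mem[of l] insert.IH] insert.prems by simp
        qed
      qed
      show ?thesis unfolding c_def by (rule sumF) auto
    qed
    have ih0: "inv\<^bsub>L\<^esub> res (h l0) \<in> carrier L" "inv\<^bsub>L\<^esub> res (h l0) \<noteq> \<zero>\<^bsub>L\<^esub>" using hL[OF l0] by auto
    have "L.psum c (\<alpha> (Suc i)) (e (Suc i)) = (\<Oplus>\<^bsub>L\<^esub>l\<in>{l \<in> I. t l < e (Suc i)}. a l \<otimes>\<^bsub>L\<^esub> (res (h l) \<otimes>\<^bsub>L\<^esub> inv\<^bsub>L\<^esub> res (h l0)) \<otimes>\<^bsub>L\<^esub> \<alpha> (Suc i) [^]\<^bsub>L\<^esub> t l)"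
      unfolding c_def using I ac hL ih0 aF by (intro L.psum_grouped) auto
    also have "{l \<in> I. t l < e (Suc i)} = I" using te by blast
    also have "(\<Oplus>\<^bsub>L\<^esub>l\<in>I. a l \<otimes>\<^bsub>L\<^esub> (res (h l) \<otimes>\<^bsub>L\<^esub> inv\<^bsub>L\<^esub> res (h l0)) \<otimes>\<^bsub>L\<^esub> \<alpha> (Suc i) [^]\<^bsub>L\<^esub> t l) =
      (\<Oplus>\<^bsub>L\<^esub>l\<in>I. (a l \<otimes>\<^bsub>L\<^esub> res (pp (Suc (Suc i)) (E l) \<otimes> inv g)) \<otimes>\<^bsub>L\<^esub> inv\<^bsub>L\<^esub> res (h l0))"
      using S(2) ac hL ih0 aF by (intro L.finsum_cong') (auto simp: L.m_ac)
    also have "\<dots> = (\<Oplus>\<^bsub>L\<^esub>l\<in>I. a l \<otimes>\<^bsub>L\<^esub> res (pp (Suc (Suc i)) (E l) \<otimes> inv g)) \<otimes>\<^bsub>L\<^esub> inv\<^bsub>L\<^esub> res (h l0)"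
      using I ac hL ih0 aF S(2) by (intro L.finsum_ldistr[symmetric]) auto
    finally have c_zero: "L.psum c (\<alpha> (Suc i)) (e (Suc i)) = \<zero>\<^bsub>L\<^esub>" using sum0 ih0 by simp
    have mp: "has_minimal_polynomial L (F i) (\<alpha> (Suc i)) (e (Suc i)) (b (Suc i))"
      using minimal[OF i1 i] by simp
    have c0: "\<forall>s<e (Suc i). c s = \<zero>\<^bsub>L\<^esub>"
      by (rule L.minimal_polynomial_props(4)[OF Fi aF mp _ c_zero]) (rule cF)
    have a0: "\<forall>l\<in>{l \<in> I. t l = s}. a l = \<zero>\<^bsub>L\<^esub>" if s: "s < e (Suc i)" for s
    proof -
      let ?J = "{l \<in> I. t l = s}"
      define P where "P = pp (Suc i) (\<lambda>k. s * v (Suc i) k)"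
      have Pc: "P \<in> carrier K" "P \<noteq> \<zero>" unfolding P_def using i by auto
      \<comment> \<open>Within the group \<open>t l = s\<close> the comparison monomial and the
        remaining power \<open>q\<close> are the same for all members, so they can be moved into the
        reference element.\<close>
      define g' where "g' = g \<otimes> inv (P \<otimes> q)"
      have g'c: "g' \<in> carrier K" "g' \<noteq> \<zero>" unfolding g'_def using g Pc qc by auto
      have hg: "h l = pp (Suc i) (E l) \<otimes> inv g'" if "l \<in> ?J" for l
      proof -
        have "B l = pp (Suc i) (E l) \<otimes> P" unfolding B_def P_def using that pp_add[of "Suc i"] i by simp
        then have "h l = pp (Suc i) (E l) \<otimes> ((P \<otimes> q) \<otimes> inv g)"
          unfolding h_def q_def[symmetric] using Pc qc g i by (simp add: m_assoc)
        also have "(P \<otimes> q) \<otimes> inv g = inv g'"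
          unfolding g'_def using Pc qc g by (simp add: inv_divide)
        finally show ?thesis .
      qed
      have vg: "\<nu> (pp (Suc i) (E l)) = \<nu> g'" if "l \<in> ?J" for l
        using unit_val[OF S(1), of l] that g'c i unfolding hg[OF that] by simp
      have "(\<Oplus>\<^bsub>L\<^esub>l\<in>?J. a l \<otimes>\<^bsub>L\<^esub> res (pp (Suc i) (E l) \<otimes> inv g')) =
        (\<Oplus>\<^bsub>L\<^esub>l\<in>?J. a l \<otimes>\<^bsub>L\<^esub> (res (h l) \<otimes>\<^bsub>L\<^esub> inv\<^bsub>L\<^esub> res (h l0)) \<otimes>\<^bsub>L\<^esub> res (h l0))"
      proof (rule L.finsum_cong')
        show "(\<lambda>l. a l \<otimes>\<^bsub>L\<^esub> (res (h l) \<otimes>\<^bsub>L\<^esub> inv\<^bsub>L\<^esub> res (h l0)) \<otimes>\<^bsub>L\<^esub> res (h l0)) \<in> ?J \<rightarrow> carrier L"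
          using ac hL ih0 l0 by auto
        fix l assume l: "l \<in> ?J"
        then show "a l \<otimes>\<^bsub>L\<^esub> res (pp (Suc i) (E l) \<otimes> inv g') =
          a l \<otimes>\<^bsub>L\<^esub> (res (h l) \<otimes>\<^bsub>L\<^esub> inv\<^bsub>L\<^esub> res (h l0)) \<otimes>\<^bsub>L\<^esub> res (h l0)"
          unfolding hg[OF l, symmetric] using ac hL l0 ih0 by (simp add: L.m_assoc)
      qed simp
      also have "\<dots> = c s \<otimes>\<^bsub>L\<^esub> res (h l0)"
        unfolding c_def using I ac hL ih0 l0 by (intro L.finsum_ldistr[symmetric]) auto
      also have "\<dots> = \<zero>\<^bsub>L\<^esub>" using c0 s hL[OF l0] by simp
      finally have sum: "(\<Oplus>\<^bsub>L\<^esub>l\<in>?J. a l \<otimes>\<^bsub>L\<^esub> res (pp (Suc i) (E l) \<otimes> inv g')) = \<zero>\<^bsub>L\<^esub>" .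
      show ?thesis
      proof (rule Suc.IH[OF _ _ _ _ g'c vg _ sum])
        show "i \<le> r" using i by simp
        show "finite ?J" using I by simp
        show "E l k < m k" if "l \<in> ?J" "k \<in> {1..i}" for l k using Em[of l k] that by simp
        show "a l \<in> residue_subfield K \<nu> T" if "l \<in> ?J" for l using a that by simp
        fix l l' assume l: "l \<in> ?J" "l' \<in> ?J" "l \<noteq> l'"
        then obtain k where k: "k \<le> Suc i" "E l k \<noteq> E l' k" using dist[of l l'] by auto
        then have "k \<noteq> Suc i" using El[of l] El[of l'] l by auto
        then have "k \<le> i" using k(1) by simp
        then show "\<exists>k\<le>i. E l k \<noteq> E l' k" using k(2) by blast
      qed
    qed
    show ?thesis
    proof
      fix l assume "l \<in> I"
      then show "a l = \<zero>\<^bsub>L\<^esub>" using a0[OF te] by simp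
    qed
  qed simp
qed

lemma independent_monomials:
  assumes "i \<le> r"
    and E: "\<forall>l<N. \<forall>k\<in>{1..i}. E l k < m k" "\<forall>l<N. \<forall>l'<N. l \<noteq> l' \<longrightarrow> (\<exists>k\<le>i. E l k \<noteq> E l' k)"
    and val: "\<forall>l<N. \<nu> (pp (Suc i) (E l)) = \<nu> (pp (Suc i) (E 0))"
  shows "L.independent (residue_subfield K \<nu> T)
    (map (\<lambda>l. res (pp (Suc i) (E l) \<otimes> inv (pp (Suc i) (E 0)))) [0..<N])"
proof (rule L.trivial_combine_imp_independent[OF residue_subfield])
  define g where "g = pp (Suc i) (E 0)"
  have g: "g \<in> carrier K" "g \<noteq> \<zero>" unfolding g_def using assms by auto
  have u: "res (pp (Suc i) (E l) \<otimes> inv g) \<in> carrier L" if "l < N" for l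
    using ratio_unit[of "Suc i" "E l" g] g val[rule_format, OF that] assms(1) unfolding g_def by simp
  show "set (map (\<lambda>l. res (pp (Suc i) (E l) \<otimes> inv (pp (Suc i) (E 0)))) [0..<N]) \<subseteq> carrier L"
    using u unfolding g_def by auto
  fix Ks let ?Us = "map (\<lambda>l. res (pp (Suc i) (E l) \<otimes> inv (pp (Suc i) (E 0)))) [0..<N]"
  assume Ks: "set Ks \<subseteq> residue_subfield K \<nu> T" "L.combine Ks ?Us = \<zero>\<^bsub>L\<^esub>"
  define a where "a l = (if l < length Ks then Ks ! l else \<zero>\<^bsub>L\<^esub>)" for l
  have a: "a l \<in> residue_subfield K \<nu> T" for l
    unfolding a_def using Ks(1) subringE(2)[OF subfieldE(1)[OF residue_subfield]] by auto
  have ac: "a l \<in> carrier L" for l using a subfieldE(3)[OF residue_subfield] by auto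
  have KL: "set Ks \<subseteq> carrier L" using Ks(1) subfieldE(3)[OF residue_subfield] by auto
  have "L.combine Ks ?Us = L.psum (\<lambda>l. if l < length Ks \<and> l < length ?Us then Ks ! l \<otimes>\<^bsub>L\<^esub> ?Us ! l else \<zero>\<^bsub>L\<^esub>) \<one>\<^bsub>L\<^esub> (length ?Us)"
    using KL u unfolding g_def by (intro L.combine_eq_psum) auto
  also have "\<dots> = L.psum (\<lambda>l. a l \<otimes>\<^bsub>L\<^esub> res (pp (Suc i) (E l) \<otimes> inv g)) \<one>\<^bsub>L\<^esub> N"
    using u unfolding length_map length_upt g_def by (simp, intro L.psum_cong) (auto simp: a_def)
  also have "\<dots> = (\<Oplus>\<^bsub>L\<^esub>l\<in>{..<N}. a l \<otimes>\<^bsub>L\<^esub> res (pp (Suc i) (E l) \<otimes> inv g) \<otimes>\<^bsub>L\<^esub> \<one>\<^bsub>L\<^esub> [^]\<^bsub>L\<^esub> l)"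
    using u ac by (intro L.psum_eq_finsum) auto
  also have "\<dots> = (\<Oplus>\<^bsub>L\<^esub>l\<in>{..<N}. a l \<otimes>\<^bsub>L\<^esub> res (pp (Suc i) (E l) \<otimes> inv g))"
    using u ac by (intro L.finsum_cong') auto
  finally have sum: "(\<Oplus>\<^bsub>L\<^esub>l\<in>{..<N}. a l \<otimes>\<^bsub>L\<^esub> res (pp (Suc i) (E l) \<otimes> inv g)) = \<zero>\<^bsub>L\<^esub>"
    using Ks(2) by simp
  have "\<forall>l\<in>{..<N}. a l = \<zero>\<^bsub>L\<^esub>"
  proof (rule independent_family[OF assms(1) _ _ _ g _ a sum])
    show "\<nu> (pp (Suc i) (E l)) = \<nu> g" if "l \<in> {..<N}" for l using val that unfolding g_def by blast
    show "E l k < m k" if "l \<in> {..<N}" "k \<in> {1..i}" for l k using E(1) that by blast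
    show "\<exists>k\<le>i. E l k \<noteq> E l' k" if "l \<in> {..<N}" "l' \<in> {..<N}" "l \<noteq> l'" for l l' using E(2) that by blast
  qed simp
  then show "set (take (length ?Us) Ks) \<subseteq> {\<zero>\<^bsub>L\<^esub>}"
    by (auto simp: in_set_conv_nth a_def split: if_splits)
qed

end

section \<open>Euclidean descent\<close>

context regular_surface
begin

text \<open>Here \<open>z\<close> has positive value, so its residue is zero with minimal polynomial
  of degree 1, and the residue field does not grow.\<close>

lemma blowup_strict:
  assumes "\<nu> u < \<nu> v"
  defines "z \<equiv> v \<otimes> inv u"
  shows "regular_surface K \<nu> (blowup A z) u z"
    "residue_subfield K \<nu> (blowup A z) = residue_subfield K \<nu> A" "A \<subseteq> blowup A z"
proof -
  interpret z: dominated_adjunction K \<nu> A z unfolding z_def by (rule blowup_adjunction) (use assms in simp)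
  have zc: "z \<in> carrier K" "z \<noteq> \<zero>" "\<nu> z = \<nu> v - \<nu> u"
    unfolding z_def using u v u_nonzero v_nonzero by auto
  then have zM: "z \<in> M" using assms by (simp add: M_iff)
  interpret blowup_surface K \<nu> A u v z z 1 "\<lambda>_. \<zero>"
  proof unfold_locales
    show "\<nu> u \<le> \<nu> v" using assms by simp
    show "z = v \<otimes> inv u" unfolding assms(2) by (rule refl)
    show "z = z [^] (1 :: nat) \<oplus> psum (\<lambda>_. \<zero>) z 1" using zc by simp
    fix r i assume "\<And>i. r i \<in> A" "psum r z 1 \<in> M" "i < (1 :: nat)"
    then show "r i \<in> M" by simp
  qed (use zM in auto)
  show "regular_surface K \<nu> (blowup A z) u z" by (rule blowup_regular)
  show "residue_subfield K \<nu> (blowup A z) = residue_subfield K \<nu> A" by (rule z.blowup_residue_M[OF zM])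
  show "A \<subseteq> blowup A z" using z.adj.A_B z.B_blowup by blast
qed

text \<open>Needed because the second parameter of the final ring is the lifted minimal polynomial
  times a power of the unit \<open>z\<close>.\<close>

lemma unit_multiple:
  assumes e: "e \<in> A" "e \<notin> M" shows "regular_surface K \<nu> A u (e \<otimes> v)"
proof (intro regular_surface.intro two_generated.intro two_generated_axioms.intro regular_surface_axioms.intro dominated_ring_axioms)
  note ie = not_M_unit[OF e]
  show "u \<in> A" "u \<in> M" "u \<noteq> \<zero>" using u u_nonzero by auto
  show "e \<otimes> v \<in> A" "e \<otimes> v \<in> M" using e v A_in_V by auto
  fix f assume "f \<in> A" "f \<in> M"
  then obtain a b where ab: "a \<in> A" "b \<in> A" "f = a \<otimes> u \<oplus> b \<otimes> v" using generate by blast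
  have "(b \<otimes> inv e) \<otimes> (e \<otimes> v) = b \<otimes> v"
    using ab e ie v by (simp add: m_assoc)
  then have "f = a \<otimes> u \<oplus> (b \<otimes> inv e) \<otimes> (e \<otimes> v)" using ab ie by simp
  then show "\<exists>a\<in>A. \<exists>b\<in>A. f = a \<otimes> u \<oplus> b \<otimes> (e \<otimes> v)"
    using ab(1) A_closed(4)[OF ab(2) ie(2)] by blast
next
  fix k :: nat and c assume c: "c \<in> A"
  note ie = not_M_unit[OF e]
  show "(e \<otimes> v) [^] k \<noteq> u \<otimes> c"
  proof
    assume eq: "(e \<otimes> v) [^] k = u \<otimes> c"
    have "inv e [^] k \<otimes> (e \<otimes> v) [^] k = v [^] k"
      using e v ie by (simp add: nat_pow_distrib[symmetric])
    then have "v [^] k = inv e [^] k \<otimes> (u \<otimes> c)" using eq ie v by simp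
    also have "\<dots> = u \<otimes> (inv e [^] k \<otimes> c)" using ie u c by (simp add: m_lcomm)
    finally show False using v_pow[of "inv e [^] k \<otimes> c" k] ie c by simp
  qed
qed

end

context valued_field
begin

text \<open>The relation with coefficients \<open>p\<close>, \<open>q\<close> plays the role of two
  integers in Euclid's algorithm: replacing the larger parameter by its quotient subtracts one
  coefficient from the other. The exponent matrix undergoes a column operation, which keeps its
  determinant.\<close>

lemma euclidean_descent:
  fixes T :: "nat \<Rightarrow> 'a set" and N :: enat
  assumes qs: "\<And>j. enat j < N \<Longrightarrow> quadratic_transform K \<nu> (T j) (T (Suc j))"
    and dim1: "\<And>j. N = enat j \<Longrightarrow> krull_dim (K\<lparr>carrier := T j\<rparr>) = 1"
    and "enat j \<le> N" "regular_surface K \<nu> (T j) s t"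
    and "x = s [^] A \<otimes> t [^] B" "y = s [^] C \<otimes> t [^] D" "A * D = B * C + (1 :: nat)"
    and "nsm p (\<nu> t) = nsm q (\<nu> s)" "0 < p" "0 < q"
    and "residue_subfield K \<nu> (T j) = \<kappa>" "R \<subseteq> T j"
    and "\<And>k. k < j \<Longrightarrow> \<not> one_component (K\<lparr>carrier := T k\<rparr>) (x \<otimes> y)"
  shows "\<exists>j s t A B C D. enat j < N \<and> regular_surface K \<nu> (T j) s t \<and> \<nu> s = \<nu> t \<and>
    x = s [^] A \<otimes> t [^] B \<and> y = s [^] C \<otimes> t [^] D \<and> A * D = B * C + (1 :: nat) \<and>
    residue_subfield K \<nu> (T j) = \<kappa> \<and> R \<subseteq> T j \<and> T (Suc j) = blowup (T j) (t \<otimes> inv s) \<and>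
    (\<forall>k\<le>j. \<not> one_component (K\<lparr>carrier := T k\<rparr>) (x \<otimes> y))"
  using assms(3-)
proof (induction "p + q" arbitrary: j s t A B C D p q rule: less_induct)
  case less
  interpret S: regular_surface K \<nu> "T j" s t by (rule less.prems(2))
  interpret S': regular_surface K \<nu> "T j" t s by (rule S.swap)
  note det = less.prems(5) and pq = less.prems(6-8)
  have car: "s \<in> carrier K" "t \<in> carrier K" and nz: "s \<noteq> \<zero>" "t \<noteq> \<zero>"
    using S.u S.v S.u_nonzero S.v_nonzero by auto
  have pos: "0 < \<nu> s" "0 < \<nu> t" using S.u S.v nz by (auto simp: M_iff)
  \<comment> \<open>The sequence can only stop at a ring of dimension one, and \<open>T j\<close>
    has dimension two.\<close>
  have jN: "enat j < N"
    using less.prems(1) dim1[of j] S.krull_dim_2 by (cases "N = enat j") (auto simp: order.order_iff_strict)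
  have "x \<otimes> y = s [^] (A + C) \<otimes> t [^] (B + D)"
    unfolding less.prems(3,4) using car by (simp add: nat_pow_mult[symmetric] m_ac)
  \<comment> \<open>The determinant condition forces \<open>A\<close> and \<open>D\<close> to be
    positive, so both parameters divide the product of \<open>x\<close> and
    \<open>y\<close>.\<close>
  moreover have "0 < A + C" "0 < B + D" using det by (auto intro: ccontr)
  ultimately have "\<not> one_component (K\<lparr>carrier := T j\<rparr>) (x \<otimes> y)" using S.not_one_component by simp
  then have noc: "\<not> one_component (K\<lparr>carrier := T k\<rparr>) (x \<otimes> y)" if "k \<le> j" for k
    using less.prems(11) that by (cases "k = j") auto
  consider "\<nu> s = \<nu> t" | "\<nu> s < \<nu> t" | "\<nu> t < \<nu> s" by fastforce
  then show ?case
  proof cases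
    case 1
    then have "T (Suc j) = blowup (T j) (t \<otimes> inv s)" using S.quadratic_transform_eq[OF _ qs[OF jN]] by simp
    then show ?thesis using 1 jN less.prems noc by blast
  next
    case 2
    define z where "z = t \<otimes> inv s"
    have T: "T (Suc j) = blowup (T j) z"
      using S.quadratic_transform_eq[OF _ qs[OF jN]] 2 unfolding z_def by simp
    note bs = S.blowup_strict[OF 2, folded z_def, folded T]
    have zc: "z \<in> carrier K" "s \<otimes> z = t" unfolding z_def using car nz by auto
    \<comment> \<open>The larger value carries the smaller coefficient, so \<open>q - p\<close> is a
      genuine positive difference.\<close>
    have qp: "p < q"
    proof (rule ccontr)
      assume "\<not> p < q"
      then have "nsm q (\<nu> s) \<le> nsm p (\<nu> s)" using pos by (intro nsm_le_mono) auto
      also have "\<dots> < nsm p (\<nu> t)" using 2 pq by (intro nsm_strict_mono) auto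
      finally show False using pq by simp
    qed
    have xz: "s [^] (a :: nat) \<otimes> t [^] b = s [^] (a + b) \<otimes> z [^] b" for a b :: nat
    proof -
      have "t [^] b = s [^] b \<otimes> z [^] b" using nat_pow_distrib[of s z b] car zc by simp
      then show ?thesis using car zc by (simp add: nat_pow_mult[symmetric] m_assoc)
    qed
    show ?thesis
    proof (rule less.hyps[where p = p and q = "q - p" and j = "Suc j" and s = s and t = z and A = "A + B" and B = B and C = "C + D" and D = D])
      show "p + (q - p) < p + q" using pq qp by simp
      show "enat (Suc j) \<le> N" using jN by (simp add: Suc_ile_eq)
      show "regular_surface K \<nu> (T (Suc j)) s z" by (rule bs)
      show "x = s [^] (A + B) \<otimes> z [^] B" "y = s [^] (C + D) \<otimes> z [^] D" using less.prems(3,4) xz by auto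
      show "(A + B) * D = B * (C + D) + 1" using det by (simp add: algebra_simps)
      have "\<nu> z = \<nu> t - \<nu> s" unfolding z_def using car nz by simp
      then show "nsm p (\<nu> z) = nsm (q - p) (\<nu> s)" using qp pq by (simp add: nsm_diff nsm_diff_right)
      show "residue_subfield K \<nu> (T (Suc j)) = \<kappa>" using bs(2) less.prems(9) by simp
      show "R \<subseteq> T (Suc j)" using bs(3) less.prems(10) by blast
    qed (use pq qp noc in auto)
  next
    case 3
    define z where "z = s \<otimes> inv t"
    have T: "T (Suc j) = blowup (T j) z"
      using S'.quadratic_transform_eq[OF _ qs[OF jN]] 3 unfolding z_def by simp
    note bs = S'.blowup_strict[OF 3, folded z_def, folded T]
    have zc: "z \<in> carrier K" "t \<otimes> z = s" unfolding z_def using car nz by auto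
    have qp: "q < p"
    proof (rule ccontr)
      assume "\<not> q < p"
      then have "nsm p (\<nu> t) \<le> nsm q (\<nu> t)" using pos by (intro nsm_le_mono) auto
      also have "\<dots> < nsm q (\<nu> s)" using 3 pq by (intro nsm_strict_mono) auto
      finally show False using pq by simp
    qed
    interpret S1: regular_surface K \<nu> "T (Suc j)" t z by (rule bs)
    have xz: "s [^] (a :: nat) \<otimes> t [^] b = z [^] a \<otimes> t [^] (a + b)" for a b :: nat
    proof -
      have "s [^] a = t [^] a \<otimes> z [^] a" using nat_pow_distrib[of t z a] car zc by simp
      then show ?thesis using car zc by (simp add: nat_pow_mult[symmetric] m_ac)
    qed
    show ?thesis
    proof (rule less.hyps[where p = "p - q" and q = q and j = "Suc j" and s = z and t = t and A = A and B = "A + B" and C = C and D = "C + D"])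
      show "p - q + q < p + q" using pq qp by simp
      show "enat (Suc j) \<le> N" using jN by (simp add: Suc_ile_eq)
      show "regular_surface K \<nu> (T (Suc j)) z t" by (rule S1.swap)
      show "x = z [^] A \<otimes> t [^] (A + B)" "y = z [^] C \<otimes> t [^] (C + D)" using less.prems(3,4) xz by auto
      show "A * (C + D) = (A + B) * C + 1" using det by (simp add: algebra_simps)
      have "\<nu> z = \<nu> s - \<nu> t" unfolding z_def using car nz by simp
      then show "nsm (p - q) (\<nu> t) = nsm q (\<nu> z)" using qp pq by (simp add: nsm_diff nsm_diff_right)
      show "residue_subfield K \<nu> (T (Suc j)) = \<kappa>" using bs(2) less.prems(9) by simp
      show "R \<subseteq> T (Suc j)" using bs(3) less.prems(10) by blast
    qed (use pq qp noc in auto)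
  qed
qed

end

section \<open>The algorithm\<close>

context valued_field
begin

lemma res_psum:
  assumes "\<And>i. c i \<in> V" "z \<in> V"
  shows "psum c z n \<in> V \<and> res (psum c z n) = L.psum (\<lambda>i. res (c i)) (res z) n"
  using assms by (induction n) auto

text \<open>As with digits in a mixed radix: since \<open>e k < n k\<close> and \<open>n k\<close>
  copies of one value stay below the next value, the contributions of all lower places stay below
  the next place. The exponent of \<open>Q 0\<close> is unrestricted and is therefore kept
  apart.\<close>

lemma val_pp_bound:
  assumes "1 \<le> i" "\<And>k. k \<le> i \<Longrightarrow> Q k \<in> carrier K" "\<And>k. k \<le> i \<Longrightarrow> Q k \<noteq> \<zero>" "0 < \<nu> (Q 1)"
    and "\<And>k. 1 \<le> k \<Longrightarrow> k < i \<Longrightarrow> nsm (n k) (\<nu> (Q k)) < \<nu> (Q (Suc k))"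
    and "\<And>k. 1 \<le> k \<Longrightarrow> k < i \<Longrightarrow> e k < n k"
  shows "0 < \<nu> (Q i) \<and> \<nu> (power_product K Q i e) < nsm (e 0) (\<nu> (Q 0)) + \<nu> (Q i)"
  using assms
proof (induction i rule: dec_induct)
  case base
  then show ?case using power_product_Suc[of 0 Q e] by simp
next
  case (step i)
  have IH: "0 < \<nu> (Q i)" "\<nu> (power_product K Q i e) < nsm (e 0) (\<nu> (Q 0)) + \<nu> (Q i)"
    using step.IH step.prems by auto
  have big: "nsm (n i) (\<nu> (Q i)) < \<nu> (Q (Suc i))" and e: "e i < n i" using step.prems step.hyps by auto
  have "nsm (Suc (e i)) (\<nu> (Q i)) \<le> nsm (n i) (\<nu> (Q i))"
    using e IH(1) by (intro nsm_le_mono) auto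
  then have le: "\<nu> (Q i) + nsm (e i) (\<nu> (Q i)) < \<nu> (Q (Suc i))" using big by simp
  have "\<nu> (power_product K Q (Suc i) e) = \<nu> (power_product K Q i e) + nsm (e i) (\<nu> (Q i))"
    using step.prems by (subst power_product_Suc) (auto simp: power_product_nonzero)
  also have "\<dots> < nsm (e 0) (\<nu> (Q 0)) + \<nu> (Q i) + nsm (e i) (\<nu> (Q i))" using IH(2) by simp
  also have "\<dots> < nsm (e 0) (\<nu> (Q 0)) + \<nu> (Q (Suc i))" using le by (simp add: add.assoc)
  finally have "\<nu> (power_product K Q (Suc i) e) < nsm (e 0) (\<nu> (Q 0)) + \<nu> (Q (Suc i))" .
  moreover have "0 < \<nu> (Q (Suc i))"
    using le IH(1) nsm_nonneg[of "\<nu> (Q i)" "e i"] by (meson add_pos_nonneg less_imp_le less_trans)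
  ultimately show ?case by simp
qed

end

lemma (in dominated_ring) ideal_finsum:
  assumes "is_ideal_of A I" "finite S" "\<And>s. s \<in> S \<Longrightarrow> f s \<in> I"
  shows "(\<Oplus>s\<in>S. f s) \<in> I"
  using assms(2,3)
proof (induction S rule: finite_induct)
  case empty then show ?case using ideal_closed(1)[OF assms(1)] by simp
next
  case (insert s S)
  have "f k \<in> carrier K" if "k \<in> insert s S" for k using insert.prems[OF that] ideal_closed(2)[OF assms(1)] by auto
  then have "(\<Oplus>s\<in>insert s S. f s) = f s \<oplus> (\<Oplus>s\<in>S. f s)" using insert.hyps by (intro finsum_insert) auto
  then show ?case using insert ideal_closed(3)[OF assms(1)] by simp
qed

locale algorithm = regular_surface K \<nu> R x y for K (structure) and \<nu> R x y +
  fixes CS \<Omega> P w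
  assumes cs: "coefficient_set (K\<lparr>carrier := R\<rparr>) CS"
    and alg: "algorithm_sequence K \<nu> R CS x y \<Omega> P w"
begin

abbreviation "nb i \<equiv> the_enat (value_index \<nu> P i)"
abbreviation "d i \<equiv> the_enat (alpha_degree K \<nu> R P w i)"
abbreviation "n \<equiv> step_degree K \<nu> R P w"
abbreviation "pp \<equiv> power_product K P"
abbreviation "\<alpha> \<equiv> alpha K \<nu> P w"
abbreviation "F \<equiv> adjoin K \<nu> R \<alpha>"
abbreviation "U i \<equiv> pp i (w i)"
abbreviation "\<theta> i \<equiv> P i [^] nb i \<otimes> inv (U i)"

lemma n_eq: "n i = nb i * d i" by (simp add: step_degree_def)

lemma start: "P 0 = x" "P 1 = y" "1 \<le> \<Omega>"
  using alg by (auto simp: algorithm_sequence_def)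

lemma step:
  assumes "1 \<le> i" "enat i < \<Omega>"
  shows "value_index \<nu> P i \<noteq> \<infinity>" "balancing_exponents K \<nu> P n i (w i)" "algorithm_step K \<nu> R CS P w i"
  using alg assms unfolding algorithm_sequence_def
  by (metis less_imp_le less_irrefl)+

lemma pp_1: "pp 1 e = x [^] e 0"
  using power_product_Suc[of 0 P e] start(1) u by simp

lemma final:
  assumes "\<Omega> = enat i" "1 \<le> i"
  shows "value_index \<nu> P i = \<infinity> \<or>
    value_index \<nu> P i \<noteq> \<infinity> \<and> balancing_exponents K \<nu> P n i (w i) \<and> alpha_degree K \<nu> R P w i = \<infinity>"
  using alg assms unfolding algorithm_sequence_def by (metis less_irrefl order_refl)

lemma CS_R: "a \<in> CS \<Longrightarrow> a \<in> R"
  using cs by (auto simp: coefficient_set_def)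

text \<open>The class of the maximal ideal is already represented by \<open>\<zero>\<close>. This
  provides the unit coefficients that a key sequence demands.\<close>

lemma CS_unit:
  assumes "a \<in> CS" "a \<noteq> \<zero>" shows "a \<notin> M"
proof
  assume aM: "a \<in> M"
  interpret R: cring "K\<lparr>carrier := R\<rparr>" by (rule subring_cring[OF sub])
  have I: "ideal (R \<inter> M) (K\<lparr>carrier := R\<rparr>)" using ideal_iff[OF sub] maximal_ideal by blast
  have inj: "inj_on (\<lambda>a. (R \<inter> M) +>\<^bsub>K\<lparr>carrier := R\<rparr>\<^esub> a) CS" and z: "\<zero> \<in> CS"
    using cs by (auto simp: coefficient_set_def max_ideal_A bij_betw_def)
  have "(R \<inter> M) +>\<^bsub>K\<lparr>carrier := R\<rparr>\<^esub> a = R \<inter> M" "(R \<inter> M) +>\<^bsub>K\<lparr>carrier := R\<rparr>\<^esub> \<zero> = R \<inter> M"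
    using R.a_rcos_zero[OF I] aM CS_R[OF assms(1)] A_closed(1) by auto
  then show False using inj_onD[OF inj _ assms(1) z] assms(2) by simp
qed

lemma balance:
  assumes "balancing_exponents K \<nu> P n i (w i)" shows "\<nu> (U i) = \<nu> (P i [^] nb i)"
  using assms by (simp add: balancing_exponents_def)

definition good where
  "good i \<longleftrightarrow> (\<forall>k\<le>i. P k \<in> R \<and> P k \<in> M \<and> P k \<noteq> \<zero>)"

lemma goodD:
  assumes "good i" "k \<le> i" shows "P k \<in> R" "P k \<in> M" "P k \<noteq> \<zero>" "P k \<in> carrier K"
  using assms by (auto simp: good_def)

lemma pp_good:
  assumes "good i" "k \<le> Suc i" shows "pp k e \<in> R" "pp k e \<noteq> \<zero>"
proof -
  show "pp k e \<noteq> \<zero>" using assms goodD[OF assms(1)] by (intro power_product_nonzero) auto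
  show "pp k e \<in> R" using assms(2)
  proof (induction k)
    case (Suc k)
    then show ?case using goodD[OF assms(1)] by (subst power_product_Suc) auto
  qed simp
qed

lemma theta_unit:
  assumes "balancing_exponents K \<nu> P n i (w i)" "good i"
  shows "\<theta> i \<in> V - M" "\<alpha> i = res (\<theta> i)"
proof -
  have "U i \<in> R" "U i \<noteq> \<zero>" using pp_good[OF assms(2)] by auto
  then show "\<theta> i \<in> V - M"
    using balance[OF assms(1)] goodD[OF assms(2), of i] by (intro unitI) auto
  show "\<alpha> i = res (\<theta> i)" by (simp add: alpha_def)
qed

lemma good_mono: "good i \<Longrightarrow> k \<le> i \<Longrightarrow> good k" by (auto simp: good_def)

lemma F_generators:
  assumes "enat i < \<Omega>" "good i" "k \<le> i" shows "residue_subfield K \<nu> R \<union> \<alpha> ` {1..k} \<subseteq> carrier L"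
proof -
  have "\<alpha> j \<in> carrier L" if "j \<in> {1..k}" for j
  proof -
    have "enat j < \<Omega>" using assms that by (meson atLeastAtMost_iff enat_ord_simps(1) le_trans order.strict_trans1)
    then show ?thesis using theta_unit[OF step(2)[of j]] good_mono[OF assms(2), of j] that assms(3) by auto
  qed
  then show ?thesis using subfieldE(3)[OF residue_subfield] by auto
qed

lemma F_subfield: "enat i < \<Omega> \<Longrightarrow> good i \<Longrightarrow> k \<le> i \<Longrightarrow> subfield (F k) L"
  unfolding adjoin_def by (intro L.generate_field_is_subfield F_generators)

text \<open>\<open>C t\<close> lifts the coefficient \<open>b\<^sub>i\<^sub>,\<^sub>t\<close> of the minimal polynomial.\<close>

definition expansion ::
    "nat \<Rightarrow> (nat \<Rightarrow> nat) \<Rightarrow> (nat \<Rightarrow> nat \<Rightarrow> 'a) \<Rightarrow> (nat \<Rightarrow> nat \<Rightarrow> nat \<Rightarrow> nat) \<Rightarrow> (nat \<Rightarrow> 'a) \<Rightarrow> bool" where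
  "expansion i lam a j C \<longleftrightarrow>
    (\<forall>t<d i. \<forall>s\<in>{1..lam t}. a s t \<in> CS \<and> (\<forall>k\<in>{1..<i}. j s t k < n k) \<and>
       \<nu> (pp i (j s t)) = nsm ((d i - t) * nb i) (\<nu> (P i))) \<and>
    (\<forall>t. C t \<in> V) \<and> (\<forall>t. d i \<le> t \<longrightarrow> C t = \<zero>) \<and>
    (\<forall>t<d i. C t = (\<Oplus>s\<in>{1..lam t}. a s t \<otimes> pp i (j s t)) \<otimes> inv (U i [^] (d i - t))) \<and>
    has_minimal_polynomial L (F (i - 1)) (\<alpha> i) (d i) (\<lambda>t. res (C t)) \<and>
    P (Suc i) = P i [^] n i \<oplus>
      (\<Oplus>t\<in>{..<d i}. (\<Oplus>s\<in>{1..lam t}. a s t \<otimes> pp i (j s t)) \<otimes> P i [^] (t * nb i)) \<and>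
    P (Suc i) = U i [^] d i \<otimes> (\<theta> i [^] d i \<oplus> psum C (\<theta> i) (d i)) \<and>
    \<theta> i [^] d i \<oplus> psum C (\<theta> i) (d i) \<in> M"

lemma expansionD:
  assumes "expansion i lam a j C"
  shows "\<And>s t. t < d i \<Longrightarrow> s \<in> {1..lam t} \<Longrightarrow> a s t \<in> CS"
    "\<And>s t k. t < d i \<Longrightarrow> s \<in> {1..lam t} \<Longrightarrow> k \<in> {1..<i} \<Longrightarrow> j s t k < n k"
    "\<And>s t. t < d i \<Longrightarrow> s \<in> {1..lam t} \<Longrightarrow> \<nu> (pp i (j s t)) = nsm ((d i - t) * nb i) (\<nu> (P i))"
    "\<And>t. C t \<in> V"
    "\<And>t. t < d i \<Longrightarrow> C t = (\<Oplus>s\<in>{1..lam t}. a s t \<otimes> pp i (j s t)) \<otimes> inv (U i [^] (d i - t))"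
    "has_minimal_polynomial L (F (i - 1)) (\<alpha> i) (d i) (\<lambda>t. res (C t))"
    "P (Suc i) = P i [^] n i \<oplus>
      (\<Oplus>t\<in>{..<d i}. (\<Oplus>s\<in>{1..lam t}. a s t \<otimes> pp i (j s t)) \<otimes> P i [^] (t * nb i))"
    "P (Suc i) = U i [^] d i \<otimes> (\<theta> i [^] d i \<oplus> psum C (\<theta> i) (d i))"
    "\<theta> i [^] d i \<oplus> psum C (\<theta> i) (d i) \<in> M"
    "\<And>t. d i \<le> t \<Longrightarrow> C t = \<zero>"
  using assms unfolding expansion_def by blast+

lemma expansion_exists:
  assumes i: "1 \<le> i" "enat i < \<Omega>" and good: "good i"
  shows "\<exists>lam a j C. expansion i lam a j C"
proof -
  obtain lam :: "nat \<Rightarrow> nat" and a :: "nat \<Rightarrow> nat \<Rightarrow> 'a" and j :: "nat \<Rightarrow> nat \<Rightarrow> nat \<Rightarrow> nat" where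
    aj: "\<forall>t<d i. \<forall>s\<in>{1..lam t}. a s t \<in> CS \<and> (\<forall>k\<in>{1..<i}. j s t k < n k) \<and>
           \<nu> (pp i (j s t) \<otimes> (P i [^] (t * nb i))) = \<nu> (P i [^] n i)"
    and mp: "has_minimal_polynomial L (F (i - 1)) (\<alpha> i) (d i)
          (\<lambda>t. res ((\<Oplus>s\<in>{1..lam t}. a s t \<otimes> pp i (j s t)) \<otimes> inv (U i [^] (d i - t))))"
    and P: "P (Suc i) = P i [^] n i \<oplus>
      (\<Oplus>t\<in>{..<d i}. (\<Oplus>s\<in>{1..lam t}. a s t \<otimes> pp i (j s t)) \<otimes> P i [^] (t * nb i))"
    using step(3)[OF i] unfolding algorithm_step_def Let_def by blast
  have Pi: "P i \<in> carrier K" "P i \<noteq> \<zero>" using goodD[OF good] by auto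
  have pc: "pp i e \<in> carrier K" "pp i e \<noteq> \<zero>" for e using pp_good[OF good, of i e] by auto
  have ac: "a s t \<in> R" "a s t \<in> carrier K" "a s t \<in> V" if "t < d i" "s \<in> {1..lam t}" for s t
    using aj CS_R A_in_V that by auto
  have val: "\<nu> (pp i (j s t)) = nsm ((d i - t) * nb i) (\<nu> (P i))" if "t < d i" "s \<in> {1..lam t}" for s t
  proof -
    have "\<nu> (pp i (j s t)) + nsm (t * nb i) (\<nu> (P i)) = nsm (nb i * d i) (\<nu> (P i))"
      using aj that Pi pc unfolding n_eq by auto
    moreover have "nb i * d i = (d i - t) * nb i + t * nb i"
      using that(1) by (metis add_mult_distrib le_add_diff_inverse2 less_imp_le mult.commute)
    ultimately show ?thesis by (simp add: nsm_add)
  qed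
  define S where "S t = (\<Oplus>s\<in>{1..lam t}. a s t \<otimes> pp i (j s t))" for t
  \<comment> \<open>All terms of \<open>S t\<close> have the value of
    \<open>U i ^ (d i - t)\<close>, so the quotient lies in \<open>V\<close>. The zeros from
    \<open>d i\<close> on make it a total coefficient function.\<close>
  define C where "C t = (if t < d i then S t \<otimes> inv (U i [^] (d i - t)) else \<zero>)" for t
  have Sc: "S t \<in> carrier K" if "t < d i" for t
    unfolding S_def using ac[OF that] pc by (intro finsum_closed) auto
  have vU: "\<nu> (U i [^] k) = nsm (k * nb i) (\<nu> (P i))" for k :: nat
    using balance[OF step(2)[OF i]] pc Pi by (simp add: nsm_mult)
  have CV: "C t \<in> V" for t
  proof (cases "t < d i")
    case True
    have "C t = (\<Oplus>s\<in>{1..lam t}. a s t \<otimes> pp i (j s t) \<otimes> inv (U i [^] (d i - t)))"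
      unfolding C_def S_def using True ac[OF True] pc by (simp, intro finsum_ldistr) auto
    also have "\<dots> \<in> V"
    proof (rule conjunct1[OF res_finsum])
      fix s assume s: "s \<in> {1..lam t}"
      have "pp i (j s t) \<otimes> inv (U i [^] (d i - t)) \<in> V"
        using val[OF True s] vU pc by (intro V_divide) auto
      then have "a s t \<otimes> (pp i (j s t) \<otimes> inv (U i [^] (d i - t))) \<in> V" using ac[OF True s] by simp
      then show "a s t \<otimes> pp i (j s t) \<otimes> inv (U i [^] (d i - t)) \<in> V"
        using ac[OF True s] pc by (simp add: m_assoc)
    qed simp
    finally show ?thesis .
  qed (simp add: C_def)
  have mp': "has_minimal_polynomial L (F (i - 1)) (\<alpha> i) (d i) (\<lambda>t. res (C t))"
  proof -
    have "map (\<lambda>t. res ((\<Oplus>s\<in>{1..lam t}. a s t \<otimes> pp i (j s t)) \<otimes> inv (U i [^] (d i - t)))) (rev [0..<d i]) =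
      map (\<lambda>t. res (C t)) (rev [0..<d i])" by (simp add: C_def S_def)
    then show ?thesis using mp unfolding has_minimal_polynomial_def by simp
  qed
  have tV: "\<theta> i \<in> V" "\<theta> i \<in> carrier K" using theta_unit(1)[OF step(2)[OF i] good] by auto
  have Uc: "U i \<in> carrier K" "U i \<noteq> \<zero>" using pc by auto
  \<comment> \<open>Writing \<open>U i ^ d i\<close> as \<open>U i ^ (d i - t)\<close> times
    \<open>U i ^ t\<close> clears the denominators of \<open>C t\<close> and of the
    \<open>t\<close>-th power of \<open>\<theta> i\<close> at once.\<close>
  have fac: "P (Suc i) = U i [^] d i \<otimes> (\<theta> i [^] d i \<oplus> psum C (\<theta> i) (d i))"
  proof -
    have tp: "\<theta> i [^] k = P i [^] (k * nb i) \<otimes> inv (U i [^] k)" for k :: nat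
      using Pi Uc by (simp add: divide_pow nat_pow_pow mult.commute)
    have "psum C (\<theta> i) (d i) = (\<Oplus>t\<in>{..<d i}. C t \<otimes> \<theta> i [^] t)"
      using CV tV by (intro psum_eq_finsum) auto
    then have "U i [^] d i \<otimes> psum C (\<theta> i) (d i) = (\<Oplus>t\<in>{..<d i}. U i [^] d i \<otimes> (C t \<otimes> \<theta> i [^] t))"
      using CV tV Uc by (simp, intro finsum_rdistr) auto
    also have "\<dots> = (\<Oplus>t\<in>{..<d i}. S t \<otimes> P i [^] (t * nb i))"
    proof (rule finsum_cong')
      show "(\<lambda>t. S t \<otimes> P i [^] (t * nb i)) \<in> {..<d i} \<rightarrow> carrier K" using Sc Pi by auto
      fix t assume "t \<in> {..<d i}"
      then have t: "t < d i" by simp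
      define A B q where "A = U i [^] (d i - t)" and "B = U i [^] t" and "q = P i [^] (t * nb i)"
      have car: "A \<in> carrier K" "B \<in> carrier K" "q \<in> carrier K" "A \<noteq> \<zero>" "B \<noteq> \<zero>" "inv A \<in> carrier K" "inv B \<in> carrier K"
        unfolding A_def B_def q_def using Uc Pi by auto
      have "U i [^] d i = A \<otimes> B" unfolding A_def B_def using t Uc by (simp add: nat_pow_mult)
      then have "U i [^] d i \<otimes> (C t \<otimes> \<theta> i [^] t) = (A \<otimes> B) \<otimes> ((S t \<otimes> inv A) \<otimes> (q \<otimes> inv B))"
        unfolding tp C_def A_def[symmetric] B_def[symmetric] q_def[symmetric] using t by simp
      also have "\<dots> = (A \<otimes> inv A) \<otimes> (B \<otimes> inv B) \<otimes> (S t \<otimes> q)" using car Sc[OF t] by algebra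
      also have "\<dots> = S t \<otimes> q" using car Sc[OF t] by simp
      finally show "U i [^] d i \<otimes> (C t \<otimes> \<theta> i [^] t) = S t \<otimes> P i [^] (t * nb i)" unfolding q_def .
    qed simp
    finally have 1: "U i [^] d i \<otimes> psum C (\<theta> i) (d i) = (\<Oplus>t\<in>{..<d i}. S t \<otimes> P i [^] (t * nb i))" .
    have 2: "U i [^] d i \<otimes> \<theta> i [^] d i = P i [^] n i"
      unfolding tp n_eq using Pi Uc by (simp add: mult.commute)
    have "psum C (\<theta> i) (d i) \<in> carrier K" using CV tV by simp
    then show ?thesis unfolding P S_def[symmetric] using 1 2 Uc tV by (simp add: r_distr)
  qed
  \<comment> \<open>Its residue is the minimal polynomial of \<open>\<alpha> i\<close> evaluated at
    \<open>\<alpha> i\<close>.\<close>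
  have "\<theta> i [^] d i \<oplus> psum C (\<theta> i) (d i) \<in> M"
  proof -
    note rp = res_psum[of C "\<theta> i" "d i", OF CV tV(1)]
    have sf: "subfield (F (i - 1)) L" by (rule F_subfield[OF i(2) good]) simp
    have ai: "\<alpha> i = res (\<theta> i)" "\<alpha> i \<in> carrier L" using theta_unit[OF step(2)[OF i] good] by auto
    have "res (\<theta> i [^] d i \<oplus> psum C (\<theta> i) (d i)) = \<zero>\<^bsub>L\<^esub>"
      using L.minimal_polynomial_props(3)[OF sf ai(2) mp'] rp tV unfolding ai(1) by simp
    then show ?thesis using res_zero_iff[of "\<theta> i [^] d i \<oplus> psum C (\<theta> i) (d i)"] rp tV by simp
  qed
  moreover have "\<forall>t<d i. C t = S t \<otimes> inv (U i [^] (d i - t))" by (simp add: C_def)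
  moreover have "\<forall>t. d i \<le> t \<longrightarrow> C t = \<zero>" by (simp add: C_def)
  ultimately have "expansion i lam a j C"
    using aj val CV mp' P fac unfolding expansion_def S_def by blast
  then show ?thesis by blast
qed

lemma pp_divisible:
  assumes "1 \<le> k" "good i" "k \<le> Suc i" "0 < e 0" shows "\<exists>r\<in>R. pp k e = x \<otimes> r"
  using assms(1,3)
proof (induction k rule: dec_induct)
  case base
  have "pp 1 e = x [^] e 0" using power_product_Suc[of 0 P e] start(1) u by simp
  also have "\<dots> = x \<otimes> x [^] (e 0 - 1)" using assms(4) u by (cases "e 0") (auto simp: m_comm)
  finally show ?case using u by auto
next
  case (step k)
  then obtain r where r: "r \<in> R" "pp k e = x \<otimes> r" by auto
  have "pp (Suc k) e = pp k e \<otimes> P k [^] e k"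
    using step.prems goodD[OF assms(2)] by (intro power_product_Suc) auto
  then have "pp (Suc k) e = x \<otimes> (r \<otimes> P k [^] e k)"
    unfolding r(2) using r(1) u goodD[OF assms(2), of k] step.prems by (simp add: m_assoc)
  then show ?case using r(1) goodD[OF assms(2), of k] step.prems by auto
qed

text \<open>Being a power of \<open>y\<close> modulo \<open>x\<close> certifies that an element is
  not zero, since no power of \<open>y\<close> is a multiple of \<open>x\<close>.\<close>

definition monic_mod_x where "monic_mod_x f \<longleftrightarrow> (\<exists>N :: nat. \<exists>r\<in>R. f = y [^] N \<oplus> x \<otimes> r)"

lemma monic_mod_x_pow:
  assumes "monic_mod_x f" shows "monic_mod_x (f [^] (k :: nat))"
proof (induction k)
  case 0
  have "f [^] (0 :: nat) = y [^] (0 :: nat) \<oplus> x \<otimes> \<zero>" using u by simp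
  then show ?case unfolding monic_mod_x_def using A_closed(1) by blast
next
  case (Suc k)
  obtain N r where f: "r \<in> R" "f = y [^] (N :: nat) \<oplus> x \<otimes> r" using assms by (auto simp: monic_mod_x_def)
  obtain N' r' where fk: "r' \<in> R" "f [^] k = y [^] (N' :: nat) \<oplus> x \<otimes> r'" using Suc by (auto simp: monic_mod_x_def)
  have car: "r \<in> carrier K" "r' \<in> carrier K" "x \<in> carrier K" "y [^] N \<in> carrier K" "y [^] N' \<in> carrier K"
    using f fk u v by auto
  have "f [^] Suc k = (y [^] N' \<oplus> x \<otimes> r') \<otimes> (y [^] N \<oplus> x \<otimes> r)" using fk f(2) by simp
  also have "\<dots> = y [^] N' \<otimes> y [^] N \<oplus> x \<otimes> (y [^] N' \<otimes> r \<oplus> r' \<otimes> (y [^] N \<oplus> x \<otimes> r))" using car by algebra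
  also have "y [^] N' \<otimes> y [^] N = y [^] (N' + N)" using v by (simp add: nat_pow_mult)
  finally show ?case unfolding monic_mod_x_def using f fk u v by (auto intro!: exI[of _ "N' + N"])
qed

text \<open>The three claims support each other: the value inequalities below \<open>i\<close> make
  every correction term divisible by \<open>x\<close>, this makes the next element a power of
  \<open>y\<close> modulo \<open>x\<close> and hence nonzero, and only for a nonzero element does
  the next value inequality make sense.\<close>

lemma P_props:
  "enat i \<le> \<Omega> \<Longrightarrow> good i \<and> (\<forall>k. 1 \<le> k \<and> k \<le> i \<longrightarrow> monic_mod_x (P k)) \<and>
    (\<forall>k. 1 \<le> k \<and> k < i \<longrightarrow> nsm (n k) (\<nu> (P k)) < \<nu> (P (Suc k)))"
proof (induction i)
  case 0
  then show ?case using start(1) u u_nonzero by (auto simp: good_def)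
next
  case (Suc i)
  have i\<Omega>: "enat i < \<Omega>" using Suc.prems by (simp add: Suc_ile_eq)
  then have IH: "good i" "\<And>k. 1 \<le> k \<Longrightarrow> k \<le> i \<Longrightarrow> monic_mod_x (P k)"
    "\<And>k. 1 \<le> k \<Longrightarrow> k < i \<Longrightarrow> nsm (n k) (\<nu> (P k)) < \<nu> (P (Suc k))" using Suc.IH by auto
  have all: "(\<forall>k\<le>Suc i. Z k) \<longleftrightarrow> (\<forall>k\<le>i. Z k) \<and> Z (Suc i)" for Z by (auto simp: le_Suc_eq)
  show ?case
  proof (cases "i = 0")
    case True
    have "y = y [^] (1 :: nat) \<oplus> x \<otimes> \<zero>" using u v by simp
    then have "monic_mod_x y" unfolding monic_mod_x_def using A_closed(1) by blast
    then show ?thesis using True IH(1) start(2) v v_nonzero by (auto simp: good_def le_Suc_eq)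
  next
    case False
    then have i1: "1 \<le> i" by simp
    note good = IH(1)
    have Pi: "P i \<in> R" "P i \<in> carrier K" "P i \<noteq> \<zero>" "0 < \<nu> (P i)"
      using goodD[OF good, of i] by (auto simp: M_iff)
    obtain lam a j C where "expansion i lam a j C" using expansion_exists[OF i1 i\<Omega> good] by blast
    note E = expansionD[OF this]
    note a = E(1) and j = E(2) and val = E(3) and CV = E(4) and P = E(7) and fac = E(8) and facM = E(9)
    have nb: "0 < nb i" by (rule value_index_finite(1)[OF step(1)[OF i1 i\<Omega>]])
    \<comment> \<open>Without a factor \<open>x\<close>, the mixed radix estimate bounds the value
      of the monomial strictly by \<open>\<nu> (P i)\<close>, whereas it is a positive multiple of
      \<open>\<nu> (P i)\<close>.\<close>
    have j0: "0 < j s t 0" if "t < d i" "s \<in> {1..lam t}" for s t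
    proof (rule ccontr)
      assume "\<not> 0 < j s t 0"
      moreover have "0 < \<nu> (P 1)" using goodD[OF good, of 1] i1 by (auto simp: M_iff)
      ultimately have "\<nu> (pp i (j s t)) < \<nu> (P i)"
        using val_pp_bound[OF i1, of P n "j s t"] goodD[OF good] IH(3) j[OF that] by auto
      moreover have "nsm 1 (\<nu> (P i)) \<le> nsm ((d i - t) * nb i) (\<nu> (P i))"
        using Pi nb that by (intro nsm_le_mono) (auto simp: Suc_le_eq)
      ultimately show False using val[OF that] by simp
    qed
    have xI: "is_ideal_of R {x \<otimes> c | c. c \<in> R}" by (rule principal_ideal[OF u(1)])
    have "(\<Oplus>t\<in>{..<d i}. (\<Oplus>s\<in>{1..lam t}. a s t \<otimes> pp i (j s t)) \<otimes> P i [^] (t * nb i)) \<in> {x \<otimes> c | c. c \<in> R}"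
    proof (rule ideal_finsum[OF xI])
      fix t assume "t \<in> {..<d i}"
      then have t: "t < d i" by simp
      have "(\<Oplus>s\<in>{1..lam t}. a s t \<otimes> pp i (j s t)) \<in> {x \<otimes> c | c. c \<in> R}"
      proof (rule ideal_finsum[OF xI])
        fix s assume s: "s \<in> {1..lam t}"
        have "pp i (j s t) \<in> {x \<otimes> c |c. c \<in> R}" using pp_divisible[OF i1 good, of "j s t"] j0[OF t s] by auto
        then show "a s t \<otimes> pp i (j s t) \<in> {x \<otimes> c | c. c \<in> R}"
          using ideal_closed(4)[OF xI] CS_R[OF a[OF t s]] by blast
      qed simp
      then show "(\<Oplus>s\<in>{1..lam t}. a s t \<otimes> pp i (j s t)) \<otimes> P i [^] (t * nb i) \<in> {x \<otimes> c | c. c \<in> R}"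
        using ideal_closed(5)[OF xI] A_pow[OF Pi(1), of "t * nb i"] by blast
    qed simp
    then obtain r where r: "r \<in> R" "P (Suc i) = P i [^] n i \<oplus> x \<otimes> r" using P by auto
    obtain N r' where N: "r' \<in> R" "P i [^] n i = y [^] (N :: nat) \<oplus> x \<otimes> r'"
      using monic_mod_x_pow[OF IH(2)[OF i1 order_refl], of "n i"] by (auto simp: monic_mod_x_def)
    have car: "r \<in> carrier K" "r' \<in> carrier K" "x \<in> carrier K" "y [^] N \<in> carrier K" using r N u v by auto
    have PN: "P (Suc i) = y [^] N \<oplus> x \<otimes> (r' \<oplus> r)" unfolding r(2) N(2) using car by algebra
    then have mon: "monic_mod_x (P (Suc i))" unfolding monic_mod_x_def using A_closed(3)[OF N(1) r(1)] by blast
    have PR: "P (Suc i) \<in> R" unfolding PN using r N u v by simp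
    have nz: "P (Suc i) \<noteq> \<zero>"
    proof
      assume "P (Suc i) = \<zero>"
      then have "y [^] N = \<ominus> (x \<otimes> (r' \<oplus> r))" using PN car by (intro sum_zero_eq_neg) auto
      then have "y [^] N = x \<otimes> (\<ominus> (r' \<oplus> r))" using car by (simp add: r_minus)
      then show False using v_pow[of "\<ominus> (r' \<oplus> r)" N] r N by simp
    qed
    have Uc: "U i \<in> carrier K" "U i \<noteq> \<zero>" using pp_good[OF good, of i "w i"] by auto
    define f where "f = \<theta> i [^] d i \<oplus> psum C (\<theta> i) (d i)"
    have fM: "f \<in> M" and fK: "f \<in> carrier K" using facM M_carrier unfolding f_def by auto
    have fnz: "f \<noteq> \<zero>" using nz fac Uc unfolding f_def by auto
    \<comment> \<open>The factor \<open>U i ^ d i\<close> accounts for exactly \<open>n i\<close>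
      times \<open>\<nu> (P i)\<close>; the other factor \<open>f\<close> lies in \<open>M\<close>
      and adds a positive amount.\<close>
    have "\<nu> (U i [^] d i) = nsm (n i) (\<nu> (P i))"
      using balance[OF step(2)[OF i1 i\<Omega>]] Uc Pi unfolding n_eq by (simp add: nsm_mult mult.commute[of "nb i"])
    then have vP: "\<nu> (P (Suc i)) = nsm (n i) (\<nu> (P i)) + \<nu> f"
      using fac Uc fnz fK unfolding f_def[symmetric] by simp
    then have big: "nsm (n i) (\<nu> (P i)) < \<nu> (P (Suc i))" using fM fnz by (simp add: M_iff)
    have "0 < \<nu> (P (Suc i))" using le_less_trans[OF nsm_nonneg[OF less_imp_le[OF Pi(4)]] big] .
    then have PM: "P (Suc i) \<in> M" using nz PR by (simp add: M_iff)
    show ?thesis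
    proof (intro conjI allI impI)
      show "good (Suc i)" using good PR PM nz unfolding good_def all by simp
      fix k assume "1 \<le> k \<and> k \<le> Suc i"
      then show "monic_mod_x (P k)" using IH(2) mon by (auto simp: le_Suc_eq)
    next
      fix k assume "1 \<le> k \<and> k < Suc i"
      then show "nsm (n k) (\<nu> (P k)) < \<nu> (P (Suc k))" using IH(3) big by (auto simp: less_Suc_eq)
    qed
  qed
qed

end

section \<open>The last quadratic transform\<close>

lemma (in field) generate_field_subfield:
  assumes "subfield F R" shows "generate_field R F = F"
  using generate_field_min_subfield1[of F F] assms subfieldE(3)[OF assms] generate_field.incl[of _ F R] by blast

text \<open>\<open>res\<close> restricted to \<open>A\<close> has kernel \<open>A \<inter> M\<close>
  and is constant on its cosets, so \<open>the_elem\<close> picks the common residue.\<close>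

lemma (in dominated_ring) residue_iso:
  "\<exists>h \<in> ring_iso (K\<lparr>carrier := A\<rparr> Quot max_ideal (K\<lparr>carrier := A\<rparr>))
      (L\<lparr>carrier := residue_subfield K \<nu> A\<rparr>).
    \<forall>f \<in> A. h (max_ideal (K\<lparr>carrier := A\<rparr>) +>\<^bsub>K\<lparr>carrier := A\<rparr>\<^esub> f) = res f"
proof -
  let ?A = "K\<lparr>carrier := A\<rparr>" and ?S = "L\<lparr>carrier := residue_subfield K \<nu> A\<rparr>"
  have rA: "cring ?A" by (rule subring_cring[OF sub])
  have rS: "ring ?S" using L.subfield_iff(2)[OF residue_subfield] field.is_ring by blast
  have hom: "res \<in> ring_hom ?A ?S"
  proof (rule ring_hom_memI)
    fix a assume "a \<in> carrier ?A"
    then show "res a \<in> carrier ?S" by (simp add: residue_subfield_def)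
  next
    fix a b assume "a \<in> carrier ?A" "b \<in> carrier ?A"
    then have "a \<in> V" "b \<in> V" using A_in_V by simp_all
    then show "res (a \<otimes>\<^bsub>?A\<^esub> b) = res a \<otimes>\<^bsub>?S\<^esub> res b" "res (a \<oplus>\<^bsub>?A\<^esub> b) = res a \<oplus>\<^bsub>?S\<^esub> res b"
      by simp_all
  qed simp
  interpret h: ring_hom_ring ?A ?S res by (rule ring_hom_ringI2[OF cring.axioms(1)[OF rA] rS hom])
  have "res a = \<zero>\<^bsub>L\<^esub> \<longleftrightarrow> a \<in> M" if "a \<in> A" for a
    by (rule res_zero_iff[OF A_in_V[OF that]])
  then have ker: "a_kernel ?A ?S res = A \<inter> M"
    unfolding a_kernel_def' by fastforce
  have iso: "(\<lambda>c. the_elem (res ` c)) \<in> ring_iso (?A Quot (A \<inter> M)) ?S"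
    using h.FactRing_iso_set unfolding ker by (simp add: residue_subfield_def)
  have "the_elem (res ` ((A \<inter> M) +>\<^bsub>?A\<^esub> f)) = res f" if f: "f \<in> A" for f
  proof -
    have "res g = res f" if g: "g \<in> (A \<inter> M) +>\<^bsub>?A\<^esub> f" for g
    proof -
      obtain m where m: "m \<in> A" "m \<in> M" "g = m \<oplus> f" using g by (auto simp: a_r_coset_def')
      have "res m = \<zero>\<^bsub>L\<^esub>" using res_zero_iff[of m] m A_in_V by auto
      then show ?thesis using m f A_in_V[OF m(1)] A_in_V[OF f] by simp
    qed
    moreover have "f \<in> (A \<inter> M) +>\<^bsub>?A\<^esub> f" using f by (force simp: a_r_coset_def')
    ultimately have "res ` ((A \<inter> M) +>\<^bsub>?A\<^esub> f) = {res f}" by blast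
    then show ?thesis by simp
  qed
  then show ?thesis using iso unfolding max_ideal_A by (intro bexI[of _ "\<lambda>c. the_elem (res ` c)"]) auto
qed

text \<open>The situation after the last quadratic transform \<open>S\<close> whose parameters \<open>s\<close>, \<open>t\<close> both divide \<open>x y\<close>.\<close>

locale algorithm_end = algorithm K \<nu> R x y CS \<Omega> P w + S: regular_surface K \<nu> S s t
  for K (structure) and \<nu> R x y CS \<Omega> P w S s t +
  fixes A B C D :: nat
  assumes two: "2 \<le> \<Omega>" and st: "\<nu> s = \<nu> t"
    and x_eq: "x = s [^] A \<otimes> t [^] B" and y_eq: "y = s [^] C \<otimes> t [^] D" and det: "A * D = B * C + 1"
    and residue_S: "residue_subfield K \<nu> S = residue_subfield K \<nu> R" and R_S: "R \<subseteq> S"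
begin

definition z where "z = t \<otimes> inv s"
abbreviation "\<omega> \<equiv> C + D"
abbreviation "T \<equiv> blowup S z"

lemma s_props [simp]: "s \<in> S" "s \<in> carrier K" "s \<noteq> \<zero>" "0 < \<nu> s"
  using S.u S.u_nonzero by (auto simp: M_iff)

lemma z_props [simp]: "z \<in> carrier K" "z \<noteq> \<zero>" "\<nu> z = 0" "z \<in> V" "z \<notin> M"
proof -
  have t: "t \<in> carrier K" "t \<noteq> \<zero>" using S.v S.v_nonzero by auto
  show 1: "z \<in> carrier K" "z \<noteq> \<zero>" "\<nu> z = 0" unfolding z_def using t st by auto
  show "z \<in> V" "z \<notin> M" using unitI[OF 1] by auto
qed

lemma t_eq: "t = s \<otimes> z"
  unfolding z_def using S.v S.u S.u_nonzero by simp

lemma monomial_eq: "s [^] (i :: nat) \<otimes> t [^] (j :: nat) = s [^] (i + j) \<otimes> z [^] j"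
proof -
  have "t [^] j = s [^] j \<otimes> z [^] j" by (subst t_eq, rule nat_pow_distrib) auto
  then have "s [^] i \<otimes> t [^] j = s [^] i \<otimes> s [^] j \<otimes> z [^] j" by (simp add: m_assoc)
  also have "s [^] i \<otimes> s [^] j = s [^] (i + j)" by (rule nat_pow_mult) auto
  finally show ?thesis .
qed

lemma x_sz: "x = s [^] (A + B) \<otimes> z [^] B" and y_sz: "y = s [^] \<omega> \<otimes> z [^] D"
  unfolding x_eq y_eq monomial_eq by auto

lemma AD_pos: "0 < A" "0 < D"
  using det by (cases A; cases D; simp)+

lemma val_x: "\<nu> x = nsm (A + B) (\<nu> s)" and val_y: "\<nu> y = nsm \<omega> (\<nu> s)"
  unfolding x_sz y_sz by auto

lemma one_lt: "enat 1 < \<Omega>"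
proof -
  have "enat 1 < 2" by (simp add: numeral_eq_enat)
  then show ?thesis using two by (rule less_le_trans)
qed

lemma good1: "good 1"
  using P_props[of 1] one_lt by simp

text \<open>The determinant condition reads \<open>(A + B) * D = B * \<omega> + 1\<close>, so
  \<open>A + B\<close> and \<omega> are coprime. The balance of \<open>U 1\<close> makes
  \<open>A + B\<close> a divisor of the index, and equality of \<open>A + B\<close> times
  \<open>\<nu> y\<close> with \<omega> times \<open>\<nu> x\<close> gives the converse
  divisibility.\<close>

lemma first_exponents: "nb 1 = A + B" "w 1 0 = \<omega>"
proof -
  have "nsm (w 1 0) (\<nu> x) = nsm (nb 1) (\<nu> y)"
    using balance[OF step(2)[OF order_refl one_lt]] start u v u_nonzero v_nonzero
    unfolding pp_1 by (simp del: One_nat_def)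
  then have "nsm (w 1 0 * (A + B)) (\<nu> s) = nsm (nb 1 * \<omega>) (\<nu> s)" by (simp only: val_x val_y nsm_mult)
  then have eq: "w 1 0 * (A + B) = nb 1 * \<omega>" by (simp only: nsm_inj[OF s_props(4)])
  have id: "(A + B) * D = B * \<omega> + 1" using det by (simp add: algebra_simps)
  have "coprime (A + B) \<omega>"
  proof (rule coprimeI)
    fix q assume q: "q dvd A + B" "q dvd \<omega>"
    then have "q dvd B * \<omega> + 1" unfolding id[symmetric] by simp
    then show "is_unit q" using q(2) by (metis dvd_add_right_iff dvd_mult)
  qed
  moreover have "A + B dvd nb 1 * \<omega>" unfolding eq[symmetric] by simp
  ultimately have 1: "A + B dvd nb 1" by (simp add: coprime_dvd_mult_left_iff)
  have "nsm (A + B) (\<nu> (P 1)) = nsm \<omega> (\<nu> (P 0))"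
    unfolding start val_x val_y nsm_mult[symmetric] by (simp add: mult.commute)
  also have "\<dots> \<in> group_closure ((\<lambda>k. \<nu> (P k)) ` {..<1})"
    by (intro group_closure_nsm group_closure.base) auto
  finally have "nb 1 dvd A + B" by (rule value_index_finite(3)[OF step(1)[OF order_refl one_lt]])
  with 1 show nb: "nb 1 = A + B" by (rule dvd_antisym[symmetric])
  show "w 1 0 = \<omega>" using eq AD_pos unfolding nb by (simp add: mult.commute)
qed

text \<open>The powers of \<open>s\<close> cancel, and the exponent of \<open>z\<close> is
  \<open>D * (A + B) - B * \<omega>\<close>, the determinant.\<close>

lemma theta_1: "\<theta> 1 = z"
proof -
  have y: "y [^] (A + B) = s [^] (\<omega> * (A + B)) \<otimes> z [^] (D * (A + B))"
    and x: "x [^] \<omega> = s [^] ((A + B) * \<omega>) \<otimes> z [^] (B * \<omega>)"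
    unfolding x_sz y_sz by (simp_all add: nat_pow_distrib nat_pow_pow)
  have "D * (A + B) = Suc (B * \<omega>)" using det by (simp add: algebra_simps)
  then have "z \<otimes> x [^] \<omega> = y [^] (A + B)" unfolding x y by (simp add: m_ac mult.commute[of \<omega>])
  then have "z = y [^] (A + B) \<otimes> inv (x [^] \<omega>)" using u v u_nonzero by (subst eq_divide_iff) auto
  then show ?thesis unfolding first_exponents start pp_1 by simp
qed

lemma alpha_1: "\<alpha> 1 = res z"
  using theta_unit(2)[OF step(2)[OF order_refl one_lt] good1] unfolding theta_1 .

lemma F_0: "F 0 = residue_subfield K \<nu> R"
  unfolding adjoin_def using L.generate_field_subfield[OF residue_subfield] by simp

text \<open>The lift is the polynomial of the first algorithm step with \<open>z\<close> in place of
  the variable. It has to have coefficients in \<open>R\<close>, and it has to be minimal over the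
  residue field of \<open>S\<close>, which equals that of \<open>R\<close>.\<close>

lemma first_step: "\<exists>g c. blowup_surface K \<nu> S s t z g (d 1) c \<and> P 2 = x [^] (\<omega> * d 1) \<otimes> g"
proof -
  obtain lam a j c where "expansion 1 lam a j c" using expansion_exists[OF order_refl one_lt good1] by blast
  note E = expansionD[OF this]
  have U: "U 1 = x [^] \<omega>" unfolding pp_1 first_exponents ..
  have vx: "0 < \<nu> x" and x: "x \<in> carrier K" using u u_nonzero by (auto simp: M_iff)
  have cR: "c k \<in> R" for k
  proof (cases "k < d 1")
    case k: True
    \<comment> \<open>Only powers of \<open>x\<close> are available in the first step, and the
      prescribed value determines the exponent. So all these monomials coincide and cancel against
      the denominator of \<open>c k\<close>, leaving a sum of coefficients.\<close>
    have ppj: "pp 1 (j l k) = U 1 [^] (d 1 - k)" if "l \<in> {1..lam k}" for l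
    proof -
      have "nsm (j l k 0) (\<nu> x) = nsm ((d 1 - k) * nb 1) (\<nu> y)"
        using E(3)[OF k that] x u_nonzero start unfolding pp_1 by simp
      also have "\<dots> = nsm ((d 1 - k) * \<omega>) (\<nu> x)"
        unfolding first_exponents val_x val_y nsm_mult[symmetric] by (simp only: ac_simps)
      finally have "j l k 0 = (d 1 - k) * \<omega>" by (simp only: nsm_inj[OF vx])
      then show ?thesis unfolding pp_1 first_exponents using x by (simp only: nat_pow_pow mult.commute)
    qed
    have aR: "a l k \<in> R" if "l \<in> {1..lam k}" for l using E(1)[OF k that] CS_R by simp
    have Uc: "U 1 [^] (d 1 - k) \<in> carrier K" "U 1 [^] (d 1 - k) \<noteq> \<zero>" unfolding U using x u_nonzero by auto
    have sumR: "(\<Oplus>l\<in>{1..lam k}. a l k) \<in> R"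
      by (rule ideal_finsum[of R]) (auto simp: is_ideal_of_def aR)
    have "(\<Oplus>l\<in>{1..lam k}. a l k \<otimes> pp 1 (j l k)) = (\<Oplus>l\<in>{1..lam k}. a l k \<otimes> U 1 [^] (d 1 - k))"
      using ppj aR Uc by (intro finsum_cong') auto
    also have "\<dots> = (\<Oplus>l\<in>{1..lam k}. a l k) \<otimes> U 1 [^] (d 1 - k)"
      using aR Uc by (intro finsum_ldistr[symmetric]) auto
    finally have "c k = (\<Oplus>l\<in>{1..lam k}. a l k) \<otimes> U 1 [^] (d 1 - k) \<otimes> inv (U 1 [^] (d 1 - k))"
      unfolding E(5)[OF k] by simp
    also have "\<dots> = (\<Oplus>l\<in>{1..lam k}. a l k)" by (rule divide_mult_cancel(3)) (use Uc sumR in auto)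
    finally show ?thesis using sumR by simp
  qed (use E(10) in simp)
  define g where "g = z [^] d 1 \<oplus> psum c z (d 1)"
  have "r i \<in> M" if r: "\<And>i. r i \<in> S" and "psum r z (d 1) \<in> M" "i < d 1" for r i
  proof -
    have rV: "r i \<in> V" for i using r S.A_in_V by blast
    note rp = res_psum[of r z "d 1", OF rV z_props(4)]
    have "res (r i) \<in> F (1 - 1)" for i using r residue_S F_0 by (auto simp: residue_subfield_def)
    moreover have "L.psum (\<lambda>i. res (r i)) (\<alpha> 1) (d 1) = \<zero>\<^bsub>L\<^esub>"
      using that(2) rp res_zero_iff unfolding alpha_1 by metis
    moreover have "subfield (F (1 - 1)) L" using F_subfield[OF one_lt good1, of 0] by simp
    moreover have "\<alpha> 1 \<in> carrier L" unfolding alpha_1 by simp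
    ultimately have "\<forall>i<d 1. res (r i) = \<zero>\<^bsub>L\<^esub>"
      using L.minimal_polynomial_props(4)[OF _ _ E(6), of "\<lambda>i. res (r i)"] by blast
    then show "r i \<in> M" using that(3) res_zero_iff[OF rV] by blast
  qed
  moreover have "g \<in> M" using E(9) unfolding theta_1 g_def by simp
  moreover have "c i \<in> S" for i using cR R_S by blast
  ultimately have "blowup_surface K \<nu> S s t z g (d 1) c"
    using st z_def g_def S.regular_surface_axioms
    by (intro blowup_surface.intro blowup_surface_axioms.intro) auto
  moreover have "P 2 = x [^] (\<omega> * d 1) \<otimes> g"
  proof -
    have "P (Suc 1) = x [^] (\<omega> * d 1) \<otimes> g"
      using E(8) unfolding theta_1 g_def[symmetric] unfolding U nat_pow_pow[OF x] .
    then show ?thesis by (simp add: numeral_2_eq_2)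
  qed
  ultimately show ?thesis by blast
qed

lemma adjunction_z: "dominated_adjunction K \<nu> S z"
  using first_step unfolding blowup_surface_def
  using S.blowup_adjunction st z_def by simp

sublocale Z: dominated_adjunction K \<nu> S z by (rule adjunction_z)

lemma S_T: "S \<subseteq> T" using Z.B_blowup Z.adj.A_B by blast
lemma R_T: "R \<subseteq> T" using S_T R_S by blast
lemma z_T: "z \<in> T" using Z.B_blowup Z.adj.z_B by blast

text \<open>Since \<open>n 1 = (A + B) * d 1\<close>, the factor \<open>x ^ (\<omega> * d 1)\<close>
  of \<open>P 2\<close> is exactly \<open>s ^ (\<omega> * n 1)\<close> times a power of
  \<open>z\<close>. The quotient is the lift \<open>g\<close> times a unit.\<close>

lemma surface_T: "regular_surface K \<nu> T s (P 2 \<otimes> inv (s [^] (\<omega> * n 1)))"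
proof -
  obtain g c where b: "blowup_surface K \<nu> S s t z g (d 1) c" and P: "P 2 = x [^] (\<omega> * d 1) \<otimes> g"
    using first_step by blast
  interpret T: regular_surface K \<nu> T s g by (rule blowup_surface.blowup_regular[OF b])
  have "x [^] (\<omega> * d 1) = s [^] (\<omega> * n 1) \<otimes> z [^] (B * (\<omega> * d 1))"
    unfolding x_sz n_eq first_exponents by (simp add: nat_pow_distrib nat_pow_pow algebra_simps)
  then have "P 2 \<otimes> inv (s [^] (\<omega> * n 1)) = s [^] (\<omega> * n 1) \<otimes> (z [^] (B * (\<omega> * d 1)) \<otimes> g) \<otimes> inv (s [^] (\<omega> * n 1))"
    unfolding P using T.v by (simp add: m_assoc)
  also have "\<dots> = z [^] (B * (\<omega> * d 1)) \<otimes> g"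
    using T.v by (subst m_comm[of "s [^] (\<omega> * n 1)"]) auto
  finally have eq: "P 2 \<otimes> inv (s [^] (\<omega> * n 1)) = z [^] (B * (\<omega> * d 1)) \<otimes> g" .
  show ?thesis unfolding eq
  proof (rule T.unit_multiple)
    show "z [^] (B * (\<omega> * d 1)) \<in> T" using z_T by simp
    show "z [^] (B * (\<omega> * d 1)) \<notin> M" using unitI[of "z [^] (B * (\<omega> * d 1))"] by auto
  qed
qed

sublocale T: regular_surface K \<nu> T s "P 2 \<otimes> inv (s [^] (\<omega> * n 1))" by (rule surface_T)

lemma z_pow_unit: "z [^] (k :: nat) \<in> T" "z [^] k \<notin> M" "z [^] k \<in> V - M"
proof -
  show "z [^] k \<in> T" using z_T by simp
  show "z [^] k \<in> V - M" by (rule unitI) auto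
  then show "z [^] k \<notin> M" by simp
qed

lemma residue_T: "residue_subfield K \<nu> T = F 1"
  unfolding Z.blowup_residue residue_S adjoin_def alpha_1[symmetric] by simp

lemma one_component_T: "one_component (K\<lparr>carrier := T\<rparr>) (x \<otimes> y)"
proof -
  have "x \<otimes> y = z [^] (B + D) \<otimes> s [^] (A + B + \<omega>)"
    unfolding x_sz y_sz by (simp add: nat_pow_mult[symmetric] m_ac)
  then show ?thesis using T.one_component_unit_power z_pow_unit AD_pos by simp
qed

text \<open>Both \<open>x\<close> and \<open>y\<close> are multiples of \<open>s\<close>, and
  \<open>x\<close> is a unit times a power of \<open>s\<close>.\<close>

lemma exceptional_T: "PIdl\<^bsub>K\<lparr>carrier := T\<rparr>\<^esub> s = exceptional_ideal K R T"
proof (rule T.exceptional_ideal_u[OF R_T])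
  show "M \<inter> R = max_ideal (K\<lparr>carrier := R\<rparr>)" unfolding max_ideal_A by auto
  have pow: "s [^] k \<otimes> z [^] l = s \<otimes> (s [^] (k - 1) \<otimes> z [^] l)" if "0 < k" for k l :: nat
    using that by (cases k) (auto simp: m_ac)
  fix f assume "f \<in> R" "f \<in> M"
  then obtain a b where f: "a \<in> R" "b \<in> R" "f = a \<otimes> x \<oplus> b \<otimes> y" using generate by blast
  define x' y' where "x' = s [^] (A + B - 1) \<otimes> z [^] B" and "y' = s [^] (\<omega> - 1) \<otimes> z [^] D"
  have xy: "x = s \<otimes> x'" "y = s \<otimes> y'" "x' \<in> T" "y' \<in> T"
    unfolding x'_def y'_def using x_sz y_sz pow AD_pos z_pow_unit T.u by auto
  have T: "a \<in> T" "b \<in> T" using f R_T by auto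
  have car: "a \<in> carrier K" "b \<in> carrier K" "x' \<in> carrier K" "y' \<in> carrier K" "s \<in> carrier K"
    using T xy by auto
  have "f = s \<otimes> (a \<otimes> x' \<oplus> b \<otimes> y')" unfolding f(3) xy(1,2) using car by algebra
  then show "\<exists>c\<in>T. f = s \<otimes> c" using T xy by auto
next
  show "z [^] B \<in> T" "z [^] B \<notin> M" using z_pow_unit by auto
  show "z [^] B \<otimes> s [^] (A + B) \<in> R" using u(1) unfolding x_sz by (simp add: m_comm)
  show "0 < A + B" using AD_pos by simp
qed

end

section \<open>The transformed sequence\<close>

context algorithm_end
begin

text \<open>The exponent of \<open>s\<close> in \<open>P l\<close>. For \<open>l \<ge> 2\<close> the
  cofactor is \<open>Qf (l - 1)\<close>; for \<open>x\<close> and \<open>y\<close> it is a power of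
  \<open>z\<close>, which is why index 0 follows no product formula.\<close>

definition Ex where "Ex l = (if l = 0 then A + B else \<omega> * (\<Prod>k = 1..l - 1. n k))"
definition Qf where "Qf l = (if l = 0 then s else P (Suc l) \<otimes> inv (s [^] (\<omega> * (\<Prod>k = 1..l. n k))))"
abbreviation "ppQ \<equiv> power_product K Qf"

lemma Ex_simps: "Ex 0 = A + B" "Ex (Suc 0) = \<omega>" "Ex (Suc (Suc l)) = n (Suc l) * Ex (Suc l)"
  by (simp_all add: Ex_def mult.commute mult.left_commute)

lemma Qf_0: "Qf 0 = s"
  by (simp add: Qf_def)

lemma Qf_1: "Qf 1 = P 2 \<otimes> inv (s [^] (\<omega> * n 1))"
  by (simp add: Qf_def numeral_2_eq_2)

lemma P_good:
  assumes "enat i \<le> \<Omega>" shows "good i" "P i \<in> carrier K" "P i \<noteq> \<zero>" "P i \<in> R"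
  using P_props[OF assms] by (auto simp: good_def)

lemma enat_mono: "enat j \<le> \<Omega> \<Longrightarrow> i \<le> j \<Longrightarrow> enat i \<le> \<Omega>"
  by (meson enat_ord_simps(1) order_trans)

lemma Q_props:
  assumes "1 \<le> l" "enat (Suc l) \<le> \<Omega>"
  shows "Qf l \<in> carrier K" "Qf l \<noteq> \<zero>" "P (Suc l) = s [^] Ex (Suc l) \<otimes> Qf l"
    "\<nu> (P (Suc l)) = nsm (Ex (Suc l)) (\<nu> s) + \<nu> (Qf l)"
proof -
  have Q: "Qf l = P (Suc l) \<otimes> inv (s [^] Ex (Suc l))" using assms(1) by (simp add: Qf_def Ex_def)
  note P = P_good[OF assms(2)]
  show 1: "Qf l \<in> carrier K" "Qf l \<noteq> \<zero>" "P (Suc l) = s [^] Ex (Suc l) \<otimes> Qf l"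
    unfolding Q using P by simp_all
  show "\<nu> (P (Suc l)) = nsm (Ex (Suc l)) (\<nu> s) + \<nu> (Qf l)"
    unfolding 1(3) using 1(1,2) by simp
qed

lemma Q_car:
  assumes "enat (Suc l) \<le> \<Omega>" shows "Qf l \<in> carrier K" "Qf l \<noteq> \<zero>"
  using Q_props[OF _ assms] by (cases l; simp add: Qf_0)+

text \<open>The exponent of \<open>s\<close> is multiplied by exactly \<open>n (Suc l)\<close> from
  one element to the next, so its contribution cancels from the corresponding inequality for
  \<open>P\<close>.\<close>

lemma Q_big:
  assumes "1 \<le> l" "enat (Suc (Suc l)) \<le> \<Omega>"
  shows "nsm (n (Suc l)) (\<nu> (Qf l)) < \<nu> (Qf (Suc l))"
proof -
  have "nsm (n (Suc l)) (\<nu> (P (Suc l))) < \<nu> (P (Suc (Suc l)))"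
    using P_props[OF assms(2)] assms(1) by auto
  also have "\<nu> (P (Suc (Suc l))) = nsm (n (Suc l) * Ex (Suc l)) (\<nu> s) + \<nu> (Qf (Suc l))"
    using Q_props(4)[of "Suc l"] assms unfolding Ex_simps by simp
  also have "nsm (n (Suc l)) (\<nu> (P (Suc l))) = nsm (n (Suc l) * Ex (Suc l)) (\<nu> s) + nsm (n (Suc l)) (\<nu> (Qf l))"
    using Q_props(4)[OF assms(1) enat_mono[OF assms(2)]] by (simp add: nsm_add_right nsm_mult)
  finally show ?thesis by simp
qed

lemma Q_pos: "enat (Suc l) \<le> \<Omega> \<Longrightarrow> 0 < \<nu> (Qf l)"
proof (induction l)
  case 0 show ?case by (simp add: Qf_0)
next
  case (Suc l)
  show ?case
  proof (cases "l = 0")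
    case True
    have "Qf 1 \<noteq> \<zero>" "Qf 1 \<in> M" using T.v T.v_nonzero unfolding Qf_1 by auto
    then show ?thesis using True by (simp add: M_iff)
  next
    case False
    have "0 \<le> nsm (n (Suc l)) (\<nu> (Qf l))"
      using Suc.IH[OF enat_mono[OF Suc.prems]] by (intro nsm_nonneg) simp
    then show ?thesis using Q_big[of l] False Suc.prems by simp
  qed
qed

text \<open>By the determinant condition \<open>D\<close> times \<open>\<nu> x\<close> minus
  \<open>B\<close> times \<open>\<nu> y\<close> is \<open>\<nu> s\<close>. So the values of
  \<open>x\<close> and \<open>y\<close> together generate the same group as \<open>\<nu> s\<close>
  alone, and one generator is saved.\<close>

lemma closure_Q:
  assumes "1 \<le> m" "enat m \<le> \<Omega>"
  shows "group_closure ((\<lambda>k. \<nu> (Qf k)) ` {..<m}) = group_closure ((\<lambda>k. \<nu> (P k)) ` {..<Suc m})"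
proof
  let ?GQ = "group_closure ((\<lambda>k. \<nu> (Qf k)) ` {..<m})" and ?GP = "group_closure ((\<lambda>k. \<nu> (P k)) ` {..<Suc m})"
  have Qin: "\<nu> (Qf k) \<in> ?GQ" if "k < m" for k using that by (intro group_closure.base) auto
  have Pin: "\<nu> (P k) \<in> ?GP" if "k < Suc m" for k using that by (intro group_closure.base) auto
  have "nsm D (\<nu> x) = nsm (D * (A + B)) (\<nu> s)" unfolding val_x by (simp only: nsm_mult)
  also have "D * (A + B) = B * \<omega> + 1" using det by (simp add: algebra_simps)
  also have "nsm (B * \<omega> + 1) (\<nu> s) = nsm B (\<nu> y) + \<nu> s" unfolding val_y by (simp only: nsm_mult nsm_add) simp
  finally have "\<nu> s = nsm D (\<nu> (P 0)) - nsm B (\<nu> (P 1))" unfolding start by simp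
  also have "\<dots> \<in> ?GP" using assms(1) by (intro group_closure.diff group_closure_nsm Pin) auto
  finally have s: "\<nu> s \<in> ?GP" .
  have "\<nu> (Qf k) \<in> ?GP" if "k < m" for k
  proof (cases "k = 0")
    case False
    have "\<nu> (Qf k) = \<nu> (P (Suc k)) - nsm (Ex (Suc k)) (\<nu> s)"
      using Q_props(4)[of k] False enat_mono[OF assms(2), of "Suc k"] that by simp
    then show ?thesis using that s by (auto intro!: group_closure.diff group_closure_nsm Pin)
  qed (use s in \<open>simp add: Qf_0\<close>)
  then show "?GQ \<subseteq> ?GP" by (intro group_closure_least) auto
  have s': "\<nu> s \<in> ?GQ" using Qin[of 0] assms(1) by (simp add: Qf_0)
  have "\<nu> (P k) \<in> ?GQ" if "k < Suc m" for k
  proof -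
    consider "k = 0" | "k = 1" | l where "k = Suc l" "1 \<le> l" by (cases k; force)
    then show ?thesis
    proof cases
      case 1 then show ?thesis using s' by (simp only: start val_x group_closure_nsm)
    next
      case 2 then show ?thesis using s' by (simp only: start val_y group_closure_nsm)
    next
      case 3
      have "\<nu> (P k) = nsm (Ex (Suc l)) (\<nu> s) + \<nu> (Qf l)"
        unfolding 3 using Q_props(4)[of l] 3 enat_mono[OF assms(2), of "Suc l"] that by simp
      also have "\<dots> \<in> ?GQ" using s' 3 that by (intro group_closure_add group_closure_nsm Qin) auto
      finally show ?thesis .
    qed
  qed
  then show "?GP \<subseteq> ?GQ" by (intro group_closure_least) auto
qed

lemma value_index_Q:
  assumes "1 \<le> l" "enat (Suc l) \<le> \<Omega>" shows "value_index \<nu> Qf l = value_index \<nu> P (Suc l)"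
  unfolding value_index_def lessThan_Suc_atMost[symmetric]
  using closure_Q[OF assms(1) enat_mono[OF assms(2)]] closure_Q[OF _ assms(2)] by simp

lemma ppQ_props:
  assumes "enat i \<le> \<Omega>" shows "ppQ i f \<in> carrier K" "ppQ i f \<noteq> \<zero>"
  using Q_car enat_mono[OF assms] by (auto intro!: power_product_closed power_product_nonzero)

lemma ppQ_Suc:
  assumes "enat (Suc i) \<le> \<Omega>" shows "ppQ (Suc i) f = ppQ i f \<otimes> Qf i [^] f i"
  using Q_car enat_mono[OF assms] by (intro power_product_Suc) auto

lemma pp_P_Suc:
  assumes "enat i \<le> \<Omega>" shows "pp (Suc i) e = pp i e \<otimes> P i [^] e i"
  using P_good(2)[OF enat_mono[OF assms]] by (intro power_product_Suc) auto

text \<open>Powers of \<open>z\<close> come only from \<open>x\<close> and \<open>y\<close>. The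
  exponent of \<open>Qf 0\<close> is left at zero because the power of \<open>s\<close> is collected
  separately and is inserted by \<open>ppQ_first\<close>.\<close>

lemma pp_PQ:
  assumes "1 \<le> i" "enat i \<le> \<Omega>"
  shows "pp (Suc i) e =
    z [^] (B * e 0 + D * e 1) \<otimes> s [^] (\<Sum>k\<le>i. Ex k * e k) \<otimes> ppQ i (\<lambda>k. if k = 0 then 0 else e (Suc k))"
  using assms
proof (induction i rule: dec_induct)
  case base
  have "pp (Suc 1) e = x [^] e 0 \<otimes> y [^] e 1"
    unfolding pp_P_Suc[OF base(1)] pp_1 start ..
  also have "\<dots> = (s [^] ((A + B) * e 0) \<otimes> z [^] (B * e 0)) \<otimes> (s [^] (\<omega> * e 1) \<otimes> z [^] (D * e 1))"
    unfolding x_sz y_sz by (simp add: nat_pow_distrib nat_pow_pow)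
  also have "\<dots> = z [^] (B * e 0 + D * e 1) \<otimes> s [^] ((A + B) * e 0 + \<omega> * e 1)"
    by (simp add: nat_pow_mult[symmetric] m_ac)
  finally show ?case
    using ppQ_Suc[of 0 "\<lambda>k. if k = 0 then 0 else e (Suc k)"] base by (simp add: Ex_simps)
next
  case (step i)
  have i\<Omega>: "enat i \<le> \<Omega>" using enat_mono[OF step.prems] by simp
  note Q = Q_props[OF step.hyps(1) step.prems]
  define q where "q = ppQ i (\<lambda>k. if k = 0 then 0 else e (Suc k))"
  have q: "q \<in> carrier K" unfolding q_def by (rule ppQ_props[OF i\<Omega>])
  have "pp (Suc (Suc i)) e = pp (Suc i) e \<otimes> P (Suc i) [^] e (Suc i)"
    by (rule pp_P_Suc[OF step.prems])
  also have "P (Suc i) [^] e (Suc i) = s [^] (Ex (Suc i) * e (Suc i)) \<otimes> Qf i [^] e (Suc i)"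
    unfolding Q(3) using Q(1) by (simp add: nat_pow_distrib nat_pow_pow)
  also have "pp (Suc i) e = z [^] (B * e 0 + D * e 1) \<otimes> s [^] (\<Sum>k\<le>i. Ex k * e k) \<otimes> q"
    unfolding q_def using step.IH[OF i\<Omega>] .
  also have "z [^] (B * e 0 + D * e 1) \<otimes> s [^] (\<Sum>k\<le>i. Ex k * e k) \<otimes> q \<otimes> (s [^] (Ex (Suc i) * e (Suc i)) \<otimes> Qf i [^] e (Suc i)) =
    z [^] (B * e 0 + D * e 1) \<otimes> s [^] ((\<Sum>k\<le>i. Ex k * e k) + Ex (Suc i) * e (Suc i)) \<otimes> (q \<otimes> Qf i [^] e (Suc i))"
    using Q(1) q by (simp add: nat_pow_mult[symmetric] m_ac del: nat_pow_Suc)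
  also have "q \<otimes> Qf i [^] e (Suc i) = ppQ (Suc i) (\<lambda>k. if k = 0 then 0 else e (Suc k))"
    unfolding q_def using step.hyps(1) by (subst ppQ_Suc[OF step.prems]) auto
  finally show ?case by simp
qed

lemma ppQ_first:
  assumes "1 \<le> i" "enat i \<le> \<Omega>"
  shows "ppQ i (\<lambda>k. if k = 0 then q else f k) = s [^] (q :: nat) \<otimes> ppQ i (\<lambda>k. if k = 0 then 0 else f k)"
  using assms
proof (induction i rule: dec_induct)
  case base
  then show ?case using ppQ_Suc[of 0] by (simp add: Qf_0)
next
  case (step i)
  have i\<Omega>: "enat i \<le> \<Omega>" using enat_mono[OF step.prems] by simp
  show ?case
    using step.IH[OF i\<Omega>] ppQ_props[OF i\<Omega>] Q_car[OF step.prems] step.hyps(1)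
    by (simp add: ppQ_Suc[OF step.prems] m_assoc)
qed

text \<open>
  \<open>conv i h e\<close> is the exponent vector in \<open>Q\<^sub>0, \<dots>, Q\<^sub>i\<^sub>-\<^sub>1\<close> of the monomial with exponents \<open>e\<close>
  in \<open>P\<^sub>0, \<dots>, P\<^sub>i\<close>, divided by \<open>s\<^sup>h\<close> and by a power of the unit \<open>z\<close>.
\<close>

definition conv where "conv i h e = (\<lambda>k. if k = 0 then (\<Sum>k\<le>i. Ex k * e k) - h else e (Suc k))"

text \<open>The subtraction in \<open>conv\<close> is one of natural numbers, so the total exponent
  of \<open>s\<close> must be at least \<open>h * Ex (Suc i)\<close>. Otherwise, as the remaining
  factor has value below \<open>\<nu> (Qf i)\<close> by the mixed radix estimate, the monomial would
  have too small a value.\<close>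

lemma conversion:
  assumes i: "1 \<le> i" "enat (Suc i) \<le> \<Omega>" and e: "\<And>k. 1 \<le> k \<Longrightarrow> k \<le> i \<Longrightarrow> e k < n k"
    and val: "\<nu> (pp (Suc i) e) = nsm h (\<nu> (P (Suc i)))" and h: "0 < h"
  defines "f \<equiv> conv i (h * Ex (Suc i)) e"
  shows "pp (Suc i) e = z [^] (B * e 0 + D * e 1) \<otimes> s [^] (h * Ex (Suc i)) \<otimes> ppQ i f"
    "\<nu> (ppQ i f) = nsm h (\<nu> (Qf i))"
proof -
  have i\<Omega>: "enat i \<le> \<Omega>" using enat_mono[OF i(2)] by simp
  define E where "E = (\<Sum>k\<le>i. Ex k * e k)"
  define q where "q = ppQ i (\<lambda>k. if k = 0 then 0 else e (Suc k))"
  have q: "q \<in> carrier K" "q \<noteq> \<zero>" unfolding q_def using ppQ_props[OF i\<Omega>] by auto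
  have pp: "pp (Suc i) e = z [^] (B * e 0 + D * e 1) \<otimes> s [^] E \<otimes> q"
    unfolding E_def q_def by (rule pp_PQ[OF i(1) i\<Omega>])
  have vP: "nsm E (\<nu> s) + \<nu> q = nsm (h * Ex (Suc i)) (\<nu> s) + nsm h (\<nu> (Qf i))"
    using val q unfolding pp Q_props(4)[OF i] by (simp add: nsm_add_right nsm_mult)
  have le: "h * Ex (Suc i) \<le> E"
  proof (rule ccontr)
    assume "\<not> h * Ex (Suc i) \<le> E"
    then have "nsm E (\<nu> s) \<le> nsm (h * Ex (Suc i)) (\<nu> s)"
      by (intro nsm_le_mono less_imp_le[OF s_props(4)]) auto
    moreover have "\<nu> (Qf i) \<le> nsm h (\<nu> (Qf i))"
      using h nsm_le_mono[OF less_imp_le[OF Q_pos[OF i(2)]], of 1 h] by simp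
    moreover have "\<nu> q < \<nu> (Qf i)"
    proof -
      have "\<nu> (ppQ i (\<lambda>k. if k = 0 then 0 else e (Suc k))) < nsm 0 (\<nu> (Qf 0)) + \<nu> (Qf i)"
        using val_pp_bound[OF i(1), of Qf "\<lambda>k. n (Suc k)" "\<lambda>k. if k = 0 then 0 else e (Suc k)"]
          Q_car Q_pos Q_big enat_mono[OF i(2)] e i(1) by simp
      then show ?thesis unfolding q_def by simp
    qed
    ultimately have "nsm E (\<nu> s) + \<nu> q < nsm (h * Ex (Suc i)) (\<nu> s) + nsm h (\<nu> (Qf i))"
      by (meson add_le_less_mono less_le_trans)
    then show False using vP by simp
  qed
  have f: "ppQ i f = s [^] (E - h * Ex (Suc i)) \<otimes> q"
    unfolding f_def conv_def q_def E_def by (rule ppQ_first[OF i(1) i\<Omega>])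
  have "s [^] E = s [^] (h * Ex (Suc i)) \<otimes> s [^] (E - h * Ex (Suc i))" using le by (simp add: nat_pow_mult)
  then show "pp (Suc i) e = z [^] (B * e 0 + D * e 1) \<otimes> s [^] (h * Ex (Suc i)) \<otimes> ppQ i f"
    unfolding pp f using q by (simp add: m_assoc)
  have "\<nu> (ppQ i f) = nsm E (\<nu> s) - nsm (h * Ex (Suc i)) (\<nu> s) + \<nu> q"
    unfolding f using q le by (simp add: nsm_diff)
  then show "\<nu> (ppQ i f) = nsm h (\<nu> (Qf i))" using vP by (simp add: algebra_simps)
qed

definition v' where "v' i = conv i (nb (Suc i) * Ex (Suc i)) (w (Suc i))"
text \<open>The power of \<open>z\<close> lost in passing from \<open>U (Suc i)\<close> to the
  comparison monomial of \<open>Qf i\<close>.\<close>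

definition \<eta> where "\<eta> i = B * w (Suc i) 0 + D * w (Suc i) 1"
definition balanced where "balanced i \<longleftrightarrow> value_index \<nu> P i \<noteq> \<infinity> \<and> balancing_exponents K \<nu> P n i (w i)"
abbreviation "\<alpha>' \<equiv> alpha K \<nu> Qf v'"

lemma U_Q:
  assumes i: "1 \<le> i" "enat (Suc i) \<le> \<Omega>" and b: "balanced (Suc i)"
  shows "U (Suc i) = z [^] \<eta> i \<otimes> s [^] (nb (Suc i) * Ex (Suc i)) \<otimes> ppQ i (v' i)"
    "balancing_exponents K \<nu> Qf (\<lambda>k. n (Suc k)) i (v' i)"
    "\<nu> (ppQ i (v' i)) = nsm (nb (Suc i)) (\<nu> (Qf i))"
proof -
  have nb: "0 < nb (Suc i)" using value_index_finite(1) b by (auto simp: balanced_def)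
  have be: "\<And>k. 1 \<le> k \<Longrightarrow> k \<le> i \<Longrightarrow> w (Suc i) k < n k" "\<nu> (U (Suc i)) = \<nu> (P (Suc i) [^] nb (Suc i))"
    using b by (auto simp: balanced_def balancing_exponents_def)
  have val: "\<nu> (U (Suc i)) = nsm (nb (Suc i)) (\<nu> (P (Suc i)))" using be(2) P_good[OF i(2)] by simp
  note c = conversion[OF i be(1) val nb]
  show "U (Suc i) = z [^] \<eta> i \<otimes> s [^] (nb (Suc i) * Ex (Suc i)) \<otimes> ppQ i (v' i)"
    and vv: "\<nu> (ppQ i (v' i)) = nsm (nb (Suc i)) (\<nu> (Qf i))"
    unfolding v'_def \<eta>_def by (rule c, assumption+)+
  have "v' i k < n (Suc k)" if "k \<in> {1..<i}" for k
    using that be(1)[of "Suc k"] by (simp add: v'_def conv_def)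
  then show "balancing_exponents K \<nu> Qf (\<lambda>k. n (Suc k)) i (v' i)"
    unfolding balancing_exponents_def value_index_Q[OF i] using vv Q_car[OF i(2)] by simp
qed

text \<open>Numerator and denominator of \<open>\<theta> (Suc i)\<close> carry the same power of
  \<open>s\<close>, so the two ratios differ only by the power of \<open>z\<close> in
  \<open>U (Suc i)\<close>.\<close>

lemma alpha_Q:
  assumes i: "1 \<le> i" "enat (Suc i) \<le> \<Omega>" and b: "balanced (Suc i)"
  shows "\<alpha> (Suc i) \<in> carrier L" "\<alpha> (Suc i) \<noteq> \<zero>\<^bsub>L\<^esub>" "\<alpha>' i = res (z [^] \<eta> i) \<otimes>\<^bsub>L\<^esub> \<alpha> (Suc i)"
proof -
  have i\<Omega>: "enat i \<le> \<Omega>" using enat_mono[OF i(2)] by simp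
  note th = theta_unit[OF _ P_good(1)[OF i(2)]]
  have th: "\<theta> (Suc i) \<in> V - M" "\<alpha> (Suc i) = res (\<theta> (Suc i))"
    using th b by (auto simp: balanced_def)
  show "\<alpha> (Suc i) \<in> carrier L" "\<alpha> (Suc i) \<noteq> \<zero>\<^bsub>L\<^esub>"
    unfolding th(2) using th(1) res_zero_iff by auto
  define a0 Z V0 q where "a0 = s [^] (nb (Suc i) * Ex (Suc i))" and "Z = z [^] \<eta> i"
    and "V0 = ppQ i (v' i)" and "q = Qf i [^] nb (Suc i)"
  have car: "a0 \<in> carrier K" "Z \<in> carrier K" "V0 \<in> carrier K" "q \<in> carrier K" "a0 \<noteq> \<zero>" "Z \<noteq> \<zero>" "V0 \<noteq> \<zero>"
    "inv a0 \<in> carrier K" "inv Z \<in> carrier K" "inv V0 \<in> carrier K"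
    unfolding a0_def Z_def V0_def q_def using ppQ_props[OF i\<Omega>] Q_car[OF i(2)] by auto
  have "P (Suc i) [^] nb (Suc i) = a0 \<otimes> q"
    unfolding a0_def q_def Q_props(3)[OF i] using Q_car[OF i(2)] by (simp add: nat_pow_distrib nat_pow_pow mult.commute)
  then have "\<theta> (Suc i) = (a0 \<otimes> q) \<otimes> inv (Z \<otimes> a0 \<otimes> V0)"
    unfolding U_Q(1)[OF i b] a0_def Z_def V0_def by simp
  also have "\<dots> = (a0 \<otimes> q) \<otimes> (inv Z \<otimes> inv a0 \<otimes> inv V0)" using car by (simp add: inv_mult_distrib)
  finally have "Z \<otimes> \<theta> (Suc i) = Z \<otimes> ((a0 \<otimes> q) \<otimes> (inv Z \<otimes> inv a0 \<otimes> inv V0))" by simp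
  also have "\<dots> = (Z \<otimes> inv Z) \<otimes> (a0 \<otimes> inv a0) \<otimes> (q \<otimes> inv V0)" using car(1-4,8-10) by algebra
  also have "\<dots> = q \<otimes> inv V0" using car by simp
  finally have "q \<otimes> inv V0 = Z \<otimes> \<theta> (Suc i)" ..
  then have "\<alpha>' i = res (Z \<otimes> \<theta> (Suc i))"
    unfolding alpha_def value_index_Q[OF i] q_def V0_def by simp
  also have "\<dots> = res Z \<otimes>\<^bsub>L\<^esub> \<alpha> (Suc i)"
    unfolding th(2) using th(1) z_pow_unit(3)[of "\<eta> i"] unfolding Z_def by (intro res_mult) auto
  finally show "\<alpha>' i = res (z [^] \<eta> i) \<otimes>\<^bsub>L\<^esub> \<alpha> (Suc i)" unfolding Z_def .
qed

lemma gamma_props: "res (z [^] (k :: nat)) \<in> carrier L" "res (z [^] k) \<noteq> \<zero>\<^bsub>L\<^esub>" "res (z [^] k) = \<alpha> 1 [^]\<^bsub>L\<^esub> k"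
  using z_pow_unit[of k] res_zero_iff[of "z [^] k"] alpha_1 by auto

lemma subfield_pow:
  assumes "subfield E L" "a \<in> E" shows "a [^]\<^bsub>L\<^esub> (k :: nat) \<in> E"
  using subringE(3,6)[OF subfieldE(1)[OF assms(1)]] assms(2) by (induction k) auto

lemma alpha_carrier:
  assumes "enat i \<le> \<Omega>" "\<And>k. k \<in> {1..i} \<Longrightarrow> balanced k" "k \<in> {1..i}"
  shows "\<alpha> k \<in> carrier L"
  using theta_unit[of k] assms(2)[OF assms(3)] P_good(1)[OF enat_mono[OF assms(1), of k]] assms(3)
  by (auto simp: balanced_def)

lemma balanced_step: "1 \<le> i \<Longrightarrow> enat i < \<Omega> \<Longrightarrow> balanced i"
  using step unfolding balanced_def by blast

text \<open>The new generators differ from the old ones by powers of \<alpha>_1, which is nonzero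
  and already belongs to the residue field of \<open>T\<close>. So each list of generators lies in
  the field generated by the other.\<close>

lemma adjoin_Q:
  assumes "enat (Suc i) \<le> \<Omega>" "\<And>k. k \<in> {1..Suc i} \<Longrightarrow> balanced k"
  shows "adjoin K \<nu> T \<alpha>' i = F (Suc i)" "subfield (F (Suc i)) L" "\<alpha> 1 \<in> F (Suc i)"
proof -
  note ac = alpha_carrier[OF assms]
  let ?J = "residue_subfield K \<nu> R \<union> \<alpha> ` {1..Suc i}" and ?J' = "residue_subfield K \<nu> T \<union> \<alpha>' ` {1..i}"
  have J: "?J \<subseteq> carrier L" using ac subfieldE(3)[OF residue_subfield] by auto
  have aQ: "\<alpha>' k = res (z [^] \<eta> k) \<otimes>\<^bsub>L\<^esub> \<alpha> (Suc k)" if "k \<in> {1..i}" for k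
    using that assms(2)[of "Suc k"] by (intro alpha_Q(3) enat_mono[OF assms(1)]) auto
  have J': "?J' \<subseteq> carrier L" using aQ ac gamma_props subfieldE(3)[OF T.residue_subfield] by auto
  have sE: "subfield (F (Suc i)) L" unfolding adjoin_def by (rule L.generate_field_is_subfield[OF J])
  have JF: "?J \<subseteq> F (Suc i)" unfolding adjoin_def by (auto intro: generate_field.incl)
  have sE': "subfield (adjoin K \<nu> T \<alpha>' i) L" unfolding adjoin_def by (rule L.generate_field_is_subfield[OF J'])
  have JF': "?J' \<subseteq> adjoin K \<nu> T \<alpha>' i" unfolding adjoin_def by (auto intro: generate_field.incl)
  have a1: "\<alpha> 1 \<in> F (Suc i)" using JF by auto
  have RT: "residue_subfield K \<nu> R \<union> {\<alpha> 1} \<subseteq> residue_subfield K \<nu> T"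
    unfolding residue_T adjoin_def by (auto intro: generate_field.incl)
  have TF: "residue_subfield K \<nu> T \<subseteq> F (Suc i)"
    unfolding residue_T unfolding adjoin_def by (rule L.mono_generate_field[OF _ J]) auto
  have "\<alpha>' k \<in> F (Suc i)" if "k \<in> {1..i}" for k
  proof -
    have "\<alpha> (Suc k) \<in> F (Suc i)" using JF that by auto
    then show ?thesis unfolding aQ[OF that] gamma_props(3)
      using subringE(6)[OF subfieldE(1)[OF sE]] subfield_pow[OF sE a1] by blast
  qed
  then have "?J' \<subseteq> F (Suc i)" using TF by auto
  then have 1: "adjoin K \<nu> T \<alpha>' i \<subseteq> F (Suc i)"
    using L.generate_field_min_subfield1[OF J' sE] unfolding adjoin_def by simp
  have "\<alpha> k \<in> adjoin K \<nu> T \<alpha>' i" if k: "k \<in> {1..Suc i}" for k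
  proof (cases "k = 1")
    case True then show ?thesis using RT JF' by auto
  next
    case False
    then obtain l where l: "k = Suc l" "l \<in> {1..i}" using k by (cases k) auto
    let ?g = "res (z [^] \<eta> l)"
    have g: "?g \<in> adjoin K \<nu> T \<alpha>' i" unfolding gamma_props(3) using subfield_pow[OF sE'] RT JF' by auto
    then have "inv\<^bsub>L\<^esub> ?g \<in> adjoin K \<nu> T \<alpha>' i" using L.subfield_m_inv(1)[OF sE', of ?g] gamma_props by auto
    then have "\<alpha>' l \<otimes>\<^bsub>L\<^esub> inv\<^bsub>L\<^esub> ?g \<in> adjoin K \<nu> T \<alpha>' i"
      using subringE(6)[OF subfieldE(1)[OF sE']] JF' l(2) by blast
    also have "\<alpha>' l \<otimes>\<^bsub>L\<^esub> inv\<^bsub>L\<^esub> ?g = \<alpha> k"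
      unfolding aQ[OF l(2)] l(1) using ac[of "Suc l"] l(2) gamma_props
      by (subst L.m_comm[of ?g]) auto
    finally show ?thesis .
  qed
  then have "?J \<subseteq> adjoin K \<nu> T \<alpha>' i" using RT JF' by blast
  then have 2: "F (Suc i) \<subseteq> adjoin K \<nu> T \<alpha>' i"
    using L.generate_field_min_subfield1[OF J sE'] unfolding adjoin_def by simp
  show "adjoin K \<nu> T \<alpha>' i = F (Suc i)" using 1 2 by (rule subset_antisym)
  show "subfield (F (Suc i)) L" "\<alpha> 1 \<in> F (Suc i)" using sE a1 by auto
qed

end

text \<open>If the constant term vanished, dividing by \<open>x\<close> would give a monic relation
  of smaller degree. This guarantees at least one term in the expansion of a key sequence.\<close>

lemma (in field) minimal_polynomial_constant:
  assumes F: "subfield F R" and x: "x \<in> carrier R" "x \<noteq> \<zero>" and mp: "has_minimal_polynomial R F x d b"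
  shows "b 0 \<noteq> \<zero>"
proof
  assume b0: "b 0 = \<zero>"
  note props = minimal_polynomial_props[OF F x(1) mp]
  have F_closed: "\<zero> \<in> F" "\<one> \<in> F" using subringE(2,3)[OF subfieldE(1)[OF F]] by auto
  obtain e where d: "d = Suc e" using props(1) by (cases d) auto
  define c where "c t = (if t < e then b (Suc t) else if t = e then \<one> else \<zero>)" for t
  have c: "c t \<in> F" for t using props(2)[of "Suc t"] F_closed d by (auto simp: c_def)
  then have cc: "c t \<in> carrier R" for t using subfieldE(3)[OF F] by blast
  define b' where "b' t = (if t < d then b t else \<zero>)" for t
  have b'c: "b' t \<in> carrier R" for t using props(2)[of t] subfieldE(3)[OF F] by (auto simp: b'_def)
  have "psum c x d = psum c x e \<oplus> x [^] e" unfolding d using x by (simp add: c_def)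
  also have "psum c x e = psum (\<lambda>t. b' (Suc t)) x e" by (rule psum_cong) (simp add: c_def b'_def d)
  finally have pc: "psum c x d = psum (\<lambda>t. b' (Suc t)) x e \<oplus> x [^] e" .
  have "psum b x d = psum b' x (Suc e)" unfolding d[symmetric] by (rule psum_cong) (simp add: b'_def)
  also have "\<dots> = b' 0 \<oplus> x \<otimes> psum (\<lambda>t. b' (Suc t)) x e" by (rule psum_Suc_shift[OF b'c x(1)])
  also have "\<dots> = x \<otimes> psum (\<lambda>t. b' (Suc t)) x e"
    using psum_closed[of "\<lambda>t. b' (Suc t)" x e] b'c x b0 by (simp add: b'_def[of 0])
  finally have "psum b x d = x \<otimes> psum (\<lambda>t. b' (Suc t)) x e" .
  then have "\<zero> = x [^] d \<oplus> x \<otimes> psum (\<lambda>t. b' (Suc t)) x e" using props(3) by simp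
  also have "\<dots> = x \<otimes> psum c x d"
    unfolding pc unfolding d using x b'c by (simp add: r_distr m_comm a_comm)
  finally have "psum c x d = \<zero>" using x cc integral[of x "psum c x d"] by simp
  then have "\<forall>t<d. c t = \<zero>" by (rule props(4)[of c, OF c])
  then have "c e = \<zero>" using d by blast
  then show False by (simp add: c_def)
qed

text \<open>The algorithm produces a double sum, a key sequence wants one list of nonzero terms.
  \<open>Z\<close> marks the terms kept, and \<open>f\<close> enumerates them.\<close>

lemma (in abelian_monoid) finsum_pairs:
  assumes A: "finite A" "\<And>k. k \<in> A \<Longrightarrow> finite (B k)"
    and h: "\<And>k l. k \<in> A \<Longrightarrow> l \<in> B k \<Longrightarrow> h (k, l) \<in> carrier G"
    and nz: "\<And>k l. k \<in> A \<Longrightarrow> l \<in> B k \<Longrightarrow> \<not> Z (k, l) \<Longrightarrow> h (k, l) = \<zero>"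
    and f: "bij_betw f I {p \<in> Sigma A B. Z p}"
  shows "k \<in> A \<Longrightarrow> (\<Oplus>m\<in>{m \<in> I. fst (f m) = k}. h (f m)) = (\<Oplus>l\<in>B k. h (k, l))"
    and "(\<Oplus>m\<in>I. h (f m)) = (\<Oplus>k\<in>A. \<Oplus>l\<in>B k. h (k, l))"
proof -
  have inj: "inj_on f I" and im: "f ` I = {p \<in> Sigma A B. Z p}" using f by (auto simp: bij_betw_def)
  have hf: "h (f m) \<in> carrier G" if "m \<in> I" for m
  proof -
    have "f m \<in> {p \<in> Sigma A B. Z p}" unfolding im[symmetric] using that by (rule imageI)
    then show ?thesis using h by auto
  qed
  show 1: "(\<Oplus>m\<in>{m \<in> I. fst (f m) = k}. h (f m)) = (\<Oplus>l\<in>B k. h (k, l))" if k: "k \<in> A" for k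
  proof -
    let ?J = "{m \<in> I. fst (f m) = k}" and ?B = "{l \<in> B k. Z (k, l)}"
    have "f ` ?J = {p \<in> f ` I. fst p = k}" by auto
    also have "\<dots> = Pair k ` ?B" unfolding im using k by auto
    finally have img: "f ` ?J = Pair k ` ?B" .
    have "(\<Oplus>m\<in>?J. h (f m)) = (\<Oplus>p\<in>f ` ?J. h p)"
      using inj hf by (intro finsum_reindex[symmetric]) (auto intro: inj_on_subset)
    also have "\<dots> = (\<Oplus>l\<in>?B. h (k, l))"
      unfolding img using h k by (intro finsum_reindex) (auto simp: inj_on_def)
    also have "\<dots> = (\<Oplus>l\<in>B k. h (k, l))"
      using A(2) h nz k by (intro add.finprod_mono_neutral_cong_left) auto
    finally show ?thesis .
  qed
  have UN: "I = (\<Union>k\<in>A. {m \<in> I. fst (f m) = k})"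
  proof -
    have "fst (f m) \<in> A" if "m \<in> I" for m
    proof -
      have "f m \<in> {p \<in> Sigma A B. Z p}" unfolding im[symmetric] using that by (rule imageI)
      then show ?thesis by auto
    qed
    then show ?thesis by auto
  qed
  have "finite (Sigma A B)" using A by (rule finite_SigmaI)
  then have fin: "finite I" using bij_betw_finite[OF f] by simp
  have "(\<Oplus>m\<in>I. h (f m)) = (\<Oplus>m\<in>(\<Union>k\<in>A. {m \<in> I. fst (f m) = k}). h (f m))" using UN by simp
  also have "\<dots> = (\<Oplus>k\<in>A. \<Oplus>m\<in>{m \<in> I. fst (f m) = k}. h (f m))"
    using A(1) fin hf by (intro add.finprod_UN_disjoint) (auto simp: pairwise_def disjnt_def)
  also have "\<dots> = (\<Oplus>k\<in>A. \<Oplus>l\<in>B k. h (k, l))"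
    using 1 h by (intro finsum_cong') auto
  finally show "(\<Oplus>m\<in>I. h (f m)) = (\<Oplus>k\<in>A. \<Oplus>l\<in>B k. h (k, l))" .
qed

context algorithm_end
begin

text \<open>The requirements of a key sequence that concern one index only, gathered so that their
  data can be chosen for each index separately.\<close>

definition key_step ::
    "nat \<Rightarrow> nat \<Rightarrow> (nat \<Rightarrow> 'a) \<Rightarrow> (nat \<Rightarrow> nat \<Rightarrow> nat) \<Rightarrow> (nat \<Rightarrow> 'a set) \<Rightarrow> bool" where
  "key_step i mu c tau b \<longleftrightarrow>
    1 \<le> mu \<and>
    (\<forall>m\<in>{1..mu}. c m \<in> T \<and> c m \<notin> M \<and> (\<forall>k\<in>{1..i}. tau m k < n (Suc k)) \<and>
      \<nu> (Qf i [^] n (Suc i)) = \<nu> (ppQ (Suc i) (tau m)) \<and> nb (Suc i) dvd tau m i) \<and>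
    Qf (Suc i) = Qf i [^] n (Suc i) \<oplus> (\<Oplus>m\<in>{1..mu}. c m \<otimes> ppQ (Suc i) (tau m)) \<and>
    0 < d (Suc i) \<and>
    (\<forall>t<d (Suc i). b t = res ((\<Oplus>m\<in>{m \<in> {1..mu}. tau m i = t * nb (Suc i)}. c m \<otimes> ppQ i (tau m))
      \<otimes> inv (ppQ i (v' i) [^] (d (Suc i) - t))) \<and> b t \<in> F i) \<and>
    has_minimal_polynomial L (F i) (\<alpha>' i) (d (Suc i)) b"

text \<open>The equation for \<open>P (Suc (Suc i))\<close> is homogeneous in \<open>s\<close>, so a
  power of \<open>s\<close> can be cancelled from all its terms. Powers of \<open>z\<close> join the
  coefficients, and terms with coefficient \<open>\<zero>\<close> are discarded because the
  remaining coefficients must be units.\<close>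

lemma key_step_exists:
  assumes i: "1 \<le> i" "enat (Suc i) < \<Omega>"
  shows "\<exists>mu c tau b. key_step i mu c tau b"
proof -
  have i\<Omega>: "enat (Suc i) \<le> \<Omega>" "enat i \<le> \<Omega>" using i(2) enat_mono[of "Suc i" i] by auto
  have bal: "balanced k" if "k \<in> {1..Suc i}" for k
  proof (rule balanced_step)
    show "enat k < \<Omega>" using that i(2) by (meson atLeastAtMost_iff enat_ord_simps(1) order.strict_trans1)
  qed (use that in simp)
  have balS: "balanced (Suc i)" by (rule bal) simp
  obtain lam a j Ct where "expansion (Suc i) lam a j Ct"
    using expansion_exists[OF _ i(2) P_good(1)[OF i\<Omega>(1)]] by auto
  note E = expansionD[OF this]
  define \<delta> \<beta> H where "\<delta> = d (Suc i)" and "\<beta> = nb (Suc i)" and "H = Ex (Suc (Suc i))"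
  note E = E[folded \<delta>_def, folded \<beta>_def]
  have n\<beta>: "n (Suc i) = \<beta> * \<delta>" unfolding \<beta>_def \<delta>_def by (rule n_eq)
  have H: "H = \<beta> * \<delta> * Ex (Suc i)" unfolding H_def Ex_simps n\<beta> ..
  have \<beta>: "0 < \<beta>" unfolding \<beta>_def using value_index_finite(1) balS by (auto simp: balanced_def)
  have Fi: "subfield (F i) L" "\<alpha> 1 \<in> F i" "adjoin K \<nu> T \<alpha>' (i - 1) = F i"
    using adjoin_Q[of "i - 1"] i i\<Omega> bal by auto
  note al = alpha_Q[OF i(1) i\<Omega>(1) balS]
  have mp: "has_minimal_polynomial L (F i) (\<alpha> (Suc i)) \<delta> (\<lambda>t. res (Ct t))" using E(6) by simp
  have \<delta>: "0 < \<delta>" by (rule L.minimal_polynomial_props(1)[OF Fi(1) al(1) mp])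
  have aR: "a l k \<in> R" "a l k \<in> carrier K" "a l k \<in> T" if "k < \<delta>" "l \<in> {1..lam k}" for l k
    using CS_R[OF E(1)[OF that]] R_T by auto
  \<comment> \<open>The power of \<open>z\<close> contributed by the term \<open>(k, l)\<close>;
    \<open>cv\<close> and \<open>cf\<close> are its converted exponent vector and
    coefficient.\<close>
  define \<epsilon> where "\<epsilon> = (\<lambda>(k, l). B * j l k 0 + D * j l k 1)"
  define cv where "cv = (\<lambda>(k, l). conv i ((\<delta> - k) * \<beta> * Ex (Suc i)) (j l k))"
  define cf where "cf = (\<lambda>(k, l). a l k \<otimes> z [^] \<epsilon> (k, l))"
  \<comment> \<open>The exponent of the last element is \<open>k\<close> times \<beta>, so it
    determines the degree \<open>k\<close>. This is what later sorts the enumerated terms by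
    degree.\<close>
  define tf where "tf p = (cv p)(i := fst p * \<beta>)" for p :: "nat \<times> nat"
  define h1 where "h1 p = cf p \<otimes> ppQ i (tf p)" for p
  define h2 where "h2 p = cf p \<otimes> ppQ (Suc i) (tf p)" for p
  have Qc: "Qf i \<in> carrier K" "Qf i \<noteq> \<zero>" by (rule Q_car[OF i\<Omega>(1)])+
  have ppc: "ppQ i e \<in> carrier K" "ppQ i e \<noteq> \<zero>" for e by (rule ppQ_props[OF i\<Omega>(2)])+
  have cfc: "cf (k, l) \<in> carrier K" if "k < \<delta>" "l \<in> {1..lam k}" for k l
    unfolding cf_def using aR[OF that] by simp
  have h1c: "h1 (k, l) \<in> carrier K" if "k < \<delta>" "l \<in> {1..lam k}" for k l
    unfolding h1_def using cfc[OF that] ppc by simp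
  have tfi: "ppQ i (tf p) = ppQ i (cv p)" for p
    using Q_car enat_mono[OF i\<Omega>(1)] by (intro power_product_cong) (auto simp: tf_def)
  have tfS: "ppQ (Suc i) (tf p) = ppQ i (cv p) \<otimes> Qf i [^] (fst p * \<beta>)" for p
    unfolding ppQ_Suc[OF i\<Omega>(1)] tfi by (simp add: tf_def)
  have h21: "h2 (k, l) = h1 (k, l) \<otimes> Qf i [^] (k * \<beta>)" if "k < \<delta>" "l \<in> {1..lam k}" for k l
    unfolding h1_def h2_def tfS tfi using cfc[OF that] ppc Qc by (simp add: m_assoc)
  have h2c: "h2 (k, l) \<in> carrier K" if "k < \<delta>" "l \<in> {1..lam k}" for k l
    unfolding h21[OF that] using h1c[OF that] Qc by simp
  have cnv: "a l k \<otimes> pp (Suc i) (j l k) = s [^] ((\<delta> - k) * \<beta> * Ex (Suc i)) \<otimes> h1 (k, l)"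
    "\<nu> (ppQ i (cv (k, l))) = nsm ((\<delta> - k) * \<beta>) (\<nu> (Qf i))" if kl: "k < \<delta>" "l \<in> {1..lam k}" for k l
  proof -
    have e: "j l k q < n q" if "1 \<le> q" "q \<le> i" for q using E(2)[OF kl, of q] that by simp
    have pos: "0 < (\<delta> - k) * \<beta>" using kl \<beta> by simp
    note c = conversion[OF i(1) i\<Omega>(1) e E(3)[OF kl] pos]
    have c1: "pp (Suc i) (j l k) = z [^] \<epsilon> (k, l) \<otimes> s [^] ((\<delta> - k) * \<beta> * Ex (Suc i)) \<otimes> ppQ i (cv (k, l))"
      using c(1) by (simp add: \<epsilon>_def cv_def)
    show "a l k \<otimes> pp (Suc i) (j l k) = s [^] ((\<delta> - k) * \<beta> * Ex (Suc i)) \<otimes> h1 (k, l)"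
      unfolding c1 h1_def cf_def tfi using aR[OF kl] ppc by (simp add: m_ac)
    show "\<nu> (ppQ i (cv (k, l))) = nsm ((\<delta> - k) * \<beta>) (\<nu> (Qf i))"
      using c(2) by (simp add: cv_def)
  qed
  have sumP: "(\<Oplus>l\<in>{1..lam k}. a l k \<otimes> pp (Suc i) (j l k)) =
    s [^] ((\<delta> - k) * \<beta> * Ex (Suc i)) \<otimes> (\<Oplus>l\<in>{1..lam k}. h1 (k, l))" if k: "k < \<delta>" for k
  proof -
    have "(\<Oplus>l\<in>{1..lam k}. a l k \<otimes> pp (Suc i) (j l k)) =
      (\<Oplus>l\<in>{1..lam k}. s [^] ((\<delta> - k) * \<beta> * Ex (Suc i)) \<otimes> h1 (k, l))"
      using cnv(1)[OF k] h1c[OF k] by (intro finsum_cong') auto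
    also have "\<dots> = s [^] ((\<delta> - k) * \<beta> * Ex (Suc i)) \<otimes> (\<Oplus>l\<in>{1..lam k}. h1 (k, l))"
      using h1c[OF k] by (intro finsum_rdistr[symmetric]) auto
    finally show ?thesis .
  qed
  have sum1c: "(\<Oplus>l\<in>{1..lam k}. h1 (k, l)) \<in> carrier K" "(\<Oplus>l\<in>{1..lam k}. h2 (k, l)) \<in> carrier K" if "k < \<delta>" for k
    using h1c[OF that] h2c[OF that] by (auto intro: finsum_closed)
  have sum2: "(\<Oplus>l\<in>{1..lam k}. h2 (k, l)) = (\<Oplus>l\<in>{1..lam k}. h1 (k, l)) \<otimes> Qf i [^] (k * \<beta>)" if k: "k < \<delta>" for k
  proof -
    have "(\<Oplus>l\<in>{1..lam k}. h2 (k, l)) = (\<Oplus>l\<in>{1..lam k}. h1 (k, l) \<otimes> Qf i [^] (k * \<beta>))"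
      using h21[OF k] h1c[OF k] Qc by (intro finsum_cong') auto
    also have "\<dots> = (\<Oplus>l\<in>{1..lam k}. h1 (k, l)) \<otimes> Qf i [^] (k * \<beta>)"
      using h1c[OF k] Qc by (intro finsum_ldistr[symmetric]) auto
    finally show ?thesis .
  qed
  have Ppow: "P (Suc i) [^] k = s [^] (k * Ex (Suc i)) \<otimes> Qf i [^] k" for k :: nat
    unfolding Q_props(3)[OF i(1) i\<Omega>(1)] using Qc by (simp add: nat_pow_distrib nat_pow_pow mult.commute)
  have sum_term: "(\<Oplus>l\<in>{1..lam k}. a l k \<otimes> pp (Suc i) (j l k)) \<otimes> P (Suc i) [^] (k * \<beta>) =
    s [^] H \<otimes> (\<Oplus>l\<in>{1..lam k}. h2 (k, l))" if k: "k < \<delta>" for k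
  proof -
    \<comment> \<open>The power of \<open>s\<close> is \<open>H\<close> for every degree
      \<open>k\<close>: what the lower monomials lack is supplied by the power of
      \<open>P (Suc i)\<close>.\<close>
    have "(\<delta> - k) * \<beta> * Ex (Suc i) + k * \<beta> * Ex (Suc i) = ((\<delta> - k) + k) * \<beta> * Ex (Suc i)"
      by (simp only: add_mult_distrib)
    also have "\<dots> = H" unfolding H using k by simp
    finally have "s [^] H = s [^] ((\<delta> - k) * \<beta> * Ex (Suc i)) \<otimes> s [^] (k * \<beta> * Ex (Suc i))"
      by (simp add: nat_pow_mult)
    then show ?thesis unfolding sumP[OF k] sum2[OF k] Ppow using sum1c[OF k] Qc by (simp add: m_ac)
  qed
  have "(\<Oplus>k\<in>{..<\<delta>}. (\<Oplus>l\<in>{1..lam k}. a l k \<otimes> pp (Suc i) (j l k)) \<otimes> P (Suc i) [^] (k * \<beta>)) =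
    (\<Oplus>k\<in>{..<\<delta>}. s [^] H \<otimes> (\<Oplus>l\<in>{1..lam k}. h2 (k, l)))"
    using sum_term sum1c by (intro finsum_cong') auto
  also have "\<dots> = s [^] H \<otimes> (\<Oplus>k\<in>{..<\<delta>}. \<Oplus>l\<in>{1..lam k}. h2 (k, l))"
    using sum1c by (intro finsum_rdistr[symmetric]) auto
  finally have "P (Suc (Suc i)) = s [^] H \<otimes> Qf i [^] n (Suc i) \<oplus> s [^] H \<otimes> (\<Oplus>k\<in>{..<\<delta>}. \<Oplus>l\<in>{1..lam k}. h2 (k, l))"
    using E(7) Ppow[of "n (Suc i)"] by (simp add: H_def Ex_simps)
  also have "\<dots> = s [^] H \<otimes> (Qf i [^] n (Suc i) \<oplus> (\<Oplus>k\<in>{..<\<delta>}. \<Oplus>l\<in>{1..lam k}. h2 (k, l)))"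
    using sum1c Qc by (intro r_distr[symmetric]) (auto intro: finsum_closed)
  finally have PS: "P (Suc (Suc i)) = s [^] H \<otimes> (Qf i [^] n (Suc i) \<oplus> (\<Oplus>k\<in>{..<\<delta>}. \<Oplus>l\<in>{1..lam k}. h2 (k, l)))" .
  have i2: "enat (Suc (Suc i)) \<le> \<Omega>" using i(2) by (simp add: Suc_ile_eq)
  have "s [^] H \<otimes> Qf (Suc i) = s [^] H \<otimes> (Qf i [^] n (Suc i) \<oplus> (\<Oplus>k\<in>{..<\<delta>}. \<Oplus>l\<in>{1..lam k}. h2 (k, l)))"
    using PS Q_props(3)[OF _ i2] unfolding H_def by simp
  then have QS: "Qf (Suc i) = Qf i [^] n (Suc i) \<oplus> (\<Oplus>k\<in>{..<\<delta>}. \<Oplus>l\<in>{1..lam k}. h2 (k, l))"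
    using Q_car[OF i2] Qc sum1c
    by (subst (asm) m_lcancel) (auto intro: finsum_closed)

  \<comment> \<open>The terms with nonzero coefficient, which is then a unit.\<close>
  define Y where "Y = {p \<in> Sigma {..<\<delta>} (\<lambda>k. {1..lam k}). a (snd p) (fst p) \<noteq> \<zero>}"
  have "finite Y" unfolding Y_def by simp
  then obtain f where "bij_betw f {1..card Y} Y" using ex_bij_betw_nat_finite_1 by blast
  define \<mu> where "\<mu> = card Y"
  have f: "bij_betw f {1..\<mu>} Y" unfolding \<mu>_def by fact
  have fY: "f m \<in> Y" if "m \<in> {1..\<mu>}" for m using f that by (auto simp: bij_betw_def)
  have zero: "h1 (k, l) = \<zero>" "h2 (k, l) = \<zero>" if "k < \<delta>" "l \<in> {1..lam k}" "\<not> a (snd (k, l)) (fst (k, l)) \<noteq> \<zero>" for k l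
    using that ppc ppQ_props[OF i\<Omega>(1)] by (auto simp: h1_def h2_def cf_def)
  have pair1: "(\<Oplus>m\<in>{m \<in> {1..\<mu>}. fst (f m) = k}. h1 (f m)) = (\<Oplus>l\<in>{1..lam k}. h1 (k, l))" if "k < \<delta>" for k
    by (rule finsum_pairs(1)[where Z = "\<lambda>p. a (snd p) (fst p) \<noteq> \<zero>" and A = "{..<\<delta>}" and h = h1, OF _ _ _ _ f[unfolded Y_def]])
      (use h1c zero that in auto)
  have pair2: "(\<Oplus>m\<in>{1..\<mu>}. h2 (f m)) = (\<Oplus>k\<in>{..<\<delta>}. \<Oplus>l\<in>{1..lam k}. h2 (k, l))"
    by (rule finsum_pairs(2)[where Z = "\<lambda>p. a (snd p) (fst p) \<noteq> \<zero>" and h = h2, OF _ _ _ _ f[unfolded Y_def]])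
      (use h2c zero in auto)
  \<comment> \<open>A nonzero constant coefficient of the minimal polynomial prevents
    \<open>Y\<close> from being empty.\<close>
  have "res (Ct 0) \<noteq> \<zero>\<^bsub>L\<^esub>" by (rule L.minimal_polynomial_constant[OF Fi(1) al(1,2) mp])
  then have "Ct 0 \<noteq> \<zero>" by auto
  have "Y \<noteq> {}"
  proof
    assume "Y = {}"
    then have a0: "a l 0 = \<zero>" if "l \<in> {1..lam 0}" for l using that \<delta> unfolding Y_def by auto
    have ppPc: "pp (Suc i) e \<in> carrier K" "pp (Suc i) e \<noteq> \<zero>" for e
      using pp_good[OF P_good(1)[OF i\<Omega>(1)], of "Suc i" e] by auto
    have "(\<Oplus>l\<in>{1..lam 0}. a l 0 \<otimes> pp (Suc i) (j l 0)) = (\<Oplus>l\<in>{1..lam 0}. \<zero>)"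
      using a0 ppPc by (intro finsum_cong') auto
    then have "Ct 0 = \<zero>" using E(5)[OF \<delta>] ppPc by simp
    then show False using \<open>Ct 0 \<noteq> \<zero>\<close> by simp
  qed
  then have mu: "1 \<le> \<mu>" unfolding \<mu>_def using \<open>finite Y\<close> by (simp add: Suc_le_eq card_gt_0_iff)

  have mono: "cf (f m) \<in> T \<and> cf (f m) \<notin> M \<and> (\<forall>k\<in>{1..i}. tf (f m) k < n (Suc k)) \<and>
      \<nu> (Qf i [^] n (Suc i)) = \<nu> (ppQ (Suc i) (tf (f m))) \<and> \<beta> dvd tf (f m) i"
    if m: "m \<in> {1..\<mu>}" for m
  proof -
    obtain k l where kl: "f m = (k, l)" "k < \<delta>" "l \<in> {1..lam k}" "a l k \<noteq> \<zero>"
      using fY[OF m] unfolding Y_def by (cases "f m") auto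
    note aT = aR[OF kl(2,3)]
    have aM: "a l k \<notin> M" by (rule CS_unit[OF E(1)[OF kl(2,3)] kl(4)])
    have "cf (f m) \<in> T" unfolding kl(1) cf_def using aT z_pow_unit by simp
    moreover have "cf (f m) \<notin> M"
      using M_prime[of "a l k" "z [^] \<epsilon> (k, l)"] aM z_pow_unit A_in_V[OF aT(1)] unfolding kl(1) cf_def by simp
    moreover have "tf (f m) k' < n (Suc k')" if k': "k' \<in> {1..i}" for k'
    proof (cases "k' = i")
      case True then show ?thesis using kl(2) \<beta> n\<beta> unfolding kl(1) by (simp add: tf_def mult.commute)
    next
      case False
      then have "tf (f m) k' = j l k (Suc k')" unfolding kl(1) using k' by (simp add: tf_def cv_def conv_def)
      then show ?thesis using E(2)[OF kl(2,3), of "Suc k'"] False k' by simp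
    qed
    moreover have "\<nu> (Qf i [^] n (Suc i)) = \<nu> (ppQ (Suc i) (tf (f m)))"
    proof -
      have "\<nu> (ppQ (Suc i) (tf (f m))) = nsm ((\<delta> - k) * \<beta>) (\<nu> (Qf i)) + nsm (k * \<beta>) (\<nu> (Qf i))"
        unfolding tfS kl(1) using cnv(2)[OF kl(2,3)] ppc Qc by simp
      also have "\<dots> = nsm (((\<delta> - k) + k) * \<beta>) (\<nu> (Qf i))" by (simp only: nsm_add add_mult_distrib)
      finally show ?thesis using Qc kl(2) by (simp add: n\<beta> mult.commute)
    qed
    moreover have "\<beta> dvd tf (f m) i" by (simp add: tf_def)
    ultimately show ?thesis by blast
  qed

  \<comment> \<open>Replacing \<open>U (Suc i)\<close> by the comparison monomial of
    \<open>Qf i\<close> in the denominator of \<open>Ct t\<close> introduces this power of the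
    residue of \<open>z\<close>; it is also the scaling that turns the minimal polynomial of
    \<open>\<alpha> (Suc i)\<close> into that of \<open>\<alpha>' i\<close>.\<close>
  define b where "b t = res (z [^] \<eta> i) [^]\<^bsub>L\<^esub> (\<delta> - t) \<otimes>\<^bsub>L\<^esub> res (Ct t)" for t
  have gF: "res (z [^] \<eta> i) \<in> F i" unfolding gamma_props(3) by (rule subfield_pow[OF Fi(1,2)])
  have mpb: "has_minimal_polynomial L (F i) (\<alpha>' i) \<delta> b"
    unfolding al(3) b_def by (rule L.minimal_polynomial_scale[OF Fi(1) al(1) mp gF gamma_props(2)]) simp
  have "\<alpha>' i \<in> carrier L" unfolding al(3) using al(1) gamma_props by simp
  then have bF: "b t \<in> F i" if "t < \<delta>" for t by (rule L.minimal_polynomial_props(2)[OF Fi(1) _ mpb that])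
  have b_eq: "b t = res ((\<Oplus>m\<in>{m \<in> {1..\<mu>}. tf (f m) i = t * \<beta>}. cf (f m) \<otimes> ppQ i (tf (f m)))
      \<otimes> inv (ppQ i (v' i) [^] (\<delta> - t)))" if t: "t < \<delta>" for t
  proof -
    define \<Sigma> where "\<Sigma> = (\<Oplus>l\<in>{1..lam t}. h1 (t, l))"
    have "{m \<in> {1..\<mu>}. tf (f m) i = t * \<beta>} = {m \<in> {1..\<mu>}. fst (f m) = t}"
      using \<beta> by (auto simp: tf_def)
    then have S1: "(\<Oplus>m\<in>{m \<in> {1..\<mu>}. tf (f m) i = t * \<beta>}. cf (f m) \<otimes> ppQ i (tf (f m))) = \<Sigma>"
      using pair1[OF t] unfolding \<Sigma>_def by (simp add: h1_def)
    define a0 Z V0 where "a0 = s [^] ((\<delta> - t) * \<beta> * Ex (Suc i))" and "Z = z [^] (\<eta> i * (\<delta> - t))"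
      and "V0 = ppQ i (v' i) [^] (\<delta> - t)"
    have car: "a0 \<in> carrier K" "Z \<in> carrier K" "V0 \<in> carrier K" "\<Sigma> \<in> carrier K" "a0 \<noteq> \<zero>" "Z \<noteq> \<zero>" "V0 \<noteq> \<zero>"
      "inv a0 \<in> carrier K" "inv Z \<in> carrier K" "inv V0 \<in> carrier K"
      unfolding a0_def Z_def V0_def \<Sigma>_def using ppc sum1c[OF t] by auto
    have "U (Suc i) [^] (\<delta> - t) = Z \<otimes> a0 \<otimes> V0"
      unfolding U_Q(1)[OF i(1) i\<Omega>(1) balS] \<beta>_def[symmetric] a0_def Z_def V0_def using ppc
      by (simp add: nat_pow_distrib nat_pow_pow m_ac ac_simps)
    then have "Ct t = (a0 \<otimes> \<Sigma>) \<otimes> inv (Z \<otimes> a0 \<otimes> V0)"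
      using E(5)[OF t] sumP[OF t] unfolding a0_def \<Sigma>_def by simp
    also have "\<dots> = (a0 \<otimes> \<Sigma>) \<otimes> (inv Z \<otimes> inv a0 \<otimes> inv V0)" using car by (simp add: inv_mult_distrib)
    finally have "Z \<otimes> Ct t = Z \<otimes> ((a0 \<otimes> \<Sigma>) \<otimes> (inv Z \<otimes> inv a0 \<otimes> inv V0))" by simp
    also have "\<dots> = (Z \<otimes> inv Z) \<otimes> (a0 \<otimes> inv a0) \<otimes> (\<Sigma> \<otimes> inv V0)" using car(1-4,8-10) by algebra
    also have "\<dots> = \<Sigma> \<otimes> inv V0" using car by simp
    finally have "\<Sigma> \<otimes> inv V0 = Z \<otimes> Ct t" ..
    moreover have "res (Z \<otimes> Ct t) = b t"
    proof -
      have "Z = (z [^] \<eta> i) [^] (\<delta> - t)" unfolding Z_def by (simp add: nat_pow_pow)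
      then have "res Z = res (z [^] \<eta> i) [^]\<^bsub>L\<^esub> (\<delta> - t)"
        using z_pow_unit(3)[of "\<eta> i"] by (simp only: res_pow Diff_iff)
      moreover have "res (Z \<otimes> Ct t) = res Z \<otimes>\<^bsub>L\<^esub> res (Ct t)"
        unfolding Z_def using z_pow_unit(3)[of "\<eta> i * (\<delta> - t)"] E(4) by (intro res_mult) auto
      ultimately show ?thesis unfolding b_def by simp
    qed
    ultimately show ?thesis unfolding S1 V0_def by simp
  qed
  have "key_step i \<mu> (\<lambda>m. cf (f m)) (\<lambda>m. tf (f m)) b"
    unfolding key_step_def \<delta>_def[symmetric] \<beta>_def[symmetric]
  proof (intro conjI mu \<delta> mpb)
    show "Qf (Suc i) = Qf i [^] n (Suc i) \<oplus> (\<Oplus>m\<in>{1..\<mu>}. cf (f m) \<otimes> ppQ (Suc i) (tf (f m)))"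
      unfolding QS using pair2 unfolding h2_def by simp
  qed (rule ballI, erule mono, intro allI impI conjI, erule b_eq, erule bF)
  then show ?thesis by blast
qed

end

section \<open>Assembling the key sequence\<close>

context algorithm_end
begin

text \<open>The new sequence is one step shorter than \<open>P\<close>; for infinite \<Omega> the
  subtraction changes nothing.\<close>

lemma shift:
  "enat i < \<Omega> - 1 \<longleftrightarrow> enat (Suc i) < \<Omega>" "enat i \<le> \<Omega> - 1 \<Longrightarrow> enat (Suc i) \<le> \<Omega>"
  "\<Omega> - 1 = enat i \<Longrightarrow> \<Omega> = enat (Suc i) \<and> 1 \<le> i" "1 \<le> \<Omega> - 1"
  using two by (cases \<Omega>; auto simp: one_enat_def numeral_eq_enat)+

text \<open>Divisibility by the power of \<open>s\<close> is not apparent from the quotient; it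
  follows from the key expansion, starting from the two regular parameters.\<close>

lemma Qf_T: "enat (Suc i) \<le> \<Omega> \<Longrightarrow> Qf i \<in> T"
proof (induction i rule: less_induct)
  case (less i)
  show ?case
  proof (cases "i \<le> 1")
    case True
    then consider "i = 0" | "i = 1" by linarith
    then show ?thesis using T.u T.v by cases (simp_all only: Qf_0 Qf_1)
  next
    case False
    then obtain j where j: "i = Suc j" "1 \<le> j" by (cases i) auto
    have "enat (Suc j) < \<Omega>" using less.prems unfolding j(1) by (simp add: Suc_ile_eq)
    then obtain mu c tau b where K: "key_step j mu c tau b" using key_step_exists[OF j(2)] by blast
    have Q: "Qf k \<in> T" if "k \<le> j" for k
      using less.IH[of k] that j(1) enat_mono[OF less.prems, of "Suc k"] by simp
    have pT: "ppQ k e \<in> T" if "k \<le> Suc j" for k e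
      using that
    proof (induction k)
      case (Suc k)
      then show ?case
        using Q[of k] enat_mono[OF less.prems, of "Suc k"] j(1) by (simp add: ppQ_Suc)
    qed simp
    have "(\<Oplus>m\<in>{1..mu}. c m \<otimes> ppQ (Suc j) (tau m)) \<in> T"
    proof (rule T.ideal_finsum[of T])
      show "is_ideal_of T T" by (auto simp: is_ideal_of_def)
      fix m assume "m \<in> {1..mu}"
      then have "c m \<in> T" using K unfolding key_step_def by blast
      then show "c m \<otimes> ppQ (Suc j) (tau m) \<in> T" using pT[of "Suc j"] by simp
    qed simp
    moreover have "Qf (Suc j) = Qf j [^] n (Suc j) \<oplus> (\<Oplus>m\<in>{1..mu}. c m \<otimes> ppQ (Suc j) (tau m))"
      using K unfolding key_step_def by blast
    ultimately show ?thesis using Q[of j] j(1) by simp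
  qed
qed

lemma key_sequence_Q: "key_sequence K \<nu> T (Qf 0) (Qf 1) (\<Omega> - 1) Qf"
proof -
  \<comment> \<open>The sequences \<open>Qf\<close>, \<open>v'\<close> and \<open>n\<close> are
    fixed already, so the choices for different indices do not interact.\<close>
  have "\<forall>i. \<exists>mu c tau b. 1 \<le> i \<and> enat (Suc i) < \<Omega> \<longrightarrow> key_step i mu c tau b"
    using key_step_exists by blast
  then obtain mu c tau b where ks: "\<And>i. 1 \<le> i \<Longrightarrow> enat (Suc i) < \<Omega> \<Longrightarrow> key_step i (mu i) (c i) (tau i) (b i)"
    by metis
  have vi: "value_index \<nu> Qf i = value_index \<nu> P (Suc i)" if "1 \<le> i" "enat (Suc i) < \<Omega>" for i
    using value_index_Q that by simp
  have be: "balancing_exponents K \<nu> Qf (\<lambda>k. n (Suc k)) i (v' i)" if "1 \<le> i" "enat (Suc i) < \<Omega>" for i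
    using U_Q(2)[of i] balanced_step[of "Suc i"] that by simp
  have ad: "adjoin K \<nu> T \<alpha>' (i - 1) = F i" if "1 \<le> i" "enat i < \<Omega>" for i
  proof -
    have "balanced k" if "k \<in> {1..i}" for k
      using balanced_step[of k] that \<open>enat i < \<Omega>\<close> by (meson atLeastAtMost_iff enat_ord_simps(1) order.strict_trans1)
    then show ?thesis using adjoin_Q(1)[of "i - 1"] that by simp
  qed
  have lt: "enat i < \<Omega>" if "enat (Suc i) < \<Omega>" for i
    using that by (meson enat_ord_simps(2) lessI order.strict_trans)
  have indep: "L.independent (residue_subfield K \<nu> T)
      (map (\<lambda>l. res (ppQ (Suc r) (e l) \<otimes> inv (ppQ (Suc r) (e 0)))) [0..<N])"
    if r: "enat (Suc r) < \<Omega>" and e: "\<forall>l<N. \<forall>k\<in>{1..r}. e l k < n (Suc k)"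
      "\<forall>l<N. \<forall>l'<N. l \<noteq> l' \<longrightarrow> (\<exists>k\<le>r. e l k \<noteq> e l' k)"
      "\<forall>l<N. \<nu> (ppQ (Suc r) (e l)) = \<nu> (ppQ (Suc r) (e 0))" for r N e
  proof -
    have le: "enat (Suc k) < \<Omega>" if "k \<le> r" for k
      using that r by (meson Suc_le_mono enat_ord_simps(1) order.strict_trans1)
    \<comment> \<open>All degrees are shifted by one: \<open>Qf k\<close> takes over the data of
      \<open>P (Suc k)\<close>.\<close>
    have "key_monomials K \<nu> T Qf (\<lambda>k. n (Suc k)) (\<lambda>k. d (Suc k)) b v' r"
    proof (intro key_monomials.intro T.dominated_ring_axioms key_monomials_axioms.intro)
      fix i assume i: "1 \<le> i" "i \<le> r"
      note l = le[OF i(2)]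
      show "value_index \<nu> Qf i \<noteq> \<infinity>"
        unfolding vi[OF i(1) l] using balanced_step[OF _ l] by (simp add: balanced_def)
      show "\<nu> (ppQ i (v' i)) = \<nu> (Qf i [^] the_enat (value_index \<nu> Qf i))"
        using be[OF i(1) l] by (simp add: balancing_exponents_def)
      show "n (Suc i) = the_enat (value_index \<nu> Qf i) * d (Suc i)"
        unfolding vi[OF i(1) l] by (rule n_eq)
      show "has_minimal_polynomial L (adjoin K \<nu> T \<alpha>' (i - 1)) (\<alpha>' i) (d (Suc i)) (b i)"
        unfolding ad[OF i(1) lt[OF l]] using ks[OF i(1) l] unfolding key_step_def by blast
    next
      fix k assume "k \<le> r"
      then show "Qf k \<in> carrier K" "Qf k \<noteq> \<zero>" using Q_car less_imp_le[OF le] by auto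
    qed (simp add: Qf_0)
    then show ?thesis by (rule key_monomials.independent_monomials[OF _ order_refl e])
  qed
  \<comment> \<open>The two fields in the last degree are those of the algorithm at
    \<open>Suc i\<close>, so its reason for stopping carries over.\<close>
  have final_step: "value_index \<nu> Qf i = \<infinity> \<or>
      (value_index \<nu> Qf i \<noteq> \<infinity> \<and> balancing_exponents K \<nu> Qf (\<lambda>k. n (Suc k)) i (v' i) \<and>
       alpha_degree K \<nu> T Qf v' i = \<infinity>)" if M: "\<Omega> - 1 = enat i" for i
  proof (cases "value_index \<nu> Qf i = \<infinity>")
    case False
    have \<Omega>: "\<Omega> = enat (Suc i)" and i: "1 \<le> i" using shift(3)[OF M] by auto
    have le: "enat (Suc i) \<le> \<Omega>" using \<Omega> by simp
    have "value_index \<nu> P (Suc i) \<noteq> \<infinity>" using False unfolding value_index_Q[OF i le] .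
    then have f: "balanced (Suc i)" "alpha_degree K \<nu> R P w (Suc i) = \<infinity>"
      using final[OF \<Omega>] by (auto simp: balanced_def)
    have "balanced k" if "k \<in> {1..Suc i}" for k
      using that f(1) balanced_step[of k] \<Omega> by (cases "k = Suc i") auto
    then have "adjoin K \<nu> T \<alpha>' i = F (Suc i)" by (rule adjoin_Q(1)[OF le])
    moreover have "adjoin K \<nu> T \<alpha>' (i - 1) = F i" by (rule ad[OF i]) (simp add: \<Omega>)
    ultimately have "alpha_degree K \<nu> T Qf v' i = \<infinity>" using f(2) by (simp add: alpha_degree_def)
    then show ?thesis using U_Q(2)[OF i le f(1)] False by blast
  qed simp
  show ?thesis
    unfolding key_sequence_def shift(1)
  proof (intro conjI exI)
    show "regular_parameters (K\<lparr>carrier := T\<rparr>) (Qf 0) (Qf 1)"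
      unfolding Qf_0 Qf_1 by (rule T.regular_parameters)
    show "dominates K \<nu> T" by (rule T.dominates_A)
    show "1 \<le> \<Omega> - 1" by (rule shift(4))
    show "\<forall>i. enat i \<le> \<Omega> - 1 \<longrightarrow> Qf i \<in> max_ideal (K\<lparr>carrier := T\<rparr>) \<and> Qf i \<noteq> \<zero>"
    proof (intro allI impI)
      fix i assume "enat i \<le> \<Omega> - 1"
      then have i: "enat (Suc i) \<le> \<Omega>" by (rule shift(2))
      have "Qf i \<in> M" using Q_pos[OF i] Q_car[OF i] by (simp add: M_iff)
      then show "Qf i \<in> max_ideal (K\<lparr>carrier := T\<rparr>) \<and> Qf i \<noteq> \<zero>"
        unfolding T.max_ideal_A using Qf_T[OF i] Q_car[OF i] by simp
    qed
    show "\<forall>i\<ge>1. enat (Suc i) < \<Omega> \<longrightarrow>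
           1 \<le> n (Suc i) \<and> 1 \<le> mu i \<and>
           (\<forall>k\<in>{1..mu i}.
              c i k \<in> Units (K\<lparr>carrier := T\<rparr>) \<and> (\<forall>s\<in>{1..i}. tau i k s < n (Suc s)) \<and>
              \<nu> (Qf i [^] n (Suc i)) = \<nu> (ppQ (Suc i) (tau i k))) \<and>
           Qf (Suc i) = Qf i [^] n (Suc i) \<oplus> (\<Oplus>k\<in>{1..mu i}. c i k \<otimes> ppQ (Suc i) (tau i k))"
    proof (intro allI impI)
      fix i assume i: "1 \<le> i" "enat (Suc i) < \<Omega>"
      note K = ks[OF i, unfolded key_step_def]
      have "0 < nb (Suc i)" using value_index_finite(1)[OF step(1)[OF _ i(2)]] by simp
      then have "1 \<le> n (Suc i)" using K by (simp add: n_eq Suc_le_eq)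
      then show "1 \<le> n (Suc i) \<and> 1 \<le> mu i \<and>
           (\<forall>k\<in>{1..mu i}.
              c i k \<in> Units (K\<lparr>carrier := T\<rparr>) \<and> (\<forall>s\<in>{1..i}. tau i k s < n (Suc s)) \<and>
              \<nu> (Qf i [^] n (Suc i)) = \<nu> (ppQ (Suc i) (tau i k))) \<and>
           Qf (Suc i) = Qf i [^] n (Suc i) \<oplus> (\<Oplus>k\<in>{1..mu i}. c i k \<otimes> ppQ (Suc i) (tau i k))"
        unfolding T.Units_A using K by blast
    qed
    show "\<forall>i\<ge>1. enat (Suc i) < \<Omega> \<longrightarrow> \<nu> (Qf i [^] n (Suc i)) < \<nu> (Qf (Suc i))"
    proof (intro allI impI)
      fix i assume i: "1 \<le> i" "enat (Suc i) < \<Omega>"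
      have "enat (Suc (Suc i)) \<le> \<Omega>" using i(2) by (simp add: Suc_ile_eq)
      then show "\<nu> (Qf i [^] n (Suc i)) < \<nu> (Qf (Suc i))"
        using Q_big[OF i(1)] Q_car[OF less_imp_le[OF i(2)]] by simp
    qed
    show "\<forall>r. enat (Suc r) < \<Omega> \<longrightarrow>
           (\<forall>N e. (\<forall>l<N. \<forall>k\<in>{1..r}. e l k < n (Suc k)) \<and>
              (\<forall>l<N. \<forall>l'<N. l \<noteq> l' \<longrightarrow> (\<exists>k\<le>r. e l k \<noteq> e l' k)) \<and>
              (\<forall>l<N. \<nu> (ppQ (Suc r) (e l)) = \<nu> (ppQ (Suc r) (e 0))) \<longrightarrow>
              L.independent (residue_subfield K \<nu> T)
                (map (\<lambda>l. res (ppQ (Suc r) (e l) \<otimes> inv (ppQ (Suc r) (e 0)))) [0..<N]))"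
      using indep by blast
    show "\<forall>i\<ge>1. enat (Suc i) < \<Omega> \<longrightarrow>
           value_index \<nu> Qf i \<noteq> \<infinity> \<and>
           (let mbar = the_enat (value_index \<nu> Qf i);
                V = ppQ i (v' i);
                F = adjoin K \<nu> T \<alpha>' (i - 1)
            in (\<forall>k\<in>{1..mu i}. mbar dvd tau i k i) \<and>
               balancing_exponents K \<nu> Qf (\<lambda>k. n (Suc k)) i (v' i) \<and>
               (\<exists>e b. 0 < e \<and> n (Suc i) = mbar * e \<and>
                  (\<forall>t<e. b t = res
                     ((\<Oplus>k\<in>{k \<in> {1..mu i}. tau i k i = t * mbar}. c i k \<otimes> ppQ i (tau i k))
                        \<otimes> inv (V [^] (e - t))) \<and> b t \<in> F) \<and>
                  has_minimal_polynomial L F (\<alpha>' i) e b))"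
    proof (intro allI impI)
      fix i assume i: "1 \<le> i" "enat (Suc i) < \<Omega>"
      note K = ks[OF i, unfolded key_step_def]
      have 1: "value_index \<nu> P (Suc i) \<noteq> \<infinity>" using step(1)[OF _ i(2)] by simp
      show "value_index \<nu> Qf i \<noteq> \<infinity> \<and>
           (let mbar = the_enat (value_index \<nu> Qf i);
                V = ppQ i (v' i);
                F = adjoin K \<nu> T \<alpha>' (i - 1)
            in (\<forall>k\<in>{1..mu i}. mbar dvd tau i k i) \<and>
               balancing_exponents K \<nu> Qf (\<lambda>k. n (Suc k)) i (v' i) \<and>
               (\<exists>e b. 0 < e \<and> n (Suc i) = mbar * e \<and>
                  (\<forall>t<e. b t = res
                     ((\<Oplus>k\<in>{k \<in> {1..mu i}. tau i k i = t * mbar}. c i k \<otimes> ppQ i (tau i k))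
                        \<otimes> inv (V [^] (e - t))) \<and> b t \<in> F) \<and>
                  has_minimal_polynomial L F (\<alpha>' i) e b))"
        unfolding Let_def vi[OF i] ad[OF i(1) lt[OF i(2)]]
        using 1 be[OF i] K n_eq[of "Suc i"] by blast
    qed
    show "\<forall>i. \<Omega> - 1 = enat i \<longrightarrow> value_index \<nu> Qf i = \<infinity> \<or>
           (value_index \<nu> Qf i \<noteq> \<infinity> \<and> balancing_exponents K \<nu> Qf (\<lambda>k. n (Suc k)) i (v' i) \<and>
            alpha_degree K \<nu> T Qf v' i = \<infinity>)"
      using final_step by blast
  qed simp_all
qed

end

text \<open>As \<Omega> is at least 2, the first value index is finite, and \<open>U 1\<close> can
  only be a power of \<open>x\<close>. Its exponent is positive because \<open>y\<close> has
  positive value.\<close>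

lemma (in algorithm) commensurable_parameters:
  assumes "2 \<le> \<Omega>" shows "\<exists>p q. 0 < p \<and> 0 < q \<and> nsm p (\<nu> y) = nsm q (\<nu> x)"
proof (intro exI conjI)
  have "enat 1 < 2" by (simp add: numeral_eq_enat)
  then have lt: "enat 1 < \<Omega>" using assms by (rule less_le_trans)
  have y: "0 < \<nu> y" using v v_nonzero by (auto simp: M_iff)
  show eq: "nsm (nb 1) (\<nu> y) = nsm (w 1 0) (\<nu> x)"
    using balance[OF step(2)[OF order_refl lt]] start u v u_nonzero v_nonzero
    unfolding pp_1 by (simp del: One_nat_def)
  show nb: "0 < nb 1" by (rule value_index_finite(1)[OF step(1)[OF order_refl lt]])
  show "0 < w 1 0"
  proof (rule ccontr)
    assume "\<not> 0 < w 1 0"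
    then show False using eq nsm_pos[OF y nb] by simp
  qed
qed

theorem theorem7p1:
  fixes K :: "('a, 'b) ring_scheme"
    and R CS :: "'a set"
    and \<nu> :: "'a \<Rightarrow> 'g :: linordered_ab_group_add"
    and x y :: 'a
    and P :: "nat \<Rightarrow> 'a"
    and w :: "nat \<Rightarrow> nat \<Rightarrow> nat"
    and \<Omega> N :: enat
    and T :: "nat \<Rightarrow> 'a set"
  defines "\<alpha> \<equiv> alpha K \<nu> P w"
    and "n \<equiv> step_degree K \<nu> R P w"
  assumes "is_quotient_field K R"
    and "regular_local_ring (K\<lparr>carrier := R\<rparr>)"
    and "krull_dim (K\<lparr>carrier := R\<rparr>) = 2"
    and "coefficient_set (K\<lparr>carrier := R\<rparr>) CS"
    and "valuation K \<nu>"
    and "dominates K \<nu> R"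
    and "regular_parameters (K\<lparr>carrier := R\<rparr>) x y"
    and "algorithm_sequence K \<nu> R CS x y \<Omega> P w"
    and "\<Omega> \<ge> 2"
    and "quadratic_sequence K \<nu> R N T"
  shows "\<exists>i\<ge>1. enat i \<le> N \<and>
    one_component (K\<lparr>carrier := T i\<rparr>) (x \<otimes>\<^bsub>K\<^esub> y) \<and>
    (\<forall>j. 1 \<le> j \<and> j < i \<longrightarrow> \<not> one_component (K\<lparr>carrier := T j\<rparr>) (x \<otimes>\<^bsub>K\<^esub> y)) \<and>
    (let R1 = K\<lparr>carrier := T i\<rparr> in
      (\<exists>h \<in> ring_iso (R1 Quot max_ideal R1)
                      ((val_residue_field K \<nu>)\<lparr>carrier := adjoin K \<nu> R \<alpha> 1\<rparr>).
         \<forall>f \<in> R. h (max_ideal R1 +>\<^bsub>R1\<^esub> f) = residue_class K \<nu> f) \<and>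
      (\<exists>x1 \<in> T i. \<exists>\<omega> > (0 :: nat).
         PIdl\<^bsub>R1\<^esub> x1 = exceptional_ideal K R (T i) \<and>
         (let Q = (\<lambda>l. if l = 0 then x1
                        else P (Suc l) \<otimes>\<^bsub>K\<^esub> inv\<^bsub>K\<^esub> (x1 [^]\<^bsub>K\<^esub> (\<omega> * (\<Prod>k = 1..l. n k))))
          in regular_parameters R1 (Q 0) (Q 1) \<and>
             key_sequence K \<nu> (T i) (Q 0) (Q 1) (\<Omega> - 1) Q)))"
proof -
  have fK: "field K" and subR: "subring R K" using assms(3) by (auto simp: is_quotient_field_def)
  have vf: "valued_field K \<nu>"
    by (intro valued_field.intro valued_field_axioms.intro fK assms(7))
  have surf: "regular_surface K \<nu> R x y"
    by (rule valued_field.regular_parameters_imp_surface[OF vf subR assms(8,9)])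
  interpret al: algorithm K \<nu> R x y CS \<Omega> P w
    by (intro algorithm.intro algorithm_axioms.intro surf assms(6,10))
  have T0: "T 0 = R" and qt: "\<And>j. enat j < N \<Longrightarrow> quadratic_transform K \<nu> (T j) (T (Suc j))"
    and dim: "\<And>j. N = enat j \<Longrightarrow> krull_dim (K\<lparr>carrier := T j\<rparr>) = 1"
    using assms(12) by (auto simp: quadratic_sequence_def)
  obtain p q where pq: "0 < p" "0 < q" "nsm p (\<nu> y) = nsm q (\<nu> x)"
    using al.commensurable_parameters[OF assms(11)] by blast
  have xc: "x \<in> carrier K" "y \<in> carrier K" using al.u(1) al.v(1) by simp_all
  \<comment> \<open>The descent begins with the identity as exponent matrix.\<close>
  have start: "regular_surface K \<nu> (T 0) x y" "x = x [^]\<^bsub>K\<^esub> (1 :: nat) \<otimes>\<^bsub>K\<^esub> y [^]\<^bsub>K\<^esub> (0 :: nat)"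
    "y = x [^]\<^bsub>K\<^esub> (0 :: nat) \<otimes>\<^bsub>K\<^esub> y [^]\<^bsub>K\<^esub> (1 :: nat)" "1 * 1 = 0 * 0 + (1 :: nat)"
    using surf T0 xc by simp_all
  have start': "residue_subfield K \<nu> (T 0) = residue_subfield K \<nu> R" "R \<subseteq> T 0" "enat 0 \<le> N"
    "\<And>k. k < 0 \<Longrightarrow> \<not> one_component (K\<lparr>carrier := T k\<rparr>) (x \<otimes>\<^bsub>K\<^esub> y)"
    using T0 by (simp_all add: zero_enat_def[symmetric])
  obtain j s t A B C D where j: "enat j < N" and s: "regular_surface K \<nu> (T j) s t" "\<nu> s = \<nu> t"
    and xy: "x = s [^]\<^bsub>K\<^esub> A \<otimes>\<^bsub>K\<^esub> t [^]\<^bsub>K\<^esub> B" "y = s [^]\<^bsub>K\<^esub> C \<otimes>\<^bsub>K\<^esub> t [^]\<^bsub>K\<^esub> D"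
      "A * D = B * C + (1 :: nat)"
    and res: "residue_subfield K \<nu> (T j) = residue_subfield K \<nu> R" "R \<subseteq> T j"
    and TS: "T (Suc j) = al.blowup (T j) (t \<otimes>\<^bsub>K\<^esub> inv\<^bsub>K\<^esub> s)"
    and no: "\<forall>k\<le>j. \<not> one_component (K\<lparr>carrier := T k\<rparr>) (x \<otimes>\<^bsub>K\<^esub> y)"
    using al.euclidean_descent[where N = N and T = T, OF qt dim start'(3) start pq(3,1,2) start'(1,2,4)] by blast
  interpret E: algorithm_end K \<nu> R x y CS \<Omega> P w "T j" s t A B C D
    by (intro algorithm_end.intro algorithm_end_axioms.intro al.algorithm_axioms s assms(11) xy res)
  have T: "E.T = T (Suc j)" unfolding TS E.z_def ..
  have Q: "E.Qf = (\<lambda>l. if l = 0 then s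
      else P (Suc l) \<otimes>\<^bsub>K\<^esub> inv\<^bsub>K\<^esub> (s [^]\<^bsub>K\<^esub> ((C + D) * (\<Prod>k = 1..l. n k))))"
    by (rule ext) (simp add: E.Qf_def n_def)
  show ?thesis
  \<comment> \<open>In \<open>T j\<close> and all rings before it the product of \<open>x\<close>
    and \<open>y\<close> still has two components; equality of \<open>\<nu> s\<close> and
    \<open>\<nu> t\<close> makes the next transform the first with one component.\<close>
  proof (intro exI[of _ "Suc j"] conjI)
    show "enat (Suc j) \<le> N" using j by (simp add: Suc_ile_eq)
    show "one_component (K\<lparr>carrier := T (Suc j)\<rparr>) (x \<otimes>\<^bsub>K\<^esub> y)"
      using E.one_component_T unfolding T .
    show "\<forall>j'. 1 \<le> j' \<and> j' < Suc j \<longrightarrow> \<not> one_component (K\<lparr>carrier := T j'\<rparr>) (x \<otimes>\<^bsub>K\<^esub> y)"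
      using no by simp
    have "\<exists>h \<in> ring_iso (K\<lparr>carrier := T (Suc j)\<rparr> Quot max_ideal (K\<lparr>carrier := T (Suc j)\<rparr>))
          ((val_residue_field K \<nu>)\<lparr>carrier := adjoin K \<nu> R \<alpha> 1\<rparr>).
        \<forall>f \<in> R. h (max_ideal (K\<lparr>carrier := T (Suc j)\<rparr>) +>\<^bsub>K\<lparr>carrier := T (Suc j)\<rparr>\<^esub> f) = residue_class K \<nu> f"
      using E.T.residue_iso E.R_T unfolding E.residue_T unfolding T \<alpha>_def by blast
    moreover have "\<exists>x1 \<in> T (Suc j). \<exists>\<omega> > (0 :: nat).
         PIdl\<^bsub>K\<lparr>carrier := T (Suc j)\<rparr>\<^esub> x1 = exceptional_ideal K R (T (Suc j)) \<and>
         (let Q = (\<lambda>l. if l = 0 then x1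
                        else P (Suc l) \<otimes>\<^bsub>K\<^esub> inv\<^bsub>K\<^esub> (x1 [^]\<^bsub>K\<^esub> (\<omega> * (\<Prod>k = 1..l. n k))))
          in regular_parameters (K\<lparr>carrier := T (Suc j)\<rparr>) (Q 0) (Q 1) \<and>
             key_sequence K \<nu> (T (Suc j)) (Q 0) (Q 1) (\<Omega> - 1) Q)"
    proof (intro bexI[of _ s] exI[of _ "C + D"] conjI)
      show "s \<in> T (Suc j)" using E.T.u(1) unfolding T .
      show "0 < C + D" using E.AD_pos by simp
      show "PIdl\<^bsub>K\<lparr>carrier := T (Suc j)\<rparr>\<^esub> s = exceptional_ideal K R (T (Suc j))"
        using E.exceptional_T unfolding T .
      have "key_sequence K \<nu> (T (Suc j)) (E.Qf 0) (E.Qf 1) (\<Omega> - 1) E.Qf"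
        using E.key_sequence_Q unfolding T .
      moreover from this have "regular_parameters (K\<lparr>carrier := T (Suc j)\<rparr>) (E.Qf 0) (E.Qf 1)"
        unfolding key_sequence_def by blast
      ultimately show "let Q = (\<lambda>l. if l = 0 then s
                        else P (Suc l) \<otimes>\<^bsub>K\<^esub> inv\<^bsub>K\<^esub> (s [^]\<^bsub>K\<^esub> ((C + D) * (\<Prod>k = 1..l. n k))))
          in regular_parameters (K\<lparr>carrier := T (Suc j)\<rparr>) (Q 0) (Q 1) \<and>
             key_sequence K \<nu> (T (Suc j)) (Q 0) (Q 1) (\<Omega> - 1) Q"
        unfolding Let_def Q[symmetric] by blast
    qed
    ultimately show "let R1 = K\<lparr>carrier := T (Suc j)\<rparr> in
      (\<exists>h \<in> ring_iso (R1 Quot max_ideal R1)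
                      ((val_residue_field K \<nu>)\<lparr>carrier := adjoin K \<nu> R \<alpha> 1\<rparr>).
         \<forall>f \<in> R. h (max_ideal R1 +>\<^bsub>R1\<^esub> f) = residue_class K \<nu> f) \<and>
      (\<exists>x1 \<in> T (Suc j). \<exists>\<omega> > (0 :: nat).
         PIdl\<^bsub>R1\<^esub> x1 = exceptional_ideal K R (T (Suc j)) \<and>
         (let Q = (\<lambda>l. if l = 0 then x1
                        else P (Suc l) \<otimes>\<^bsub>K\<^esub> inv\<^bsub>K\<^esub> (x1 [^]\<^bsub>K\<^esub> (\<omega> * (\<Prod>k = 1..l. n k))))
          in regular_parameters R1 (Q 0) (Q 1) \<and>
             key_sequence K \<nu> (T (Suc j)) (Q 0) (Q 1) (\<Omega> - 1) Q))"
      by (simp only: Let_def)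
  qed simp
qed

end
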